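(* Let $M$ be any factor (a $W^*$-algebra with trivial center), let $E$ be a $W^*$-correspondence over $M$, and let $\pi:M\to B(H)$ be a reducible faithful normal representation of $M$ on a Hilbert space $H$. Then the algebra $\rho_\pi(H^{\infty}(E))\subseteq B(\mathcal{F}(E)\otimes_\pi H)$ is reflexive.
   Context: A Hilbert $W^*$-module over a $W^*$-algebra $M$ is a self-dual right Hilbert $C^*$-module $E$ over $M$ (the $M$-valued inner product is linear in the second variable); $\mathcal{L}(E)$ is the $W^*$-algebra of adjointable operators on $E$. $E$ is a dual Banach space; its weak$^*$-topology is called the $\sigma$-topology. A $W^*$-correspondence over $M$ is a Hilbert $W^*$-module $E$ over $M$ with a left action given by a normal $*$-homomorphism $\phi:M\to\mathcal{L}(E)$; it is always assumed essential: $\phi(M)E$ is dense in $E$ in the $\sigma$-topology. $E^{\otimes 0}=M$ with $\phi_0(a)b=ab$; for $n\ge1$, $E^{\otimes n}$ is the self-dual completion of the internal tensor power balanced over $\phi$ (inner product $\langle\xi_1\otimes\eta_1,\xi_2\otimes\eta_2\rangle=\langle\eta_1,\phi(\langle\xi_1,\xi_2\rangle)\eta_2\rangle$), with left action $\phi_n(a)(\xi_1\otimes\dots\otimes\xi_n)=(\phi(a)\xi_1)\otimes\xi_2\otimes\dots\otimes\xi_n$. The full Fock space $\mathcal{F}(E)=\sum^{\oplus}_{n\ge0}E^{\otimes n}$ is the ultraweak direct sum (self-dual completion of the Hilbert module direct sum), with left action $\phi_\infty(a)=\sum_{n\ge 0}\phi_n(a)$. For $\xi\in E$, $T_\xi\in\mathcal{L}(\mathcal{F}(E))$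 is $T_\xi\eta=\xi\otimes\eta$. The Hardy algebra $H^\infty(E)$ is the weak$^*$ (ultraweak) closure in $\mathcal{L}(\mathcal{F}(E))$ of the algebra generated by all $T_\xi$ ($\xi\in E$) and all $\phi_\infty(a)$ ($a\in M$). For a normal (nondegenerate) representation $\pi:M\to B(H)$ and a Hilbert $W^*$-module $F$ over $M$, $F\otimes_\pi H$ is the Hilbert space completion of the algebraic tensor product with $\langle\xi_1\otimes h_1,\xi_2\otimes h_2\rangle=\langle h_1,\pi(\langle\xi_1,\xi_2\rangle)h_2\rangle$. The induced representation $\rho_\pi$ of $H^\infty(E)$ on $\mathcal{F}(E)\otimes_\pi H$ is $\rho_\pi(X)=X\otimes I_H$. $\pi$ is reducible if there is a closed $\pi(M)$-invariant subspace of $H$ other than $\{0\}$ and $H$. For a subalgebra $\mathcal{A}\subseteq B(K)$, $Lat\,\mathcal{A}$ is the lattice of closed $\mathcal{A}$-invariant subspaces of $K$, $Alg\,Lat\,\mathcal{A}=\{T\in B(K):T\mathcal{N}\subseteq\mathcal{N}\ \forall \mathcal{N}\in Lat\,\mathcal{A}\}$, and $\mathcal{A}$ is reflexive if $\mathcal{A}=Alg\,Lat\,\mathcal{A}$. *)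

theory Defs
  imports "HOL-Analysis.Analysis"
begin

section \<open>Complex Banach spaces, C*-algebras and Hilbert spaces\<close>

class cvector = real_vector +
  fixes scaleC :: "complex \<Rightarrow> 'a \<Rightarrow> 'a"  (infixr \<open>*\<^sub>C\<close> 75)
  assumes scaleC_add_right: "c *\<^sub>C (x + y) = c *\<^sub>C x + c *\<^sub>C y"
    and scaleC_add_left: "(c + d) *\<^sub>C x = c *\<^sub>C x + d *\<^sub>C x"
    and scaleC_scaleC: "c *\<^sub>C (d *\<^sub>C x) = (c * d) *\<^sub>C x"
    and scaleC_one: "1 *\<^sub>C x = x"
    and scaleR_scaleC: "r *\<^sub>R x = complex_of_real r *\<^sub>C x"

global_interpretation cvec: vector_space "scaleC :: complex \<Rightarrow> 'a \<Rightarrow> 'a::cvector"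
  defines csubspace = cvec.subspace
    and cspan = cvec.span
  by unfold_locales (rule scaleC_add_right scaleC_add_left scaleC_scaleC scaleC_one)+

class cbanach = cvector + banach +
  assumes norm_scaleC: "norm (c *\<^sub>C x) = cmod c * norm x"

instantiation complex :: cbanach
begin
definition "scaleC_complex = ((*) :: complex \<Rightarrow> complex \<Rightarrow> complex)"
instance
  by standard (auto simp: scaleC_complex_def algebra_simps scaleR_conv_of_real norm_mult)
end

definition bounded_clinear :: "('a::cbanach \<Rightarrow> 'b::cbanach) \<Rightarrow> bool" where
  "bounded_clinear f \<longleftrightarrow> bounded_linear f \<and> (\<forall>c x. f (c *\<^sub>C x) = c *\<^sub>C f x)"

text \<open>Unital C*-algebras; the W*-algebras below are automatically unital.\<close>

class cstar_algebra = cbanach + real_normed_algebra_1 +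
  fixes star :: "'a \<Rightarrow> 'a"
  assumes mult_scaleC_left: "(c *\<^sub>C x) * y = c *\<^sub>C (x * y)"
    and mult_scaleC_right: "x * (c *\<^sub>C y) = c *\<^sub>C (x * y)"
    and star_add: "star (x + y) = star x + star y"
    and star_scaleC: "star (c *\<^sub>C x) = cnj c *\<^sub>C star x"
    and star_mult: "star (x * y) = star y * star x"
    and star_star: "star (star x) = x"
    and cstar_identity: "norm (star x * x) = (norm x)\<^sup>2"

definition positive_element :: "'m::cstar_algebra \<Rightarrow> bool" where
  "positive_element a \<longleftrightarrow> (\<exists>b. a = star b * b)"

definition center :: "'m::cstar_algebra set" where
  "center = {a. \<forall>b. a * b = b * a}"

text \<open>Inner products are linear in the second variable.\<close>

class chilbert = cbanach +
  fixes cinner :: "'a \<Rightarrow> 'a \<Rightarrow> complex"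
  assumes cinner_add_right: "cinner x (y + z) = cinner x y + cinner x z"
    and cinner_scaleC_right: "cinner x (c *\<^sub>C y) = c * cinner x y"
    and cinner_commute: "cinner x y = cnj (cinner y x)"
    and cinner_self: "cinner x x = complex_of_real ((norm x)\<^sup>2)"


section \<open>Preduals and weak topologies\<close>

text \<open>\<open>P\<close> is a predual of the Banach space \<open>'a\<close>: a norm-closed subspace of the dual space such
  that evaluation is an isometric isomorphism of \<open>'a\<close> onto the dual space of \<open>P\<close>. A W*-algebra is a
  C*-algebra together with such a \<open>P\<close>, which is unique by a theorem of Sakai.\<close>

definition is_predual :: "('a::cbanach \<Rightarrow> complex) set \<Rightarrow> bool" where
  "is_predual P \<longleftrightarrow>
     (\<forall>f\<in>P. bounded_clinear f) \<and>
     (\<lambda>x. 0) \<in> P \<and>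
     (\<forall>f\<in>P. \<forall>g\<in>P. (\<lambda>x. f x + g x) \<in> P) \<and>
     (\<forall>c. \<forall>f\<in>P. (\<lambda>x. c * f x) \<in> P) \<and>
     (\<forall>f. bounded_clinear f \<and> (\<forall>e>0. \<exists>g\<in>P. onorm (\<lambda>x. f x - g x) < e) \<longrightarrow> f \<in> P) \<and>
     (\<forall>a. norm a = (SUP f\<in>{f \<in> P. onorm f \<le> 1}. cmod (f a))) \<and>
     (\<forall>\<Phi>. (\<forall>f\<in>P. \<forall>g\<in>P. \<Phi> (\<lambda>x. f x + g x) = \<Phi> f + \<Phi> g) \<and>
          (\<forall>c. \<forall>f\<in>P. \<Phi> (\<lambda>x. c * f x) = c * \<Phi> f) \<and>
          (\<exists>B. \<forall>f\<in>P. cmod (\<Phi> f) \<le> B * onorm f)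
        \<longrightarrow> (\<exists>a. \<forall>f\<in>P. \<Phi> f = f a))"

definition wstar_algebra :: "('m::cstar_algebra \<Rightarrow> complex) set \<Rightarrow> bool" where
  "wstar_algebra P \<longleftrightarrow> is_predual P"

definition factor :: "('m::cstar_algebra \<Rightarrow> complex) set \<Rightarrow> bool" where
  "factor P \<longleftrightarrow> wstar_algebra P \<and> (center :: 'm set) = range (\<lambda>c. c *\<^sub>C 1)"

definition weak_topology :: "('a \<Rightarrow> complex) set \<Rightarrow> 'a topology" where
  "weak_topology F = topology_generated_by {f -` U | f U. f \<in> F \<and> open U}"


section \<open>Operators on Hilbert spaces\<close>

definition ultraweak_B :: "('h::chilbert \<Rightarrow> 'h) topology" where
  "ultraweak_B = subtopology
     (weak_topology {\<lambda>T. (\<Sum>n. cinner (x n) (T (y n))) | x y.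
        summable (\<lambda>n. (norm (x n))\<^sup>2) \<and> summable (\<lambda>n. (norm (y n))\<^sup>2)})
     {T. bounded_clinear T}"

definition Lat :: "('k::cbanach \<Rightarrow> 'k) set \<Rightarrow> 'k set set" where
  "Lat \<A> = {N. csubspace N \<and> closed N \<and> (\<forall>T\<in>\<A>. T ` N \<subseteq> N)}"

definition Alg :: "'k::cbanach set set \<Rightarrow> ('k \<Rightarrow> 'k) set" where
  "Alg \<L> = {T. bounded_clinear T \<and> (\<forall>N\<in>\<L>. T ` N \<subseteq> N)}"

definition reflexive :: "('k::cbanach \<Rightarrow> 'k) set \<Rightarrow> bool" where
  "reflexive \<A> \<longleftrightarrow> \<A> = Alg (Lat \<A>)"

locale normal_representation =
  fixes P :: "('m::cstar_algebra \<Rightarrow> complex) set"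
    and \<pi> :: "'m \<Rightarrow> 'h::chilbert \<Rightarrow> 'h"
  assumes bounded: "bounded_clinear (\<pi> a)"
    and add: "\<pi> (a + b) h = \<pi> a h + \<pi> b h"
    and scaleC: "\<pi> (c *\<^sub>C a) h = c *\<^sub>C \<pi> a h"
    and mult: "\<pi> (a * b) h = \<pi> a (\<pi> b h)"
    and star: "cinner (\<pi> (star a) h) k = cinner h (\<pi> a k)"
    and nondegenerate: "closure (cspan {\<pi> a h | a h. True}) = UNIV"
    and normal: "continuous_map (weak_topology P) ultraweak_B \<pi>"

definition reducible :: "('m::cstar_algebra \<Rightarrow> 'h::chilbert \<Rightarrow> 'h) \<Rightarrow> bool" where
  "reducible \<pi> \<longleftrightarrow>
     (\<exists>N. csubspace N \<and> closed N \<and> (\<forall>a. \<pi> a ` N \<subseteq> N) \<and> N \<noteq> {0} \<and> N \<noteq> UNIV)"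


section \<open>Hilbert modules\<close>

text \<open>Right Hilbert C*-modules. Definiteness and completeness of the inner product follow from
  \<open>norm_ip\<close>, since the norm of the type \<open>'e\<close> is definite and complete.\<close>

locale hilbert_module =
  fixes ip :: "'e::cbanach \<Rightarrow> 'e \<Rightarrow> 'm::cstar_algebra"
    and act :: "'e \<Rightarrow> 'm \<Rightarrow> 'e"
  assumes act_add_left: "act (x + y) a = act x a + act y a"
    and act_add_right: "act x (a + b) = act x a + act x b"
    and act_scaleC_left: "act (c *\<^sub>C x) a = c *\<^sub>C act x a"
    and act_scaleC_right: "act x (c *\<^sub>C a) = c *\<^sub>C act x a"
    and act_mult: "act x (a * b) = act (act x a) b"
    and act_one: "act x 1 = x"
    and ip_add_right: "ip x (y + z) = ip x y + ip x z"
    and ip_scaleC_right: "ip x (c *\<^sub>C y) = c *\<^sub>C ip x y"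
    and ip_act_right: "ip x (act y a) = ip x y * a"
    and ip_star: "ip y x = star (ip x y)"
    and ip_positive: "positive_element (ip x x)"
    and norm_ip: "norm (ip x x) = (norm x)\<^sup>2"

definition submodule :: "('e::cbanach \<Rightarrow> 'm::cstar_algebra \<Rightarrow> 'e) \<Rightarrow> 'e set \<Rightarrow> bool" where
  "submodule act D \<longleftrightarrow> csubspace D \<and> (\<forall>x\<in>D. \<forall>a. act x a \<in> D)"

text \<open>Bounded module maps from the submodule \<open>D\<close> to the algebra.\<close>

definition module_functional ::
    "('e::cbanach \<Rightarrow> 'm::cstar_algebra \<Rightarrow> 'e) \<Rightarrow> 'e set \<Rightarrow> ('e \<Rightarrow> 'm) \<Rightarrow> bool" where
  "module_functional act D f \<longleftrightarrow>
     (\<forall>x\<in>D. \<forall>y\<in>D. f (x + y) = f x + f y) \<and>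
     (\<forall>x\<in>D. \<forall>a. f (act x a) = f x * a) \<and>
     (\<exists>B. \<forall>x\<in>D. norm (f x) \<le> B * norm x)"

definition self_dual ::
    "('e::cbanach \<Rightarrow> 'e \<Rightarrow> 'm::cstar_algebra) \<Rightarrow> ('e \<Rightarrow> 'm \<Rightarrow> 'e) \<Rightarrow> 'e set \<Rightarrow> bool" where
  "self_dual ip act Y \<longleftrightarrow>
     (\<forall>f. module_functional act Y f \<longrightarrow> (\<exists>y\<in>Y. \<forall>x\<in>Y. f x = ip y x))"

text \<open>Paschke's self-dual completion of a pre-Hilbert module \<open>D\<close> is the module of all bounded
  module maps on \<open>D\<close>, in which \<open>D\<close> is embedded by \<open>x \<mapsto> \<langle>x, \<cdot>\<rangle>\<close>. Accordingly a self-dual module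
  \<open>Y \<supseteq> D\<close> is the self-dual completion of \<open>D\<close> if \<open>y \<mapsto> \<langle>y, \<cdot>\<rangle>\<close> is a bijection of \<open>Y\<close> onto the
  bounded module maps on \<open>D\<close>. All modules are submodules of an ambient Hilbert module.\<close>

definition self_dual_completion ::
    "('e::cbanach \<Rightarrow> 'e \<Rightarrow> 'm::cstar_algebra) \<Rightarrow> ('e \<Rightarrow> 'm \<Rightarrow> 'e) \<Rightarrow> 'e set \<Rightarrow> 'e set \<Rightarrow> bool" where
  "self_dual_completion ip act D Y \<longleftrightarrow>
     submodule act D \<and> submodule act Y \<and> closed Y \<and> D \<subseteq> Y \<and> self_dual ip act Y \<and>
     (\<forall>f. module_functional act D f \<longrightarrow> (\<exists>!y. y \<in> Y \<and> (\<forall>x\<in>D. f x = ip y x)))"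

locale hilbert_wstar_module = hilbert_module +
  assumes self_dual: "self_dual ip act UNIV"

text \<open>The weak* topology of a Hilbert W*-module: its predual consists of the functionals
  \<open>x \<mapsto> \<Sum>n. \<omega> n (\<langle>\<eta> n, x\<rangle>)\<close> with \<open>\<omega> n\<close> in the predual \<open>P\<close> of the algebra and
  \<open>\<Sum>n. \<parallel>\<omega> n\<parallel> \<parallel>\<eta> n\<parallel> < \<infinity>\<close>.\<close>

definition sigma_topology ::
    "('m::cstar_algebra \<Rightarrow> complex) set \<Rightarrow> ('e::cbanach \<Rightarrow> 'e \<Rightarrow> 'm) \<Rightarrow> 'e topology" where
  "sigma_topology P ip = weak_topology
     {\<lambda>x. (\<Sum>n. \<omega> n (ip (\<eta> n) x)) | \<omega> \<eta>.
        range \<omega> \<subseteq> P \<and> summable (\<lambda>n. onorm (\<omega> n) * norm (\<eta> n))}"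

text \<open>The adjointable operators (these are automatically bounded and linear), and the weak*
  topology they carry: the predual consists of the functionals
  \<open>T \<mapsto> \<Sum>n. \<omega> n (\<langle>\<eta> n, T (\<zeta> n)\<rangle>)\<close> with \<open>\<Sum>n. \<parallel>\<omega> n\<parallel> \<parallel>\<eta> n\<parallel> \<parallel>\<zeta> n\<parallel> < \<infinity>\<close>.\<close>

definition adjointable :: "('e::cbanach \<Rightarrow> 'e \<Rightarrow> 'm::cstar_algebra) \<Rightarrow> ('e \<Rightarrow> 'e) set" where
  "adjointable ip = {T. \<exists>S. \<forall>x y. ip (T x) y = ip x (S y)}"

definition ultraweak_L ::
    "('m::cstar_algebra \<Rightarrow> complex) set \<Rightarrow> ('e::cbanach \<Rightarrow> 'e \<Rightarrow> 'm) \<Rightarrow> ('e \<Rightarrow> 'e) topology" where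
  "ultraweak_L P ip = subtopology
     (weak_topology {\<lambda>T. (\<Sum>n. \<omega> n (ip (\<eta> n) (T (\<zeta> n)))) | \<omega> \<eta> \<zeta>.
        range \<omega> \<subseteq> P \<and> summable (\<lambda>n. onorm (\<omega> n) * norm (\<eta> n) * norm (\<zeta> n))})
     (adjointable ip)"


section \<open>W*-correspondences and the full Fock space\<close>

locale wstar_correspondence = hilbert_wstar_module ip act
  for P :: "('m::cstar_algebra \<Rightarrow> complex) set"
    and ip :: "'e::cbanach \<Rightarrow> 'e \<Rightarrow> 'm"
    and act :: "'e \<Rightarrow> 'm \<Rightarrow> 'e"
    and \<phi> :: "'m \<Rightarrow> 'e \<Rightarrow> 'e" +
  assumes left_add: "\<phi> (a + b) x = \<phi> a x + \<phi> b x"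
    and left_scaleC: "\<phi> (c *\<^sub>C a) x = c *\<^sub>C \<phi> a x"
    and left_mult: "\<phi> (a * b) x = \<phi> a (\<phi> b x)"
    and left_star: "ip (\<phi> (star a) x) y = ip x (\<phi> a y)"
    and left_normal: "continuous_map (weak_topology P) (ultraweak_L P ip) \<phi>"
    and essential: "sigma_topology P ip closure_of cspan {\<phi> a x | a x. True} = UNIV"

text \<open>The \<open>M\<close>-valued inner product of two elementary tensors of the same length \<open>n \<ge> 1\<close>, using
  \<open>\<langle>\<xi>\<^sub>1 \<otimes> \<xi>, \<eta>\<^sub>1 \<otimes> \<eta>\<rangle> = \<langle>\<xi>, \<phi>(\<langle>\<xi>\<^sub>1, \<eta>\<^sub>1\<rangle>) \<eta>\<rangle>\<close>, where \<open>\<phi>(a)\<close> acts on the first tensor factor of \<open>\<eta>\<close>.\<close>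

fun tensor_ip :: "('e \<Rightarrow> 'e \<Rightarrow> 'm::zero) \<Rightarrow> ('m \<Rightarrow> 'e \<Rightarrow> 'e) \<Rightarrow> 'e list \<Rightarrow> 'e list \<Rightarrow> 'm" where
  "tensor_ip ip \<phi> [x] [y] = ip x y"
| "tensor_ip ip \<phi> (x # x' # xs) (y # y' # ys) = tensor_ip ip \<phi> (x' # xs) (\<phi> (ip x y) y' # ys)"
| "tensor_ip ip \<phi> _ _ = 0"

text \<open>A model \<open>'f\<close> of the full Fock space of a correspondence, determined up to unitary isomorphism:
  \<open>pow n\<close> is the \<open>n\<close>-th tensor power as a submodule of \<open>'f\<close>, \<open>vac\<close> identifies the algebra with
  \<open>pow 0\<close>, and \<open>tens [x\<^sub>1, \<dots>, x\<^sub>n]\<close> with \<open>n \<ge> 1\<close> is the elementary tensor \<open>x\<^sub>1 \<otimes> \<dots> \<otimes> x\<^sub>n\<close> (the value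
  at \<open>[]\<close> is irrelevant). Multilinearity and balancedness of \<open>tens\<close> and module linearity of \<open>vac\<close>
  follow from the formulas for the inner products. The Hilbert module direct sum of the pairwise
  orthogonal \<open>pow n\<close> is the norm closure of their linear span.\<close>

locale fock_space = F: hilbert_wstar_module ipF actF
  for ip :: "'e::cbanach \<Rightarrow> 'e \<Rightarrow> 'm::cstar_algebra"
    and \<phi> :: "'m \<Rightarrow> 'e \<Rightarrow> 'e"
    and ipF :: "'f::cbanach \<Rightarrow> 'f \<Rightarrow> 'm"
    and actF :: "'f \<Rightarrow> 'm \<Rightarrow> 'f"
    and pow :: "nat \<Rightarrow> 'f set"
    and vac :: "'m \<Rightarrow> 'f"
    and tens :: "'e list \<Rightarrow> 'f" +
  assumes pow_0: "pow 0 = range vac"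
    and ip_vac: "ipF (vac a) (vac b) = star a * b"
    and ip_tens: "length xs = length ys \<Longrightarrow> xs \<noteq> [] \<Longrightarrow>
      ipF (tens xs) (tens ys) = tensor_ip ip \<phi> xs ys"
    and pow_Suc: "n \<ge> 1 \<Longrightarrow>
      self_dual_completion ipF actF (cspan {tens xs | xs. length xs = n}) (pow n)"
    and pow_orthogonal: "m \<noteq> n \<Longrightarrow> x \<in> pow m \<Longrightarrow> y \<in> pow n \<Longrightarrow> ipF x y = 0"
    and direct_sum: "self_dual_completion ipF actF (closure (cspan (\<Union>n. pow n))) UNIV"


section \<open>The Hardy algebra and induced representations\<close>

text \<open>On \<open>pow 0\<close> the creation operator is \<open>\<xi> \<otimes> a = \<xi>\<cdot>a\<close>.\<close>

definition creation ::
    "('e \<Rightarrow> 'm \<Rightarrow> 'e) \<Rightarrow> ('f::cbanach \<Rightarrow> 'f \<Rightarrow> 'm::cstar_algebra) \<Rightarrow> ('m \<Rightarrow> 'f) \<Rightarrow> ('e list \<Rightarrow> 'f)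
      \<Rightarrow> 'e \<Rightarrow> 'f \<Rightarrow> 'f" where
  "creation act ipF vac tens \<xi> = (THE T. T \<in> adjointable ipF \<and>
     (\<forall>a. T (vac a) = tens [act \<xi> a]) \<and>
     (\<forall>\<eta>s. \<eta>s \<noteq> [] \<longrightarrow> T (tens \<eta>s) = tens (\<xi> # \<eta>s)))"

definition phi_infinity ::
    "('m \<Rightarrow> 'e \<Rightarrow> 'e) \<Rightarrow> ('f::cbanach \<Rightarrow> 'f \<Rightarrow> 'm::cstar_algebra) \<Rightarrow> ('m \<Rightarrow> 'f) \<Rightarrow> ('e list \<Rightarrow> 'f)
      \<Rightarrow> 'm \<Rightarrow> 'f \<Rightarrow> 'f" where
  "phi_infinity \<phi> ipF vac tens a = (THE T. T \<in> adjointable ipF \<and>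
     (\<forall>b. T (vac b) = vac (a * b)) \<and>
     (\<forall>\<eta> \<eta>s. T (tens (\<eta> # \<eta>s)) = tens (\<phi> a \<eta> # \<eta>s)))"

inductive_set generated_algebra :: "('f::cvector \<Rightarrow> 'f) set \<Rightarrow> ('f \<Rightarrow> 'f) set"
  for G :: "('f \<Rightarrow> 'f) set" where
  base: "T \<in> G \<Longrightarrow> T \<in> generated_algebra G"
| add: "S \<in> generated_algebra G \<Longrightarrow> T \<in> generated_algebra G \<Longrightarrow>
    (\<lambda>x. S x + T x) \<in> generated_algebra G"
| scaleC: "T \<in> generated_algebra G \<Longrightarrow> (\<lambda>x. c *\<^sub>C T x) \<in> generated_algebra G"
| comp: "S \<in> generated_algebra G \<Longrightarrow> T \<in> generated_algebra G \<Longrightarrow> S \<circ> T \<in> generated_algebra G"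

definition hardy_algebra ::
    "('m::cstar_algebra \<Rightarrow> complex) set \<Rightarrow> ('e \<Rightarrow> 'm \<Rightarrow> 'e) \<Rightarrow> ('m \<Rightarrow> 'e \<Rightarrow> 'e)
      \<Rightarrow> ('f::cbanach \<Rightarrow> 'f \<Rightarrow> 'm) \<Rightarrow> ('m \<Rightarrow> 'f) \<Rightarrow> ('e list \<Rightarrow> 'f) \<Rightarrow> ('f \<Rightarrow> 'f) set" where
  "hardy_algebra P act \<phi> ipF vac tens = ultraweak_L P ipF closure_of
     generated_algebra (range (creation act ipF vac tens) \<union> range (phi_infinity \<phi> ipF vac tens))"

text \<open>A model \<open>'k\<close> of the Hilbert space \<open>F \<otimes>\<^sub>\<pi> H\<close>, with elementary tensors \<open>tensH x h\<close>.\<close>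

locale induced_hilbert_space =
  fixes ipF :: "'f::cbanach \<Rightarrow> 'f \<Rightarrow> 'm::cstar_algebra"
    and \<pi> :: "'m \<Rightarrow> 'h::chilbert \<Rightarrow> 'h"
    and tensH :: "'f \<Rightarrow> 'h \<Rightarrow> 'k::chilbert"
  assumes cinner_tensH: "cinner (tensH x h) (tensH y k) = cinner h (\<pi> (ipF x y) k)"
    and dense: "closure (cspan {tensH x h | x h. True}) = UNIV"

text \<open>The operator \<open>X \<otimes> I\<close>.\<close>

definition induced_rep :: "('f \<Rightarrow> 'h \<Rightarrow> 'k::chilbert) \<Rightarrow> ('f \<Rightarrow> 'f) \<Rightarrow> 'k \<Rightarrow> 'k" where
  "induced_rep tensH X = (THE R. bounded_clinear R \<and> (\<forall>x h. R (tensH x h) = tensH (X x) h))"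

end

theory Submission
  imports Defs "HOL-Library.Function_Algebras"
begin

text \<open>Let \<open>K\<close> be the induced Hilbert space and \<open>\<A>\<close> the image on \<open>K\<close> of the algebra generated by the creation
  operators and the \<open>\<phi>\<^sub>\<infinity>(a)\<close>. Vector functionals are ultraweakly continuous, so the Hardy algebra has the same
  invariant subspaces as \<open>\<A>\<close>. Let \<open>T\<close> leave all of them invariant, let \<open>p\<close> be a projection in the commutant of
  \<open>\<pi>\<close> and \<open>S\<close> an operator in the commutant of \<open>\<A>\<close>. The graph of an off-diagonal corner of \<open>S\<close> relative to
  \<open>I \<otimes> p\<close> is invariant under \<open>\<A>\<close>, hence under \<open>T\<close>, so \<open>T\<close> commutes with this corner. Since the algebra is a factor,
  the off-diagonal corners of \<open>I \<otimes> \<pi>(M)'\<close> have total ranges, so \<open>T\<close> commutes with the diagonal corners, too.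
  Thus \<open>T\<close> lies in the bicommutant of \<open>\<A>\<close> and in particular has the form \<open>X \<otimes> I\<close>.

  It remains to see that the bicommutant is the ultraweak closure. After amplification every normal functional
  is a vector functional, and it suffices that \<open>T u\<close> lies in the closure of \<open>\<A> u\<close> for each vector \<open>u\<close>. Now
  \<open>u = W z\<close> for a vector \<open>z\<close> of the space of \<open>\<pi>\<close> and an intertwiner \<open>W\<close> of \<open>\<pi>\<close> with the left action on \<open>K\<close>. Each
  \<open>1 \<otimes> h \<mapsto> Q\<^sub>k W h\<close>, with \<open>Q\<^sub>k\<close> the projection to degree \<open>k\<close>, extends to an operator in the commutant of
  \<open>\<A>\<close>. So the components of \<open>T u\<close> are determined by those of \<open>T (1 \<otimes> z)\<close>, and the Fej\'er means of \<open>T u\<close> can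
  be formed within the closure of \<open>\<A> u\<close>.\<close>

subsection \<open>Complex linear maps\<close>

text \<open>The predual of the algebra is given only as an abstract space of functionals, so its
  relation to vectors has to be derived, and in both directions. Membership in the Hardy algebra
  requires every functional in \<open>L_predual\<close> to come from vectors; the comparison of
  invariant subspaces requires every vector functional of \<open>\<rho>\<close> to lie in
  \<open>L_predual\<close>. Both directions rest on \<open>series_representation\<close>, a bipolar
  argument with norm control. Two amplifications occur because a single functional in
  \<open>P\<close> already needs one, and \<open>L_predual\<close> consists of series of such
  functionals.

  Reducibility provides a projection \<open>p\<close> different from 0 and 1; otherwise there would
  be no off-diagonal corners to start from. Triviality of the center says that a nonzero corner has
  central support 1.

  Averaging is unavoidable in the last part: the homogeneous components of a bounded operator are
  obtained one degree at a time, but partial sums of their series need not be bounded, as for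
  Fourier series of bounded functions. Cesaro means are bounded by the norm of the operator.\<close>

lemmas cvec_simps [simp] = cvec.scale_zero_left cvec.scale_zero_right scaleC_one

lemma bounded_clinearI:
  assumes "\<And>x y. f (x + y) = f x + f y" "\<And>c x. f (c *\<^sub>C x) = c *\<^sub>C f x" "\<And>x. norm (f x) \<le> B * norm x"
  shows "bounded_clinear f"
  unfolding bounded_clinear_def
proof (intro conjI allI bounded_linear_intro[where K = B])
  show "f (r *\<^sub>R x) = r *\<^sub>R f x" for r x
    by (simp add: scaleR_scaleC assms)
  show "norm (f x) \<le> norm x * B" for x
    using assms(3)[of x] by (simp add: mult.commute)
qed (use assms in auto)

lemma
  assumes "bounded_clinear f"
  shows bounded_clinear_linear: "bounded_linear f"
    and clinear_add: "f (x + y) = f x + f y"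
    and clinear_scaleC: "f (c *\<^sub>C x) = c *\<^sub>C f x"
    and clinear_zero: "f 0 = 0"
    and clinear_diff: "f (x - y) = f x - f y"
    and clinear_sum: "f (sum g A) = (\<Sum>i\<in>A. f (g i))"
    and clinear_bound: "norm (f x) \<le> onorm f * norm x"
    and clinear_tendsto: "(h \<longlongrightarrow> l) \<F> \<Longrightarrow> ((\<lambda>i. f (h i)) \<longlongrightarrow> f l) \<F>"
    and clinear_continuous: "continuous_on S f"
proof -
  have b: "bounded_linear f" and s: "\<And>c x. f (c *\<^sub>C x) = c *\<^sub>C f x"
    using assms unfolding bounded_clinear_def by auto
  interpret bounded_linear f by (fact b)
  show "bounded_linear f" "f (x + y) = f x + f y" "f (c *\<^sub>C x) = c *\<^sub>C f x" "f 0 = 0"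
    "f (x - y) = f x - f y" "f (sum g A) = (\<Sum>i\<in>A. f (g i))"
    by (fact b add s zero diff sum)+
  show "norm (f x) \<le> onorm f * norm x" by (rule onorm[OF b])
  show "(h \<longlongrightarrow> l) \<F> \<Longrightarrow> ((\<lambda>i. f (h i)) \<longlongrightarrow> f l) \<F>" by (rule tendsto)
  show "continuous_on S f" by (rule linear_continuous_on[OF b])
qed

lemma clinear_bound_ex: "bounded_clinear f \<Longrightarrow> \<exists>B>0. \<forall>x. norm (f x) \<le> B * norm x"
  using bounded_linear.pos_bounded[OF bounded_clinear_linear] by (auto simp: mult.commute)

lemma bounded_clinear_comp: "bounded_clinear f \<Longrightarrow> bounded_clinear g \<Longrightarrow> bounded_clinear (\<lambda>x. f (g x))"
  unfolding bounded_clinear_def using bounded_linear_compose by auto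

lemma bounded_clinear_add: "bounded_clinear f \<Longrightarrow> bounded_clinear g \<Longrightarrow> bounded_clinear (\<lambda>x. f x + g x)"
  unfolding bounded_clinear_def by (auto intro: bounded_linear_add simp: scaleC_add_right)

lemma bounded_clinear_scaleC:
  assumes f: "bounded_clinear f" shows "bounded_clinear (\<lambda>x. c *\<^sub>C f x)"
proof (rule bounded_clinearI[where B = "cmod c * onorm f"])
  show "norm (c *\<^sub>C f x) \<le> cmod c * onorm f * norm x" for x
    using clinear_bound[OF f, of x] by (simp add: norm_scaleC mult.assoc mult_left_mono)
qed (simp_all add: clinear_add[OF f] clinear_scaleC[OF f] scaleC_add_right scaleC_scaleC mult.commute)

lemma bounded_clinear_minus: "bounded_clinear f \<Longrightarrow> bounded_clinear (\<lambda>x. - f x)"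
  unfolding bounded_clinear_def by (auto intro: bounded_linear_minus)

lemma bounded_clinear_diff: "bounded_clinear f \<Longrightarrow> bounded_clinear g \<Longrightarrow> bounded_clinear (\<lambda>x. f x - g x)"
  using bounded_clinear_add[OF _ bounded_clinear_minus] by force

lemma bounded_clinear_id: "bounded_clinear (\<lambda>x. x)"
  by (rule bounded_clinearI[where B = 1]) auto

lemma bounded_clinear_zero: "bounded_clinear (\<lambda>x. 0)"
  by (rule bounded_clinearI[where B = 1]) auto

lemma tendsto_scaleC:
  fixes h :: "'i \<Rightarrow> 'a::cbanach"
  assumes "(h \<longlongrightarrow> l) \<F>" shows "((\<lambda>i. c *\<^sub>C h i) \<longlongrightarrow> c *\<^sub>C l) \<F>"
  by (rule clinear_tendsto[OF bounded_clinear_scaleC[OF bounded_clinear_id] assms])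

lemma norm_le_of_sq:
  fixes x :: "'a::real_normed_vector" assumes "(norm x)\<^sup>2 \<le> B * norm x" "B \<ge> 0" shows "norm x \<le> B"
  using assms by (cases "norm x = 0") (auto simp: power2_eq_square mult_le_cancel_right)

lemma csubspace_closure:
  fixes S :: "'a::cbanach set" assumes "csubspace S" shows "csubspace (closure S)"
  unfolding cvec.subspace_def
proof (intro conjI ballI allI)
  show "0 \<in> closure S" using cvec.subspace_0[OF assms] closure_subset by blast
  show "x + y \<in> closure S" if "x \<in> closure S" "y \<in> closure S" for x y
  proof -
    obtain f g where "\<And>n. f n \<in> S" "f \<longlonglongrightarrow> x" "\<And>n. g n \<in> S" "g \<longlonglongrightarrow> y"
      using \<open>x \<in> closure S\<close> \<open>y \<in> closure S\<close> unfolding closure_sequential by blast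
    then have "\<And>n. f n + g n \<in> S" "(\<lambda>n. f n + g n) \<longlonglongrightarrow> x + y"
      using cvec.subspace_add[OF assms] by (auto intro: tendsto_add)
    then show ?thesis unfolding closure_sequential by (intro exI[of _ "\<lambda>n. f n + g n"]) auto
  qed
  show "c *\<^sub>C x \<in> closure S" if "x \<in> closure S" for c x
  proof -
    obtain f where "\<And>n. f n \<in> S" "f \<longlonglongrightarrow> x"
      using \<open>x \<in> closure S\<close> unfolding closure_sequential by blast
    then have "\<And>n. c *\<^sub>C f n \<in> S" "(\<lambda>n. c *\<^sub>C f n) \<longlonglongrightarrow> c *\<^sub>C x"
      using cvec.subspace_scale[OF assms] by (auto intro: tendsto_scaleC)
    then show ?thesis unfolding closure_sequential by (intro exI[of _ "\<lambda>n. c *\<^sub>C f n"]) auto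
  qed
qed

abbreviation ccspan :: "'a::cbanach set \<Rightarrow> 'a set" where "ccspan S \<equiv> closure (cspan S)"

lemma ccspan_subspace [simp]: "csubspace (ccspan S)"
  by (intro csubspace_closure cvec.subspace_span)

lemma ccspan_superset: "x \<in> S \<Longrightarrow> x \<in> ccspan S"
  using cvec.span_base closure_subset by blast

lemma ccspan_minimal: "S \<subseteq> N \<Longrightarrow> csubspace N \<Longrightarrow> closed N \<Longrightarrow> ccspan S \<subseteq> N"
  by (intro closure_minimal cvec.span_minimal)

lemma clinear_image_ccspan:
  assumes "bounded_clinear f" "\<And>x. x \<in> S \<Longrightarrow> f x \<in> N" "csubspace N" "closed N" "x \<in> ccspan S"
  shows "f x \<in> N"
proof -
  have "csubspace {x. f x \<in> N}"
    unfolding cvec.subspace_def using assms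
    by (auto simp: clinear_zero clinear_add clinear_scaleC cvec.subspace_0 cvec.subspace_add cvec.subspace_scale)
  moreover have "closed {x. f x \<in> N}"
    using continuous_closed_preimage[OF clinear_continuous[OF assms(1)] closed_UNIV assms(4)]
    by (simp add: vimage_def)
  ultimately have "ccspan S \<subseteq> {x. f x \<in> N}" using assms(2) by (intro ccspan_minimal) auto
  then show ?thesis using assms(5) by auto
qed

lemma clinear_eq_on_ccspan:
  assumes "bounded_clinear f" "bounded_clinear g" "\<And>x. x \<in> S \<Longrightarrow> f x = g x" "x \<in> ccspan S"
  shows "f x = g x"
proof -
  have "f x - g x \<in> {0}"
    by (rule clinear_image_ccspan[OF bounded_clinear_diff[OF assms(1,2)] _ _ _ assms(4)])
      (auto simp: assms(3) cvec.subspace_def)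
  then show ?thesis by simp
qed

subsection \<open>Hilbert spaces\<close>

lemma cinner_zero_right [simp]: "cinner x 0 = 0"
  using cinner_scaleC_right[of x 0 0] by simp

lemma cinner_zero_left [simp]: "cinner 0 x = 0"
  using cinner_commute[of 0 x] by simp

lemma cinner_add_left: "cinner (x + y) z = cinner x z + cinner y z"
  by (metis cinner_add_right cinner_commute complex_cnj_add)

lemma cinner_scaleC_left: "cinner (c *\<^sub>C x) y = cnj c * cinner x y"
  by (metis cinner_scaleC_right cinner_commute complex_cnj_mult)

lemma cinner_minus_right [simp]: "cinner x (- y) = - cinner x y"
  using cinner_add_right[of x y "- y"] by (simp add: eq_neg_iff_add_eq_0 add.commute)

lemma cinner_minus_left [simp]: "cinner (- x) y = - cinner x y"
  using cinner_add_left[of x "- x" y] by (simp add: eq_neg_iff_add_eq_0 add.commute)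

lemma cinner_diff_right: "cinner x (y - z) = cinner x y - cinner x z"
  using cinner_add_right[of x y "- z"] by simp

lemma cinner_diff_left: "cinner (x - y) z = cinner x z - cinner y z"
  using cinner_add_left[of x "- y" z] by simp

lemma cinner_sum_right: "cinner x (sum g A) = (\<Sum>i\<in>A. cinner x (g i))"
  by (induction A rule: infinite_finite_induct) (auto simp: cinner_add_right)

lemma cinner_sum_left: "cinner (sum g A) x = (\<Sum>i\<in>A. cinner (g i) x)"
  by (induction A rule: infinite_finite_induct) (auto simp: cinner_add_left)

lemma norm_sq_cinner: "(norm x)\<^sup>2 = Re (cinner x x)"
  by (simp add: cinner_self)

lemma cinner_self_eq_0: "cinner x x = 0 \<longleftrightarrow> x = 0"
  by (simp add: cinner_self)

lemma norm_add_sq: "(norm (x + y))\<^sup>2 = (norm x)\<^sup>2 + (norm y)\<^sup>2 + 2 * Re (cinner x y)"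
  for x y :: "'a::chilbert"
  using cinner_commute[of y x] by (simp add: norm_sq_cinner cinner_add_left cinner_add_right)

lemma norm_diff_sq: "(norm (x - y))\<^sup>2 = (norm x)\<^sup>2 + (norm y)\<^sup>2 - 2 * Re (cinner x y)"
  for x y :: "'a::chilbert"
  using norm_add_sq[of x "- y"] by simp

lemma parallelogram: "(norm (x + y))\<^sup>2 + (norm (x - y))\<^sup>2 = 2 * (norm x)\<^sup>2 + 2 * (norm y)\<^sup>2"
  for x y :: "'a::chilbert"
  by (simp add: norm_add_sq norm_diff_sq)

lemma cauchy_schwarz: "cmod (cinner x y) \<le> norm x * norm y"
proof (cases "y = 0")
  case False
  define c where "c = cinner y x / (norm y)\<^sup>2"
  have n: "complex_of_real ((norm y)\<^sup>2) \<noteq> 0" using False by simp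
  have "cinner y (x - c *\<^sub>C y) = 0"
    using n by (simp add: cinner_diff_right cinner_scaleC_right cinner_self c_def)
  then have "cinner (c *\<^sub>C y) (x - c *\<^sub>C y) = 0" by (simp add: cinner_scaleC_left)
  then have "(norm (c *\<^sub>C y + (x - c *\<^sub>C y)))\<^sup>2 = (norm (c *\<^sub>C y))\<^sup>2 + (norm (x - c *\<^sub>C y))\<^sup>2"
    unfolding norm_add_sq by simp
  then have "(norm (c *\<^sub>C y))\<^sup>2 \<le> (norm x)\<^sup>2" by simp
  then have "norm (c *\<^sub>C y) \<le> norm x" by (simp add: abs_le_square_iff[symmetric])
  then have "cmod (cinner y x) / (norm y)\<^sup>2 * norm y \<le> norm x"
    by (simp add: norm_scaleC c_def norm_divide norm_power)
  then have "cmod (cinner y x) \<le> norm x * norm y"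
    using False by (simp add: power2_eq_square field_simps)
  then show ?thesis by (metis cinner_commute complex_mod_cnj)
qed simp

lemma bounded_bilinear_cinner: "bounded_bilinear (cinner :: 'a::chilbert \<Rightarrow> _)"
proof
  show "\<exists>K. \<forall>a b. norm (cinner (a::'a) b) \<le> norm a * norm b * K"
    by (rule exI[of _ 1]) (simp add: cauchy_schwarz)
qed (simp_all add: cinner_add_left cinner_add_right scaleR_scaleC cinner_scaleC_left
      cinner_scaleC_right scaleC_complex_def)

lemmas tendsto_cinner = bounded_bilinear.tendsto[OF bounded_bilinear_cinner]

lemma bounded_clinear_cinner: "bounded_clinear (cinner x)"
  by (rule bounded_clinearI[where B = "norm x"])
    (auto simp: cinner_add_right cinner_scaleC_right scaleC_complex_def cauchy_schwarz)

lemma norm_le_cinnerI: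
  fixes x :: "'a::chilbert"
  assumes "\<And>y. cmod (cinner y x) \<le> B * norm y" "B \<ge> 0" shows "norm x \<le> B"
  using assms(1)[of x] assms(2) by (intro norm_le_of_sq) (simp_all add: cinner_self norm_power)

lemma cinner_eqI: "(\<And>y. cinner y x = cinner y z) \<Longrightarrow> x = z"
  using cinner_diff_right[of "x - z" x z] cinner_self_eq_0[of "x - z"] by simp

section \<open>Orthogonal complements, projections, Riesz representation and adjoints\<close>

definition orth :: "'a::chilbert set \<Rightarrow> 'a set" where
  "orth S = {y. \<forall>x\<in>S. cinner x y = 0}"

lemma csubspace_orth: "csubspace (orth S)"
  unfolding cvec.subspace_def orth_def by (auto simp: cinner_add_right cinner_scaleC_right)

lemma closed_orth: "closed (orth S)"
proof -
  have "orth S = (\<Inter>x\<in>S. {y. cinner x y = 0})" unfolding orth_def by auto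
  moreover have "closed {y. cinner x y = 0}" for x :: 'a
    by (intro closed_Collect_eq clinear_continuous bounded_clinear_cinner continuous_on_const)
  ultimately show ?thesis by auto
qed

lemma orth_sym: "x \<in> orth S \<Longrightarrow> y \<in> S \<Longrightarrow> cinner x y = 0"
  unfolding orth_def using cinner_commute[of x y] by auto

lemma orth_ccspan: "orth (ccspan S) = orth S"
proof
  show "orth (ccspan S) \<subseteq> orth S" unfolding orth_def using ccspan_superset by blast
  show "orth S \<subseteq> orth (ccspan S)"
  proof
    fix y assume y: "y \<in> orth S"
    have "ccspan S \<subseteq> orth {y}"
      by (intro ccspan_minimal csubspace_orth closed_orth) (use orth_sym[OF y] in \<open>auto simp: orth_def\<close>)
    then show "y \<in> orth (ccspan S)"
      unfolding orth_def using cinner_commute[of _ y] by auto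
  qed
qed

text \<open>A sequence in \<open>N\<close> that minimises the distance to \<open>x\<close> is Cauchy
  by the parallelogram law, since midpoints stay in \<open>N\<close>. Its limit is a closest point,
  and orthogonality expresses that no shift inside \<open>N\<close> brings it closer.\<close>

lemma projection_exists:
  fixes N :: "'a::chilbert set"
  assumes sub: "csubspace N" and cl: "closed N"
  shows "\<exists>p\<in>N. \<forall>n\<in>N. cinner n (x - p) = 0"
proof -
  define d where "d = infdist x N"
  have ne: "N \<noteq> {}" using cvec.subspace_0[OF sub] by auto
  have dle: "d \<le> norm (x - n)" if "n \<in> N" for n
    using infdist_le[OF that, of x] by (simp add: d_def dist_norm)
  have d0: "d \<ge> 0" by (simp add: d_def infdist_nonneg)
  have "\<exists>n\<in>N. norm (x - n) < d + inverse (real (Suc k))" for k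
  proof -
    have "infdist x N < d + inverse (real (Suc k))" by (simp add: d_def del: of_nat_Suc)
    then obtain n where "n \<in> N" "dist x n < d + inverse (real (Suc k))"
      using cInf_lessD[of "(dist x) ` N"] ne unfolding infdist_notempty[OF ne] by blast
    then show ?thesis by (auto simp: dist_norm)
  qed
  then obtain f where f: "\<And>k. f k \<in> N" "\<And>k. norm (x - f k) < d + inverse (real (Suc k))" by metis
  have key: "(norm (f k - f l))\<^sup>2 \<le> 2 * (norm (x - f k))\<^sup>2 + 2 * (norm (x - f l))\<^sup>2 - 4 * d\<^sup>2" for k l
  proof -
    have mid: "(1/2) *\<^sub>C (f k + f l) \<in> N"
      using f(1) by (intro cvec.subspace_scale[OF sub] cvec.subspace_add[OF sub])
    have "(x - f k) + (x - f l) = 2 *\<^sub>C (x - (1/2) *\<^sub>C (f k + f l))"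
    proof -
      have "2 *\<^sub>C (x - (1/2) *\<^sub>C (f k + f l)) = 2 *\<^sub>C x - (f k + f l)"
        by (simp add: cvec.scale_right_diff_distrib scaleC_scaleC)
      moreover have "2 *\<^sub>C x = x + x" using scaleC_add_left[of 1 1 x] by simp
      ultimately show ?thesis by simp
    qed
    then have "norm ((x - f k) + (x - f l)) = 2 * norm (x - (1/2) *\<^sub>C (f k + f l))"
      by (simp add: norm_scaleC)
    then have "norm ((x - f k) + (x - f l)) \<ge> 2 * d" using dle[OF mid] by simp
    then have "(norm ((x - f k) + (x - f l)))\<^sup>2 \<ge> (2 * d)\<^sup>2" using d0 by (intro power_mono) auto
    moreover have "norm ((x - f k) - (x - f l)) = norm (f k - f l)"
      by (simp add: norm_minus_commute)
    ultimately show ?thesis using parallelogram[of "x - f k" "x - f l"] by (simp add: power_mult_distrib)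
  qed
  have lim: "(\<lambda>k. norm (x - f k)) \<longlonglongrightarrow> d"
  proof (rule tendsto_sandwich[of "\<lambda>k. d" _ _ "\<lambda>k. d + inverse (real (Suc k))"])
    show "(\<lambda>k. d + inverse (real (Suc k))) \<longlonglongrightarrow> d"
      using LIMSEQ_inverse_real_of_nat_add[of d] by simp
  qed (use dle f in \<open>auto simp: less_imp_le\<close>)
  have "Cauchy f"
    unfolding Cauchy_def dist_norm
  proof (intro allI impI)
    fix e :: real assume e: "e > 0"
    have "(\<lambda>k. (norm (x - f k))\<^sup>2) \<longlonglongrightarrow> d\<^sup>2" by (intro tendsto_intros lim)
    then have "eventually (\<lambda>k. (norm (x - f k))\<^sup>2 < d\<^sup>2 + e\<^sup>2/4) sequentially"
      by (rule order_tendstoD) (use e in auto)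
    then obtain M where M: "\<And>k. k \<ge> M \<Longrightarrow> (norm (x - f k))\<^sup>2 < d\<^sup>2 + e\<^sup>2/4"
      unfolding eventually_sequentially by auto
    show "\<exists>M. \<forall>m\<ge>M. \<forall>n\<ge>M. norm (f m - f n) < e"
    proof (intro exI[of _ M] allI impI)
      fix m n assume "m \<ge> M" "n \<ge> M"
      then have "(norm (f m - f n))\<^sup>2 < e\<^sup>2" using M[of m] M[of n] key[of m n] by simp
      then show "norm (f m - f n) < e" using e by (simp add: power2_less_imp_less)
    qed
  qed
  then obtain p where p: "f \<longlonglongrightarrow> p" by (auto simp: Cauchy_convergent_iff convergent_def)
  have pN: "p \<in> N" using closed_sequentially[OF cl _ p] f(1) by auto
  have "(\<lambda>k. norm (x - f k)) \<longlonglongrightarrow> norm (x - p)" by (intro tendsto_intros p)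
  then have pd: "norm (x - p) = d" using lim LIMSEQ_unique by blast
  have "cinner n (x - p) = 0" if n: "n \<in> N" for n
  proof (cases "n = 0")
    case False
    \<comment> \<open>The coefficient of the projection of \<open>x - p\<close> to the line of
      \<open>n\<close>; subtracting it would strictly reduce the distance unless the inner product
      is 0.\<close>
    define c where "c = cinner n (x - p) / (norm n)\<^sup>2"
    have "p + c *\<^sub>C n \<in> N" using pN n by (intro cvec.subspace_add[OF sub] cvec.subspace_scale[OF sub])
    then have "norm (x - p) \<le> norm ((x - p) - c *\<^sub>C n)" using dle pd by (metis diff_diff_add)
    then have "(norm (x - p))\<^sup>2 \<le> (norm ((x - p) - c *\<^sub>C n))\<^sup>2" by (intro power_mono) auto
    also have "\<dots> = (norm (x - p))\<^sup>2 + (norm (c *\<^sub>C n))\<^sup>2 - 2 * Re (cinner (x - p) (c *\<^sub>C n))"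
      by (rule norm_diff_sq)
    also have "(norm (c *\<^sub>C n))\<^sup>2 = (cmod (cinner n (x - p)))\<^sup>2 / (norm n)\<^sup>2"
      using False by (simp add: c_def norm_scaleC norm_divide power2_eq_square norm_mult)
    also have "cinner (x - p) (c *\<^sub>C n) = complex_of_real ((cmod (cinner n (x - p)))\<^sup>2 / (norm n)\<^sup>2)"
      using cinner_commute[of "x - p" n]
      by (simp add: c_def cinner_scaleC_right complex_norm_square[symmetric] mult.commute del: of_real_power)
    finally have "(cmod (cinner n (x - p)))\<^sup>2 / (norm n)\<^sup>2 \<le> 0" by simp
    then show ?thesis using False by (simp add: divide_le_0_iff)
  qed simp
  then show ?thesis using pN by blast
qed

definition proj :: "'a::chilbert set \<Rightarrow> 'a \<Rightarrow> 'a" where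
  "proj N x = (SOME p. p \<in> N \<and> (\<forall>n\<in>N. cinner n (x - p) = 0))"

lemma
  fixes N :: "'a::chilbert set"
  assumes sub: "csubspace N" and cl: "closed N"
  shows proj_in: "proj N x \<in> N"
    and proj_orth: "x - proj N x \<in> orth N"
    and proj_unique: "p \<in> N \<Longrightarrow> x - p \<in> orth N \<Longrightarrow> proj N x = p"
proof -
  have "proj N x \<in> N \<and> (\<forall>n\<in>N. cinner n (x - proj N x) = 0)"
    unfolding proj_def by (rule someI_ex) (use projection_exists[OF assms] in blast)
  then show 1: "proj N x \<in> N" and 2: "x - proj N x \<in> orth N" unfolding orth_def by auto
  show "proj N x = p" if "p \<in> N" "x - p \<in> orth N"
  proof -
    have "(x - p) - (x - proj N x) \<in> orth N"
      by (rule cvec.subspace_diff[OF csubspace_orth that(2) 2])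
    moreover have "proj N x - p \<in> N" using 1 that by (intro cvec.subspace_diff sub)
    ultimately have "cinner (proj N x - p) (proj N x - p) = 0" unfolding orth_def by auto
    then show ?thesis by (simp add: cinner_self_eq_0)
  qed
qed

lemma
  fixes N :: "'a::chilbert set"
  assumes sub: "csubspace N" and cl: "closed N"
  shows bounded_clinear_proj: "bounded_clinear (proj N)"
    and norm_proj_le: "norm (proj N x) \<le> norm x"
    and proj_selfadjoint: "cinner (proj N x) y = cinner x (proj N y)"
    and proj_eq_iff: "proj N x = x \<longleftrightarrow> x \<in> N"
    and proj_eq_0_iff: "proj N x = 0 \<longleftrightarrow> x \<in> orth N"
proof -
  note pin = proj_in[OF assms] and po = proj_orth[OF assms] and pu = proj_unique[OF assms]
  show le: "norm (proj N x) \<le> norm x" for x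
  proof -
    have "cinner (proj N x) (x - proj N x) = 0" using pin po unfolding orth_def by auto
    then have "(norm (proj N x + (x - proj N x)))\<^sup>2 = (norm (proj N x))\<^sup>2 + (norm (x - proj N x))\<^sup>2"
      unfolding norm_add_sq by simp
    then have "(norm (proj N x))\<^sup>2 \<le> (norm x)\<^sup>2" by simp
    then show ?thesis by (simp add: abs_le_square_iff[symmetric])
  qed
  show "bounded_clinear (proj N)"
  proof (rule bounded_clinearI[where B = 1])
    show "proj N (x + y) = proj N x + proj N y" for x y
      using cvec.subspace_add[OF csubspace_orth po[of x] po[of y]]
      by (intro pu cvec.subspace_add[OF sub] pin) (simp add: algebra_simps)
    show "proj N (c *\<^sub>C x) = c *\<^sub>C proj N x" for c x
      using cvec.subspace_scale[OF csubspace_orth po[of x], of c]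
      by (intro pu cvec.subspace_scale[OF sub] pin) (simp add: cvec.scale_right_diff_distrib)
  qed (use le in auto)
  have 1: "cinner (proj N x) (y - proj N y) = 0" for x y using pin po unfolding orth_def by blast
  have 2: "cinner (x - proj N x) (proj N y) = 0" for x y using pin po orth_sym by blast
  show "cinner (proj N x) y = cinner x (proj N y)"
    using 1[of x y] 2[of x y] by (simp add: cinner_diff_right cinner_diff_left)
  show "proj N x = x \<longleftrightarrow> x \<in> N" using pin[of x] pu[of x x] cvec.subspace_0[OF csubspace_orth, of N] by auto
  show "proj N x = 0 \<longleftrightarrow> x \<in> orth N" using po[of x] pu[of 0 x] cvec.subspace_0[OF sub] by auto
qed

lemma in_ccspan_iff: "x \<in> ccspan S \<longleftrightarrow> (\<forall>y\<in>orth S. cinner y x = 0)"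
  for x :: "'a::chilbert"
proof
  assume "x \<in> ccspan S"
  then show "\<forall>y\<in>orth S. cinner y x = 0" using orth_sym orth_ccspan by blast
next
  assume *: "\<forall>y\<in>orth S. cinner y x = 0"
  define p where "p = proj (ccspan S) x"
  have pin: "p \<in> ccspan S" and po: "x - p \<in> orth S"
    unfolding p_def using proj_in[of "ccspan S" x] proj_orth[of "ccspan S" x] by (simp_all add: orth_ccspan)
  have "cinner (x - p) p = 0" using po pin orth_sym orth_ccspan by blast
  moreover have "cinner (x - p) x = 0" using * po by blast
  ultimately have "cinner (x - p) (x - p) = 0" by (simp add: cinner_diff_right)
  then show "x \<in> ccspan S" using pin by (simp add: cinner_self_eq_0)
qed

lemma ccspan_eq_UNIV_iff: "ccspan S = UNIV \<longleftrightarrow> orth S = {0}"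
  for S :: "'a::chilbert set"
proof
  assume "ccspan S = UNIV"
  then show "orth S = {0}"
    using in_ccspan_iff[of _ S] cvec.subspace_0[OF csubspace_orth, of S]
    by (metis (no_types, lifting) UNIV_I cinner_self_eq_0 empty_iff insertI1 is_singletonI' is_singleton_def singletonD)
next
  assume "orth S = {0}"
  then show "ccspan S = UNIV" using in_ccspan_iff[of _ S] by auto
qed

lemma closed_subspace_eq_orth_orth:
  fixes N :: "'a::chilbert set"
  assumes "csubspace N" "closed N"
  shows "x \<in> N \<longleftrightarrow> (\<forall>y\<in>orth N. cinner y x = 0)"
  using in_ccspan_iff[of x N] cvec.span_eq_iff[THEN iffD2, OF assms(1)] closure_closed[OF assms(2)] by simp

lemma riesz:
  fixes f :: "'a::chilbert \<Rightarrow> complex"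
  assumes f: "bounded_clinear f"
  shows "\<exists>y. \<forall>x. f x = cinner y x"
proof (cases "\<forall>x. f x = 0")
  case False
  define N where "N = {x. f x = 0}"
  have sub: "csubspace N"
    unfolding N_def cvec.subspace_def using f
    by (auto simp: clinear_zero clinear_add clinear_scaleC scaleC_complex_def)
  have cl: "closed N"
    unfolding N_def by (intro closed_Collect_eq clinear_continuous[OF f] continuous_on_const)
  obtain x0 where x0: "f x0 \<noteq> 0" using False by auto
  define z where "z = x0 - proj N x0"
  have fz: "f z = f x0" using proj_in[OF sub cl, of x0] by (simp add: z_def clinear_diff[OF f] N_def)
  then have z0: "z \<noteq> 0" using x0 clinear_zero[OF f] by auto
  have zo: "z \<in> orth N" unfolding z_def by (rule proj_orth[OF sub cl])
  have "f x = cinner (cnj (f z / cinner z z) *\<^sub>C z) x" for x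
  proof -
    have "f (x - (f x / f z) *\<^sub>C z) = 0"
      using x0 fz by (simp add: clinear_diff[OF f] clinear_scaleC[OF f] scaleC_complex_def)
    then have "cinner z (x - (f x / f z) *\<^sub>C z) = 0" using orth_sym[OF zo] by (simp add: N_def)
    then have "cinner z x = f x / f z * cinner z z" by (simp add: cinner_diff_right cinner_scaleC_right)
    then show ?thesis using z0 x0 fz by (simp add: cinner_scaleC_left cinner_self_eq_0)
  qed
  then show ?thesis by blast
qed (auto intro: exI[of _ 0])

lemma adjoint_exists:
  fixes T :: "'a::chilbert \<Rightarrow> 'b::chilbert"
  assumes T: "bounded_clinear T"
  obtains S where "bounded_clinear S" "\<And>x y. cinner (S x) y = cinner x (T y)" "\<And>x y. cinner x (S y) = cinner (T x) y"
    "\<And>x. norm (S x) \<le> onorm T * norm x"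
proof -
  have "\<exists>z. \<forall>y. cinner x (T y) = cinner z y" for x
    by (rule riesz) (intro bounded_clinear_comp[OF bounded_clinear_cinner T])
  then obtain S where S: "\<And>x y. cinner x (T y) = cinner (S x) y" by metis
  have S': "cinner x (S y) = cinner (T x) y" for x y
    using S[of y x] cinner_commute by metis
  have on: "onorm T \<ge> 0" by (rule onorm_pos_le[OF bounded_clinear_linear[OF T]])
  have b: "norm (S x) \<le> onorm T * norm x" for x
  proof (rule norm_le_cinnerI)
    show "cmod (cinner y (S x)) \<le> onorm T * norm x * norm y" for y
    proof -
      have "cmod (cinner (T y) x) \<le> norm (T y) * norm x" by (rule cauchy_schwarz)
      also have "\<dots> \<le> (onorm T * norm y) * norm x"
        by (intro mult_right_mono clinear_bound[OF T]) auto
      finally show ?thesis by (simp add: S' mult_ac)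
    qed
  qed (use on in simp)
  have "bounded_clinear S"
    by (rule bounded_clinearI[OF _ _ b]; rule cinner_eqI)
      (simp_all add: S' cinner_add_right cinner_scaleC_right)
  then show ?thesis using S S' b that by metis
qed

subsection \<open>Extension of bounded operators\<close>

text \<open>The vectors \<open>v i\<close> may be linearly dependent. The norm bound on finite
  combinations makes the graph \<open>G\<close> single-valued and lets it pass to the closure; the
  projection to the closed span then gives an operator on the whole space that vanishes on the
  complement.\<close>

lemma operator_extension:
  fixes v :: "'i \<Rightarrow> 'a::chilbert" and w :: "'i \<Rightarrow> 'b::chilbert"
  assumes B0: "B \<ge> 0"
    and B: "\<And>F c. finite F \<Longrightarrow> norm (\<Sum>i\<in>F. c i *\<^sub>C w i) \<le> B * norm (\<Sum>i\<in>F. c i *\<^sub>C v i)"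
  obtains T where "bounded_clinear T" "\<And>i. T (v i) = w i" "\<And>x. norm (T x) \<le> B * norm x"
    "\<And>x. x \<in> orth (range v) \<Longrightarrow> T x = 0"
proof -
  define G where "G = {(\<Sum>i\<in>F. c i *\<^sub>C v i, \<Sum>i\<in>F. c i *\<^sub>C w i) | F c. finite F}"
  define N where "N = ccspan (range v)"
  have sub: "csubspace N" and cl: "closed N" unfolding N_def by auto
  have Gadd: "(x + x', y + y') \<in> G" if G: "(x, y) \<in> G" "(x', y') \<in> G" for x y x' y'
  proof -
    obtain F c F' c' where *: "finite F" "x = (\<Sum>i\<in>F. c i *\<^sub>C v i)" "y = (\<Sum>i\<in>F. c i *\<^sub>C w i)"
      "finite F'" "x' = (\<Sum>i\<in>F'. c' i *\<^sub>C v i)" "y' = (\<Sum>i\<in>F'. c' i *\<^sub>C w i)"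
      using G unfolding G_def by auto
    \<comment> \<open>Coefficients are extended by 0 so that both combinations run over the same
      index set.\<close>
    define d where "d i = (if i \<in> F then c i else 0)" for i
    define d' where "d' i = (if i \<in> F' then c' i else 0)" for i
    have "(\<Sum>i\<in>F \<union> F'. d i *\<^sub>C u i) = (\<Sum>i\<in>F. c i *\<^sub>C u i)" for u :: "'i \<Rightarrow> 'a"
      using * by (intro sum.mono_neutral_cong_right) (auto simp: d_def)
    moreover have "(\<Sum>i\<in>F \<union> F'. d i *\<^sub>C u i) = (\<Sum>i\<in>F. c i *\<^sub>C u i)" for u :: "'i \<Rightarrow> 'b"
      using * by (intro sum.mono_neutral_cong_right) (auto simp: d_def)
    moreover have "(\<Sum>i\<in>F \<union> F'. d' i *\<^sub>C u i) = (\<Sum>i\<in>F'. c' i *\<^sub>C u i)" for u :: "'i \<Rightarrow> 'a"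
      using * by (intro sum.mono_neutral_cong_right) (auto simp: d'_def)
    moreover have "(\<Sum>i\<in>F \<union> F'. d' i *\<^sub>C u i) = (\<Sum>i\<in>F'. c' i *\<^sub>C u i)" for u :: "'i \<Rightarrow> 'b"
      using * by (intro sum.mono_neutral_cong_right) (auto simp: d'_def)
    ultimately have "x + x' = (\<Sum>i\<in>F \<union> F'. (d i + d' i) *\<^sub>C v i)" "y + y' = (\<Sum>i\<in>F \<union> F'. (d i + d' i) *\<^sub>C w i)"
      using * by (simp_all add: scaleC_add_left sum.distrib)
    then show ?thesis unfolding G_def using * by (intro CollectI exI[of _ "F \<union> F'"] exI[of _ "\<lambda>i. d i + d' i"]) auto
  qed
  have Gscale: "(a *\<^sub>C x, a *\<^sub>C y) \<in> G" if G: "(x, y) \<in> G" for a x y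
  proof -
    obtain F c where *: "finite F" "x = (\<Sum>i\<in>F. c i *\<^sub>C v i)" "y = (\<Sum>i\<in>F. c i *\<^sub>C w i)"
      using G unfolding G_def by auto
    then have "a *\<^sub>C x = (\<Sum>i\<in>F. (a * c i) *\<^sub>C v i)" "a *\<^sub>C y = (\<Sum>i\<in>F. (a * c i) *\<^sub>C w i)"
      by (simp_all add: cvec.scale_sum_right scaleC_scaleC)
    then show ?thesis unfolding G_def using * by (intro CollectI exI[of _ F] exI[of _ "\<lambda>i. a * c i"]) auto
  qed
  have Gbound: "norm y \<le> B * norm x" if "(x, y) \<in> G" for x y
    using that B unfolding G_def by auto
  have Gbase: "(v i, w i) \<in> G" for i
    unfolding G_def by (intro CollectI exI[of _ "{i}"] exI[of _ "\<lambda>_. 1"]) auto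
  have fst_image_mem: "x \<in> fst ` G \<longleftrightarrow> (\<exists>y. (x, y) \<in> G)" for x by force
  have Gdom: "cspan (range v) \<subseteq> fst ` G"
  proof (rule cvec.span_minimal)
    show "range v \<subseteq> fst ` G" using Gbase by force
    have "(0, 0) \<in> G" unfolding G_def by (intro CollectI exI[of _ "{}"]) auto
    then show "csubspace (fst ` G)"
      unfolding cvec.subspace_def
      by (auto simp: fst_image_mem) (meson Gadd Gscale)+
  qed
  \<comment> \<open>\<open>R\<close> is the closure of the graph \<open>G\<close>; the bound
    survives the limit and gives uniqueness when applied to a difference.\<close>
  define R where "R x y \<longleftrightarrow> (\<exists>s t. (\<forall>n. (s n, t n) \<in> G) \<and> s \<longlonglongrightarrow> x \<and> t \<longlonglongrightarrow> y)" for x y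
  have Gdiff: "(x - x', y - y') \<in> G" if "(x, y) \<in> G" "(x', y') \<in> G" for x y x' y'
    using Gadd[OF that(1) Gscale[OF that(2), of "-1"]] by simp
  have Rbound: "norm y \<le> B * norm x" if "R x y" for x y
  proof -
    obtain s t where *: "\<And>n. (s n, t n) \<in> G" "s \<longlonglongrightarrow> x" "t \<longlonglongrightarrow> y" using \<open>R x y\<close> unfolding R_def by auto
    have "(\<lambda>n. norm (t n)) \<longlonglongrightarrow> norm y" "(\<lambda>n. B * norm (s n)) \<longlonglongrightarrow> B * norm x"
      by (intro tendsto_intros *)+
    then show ?thesis using Gbound[OF *(1)] by (intro LIMSEQ_le) auto
  qed
  have Radd: "R (x + x') (y + y')" if R: "R x y" "R x' y'" for x y x' y'
  proof -
    obtain s t s' t' where *: "\<And>n. (s n, t n) \<in> G" "s \<longlonglongrightarrow> x" "t \<longlonglongrightarrow> y"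
      "\<And>n. (s' n, t' n) \<in> G" "s' \<longlonglongrightarrow> x'" "t' \<longlonglongrightarrow> y'" using R unfolding R_def by auto
    then show ?thesis unfolding R_def
      by (intro exI[of _ "\<lambda>n. s n + s' n"] exI[of _ "\<lambda>n. t n + t' n"]) (auto intro: tendsto_add Gadd)
  qed
  have Rscale: "R (a *\<^sub>C x) (a *\<^sub>C y)" if R: "R x y" for x y a
  proof -
    obtain s t where *: "\<And>n. (s n, t n) \<in> G" "s \<longlonglongrightarrow> x" "t \<longlonglongrightarrow> y" using R unfolding R_def by auto
    then show ?thesis unfolding R_def
      by (intro exI[of _ "\<lambda>n. a *\<^sub>C s n"] exI[of _ "\<lambda>n. a *\<^sub>C t n"]) (auto intro: tendsto_scaleC Gscale)
  qed
  have Runique: "y = y'" if R: "R x y" "R x y'" for x y y'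
  proof -
    have "R (x - x) (y - y')"
      using Radd[OF R(1) Rscale[OF R(2), of "-1"]] by simp
    then show ?thesis using Rbound[of "x - x" "y - y'"] by simp
  qed
  have Rex: "\<exists>y. R x y" if "x \<in> N" for x
  proof -
    obtain s where s: "\<And>n. s n \<in> cspan (range v)" "s \<longlonglongrightarrow> x"
      using \<open>x \<in> N\<close> unfolding N_def closure_sequential by blast
    then have "\<exists>t. (s n, t) \<in> G" for n using Gdom by force
    then obtain t where t: "\<And>n. (s n, t n) \<in> G" by metis
    have Bpos: "norm (t m - t n) \<le> \<bar>B\<bar> * norm (s m - s n)" for m n
      using Gbound[OF Gdiff[OF t t], of m n] mult_right_mono[OF abs_ge_self, of "norm (s m - s n)" B] by simp
    have "Cauchy s" using s(2) by (rule LIMSEQ_imp_Cauchy)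
    have "Cauchy t" unfolding Cauchy_def dist_norm
    proof (intro allI impI)
      fix e :: real assume "e > 0"
      then have "e / (\<bar>B\<bar> + 1) > 0" by auto
      with \<open>Cauchy s\<close> obtain M where M: "\<And>m n. m \<ge> M \<Longrightarrow> n \<ge> M \<Longrightarrow> norm (s m - s n) < e / (\<bar>B\<bar> + 1)"
        unfolding Cauchy_def dist_norm by blast
      show "\<exists>M. \<forall>m\<ge>M. \<forall>n\<ge>M. norm (t m - t n) < e"
      proof (intro exI[of _ M] allI impI)
        fix m n assume "m \<ge> M" "n \<ge> M"
        have "norm (t m - t n) \<le> (\<bar>B\<bar> + 1) * norm (s m - s n)"
          unfolding distrib_right using Bpos[of m n] norm_ge_zero[of "s m - s n"] by linarith
        also have "\<dots> < e" using M[OF \<open>m \<ge> M\<close> \<open>n \<ge> M\<close>] by (simp add: field_simps)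
        finally show "norm (t m - t n) < e" .
      qed
    qed
    then show ?thesis using s t unfolding R_def by (auto simp: Cauchy_convergent_iff convergent_def)
  qed
  define T where "T x = (THE y. R (proj N x) y)" for x
  have TR: "R (proj N x) (T x)" for x
    unfolding T_def using Rex[OF proj_in[OF sub cl]] Runique by (metis theI)
  note pl = bounded_clinear_proj[OF sub cl]
  have Tb: "norm (T x) \<le> B * norm x" for x
  proof -
    have "norm (T x) \<le> B * norm (proj N x)" by (rule Rbound[OF TR])
    also have "\<dots> \<le> B * norm x" by (intro mult_left_mono norm_proj_le sub cl B0)
    finally show ?thesis .
  qed
  have Tlin: "bounded_clinear T"
  proof (rule bounded_clinearI[OF _ _ Tb])
    show "T (x + y) = T x + T y" for x y
      by (rule Runique[OF TR]) (simp add: clinear_add[OF pl] Radd TR)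
    show "T (c *\<^sub>C x) = c *\<^sub>C T x" for c x
      by (rule Runique[OF TR]) (simp add: clinear_scaleC[OF pl] Rscale TR)
  qed
  show ?thesis
  proof (rule that[OF Tlin])
    show "T (v i) = w i" for i
    proof -
      have "proj N (v i) = v i"
        using proj_eq_iff[OF sub cl] ccspan_superset[of "v i" "range v"] by (auto simp: N_def)
      moreover have "R (v i) (w i)"
        unfolding R_def using Gbase by (intro exI[of _ "\<lambda>_. v i"] exI[of _ "\<lambda>_. w i"]) auto
      ultimately show ?thesis using TR[of "v i"] Runique by simp
    qed
    show "T x = 0" if "x \<in> orth (range v)" for x
    proof -
      have "proj N x = 0" using that proj_eq_0_iff[OF sub cl] by (simp add: N_def orth_ccspan)
      then show ?thesis using Rbound[OF TR[of x]] by simp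
    qed
  qed (rule Tb)
qed

text \<open>The squared norm of a combination of the \<open>w i\<close> is
  \<open>cinner s (G s)\<close> for the same combination \<open>s\<close> of the \<open>v i\<close>,
  so boundedness of \<open>G\<close> yields the estimate required by
  \<open>operator_extension\<close>. In the applications \<open>G\<close> is the expected product of
  the adjoint of the operator with the operator itself.\<close>

lemma gram_extension:
  fixes v :: "'i \<Rightarrow> 'a::chilbert" and w :: "'i \<Rightarrow> 'b::chilbert"
  assumes G: "bounded_clinear G" and vw: "\<And>i j. cinner (w i) (w j) = cinner (v i) (G (v j))"
  obtains T where "bounded_clinear T" "\<And>i. T (v i) = w i" "\<And>x. x \<in> orth (range v) \<Longrightarrow> T x = 0"
proof -
  obtain B where B: "B > 0" "\<And>x. norm (G x) \<le> B * norm x" using clinear_bound_ex[OF G] by blast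
  have "norm (\<Sum>i\<in>F. c i *\<^sub>C w i) \<le> sqrt B * norm (\<Sum>i\<in>F. c i *\<^sub>C v i)" if F: "finite F" for F c
  proof -
    define s where "s = (\<Sum>i\<in>F. c i *\<^sub>C v i)"
    have "cinner (\<Sum>i\<in>F. c i *\<^sub>C w i) (\<Sum>i\<in>F. c i *\<^sub>C w i) = cinner s (G s)"
      unfolding s_def clinear_sum[OF G] cinner_sum_left cinner_sum_right cinner_scaleC_left
        cinner_scaleC_right vw clinear_scaleC[OF G] ..
    then have "(norm (\<Sum>i\<in>F. c i *\<^sub>C w i))\<^sup>2 \<le> cmod (cinner s (G s))"
      unfolding norm_sq_cinner by (simp add: complex_Re_le_cmod)
    also have "\<dots> \<le> norm s * norm (G s)" by (rule cauchy_schwarz)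
    also have "\<dots> \<le> norm s * (B * norm s)" by (intro mult_left_mono B) auto
    also have "\<dots> = (sqrt B * norm s)\<^sup>2" using B by (simp add: power_mult_distrib power2_eq_square)
    finally show ?thesis unfolding s_def[symmetric] by (rule power2_le_imp_le) (use B in auto)
  qed
  then show ?thesis
    using operator_extension[of "sqrt B" w v, OF _ _ that] B(1) by simp
qed

subsection \<open>Square-summable sequences of vectors\<close>

text \<open>Countable direct sum of copies of a Hilbert space, the carrier of amplifications. Being
  a type constructor on \<open>chilbert\<close>, it can be iterated.\<close>

typedef (overloaded) 'a ell2 = "{f :: nat \<Rightarrow> 'a::chilbert. summable (\<lambda>n. (norm (f n))\<^sup>2)}"
  morphisms coord Abs_ell2
  by (rule exI[of _ "\<lambda>n. 0"]) simp

setup_lifting type_definition_ell2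

lemma norm_add_sq_le: "(norm (x + y))\<^sup>2 \<le> 2 * (norm x)\<^sup>2 + 2 * (norm y)\<^sup>2"
  for x y :: "'a::chilbert"
  using parallelogram[of x y] zero_le_power2[of "norm (x - y)"] by linarith

lemma summable_coord: "summable (\<lambda>n. (norm (coord x n))\<^sup>2)"
  using coord[of x] by simp

lemma summable_add_sq:
  assumes "summable (\<lambda>n. (norm (f n))\<^sup>2)" "summable (\<lambda>n. (norm (g n))\<^sup>2)"
  shows "summable (\<lambda>n. (norm (f n + g n :: 'a::chilbert))\<^sup>2)"
proof (rule summable_comparison_test')
  show "summable (\<lambda>n. 2 * (norm (f n))\<^sup>2 + 2 * (norm (g n))\<^sup>2)"
    using assms by (intro summable_add summable_mult)
  show "norm ((norm (f n + g n))\<^sup>2) \<le> 2 * (norm (f n))\<^sup>2 + 2 * (norm (g n))\<^sup>2" if "n \<ge> 0" for n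
    using norm_add_sq_le[of "f n" "g n"] by simp
qed

lemma summable_cinner:
  assumes "summable (\<lambda>n. (norm (f n))\<^sup>2)" "summable (\<lambda>n. (norm (g n :: 'a::chilbert))\<^sup>2)"
  shows "summable (\<lambda>n. norm (cinner (f n) (g n)))"
proof (rule summable_comparison_test')
  show "summable (\<lambda>n. (norm (f n))\<^sup>2 + (norm (g n))\<^sup>2)" using assms by (rule summable_add)
  show "norm (norm (cinner (f n) (g n))) \<le> (norm (f n))\<^sup>2 + (norm (g n))\<^sup>2" if "n \<ge> 0" for n
    using cauchy_schwarz[of "f n" "g n"] sum_squares_bound[of "norm (f n)" "norm (g n)"]
      mult_nonneg_nonneg[OF norm_ge_zero norm_ge_zero, of "f n" "g n"] unfolding real_norm_def abs_norm_cancel by linarith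
qed

instantiation ell2 :: (chilbert) real_normed_vector
begin

lift_definition zero_ell2 :: "'a ell2" is "\<lambda>n. 0" by simp
lift_definition plus_ell2 :: "'a ell2 \<Rightarrow> 'a ell2 \<Rightarrow> 'a ell2" is "\<lambda>f g n. f n + g n"
  by (rule summable_add_sq)
lift_definition uminus_ell2 :: "'a ell2 \<Rightarrow> 'a ell2" is "\<lambda>f n. - f n" by simp
lift_definition minus_ell2 :: "'a ell2 \<Rightarrow> 'a ell2 \<Rightarrow> 'a ell2" is "\<lambda>f g n. f n - g n"
  using summable_add_sq[where g = "\<lambda>n. - g n" for g] by simp
lift_definition scaleR_ell2 :: "real \<Rightarrow> 'a ell2 \<Rightarrow> 'a ell2" is "\<lambda>r f n. r *\<^sub>R f n"
  by (simp add: power_mult_distrib summable_mult)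
definition norm_ell2 :: "'a ell2 \<Rightarrow> real" where "norm_ell2 x = sqrt (\<Sum>n. (norm (coord x n))\<^sup>2)"
definition sgn_ell2 :: "'a ell2 \<Rightarrow> 'a ell2" where "sgn_ell2 x = scaleR (inverse (norm x)) x"
definition dist_ell2 :: "'a ell2 \<Rightarrow> 'a ell2 \<Rightarrow> real" where "dist_ell2 x y = norm (x - y)"
definition uniformity_ell2 :: "('a ell2 \<times> 'a ell2) filter" where
  "uniformity_ell2 = (INF e\<in>{0<..}. principal {(x, y). dist x y < e})"
definition open_ell2 :: "'a ell2 set \<Rightarrow> bool" where
  "open_ell2 U = (\<forall>x\<in>U. \<forall>\<^sub>F (x', y) in uniformity. x' = x \<longrightarrow> y \<in> U)"

lemma norm_ell2_sq: "(norm x)\<^sup>2 = (\<Sum>n. (norm (coord x n))\<^sup>2)" for x :: "'a ell2"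
  by (simp add: norm_ell2_def suminf_nonneg summable_coord)

lemma L2_le_norm_ell2: "L2_set (\<lambda>n. norm (coord x n)) {..<N} \<le> norm x" for x :: "'a ell2"
  unfolding L2_set_def norm_ell2_def
  by (intro real_sqrt_le_mono sum_le_suminf summable_coord) auto

lemma norm_ell2_leI:
  fixes x :: "'a ell2"
  assumes "\<And>N. L2_set (\<lambda>n. norm (coord x n)) {..<N} \<le> B"
  shows "norm x \<le> B"
proof -
  have B: "B \<ge> 0" using assms[of 0] by simp
  have "(\<Sum>n<N. (norm (coord x n))\<^sup>2) \<le> B\<^sup>2" for N
    using power_mono[OF assms[of N], of 2] by (simp add: L2_set_def sum_nonneg)
  then have "(\<Sum>n. (norm (coord x n))\<^sup>2) \<le> B\<^sup>2" by (intro suminf_le_const summable_coord)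
  then show ?thesis unfolding norm_ell2_def using B by (simp add: real_le_lsqrt suminf_nonneg summable_coord)
qed

instance
proof
  fix x y z :: "'a ell2" and a b :: real
  show "x + y + z = x + (y + z)" by transfer (simp add: add.assoc)
  show "x + y = y + x" by transfer (simp add: add.commute)
  show "0 + x = x" "- x + x = 0" by (transfer; simp)+
  show "x - y = x + - y" by transfer simp
  show "a *\<^sub>R (x + y) = a *\<^sub>R x + a *\<^sub>R y" by transfer (simp add: scaleR_add_right)
  show "(a + b) *\<^sub>R x = a *\<^sub>R x + b *\<^sub>R x" by transfer (simp add: scaleR_add_left)
  show "a *\<^sub>R b *\<^sub>R x = (a * b) *\<^sub>R x" "1 *\<^sub>R x = x" by (transfer; simp)+
  show "dist x y = norm (x - y)" "sgn x = inverse (norm x) *\<^sub>R x" by (simp_all add: dist_ell2_def sgn_ell2_def)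
  show "uniformity = (INF e\<in>{0<..}. principal {(x :: 'a ell2, y). dist x y < e})"
    by (rule uniformity_ell2_def)
  show "open U = (\<forall>x\<in>U. \<forall>\<^sub>F (x', y) in uniformity. x' = x \<longrightarrow> y \<in> U)" for U :: "'a ell2 set"
    by (rule open_ell2_def)
  show "norm x = 0 \<longleftrightarrow> x = 0"
  proof
    assume "norm x = 0"
    then have "(\<Sum>n. (norm (coord x n))\<^sup>2) = 0" by (simp add: norm_ell2_def)
    then have "\<forall>n. coord x n = 0" using suminf_eq_zero_iff[OF summable_coord[of x]] by simp
    then show "x = 0" by transfer auto
  next
    assume "x = 0"
    then show "norm x = 0" by (simp add: norm_ell2_def zero_ell2.rep_eq)
  qed
  show "norm (x + y) \<le> norm x + norm y"
  proof (rule norm_ell2_leI)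
    fix N
    have "L2_set (\<lambda>n. norm (coord (x + y) n)) {..<N} \<le> L2_set (\<lambda>n. norm (coord x n) + norm (coord y n)) {..<N}"
      by (intro L2_set_mono) (simp_all add: plus_ell2.rep_eq norm_triangle_ineq)
    also have "\<dots> \<le> L2_set (\<lambda>n. norm (coord x n)) {..<N} + L2_set (\<lambda>n. norm (coord y n)) {..<N}"
      by (rule L2_set_triangle_ineq)
    also have "\<dots> \<le> norm x + norm y" by (intro add_mono L2_le_norm_ell2)
    finally show "L2_set (\<lambda>n. norm (coord (x + y) n)) {..<N} \<le> norm x + norm y" .
  qed
  show "norm (a *\<^sub>R x) = \<bar>a\<bar> * norm x"
    by (simp add: norm_ell2_def scaleR_ell2.rep_eq power_mult_distrib suminf_mult summable_coord real_sqrt_mult)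
qed

end

lemma norm_coord_le: "norm (coord x k) \<le> norm x"
  using L2_le_norm_ell2[of x "Suc k"] member_le_L2_set[of "{..<Suc k}" k "\<lambda>n. norm (coord x n)"] by simp

lemma coord_add [simp]: "coord (x + y) n = coord x n + coord y n"
  and coord_diff [simp]: "coord (x - y) n = coord x n - coord y n"
  and coord_zero [simp]: "coord 0 n = 0"
  and coord_minus [simp]: "coord (- x) n = - coord x n"
  by (simp_all add: plus_ell2.rep_eq minus_ell2.rep_eq zero_ell2.rep_eq uminus_ell2.rep_eq)

lemma ell2_eqI: "(\<And>n. coord x n = coord y n) \<Longrightarrow> x = y"
  by (metis coord_inject ext)

instance ell2 :: (chilbert) banach
proof
  fix X :: "nat \<Rightarrow> 'a ell2" assume X: "Cauchy X"
  have C: "\<exists>M. \<forall>m\<ge>M. \<forall>n\<ge>M. norm (X m - X n) < e" if "e > 0" for e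
    using X that unfolding Cauchy_def dist_norm by blast
  have "Cauchy (\<lambda>n. coord (X n) k)" for k
    unfolding Cauchy_def dist_norm
  proof (intro allI impI)
    fix e :: real assume "e > 0"
    then obtain M where "\<forall>m\<ge>M. \<forall>n\<ge>M. norm (X m - X n) < e" using C by blast
    then show "\<exists>M. \<forall>m\<ge>M. \<forall>n\<ge>M. norm (coord (X m) k - coord (X n) k) < e"
      using norm_coord_le[of "X m - X n" k for m n] by (intro exI[of _ M]) (metis coord_diff le_less_trans)
  qed
  then have "\<exists>l. (\<lambda>n. coord (X n) k) \<longlonglongrightarrow> l" for k by (simp add: Cauchy_convergent_iff convergent_def)
  then obtain f where f: "\<And>k. (\<lambda>n. coord (X n) k) \<longlonglongrightarrow> f k" by metis
  have lim: "L2_set (\<lambda>k. norm (coord (X m) k - f k)) {..<N} \<le> e"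
    if "e > 0" "\<And>n. n \<ge> M \<Longrightarrow> norm (X m - X n) < e" for e M m N
  proof (rule LIMSEQ_le_const2)
    show "(\<lambda>n. L2_set (\<lambda>k. norm (coord (X m) k - coord (X n) k)) {..<N})
        \<longlonglongrightarrow> L2_set (\<lambda>k. norm (coord (X m) k - f k)) {..<N}"
      unfolding L2_set_def by (intro tendsto_intros f)
    show "\<exists>M. \<forall>n\<ge>M. L2_set (\<lambda>k. norm (coord (X m) k - coord (X n) k)) {..<N} \<le> e"
    proof (intro exI[of _ M] allI impI)
      fix n assume "n \<ge> M"
      then show "L2_set (\<lambda>k. norm (coord (X m) k - coord (X n) k)) {..<N} \<le> e"
        using L2_le_norm_ell2[of "X m - X n" N] that(2)[of n] by simp
    qed
  qed
  obtain M1 where M1: "\<And>n. n \<ge> M1 \<Longrightarrow> norm (X M1 - X n) < 1" using C[of 1] by auto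
  have "(\<Sum>k<N. (norm (coord (X M1) k - f k))\<^sup>2) \<le> 1" for N
    using M1 power_mono[OF lim[of 1 M1 M1 N], of 2] by (simp add: L2_set_def sum_nonneg)
  then have "summable (\<lambda>k. (norm (coord (X M1) k - f k))\<^sup>2)" by (intro summableI_nonneg_bounded) auto
  \<comment> \<open>The limit \<open>f\<close> is written as the member \<open>X M1\<close> of the
    sequence minus a square-summable difference.\<close>
  then have "summable (\<lambda>k. (norm (coord (X M1) k + - (coord (X M1) k - f k)))\<^sup>2)"
    by (intro summable_add_sq summable_coord) (simp only: norm_minus_cancel)
  then have "summable (\<lambda>k. (norm (f k))\<^sup>2)" by simp
  then obtain L where L: "\<And>k. coord L k = f k" by (metis (full_types) Abs_ell2_inverse mem_Collect_eq)
  have "X \<longlonglongrightarrow> L"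
  proof (rule metric_LIMSEQ_I)
    fix e :: real assume e: "e > 0"
    then obtain M where M: "\<forall>m\<ge>M. \<forall>n\<ge>M. norm (X m - X n) < e/2" using C[of "e/2"] by auto
    show "\<exists>no. \<forall>n\<ge>no. dist (X n) L < e"
    proof (intro exI[of _ M] allI impI)
      fix m assume "m \<ge> M"
      then have "norm (X m - L) \<le> e/2"
        using lim[of "e/2" M m] M e by (intro norm_ell2_leI) (simp add: L)
      then show "dist (X m) L < e" using e by (simp add: dist_norm)
    qed
  qed
  then show "convergent X" by (auto simp: convergent_def)
qed

instantiation ell2 :: (chilbert) chilbert
begin

lift_definition scaleC_ell2 :: "complex \<Rightarrow> 'a ell2 \<Rightarrow> 'a ell2" is "\<lambda>c f n. c *\<^sub>C f n"
  by (simp add: norm_scaleC power_mult_distrib summable_mult)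
definition cinner_ell2 :: "'a ell2 \<Rightarrow> 'a ell2 \<Rightarrow> complex" where
  "cinner_ell2 x y = (\<Sum>n. cinner (coord x n) (coord y n))"

lemma summable_cinner_coord: "summable (\<lambda>n. cinner (coord x n) (coord y n))" for x y :: "'a ell2"
  by (rule summable_norm_cancel[OF summable_cinner]) (rule summable_coord)+

instance
proof
  fix x y z :: "'a ell2" and c d :: complex and r :: real
  show "c *\<^sub>C (x + y) = c *\<^sub>C x + c *\<^sub>C y" by transfer (simp add: scaleC_add_right)
  show "(c + d) *\<^sub>C x = c *\<^sub>C x + d *\<^sub>C x" by transfer (simp add: scaleC_add_left)
  show "c *\<^sub>C d *\<^sub>C x = (c * d) *\<^sub>C x" "1 *\<^sub>C x = x" by (transfer; simp add: scaleC_scaleC)+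
  show "r *\<^sub>R x = complex_of_real r *\<^sub>C x" by transfer (simp add: scaleR_scaleC)
  show "norm (c *\<^sub>C x) = cmod c * norm x"
    by (simp add: norm_ell2_def scaleC_ell2.rep_eq norm_scaleC power_mult_distrib suminf_mult
        summable_coord real_sqrt_mult)
  show "cinner x (y + z) = cinner x y + cinner x z"
    by (simp add: cinner_ell2_def cinner_add_right suminf_add[symmetric] summable_cinner_coord)
  show "cinner x (c *\<^sub>C y) = c * cinner x y"
    by (simp add: cinner_ell2_def scaleC_ell2.rep_eq cinner_scaleC_right suminf_mult summable_cinner_coord)
  show "cinner x y = cnj (cinner y x)"
  proof -
    have "(\<lambda>n. cnj (cinner (coord y n) (coord x n))) sums cnj (cinner y x)"
      unfolding cinner_ell2_def by (intro sums_cnj[THEN iffD2] summable_sums summable_cinner_coord)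
    then show ?thesis
      unfolding cinner_ell2_def by (subst cinner_commute) (simp add: sums_iff)
  qed
  show "cinner x x = complex_of_real ((norm x)\<^sup>2)"
    unfolding norm_ell2_sq cinner_ell2_def cinner_self by (intro suminf_of_real[symmetric] summable_coord)
qed

end

lemma coord_scaleC [simp]: "coord (c *\<^sub>C x) n = c *\<^sub>C coord x n"
  by (simp add: scaleC_ell2.rep_eq)

lemma cinner_ell2_sums: "(\<lambda>n. cinner (coord x n) (coord y n)) sums cinner x y"
  unfolding cinner_ell2_def by (rule summable_sums[OF summable_cinner_coord])

lemma bounded_clinear_coord: "bounded_clinear (\<lambda>x. coord x n)"
  by (rule bounded_clinearI[where B = 1]) (simp_all add: norm_coord_le)

lift_definition single :: "nat \<Rightarrow> 'a::chilbert \<Rightarrow> 'a ell2" is "\<lambda>n h m. if m = n then h else 0"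
proof -
  fix n and h :: 'a
  show "summable (\<lambda>m. (norm (if m = n then h else 0))\<^sup>2)"
    by (rule summable_finite[of "{n}"]) auto
qed

lemma coord_single: "coord (single n h) m = (if m = n then h else 0)"
  by (rule single.rep_eq[THEN fun_cong])

lemma cinner_single_left: "cinner (single n h) x = cinner h (coord x n)"
proof -
  have "(\<lambda>m. cinner (coord (single n h) m) (coord x m)) = (\<lambda>m. if m = n then cinner h (coord x n) else 0)"
    by (auto simp: coord_single)
  then have "(\<lambda>m. if m = n then cinner h (coord x n) else 0) sums cinner (single n h) x"
    using cinner_ell2_sums[of "single n h" x] by simp
  then show ?thesis by (rule sums_unique2[OF _ sums_single])
qed

lemma bounded_clinear_single: "bounded_clinear (single n)"
proof (rule bounded_clinearI[where B = 1])
  show "norm (single n x) \<le> 1 * norm x" for x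
  proof -
    have "(norm (single n x))\<^sup>2 = (norm x)\<^sup>2"
      unfolding norm_sq_cinner cinner_single_left by (simp add: coord_single)
    then show ?thesis by simp
  qed
qed (auto intro!: ell2_eqI simp: coord_single)

lemma ccspan_single: "ccspan {single n h | n h. True} = UNIV"
  unfolding ccspan_eq_UNIV_iff
proof (intro equalityI subsetI)
  fix y assume "y \<in> orth {single n h | n h. True}"
  then have "cinner (single n h) y = 0" for n h unfolding orth_def by blast
  then have "cinner h (coord y n) = 0" for n h by (simp add: cinner_single_left)
  then have "coord y n = 0" for n using cinner_self_eq_0 by blast
  then show "y \<in> {0}" by (auto intro: ell2_eqI)
qed (auto simp: orth_def)

lemma ell2_operator_eqI:
  assumes "bounded_clinear S" "bounded_clinear T" "\<And>n h. S (single n h) = T (single n h)"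
  shows "S x = T x"
  by (rule clinear_eq_on_ccspan[OF assms(1,2), of "{single n h | n h. True}"])
    (use assms(3) ccspan_single in auto)

text \<open>The diagonal operator with \<open>T\<close> in every coordinate. The image sequence is
  square summable for bounded \<open>T\<close>; otherwise \<open>Abs_ell2\<close> may be
  meaningless.\<close>

definition inflate :: "('a::chilbert \<Rightarrow> 'b::chilbert) \<Rightarrow> 'a ell2 \<Rightarrow> 'b ell2" where
  "inflate T x = Abs_ell2 (\<lambda>n. T (coord x n))"

lemma
  assumes T: "bounded_clinear T"
  shows coord_inflate: "coord (inflate T x) n = T (coord x n)"
    and bounded_clinear_inflate: "bounded_clinear (inflate T)"
    and inflate_single: "inflate T (single n h) = single n (T h)"
proof -
  have ineq: "(norm (T y))\<^sup>2 \<le> (onorm T)\<^sup>2 * (norm y)\<^sup>2" for y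
    using power_mono[OF clinear_bound[OF T, of y], of 2] by (simp add: power_mult_distrib)
  have s: "summable (\<lambda>n. (norm (T (coord x n)))\<^sup>2)" for x
    by (rule summable_comparison_test'[OF summable_mult[OF summable_coord, of "(onorm T)\<^sup>2" x]])
      (simp add: ineq)
  then show c: "coord (inflate T x) n = T (coord x n)" for x n
    by (simp add: inflate_def Abs_ell2_inverse)
  show "bounded_clinear (inflate T)"
  proof (rule bounded_clinearI[where B = "onorm T"])
    show "norm (inflate T x) \<le> onorm T * norm x" for x
    proof (rule power2_le_imp_le, goal_cases)
      case 1
      have "(\<Sum>n. (norm (T (coord x n)))\<^sup>2) \<le> (\<Sum>n. (onorm T)\<^sup>2 * (norm (coord x n))\<^sup>2)"
        by (intro suminf_le s summable_mult summable_coord ineq)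
      then show ?case
        by (simp add: norm_ell2_sq c suminf_mult summable_coord power_mult_distrib)
    next
      case 2
      show ?case using onorm_pos_le[OF bounded_clinear_linear[OF T]] by simp
    qed
  next
    show "inflate T (x + y) = inflate T x + inflate T y" for x y
      by (rule ell2_eqI) (simp add: c clinear_add[OF T])
    show "inflate T (b *\<^sub>C x) = b *\<^sub>C inflate T x" for b x
      by (rule ell2_eqI) (simp add: c clinear_scaleC[OF T])
  qed
  show "inflate T (single n h) = single n (T h)"
    by (rule ell2_eqI) (simp add: c coord_single clinear_zero[OF T])
qed

definition commutant :: "('a::cbanach \<Rightarrow> 'a) set \<Rightarrow> ('a \<Rightarrow> 'a) set" where
  "commutant \<A> = {S. bounded_clinear S \<and> (\<forall>T\<in>\<A>. \<forall>x. S (T x) = T (S x))}"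

text \<open>Every matrix entry of an operator that commutes with the amplified algebra lies in the
  commutant of \<open>\<A>\<close>, hence commutes with \<open>T\<close>; comparing entries gives
  the claim.\<close>

lemma inflate_bicommutant:
  assumes \<A>: "\<And>A. A \<in> \<A> \<Longrightarrow> bounded_clinear A" and T: "T \<in> commutant (commutant \<A>)"
  shows "inflate T \<in> commutant (commutant (inflate ` \<A>))"
proof -
  have bT: "bounded_clinear T" using T by (simp add: commutant_def)
  have "inflate T (V x) = V (inflate T x)" if V: "V \<in> commutant (inflate ` \<A>)" for V x
  proof (rule ell2_operator_eqI[where S = "\<lambda>x. inflate T (V x)" and T = "\<lambda>x. V (inflate T x)"])
    have bV: "bounded_clinear V" using V by (simp add: commutant_def)
    show "bounded_clinear (\<lambda>x. inflate T (V x))" "bounded_clinear (\<lambda>x. V (inflate T x))"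
      by (rule bounded_clinear_comp[OF bounded_clinear_inflate[OF bT] bV]
          bounded_clinear_comp[OF bV bounded_clinear_inflate[OF bT]])+
    fix j h
    show "inflate T (V (single j h)) = V (inflate T (single j h))"
    proof (rule ell2_eqI)
      fix i
      define W where "W g = coord (V (single j g)) i" for g
      have "bounded_clinear W"
        unfolding W_def by (rule bounded_clinear_comp[OF bounded_clinear_coord
            bounded_clinear_comp[OF bV bounded_clinear_single]])
      moreover have "W (A g) = A (W g)" if "A \<in> \<A>" for A g
      proof -
        have "V (inflate A (single j g)) = inflate A (V (single j g))"
          using V that by (auto simp: commutant_def)
        then show ?thesis
          using \<A>[OF that] by (simp add: W_def inflate_single coord_inflate)
      qed
      ultimately have "W \<in> commutant \<A>" by (simp add: commutant_def)
      then have "T (W h) = W (T h)" using T by (auto simp: commutant_def)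
      then show "coord (inflate T (V (single j h))) i = coord (V (inflate T (single j h))) i"
        by (simp add: W_def coord_inflate[OF bT] inflate_single[OF bT])
    qed
  qed
  then show ?thesis by (simp add: commutant_def bounded_clinear_inflate[OF bT])
qed

subsection \<open>Square roots in C*-algebras\<close>

lemma star_zero [simp]: "star (0 :: 'a::cstar_algebra) = 0"
  using star_scaleC[of 0 "0 :: 'a"] by simp

lemma star_minus [simp]: "star (- x) = - star (x :: 'a::cstar_algebra)"
  using star_add[of x "- x"] by (simp add: eq_neg_iff_add_eq_0 add.commute)

lemma star_diff: "star (x - y) = star x - star (y :: 'a::cstar_algebra)"
  using star_add[of x "- y"] by simp

lemma star_one [simp]: "star (1 :: 'a::cstar_algebra) = 1"
  by (metis mult.left_neutral mult.right_neutral star_mult star_star)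

lemma star_scaleR: "star (r *\<^sub>R x) = r *\<^sub>R star (x :: 'a::cstar_algebra)"
  by (simp add: scaleR_scaleC star_scaleC)

lemma star_power: "star (x ^ n) = star x ^ n" for x :: "'a::cstar_algebra"
  by (induction n) (simp_all add: star_mult power_commutes)

lemma norm_star [simp]: "norm (star x) = norm (x :: 'a::cstar_algebra)"
proof -
  have "norm x \<le> norm (star x)" for x :: 'a
    using norm_mult_ineq[of "star x" x] by (cases "x = 0") (auto simp: cstar_identity power2_eq_square)
  from this[of x] this[of "star x"] show ?thesis by (simp add: star_star)
qed

lemma bounded_linear_star: "bounded_linear (star :: 'a::cstar_algebra \<Rightarrow> 'a)"
  by (rule bounded_linear_intro[where K = 1]) (simp_all add: star_add star_scaleR)

lemma cinner_scaleR_right: "cinner x (r *\<^sub>R y) = complex_of_real r * cinner x y"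
  by (simp add: scaleR_scaleC cinner_scaleC_right)

text \<open>Taylor coefficients at 0 of the square root of 1 - x.\<close>

definition sqrt_coeff :: "nat \<Rightarrow> real" where
  "sqrt_coeff n = (1/2 gchoose n) * (- 1) ^ n"

lemma sqrt_coeff_pochhammer: "sqrt_coeff n = pochhammer (- 1/2) n / fact n"
  by (simp add: sqrt_coeff_def gbinomial_pochhammer power_mult_distrib[symmetric])

lemma sqrt_coeff_0 [simp]: "sqrt_coeff 0 = 1"
  by (simp add: sqrt_coeff_def)

lemma sqrt_coeff_Suc_nonpos: "sqrt_coeff (Suc n) \<le> 0"
  unfolding sqrt_coeff_pochhammer pochhammer_rec using pochhammer_nonneg[of "1/2 :: real" n]
  by (simp add: divide_nonpos_pos mult_nonpos_nonneg)

text \<open>Partial sums of coefficients belong to the series divided by 1 - x, here the power -1/2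
  of 1 - x, whose coefficients are nonnegative. Together with the signs of the coefficients this
  gives absolute convergence up to the boundary of the unit disc.\<close>

lemma sum_sqrt_coeff_nonneg: "(\<Sum>k\<le>n. sqrt_coeff k) \<ge> 0"
proof -
  have "(\<Sum>k\<le>n. sqrt_coeff k) = pochhammer (1/2) n / fact n"
    unfolding sqrt_coeff_def gbinomial_sum_lower_neg
    by (simp add: gbinomial_pochhammer power_mult_distrib[symmetric])
  then show ?thesis using pochhammer_nonneg[of "1/2 :: real" n] by (simp add: divide_nonneg_pos)
qed

lemma sum_sqrt_coeff_Suc_le: "(\<Sum>k<n. \<bar>sqrt_coeff (Suc k)\<bar>) \<le> 1"
proof -
  have "(\<Sum>k\<le>n. sqrt_coeff k) = 1 + (\<Sum>k<n. sqrt_coeff (Suc k))"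
    by (simp add: sum.atMost_shift)
  moreover have "(\<Sum>k<n. \<bar>sqrt_coeff (Suc k)\<bar>) = - (\<Sum>k<n. sqrt_coeff (Suc k))"
    by (simp add: abs_of_nonpos sqrt_coeff_Suc_nonpos sum_negf)
  ultimately show ?thesis using sum_sqrt_coeff_nonneg[of n] by simp
qed

lemma sqrt_coeff_convolution:
  "(\<Sum>i\<le>n. sqrt_coeff i * sqrt_coeff (n - i)) = (if n = 0 then 1 else if n = 1 then -1 else 0)"
proof -
  have "(\<Sum>i\<le>n. sqrt_coeff i * sqrt_coeff (n - i)) = (\<Sum>i\<le>n. (1/2 gchoose i) * (1/2 gchoose (n - i)) * (- 1) ^ n)"
    by (intro sum.cong refl) (simp add: sqrt_coeff_def power_add[symmetric])
  also have "\<dots> = (1 gchoose n) * (- 1) ^ n"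
    using gbinomial_Vandermonde[of "1/2 :: real" "1/2" n]
    by (simp add: sum_distrib_right[symmetric] atMost_atLeast0)
  also have "(1 gchoose n :: real) = of_nat (1 choose n)"
    using binomial_gbinomial[of 1 n, where ?'a = real] by simp
  also have "of_nat (1 choose n) * (- 1) ^ n = (if n = 0 then 1 else if n = 1 then -1 else (0 :: real))"
    by (cases n rule: nat.exhaust) (auto simp: binomial_eq_0 less_Suc_eq_0_disj)
  finally show ?thesis .
qed

text \<open>The binomial series converges absolutely for norm at most 1, and \<open>1 - d\<close> is
  its value at \<open>x\<close>. All terms of positive degree have coefficients of one sign with
  absolute sum at most 1, which bounds \<open>d\<close>; commutation passes from powers of
  \<open>x\<close> to the limit.\<close>

lemma cstar_sqrt:
  fixes x :: "'a::cstar_algebra"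
  assumes sx: "star x = x" and nx: "norm x \<le> 1"
  obtains d where "star d = d" "norm d \<le> 1" "(1 - d) * (1 - d) = 1 - x"
    "\<And>y. y * x = x * y \<Longrightarrow> y * d = d * y"
proof -
  define e where "e n = sqrt_coeff (Suc n) *\<^sub>R x ^ Suc n" for n
  have px: "norm (x ^ n) \<le> 1" for n
    using norm_power_ineq[of x n] power_mono[OF nx, of n] by simp
  have ne: "norm (e n) \<le> \<bar>sqrt_coeff (Suc n)\<bar>" for n
    using mult_left_mono[OF px[of "Suc n"], of "\<bar>sqrt_coeff (Suc n)\<bar>"] by (simp add: e_def del: power_Suc)
  have sc: "summable (\<lambda>n. \<bar>sqrt_coeff (Suc n)\<bar>)"
    by (rule summableI_nonneg_bounded[OF _ sum_sqrt_coeff_Suc_le]) simp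
  have se: "summable (\<lambda>n. norm (e n))"
    by (rule summable_comparison_test'[OF sc]) (simp add: ne)
  define d where "d = - (\<Sum>n. e n)"
  have nd: "norm d \<le> 1"
  proof -
    have "norm d \<le> (\<Sum>n. norm (e n))" unfolding d_def norm_minus_cancel by (rule summable_norm[OF se])
    also have "\<dots> \<le> (\<Sum>n. \<bar>sqrt_coeff (Suc n)\<bar>)" by (rule suminf_le[OF ne se sc])
    also have "\<dots> \<le> 1" by (rule suminf_le_const[OF sc sum_sqrt_coeff_Suc_le])
    finally show ?thesis .
  qed
  have es: "e sums (- d)" unfolding d_def using summable_sums[OF summable_norm_cancel[OF se]] by simp
  define a where "a n = sqrt_coeff n *\<^sub>R x ^ n" for n
  have as: "a sums (1 - d)"
    using sums_Suc[of a "- d"] es by (simp add: a_def e_def[abs_def])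
  have na: "summable (\<lambda>n. norm (a n))"
    using se unfolding a_def e_def by (rule summable_Suc_iff[THEN iffD1])
  have "(\<lambda>k. \<Sum>i\<le>k. a i * a (k - i)) sums ((\<Sum>k. a k) * (\<Sum>k. a k))"
    by (rule Cauchy_product_sums[OF na na])
  moreover have "(\<Sum>i\<le>k. a i * a (k - i)) = (if k = 0 then 1 else if k = 1 then - x else 0)" for k
  proof -
    have "(\<Sum>i\<le>k. a i * a (k - i)) = (\<Sum>i\<le>k. (sqrt_coeff i * sqrt_coeff (k - i)) *\<^sub>R x ^ k)"
      by (intro sum.cong refl) (simp add: a_def power_add[symmetric])
    then show ?thesis by (simp add: scaleR_sum_left[symmetric] sqrt_coeff_convolution)
  qed
  ultimately have "(\<lambda>k. if k = 0 then 1 else if k = 1 then - x else 0) sums ((1 - d) * (1 - d))"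
    using sums_unique[OF as] by simp
  moreover have "(\<lambda>k. if k = 0 then 1 else if k = 1 then - x else 0) sums (\<Sum>k\<in>{0,1::nat}. if k = 0 then 1 else if k = 1 then - x else 0)"
    by (rule sums_finite) auto
  ultimately have "(1 - d) * (1 - d) = 1 - x" using sums_unique2 by fastforce
  moreover have "star d = d"
  proof -
    have "star (e n) = e n" for n by (simp add: e_def star_scaleR star_power sx del: power_Suc)
    then have "e sums star (- d)" using bounded_linear.sums[OF bounded_linear_star es] by simp
    then show ?thesis using sums_unique2[OF es] by fastforce
  qed
  moreover have "y * d = d * y" if yx: "y * x = x * y" for y
  proof -
    have "y * x ^ n = x ^ n * y" for n
      by (induction n) (auto simp: yx mult.assoc[symmetric], simp add: mult.assoc yx)
    then have "y * e n = e n * y" for n by (simp add: e_def del: power_Suc)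
    then have "(\<lambda>n. y * e n) = (\<lambda>n. e n * y)" by simp
    moreover have "(\<lambda>n. y * e n) sums (y * - d)" "(\<lambda>n. e n * y) sums (- d * y)"
      using sums_mult[OF es] sums_mult2[OF es] by auto
    ultimately show ?thesis using sums_unique2 by fastforce
  qed
  ultimately show ?thesis using that nd by blast
qed

text \<open>The element \<open>b + \<i> *\<^sub>C w\<close> is \<open>r\<close> times an isometry by
  the hypothesis on squares, and \<open>b\<close> is its real part.\<close>

lemma norm_le_of_squares:
  fixes b w :: "'a::cstar_algebra"
  assumes sb: "star b = b" and sw: "star w = w" and bw: "b * w = w * b"
    and sq: "b * b + w * w = (r\<^sup>2) *\<^sub>R 1" and r: "r \<ge> 0"
  shows "norm b \<le> r"
proof -
  define u where "u = b + \<i> *\<^sub>C w"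
  have su: "star u = b - \<i> *\<^sub>C w" by (simp add: u_def star_add star_scaleC sb sw)
  have "star u * u = b * b + w * w"
    unfolding su unfolding u_def
    by (simp add: algebra_simps mult_scaleC_left mult_scaleC_right bw scaleC_scaleC)
  then have "(norm u)\<^sup>2 = r\<^sup>2" using cstar_identity[of u] sq by simp
  then have nu: "norm u = r" using r by simp
  have "2 *\<^sub>R b = u + star u" unfolding su by (simp add: u_def scaleR_2)
  then have "2 * norm b \<le> norm u + norm (star u)"
    using norm_triangle_ineq[of u "star u"] by (metis norm_scaleR abs_numeral)
  then show ?thesis using nu by simp
qed

text \<open>The square root \<open>1 - d\<close> of \<open>1 - b * b\<close> satisfies the relation
  in \<open>norm_le_of_squares\<close> with \<open>b\<close> as partner and \<open>r = 1\<close>. It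
  is thus a contraction, and so is its square.\<close>

lemma norm_one_minus_sq_le:
  fixes b :: "'a::cstar_algebra"
  assumes sb: "star b = b" and nb: "norm b \<le> 1" shows "norm (1 - b * b) \<le> 1"
proof -
  have "norm (b * b) \<le> 1" using cstar_identity[of b] nb sb by (simp add: power_le_one)
  then obtain d where d: "star d = d" "(1 - d) * (1 - d) = 1 - b * b" "b * d = d * b"
    using cstar_sqrt[of "b * b"] sb by (metis star_mult mult.assoc)
  have "norm (1 - d) \<le> 1"
    by (rule norm_le_of_squares[of "1 - d" b 1]) (use d sb in \<open>simp_all add: star_diff algebra_simps\<close>)
  then show ?thesis
    using cstar_identity[of "1 - d"] d by (simp add: star_diff power_le_one)
qed

text \<open>Two successive square roots: \<open>1 - d\<close> is the absolute value of
  \<open>g\<close>, and \<open>w\<close> is a square root of it. Having the absolute value in the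
  form \<open>w * w\<close> makes its positivity visible in every representation.\<close>

lemma cstar_abs:
  fixes g :: "'a::cstar_algebra"
  assumes sg: "star g = g" and ng: "norm g \<le> 1"
  obtains w where "star w = w" "(w * w) * (w * w) = g * g" "\<And>y. y * g = g * y \<Longrightarrow> y * w = w * y"
proof -
  obtain d where d: "star d = d" "norm d \<le> 1" "(1 - d) * (1 - d) = 1 - (1 - g * g)"
    "\<And>y. y * (1 - g * g) = (1 - g * g) * y \<Longrightarrow> y * d = d * y"
    using norm_one_minus_sq_le[OF assms] sg by (rule_tac cstar_sqrt[of "1 - g * g"]) (auto simp: star_diff star_mult)
  obtain e where e: "star e = e" "(1 - e) * (1 - e) = 1 - d" "\<And>y. y * d = d * y \<Longrightarrow> y * e = e * y"
    using cstar_sqrt[OF d(1,2)] by metis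
  show ?thesis
  proof (rule that[of "1 - e"])
    show "y * (1 - e) = (1 - e) * y" if "y * g = g * y" for y
    proof -
      have "y * (g * g) = g * g * y" using that by (metis mult.assoc)
      then show ?thesis using d(4)[of y] e(3)[of y] by (simp add: algebra_simps)
    qed
  qed (use d e in \<open>simp_all add: star_diff\<close>)
qed

text \<open>Positivity of the difference, with an explicit square root after scaling to norm 1.
  Applied under a representation, it becomes the bound on operator norms.\<close>

lemma norm_sq_minus_star_mult:
  fixes a :: "'a::cstar_algebra"
  obtains c where "star c * c = ((norm a)\<^sup>2) *\<^sub>R 1 - star a * a"
proof (cases "a = 0")
  case True
  then show ?thesis using that[of 0] by simp
next
  case False
  define x where "x = inverse ((norm a)\<^sup>2) *\<^sub>R (star a * a)"
  have "star x = x" by (simp add: x_def star_scaleR star_mult star_star)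
  moreover have "norm x \<le> 1" using False by (simp add: x_def cstar_identity)
  ultimately obtain d where d: "star d = d" "(1 - d) * (1 - d) = 1 - x" using cstar_sqrt by metis
  show ?thesis
  proof (rule that[of "norm a *\<^sub>R (1 - d)"])
    have "star (norm a *\<^sub>R (1 - d)) * (norm a *\<^sub>R (1 - d)) = ((norm a)\<^sup>2) *\<^sub>R ((1 - d) * (1 - d))"
      unfolding star_scaleR star_diff star_one d(1) mult_scaleR_left mult_scaleR_right
      by (simp add: power2_eq_square)
    also have "\<dots> = ((norm a)\<^sup>2) *\<^sub>R 1 - star a * a"
      unfolding d(2) x_def scaleR_diff_right using False by simp
    finally show "star (norm a *\<^sub>R (1 - d)) * (norm a *\<^sub>R (1 - d)) = ((norm a)\<^sup>2) *\<^sub>R 1 - star a * a" .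
  qed
qed

subsection \<open>Representations\<close>

locale star_rep =
  fixes \<pi> :: "'m::cstar_algebra \<Rightarrow> 'h::chilbert \<Rightarrow> 'h"
  assumes rep_bounded: "bounded_clinear (\<pi> a)"
    and rep_add: "\<pi> (a + b) h = \<pi> a h + \<pi> b h"
    and rep_scaleC: "\<pi> (c *\<^sub>C a) h = c *\<^sub>C \<pi> a h"
    and rep_mult: "\<pi> (a * b) h = \<pi> a (\<pi> b h)"
    and rep_star: "cinner (\<pi> (star a) h) k = cinner h (\<pi> a k)"
    and rep_one: "\<pi> 1 h = h"
begin

lemma rep_star': "cinner h (\<pi> (star a) k) = cinner (\<pi> a h) k"
  using rep_star[of "star a" h k] by (simp add: star_star)

lemma rep_scaleR: "\<pi> (r *\<^sub>R a) h = r *\<^sub>R \<pi> a h"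
  by (simp add: scaleR_scaleC rep_scaleC)

lemma rep_zero [simp]: "\<pi> 0 h = 0"
  using rep_scaleC[of 0 0 h] by simp

lemma rep_minus: "\<pi> (- a) h = - \<pi> a h"
  using rep_scaleC[of "-1" a h] by simp

lemma rep_diff: "\<pi> (a - b) h = \<pi> a h - \<pi> b h"
  using rep_add[of a "- b" h] by (simp add: rep_minus)

lemma norm_rep_sq: "complex_of_real ((norm (\<pi> a h))\<^sup>2) = cinner h (\<pi> (star a * a) h)"
  by (metis cinner_self rep_star' rep_mult)

text \<open>The gap between the two squared norms is the squared norm of \<open>\<pi> c h\<close>,
  where \<open>star c * c\<close> is the positive element from
  \<open>norm_sq_minus_star_mult\<close>.\<close>

lemma rep_contractive: "norm (\<pi> a h) \<le> norm a * norm h"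
proof -
  obtain c where c: "star c * c = ((norm a)\<^sup>2) *\<^sub>R 1 - star a * a"
    using norm_sq_minus_star_mult .
  have "complex_of_real ((norm (\<pi> c h))\<^sup>2) = complex_of_real ((norm a)\<^sup>2 * (norm h)\<^sup>2 - (norm (\<pi> a h))\<^sup>2)"
    unfolding of_real_diff unfolding norm_rep_sq c
    by (simp add: rep_diff rep_scaleR rep_one cinner_diff_right cinner_scaleR_right cinner_self)
  then have "(norm (\<pi> c h))\<^sup>2 = (norm a)\<^sup>2 * (norm h)\<^sup>2 - (norm (\<pi> a h))\<^sup>2"
    unfolding of_real_eq_iff .
  then have "(norm (\<pi> a h))\<^sup>2 \<le> (norm a * norm h)\<^sup>2"
    using zero_le_power2[of "norm (\<pi> c h)"] by (simp add: power_mult_distrib)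
  then show ?thesis by (rule power2_le_imp_le) simp
qed

end

locale faithful_rep = star_rep +
  assumes rep_faithful: "(\<And>h. \<pi> a h = 0) \<Longrightarrow> a = 0"
begin

text \<open>With \<open>c = r\<^sup>2 - b\<^sup>2\<close> and \<open>q = \<bar>c\<bar>\<close>, faithfulness gives \<open>q = c\<close>; hence \<open>c\<close> is a square \<open>w\<^sup>2\<close>
  and \<open>b + \<i> w\<close> is \<open>r\<close> times a unitary.\<close>

lemma selfadjoint_norm_le:
  assumes sb: "star b = b" and r: "r \<ge> 0" and le: "\<And>h. norm (\<pi> b h) \<le> r * norm h"
  shows "norm b \<le> r"
proof -
  define c where "c = (r\<^sup>2) *\<^sub>R 1 - b * b"
  \<comment> \<open>Scaling brings \<open>c\<close> into the unit ball, as \<open>cstar_abs\<close>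
    requires; the summand 1 keeps the divisor positive if \<open>c = 0\<close>.\<close>
  define t where "t = norm c + 1"
  have t: "t > 0" by (simp add: t_def add_nonneg_pos)
  have sc: "star c = c" by (simp add: c_def star_diff star_scaleR star_mult sb)
  have "star (inverse t *\<^sub>R c) = inverse t *\<^sub>R c" by (simp add: star_scaleR sc)
  moreover have "norm (inverse t *\<^sub>R c) \<le> 1" using t by (simp add: t_def divide_simps)
  ultimately obtain w where w: "star w = w" "(w * w) * (w * w) = (inverse t *\<^sub>R c) * (inverse t *\<^sub>R c)"
    and wc: "\<And>y. y * (inverse t *\<^sub>R c) = (inverse t *\<^sub>R c) * y \<Longrightarrow> y * w = w * y"
    using cstar_abs[of "inverse t *\<^sub>R c"] by metis
  have bw: "b * w = w * b" by (rule wc) (simp add: c_def algebra_simps)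
  have cw: "c * w = w * c" by (rule wc) simp
  define q where "q = t *\<^sub>R (w * w)"
  have qc: "q * c = c * q" using cw by (simp add: q_def) (metis mult.assoc)
  have qq: "q * q = c * c"
  proof -
    have "t * (t * (inverse t * inverse t)) = 1" using t by (simp add: field_simps)
    then show ?thesis unfolding q_def mult_scaleR_left mult_scaleR_right w(2) by simp
  qed
  have sq: "star q = q" by (simp add: q_def star_scaleR star_mult w)
  have "\<pi> (q - c) h = 0" for h
  proof -
    \<comment> \<open>Since \<open>q * q = c * c\<close> and both commute,
      \<open>\<pi> (q + c)\<close> kills \<open>v\<close>. Both forms are nonnegative at
      \<open>v\<close>, the one of \<open>c\<close> because of the assumed operator bound, so each
      vanishes there.\<close>
    define v where "v = \<pi> (q - c) h"
    have "(q + c) * (q - c) = 0" by (simp add: algebra_simps qq qc)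
    then have v0: "\<pi> (q + c) v = 0" unfolding v_def by (metis rep_mult rep_zero)
    have "cinner v (\<pi> q v) = complex_of_real (t * (norm (\<pi> w v))\<^sup>2)"
      unfolding of_real_mult norm_rep_sq by (simp add: q_def rep_scaleR cinner_scaleR_right w)
    moreover have "cinner v (\<pi> c v) = complex_of_real (r\<^sup>2 * (norm v)\<^sup>2 - (norm (\<pi> b v))\<^sup>2)"
      unfolding of_real_diff of_real_mult norm_rep_sq sb
      by (simp add: c_def rep_diff rep_scaleR rep_one cinner_diff_right cinner_scaleR_right cinner_self)
    moreover have "cinner v (\<pi> q v) + cinner v (\<pi> c v) = 0"
      using v0 by (metis cinner_add_right cinner_zero_right rep_add)
    ultimately have "complex_of_real (t * (norm (\<pi> w v))\<^sup>2 + (r\<^sup>2 * (norm v)\<^sup>2 - (norm (\<pi> b v))\<^sup>2)) = 0"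
      by simp
    then have "t * (norm (\<pi> w v))\<^sup>2 + (r\<^sup>2 * (norm v)\<^sup>2 - (norm (\<pi> b v))\<^sup>2) = 0"
      unfolding of_real_eq_0_iff .
    moreover have "(norm (\<pi> b v))\<^sup>2 \<le> r\<^sup>2 * (norm v)\<^sup>2"
      using power_mono[OF le[of v], of 2] by (simp add: power_mult_distrib)
    moreover have "t * (norm (\<pi> w v))\<^sup>2 \<ge> 0" using t by simp
    ultimately have "t * (norm (\<pi> w v))\<^sup>2 = 0" by linarith
    then have "\<pi> w v = 0" using t by simp
    then have q0: "\<pi> q v = 0" by (simp add: q_def rep_scaleR rep_mult clinear_zero[OF rep_bounded])
    then have "\<pi> (q - c) v = 0" using v0 by (simp add: rep_diff rep_add)
    moreover have "cinner v v = cinner h (\<pi> (q - c) v)"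
      using rep_star[of "q - c" h v] by (simp add: v_def star_diff sq sc)
    ultimately show ?thesis by (simp add: cinner_self_eq_0 v_def[symmetric])
  qed
  then have "q - c = 0" by (rule rep_faithful)
  then have "b * b + (sqrt t *\<^sub>R w) * (sqrt t *\<^sub>R w) = (r\<^sup>2) *\<^sub>R 1"
    using t by (simp add: q_def c_def)
  then show ?thesis
    by (intro norm_le_of_squares[of b "sqrt t *\<^sub>R w"]) (use sb r bw in \<open>simp_all add: star_scaleR w\<close>)
qed

text \<open>The self-adjoint case applies to \<open>star a * a\<close>, as the adjoint of
  \<open>\<pi> a\<close> obeys the same bound; the C*-identity returns to \<open>a\<close>. So a
  faithful representation is isometric.\<close>

lemma faithful_norm_le:
  assumes r: "r \<ge> 0" and le: "\<And>h. norm (\<pi> a h) \<le> r * norm h"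
  shows "norm a \<le> r"
proof -
  have le': "norm (\<pi> (star a) h) \<le> r * norm h" for h
  proof (rule norm_le_cinnerI)
    show "cmod (cinner y (\<pi> (star a) h)) \<le> r * norm h * norm y" for y
    proof -
      have "cmod (cinner (\<pi> a y) h) \<le> norm (\<pi> a y) * norm h" by (rule cauchy_schwarz)
      also have "\<dots> \<le> (r * norm y) * norm h" by (intro mult_right_mono le) auto
      finally show ?thesis by (simp add: rep_star' mult_ac)
    qed
  qed (use r in simp)
  have "norm (star a * a) \<le> r * r"
  proof (rule selfadjoint_norm_le)
    show "norm (\<pi> (star a * a) h) \<le> r * r * norm h" for h
      using le'[of "\<pi> a h"] mult_left_mono[OF le[of h] r] by (simp add: rep_mult mult_ac)
  qed (use r in \<open>simp_all add: star_mult star_star\<close>)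
  then have "(norm a)\<^sup>2 \<le> r\<^sup>2" by (simp add: cstar_identity power2_eq_square)
  then show ?thesis using r by (rule power2_le_imp_le)
qed

end

subsection \<open>The Hahn--Banach theorem\<close>

definition sublinear_on :: "'v::real_vector set \<Rightarrow> ('v \<Rightarrow> real) \<Rightarrow> bool" where
  "sublinear_on V p \<longleftrightarrow> (\<forall>x\<in>V. \<forall>y\<in>V. p (x + y) \<le> p x + p y) \<and> (\<forall>r\<ge>0. \<forall>x\<in>V. p (r *\<^sub>R x) = r * p x)"

lemma
  assumes "sublinear_on V p"
  shows sublinear_add: "x \<in> V \<Longrightarrow> y \<in> V \<Longrightarrow> p (x + y) \<le> p x + p y"
    and sublinear_scale: "r \<ge> 0 \<Longrightarrow> x \<in> V \<Longrightarrow> p (r *\<^sub>R x) = r * p x"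
  using assms unfolding sublinear_on_def by auto

lemma sublinear_zero: "sublinear_on V p \<Longrightarrow> subspace V \<Longrightarrow> p 0 = 0"
  using sublinear_scale[of V p 0 0] subspace_0[of V] by simp

lemma sublinear_minus_le: "sublinear_on V p \<Longrightarrow> subspace V \<Longrightarrow> x \<in> V \<Longrightarrow> - p (- x) \<le> p x"
  using sublinear_add[of V p x "- x"] sublinear_zero[of V p] subspace_neg[of V x] by simp

text \<open>The largest lowering of \<open>q\<close> that is at most \<open>- q x\<close> at
  \<open>- x\<close>. A sublinear function which admits no proper lowering is therefore odd, and an
  odd sublinear function is linear.\<close>

lemma sublinear_shift:
  fixes q :: "'v::real_vector \<Rightarrow> real"
  assumes V: "subspace V" and q: "sublinear_on V q" and x: "x \<in> V"
  defines "s \<equiv> (\<lambda>y. if y \<in> V then (INF t\<in>{0..}. q (y + t *\<^sub>R x) - t * q x) else 0)"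
  shows "sublinear_on V s" and "\<And>y. y \<in> V \<Longrightarrow> s y \<le> q y" and "s (- x) \<le> - q x"
proof -
  note Vi = subspace_add[OF V] subspace_scale[OF V] subspace_neg[OF V]
  have lb: "- q (- y) \<le> q (y + t *\<^sub>R x) - t * q x" if "y \<in> V" "t \<ge> 0" for y t
  proof -
    have "q (t *\<^sub>R x) \<le> q (y + t *\<^sub>R x) + q (- y)"
      using sublinear_add[OF q, of "y + t *\<^sub>R x" "- y"] that x Vi by simp
    then show ?thesis using sublinear_scale[OF q that(2) x] by simp
  qed
  have bdd: "bdd_below ((\<lambda>t. q (y + t *\<^sub>R x) - t * q x) ` {0..})" if "y \<in> V" for y
    using lb[OF that] by (intro bdd_belowI2[of _ "- q (- y)"]) auto
  have low: "s y \<le> q (y + t *\<^sub>R x) - t * q x" if "y \<in> V" "t \<ge> 0" for y t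
    using cINF_lower[OF bdd[OF that(1)], of t] that by (simp add: s_def)
  have great: "c \<le> s y" if "y \<in> V" "\<And>t. t \<ge> 0 \<Longrightarrow> c \<le> q (y + t *\<^sub>R x) - t * q x" for c y
    unfolding s_def using that by (auto intro!: cINF_greatest)
  show le: "s y \<le> q y" if "y \<in> V" for y using low[OF that, of 0] by simp
  show "s (- x) \<le> - q x"
    using low[of "- x" 1] x Vi sublinear_zero[OF q V] by simp
  have s0: "s 0 = 0"
    using le[of 0] great[of 0 0] sublinear_zero[OF q V] sublinear_scale[OF q _ x] subspace_0[OF V]
    by (intro antisym) auto
  have sc: "s (r *\<^sub>R y) \<le> r * s y" if r: "r > 0" and y: "y \<in> V" for r y
  proof -
    have "inverse r * s (r *\<^sub>R y) \<le> s y"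
    proof (rule great[OF y])
      fix t :: real assume t: "t \<ge> 0"
      have "s (r *\<^sub>R y) \<le> q (r *\<^sub>R y + (r * t) *\<^sub>R x) - (r * t) * q x"
        by (rule low) (use r t y Vi in auto)
      also have "r *\<^sub>R y + (r * t) *\<^sub>R x = r *\<^sub>R (y + t *\<^sub>R x)" by (simp add: scaleR_add_right)
      also have "q \<dots> = r * q (y + t *\<^sub>R x)" using r y x Vi by (intro sublinear_scale[OF q]) auto
      finally show "inverse r * s (r *\<^sub>R y) \<le> q (y + t *\<^sub>R x) - t * q x"
        using r by (simp add: field_simps)
    qed
    then show ?thesis using r by (simp add: field_simps)
  qed
  show "sublinear_on V s"
    unfolding sublinear_on_def
  proof (intro conjI ballI allI impI)
    fix y z assume y: "y \<in> V" and z: "z \<in> V"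
    have "s (y + z) - s z \<le> s y"
    proof (rule great[OF y])
      fix t :: real assume t: "t \<ge> 0"
      have "s (y + z) - (q (y + t *\<^sub>R x) - t * q x) \<le> s z"
      proof (rule great[OF z])
        fix t' :: real assume t': "t' \<ge> 0"
        have "s (y + z) \<le> q ((y + z) + (t + t') *\<^sub>R x) - (t + t') * q x"
          by (rule low) (use t t' y z Vi in auto)
        also have "(y + z) + (t + t') *\<^sub>R x = (y + t *\<^sub>R x) + (z + t' *\<^sub>R x)" by (simp add: scaleR_add_left)
        also have "q \<dots> \<le> q (y + t *\<^sub>R x) + q (z + t' *\<^sub>R x)"
          by (rule sublinear_add[OF q]) (use x y z Vi in auto)
        finally show "s (y + z) - (q (y + t *\<^sub>R x) - t * q x) \<le> q (z + t' *\<^sub>R x) - t' * q x"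
          by (simp add: distrib_right)
      qed
      then show "s (y + z) - s z \<le> q (y + t *\<^sub>R x) - t * q x" by simp
    qed
    then show "s (y + z) \<le> s y + s z" by simp
  next
    fix r :: real and y assume r: "r \<ge> 0" and y: "y \<in> V"
    show "s (r *\<^sub>R y) = r * s y"
    proof (cases "r = 0")
      case False
      with r have r: "r > 0" by simp
      have "s (inverse r *\<^sub>R (r *\<^sub>R y)) \<le> inverse r * s (r *\<^sub>R y)" by (rule sc) (use r y Vi in auto)
      then have "r * s y \<le> s (r *\<^sub>R y)" using r by (simp add: field_simps)
      then show ?thesis using sc[OF r y] by simp
    qed (use s0 in simp)
  qed
qed

lemma hahn_banach:
  fixes p :: "'v::real_vector \<Rightarrow> real"
  assumes V: "subspace V" and p: "sublinear_on V p" and v: "v \<in> V"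
  obtains f where "\<And>x y. x \<in> V \<Longrightarrow> y \<in> V \<Longrightarrow> f (x + y) = f x + f y"
    "\<And>r x. x \<in> V \<Longrightarrow> f (r *\<^sub>R x) = r * f x" "\<And>x. x \<in> V \<Longrightarrow> f x \<le> p x" "f v = p v"
proof -
  \<comment> \<open>The condition at \<open>- v\<close> gives \<open>p v\<close> as a lower bound
    for the value of a linear member at \<open>v\<close>. Fixing the value 0 outside
    \<open>V\<close> makes members equal as soon as they agree on \<open>V\<close>.\<close>
  define A where "A = {q. sublinear_on V q \<and> (\<forall>x\<in>V. q x \<le> p x) \<and> q (- v) \<le> - p v \<and> (\<forall>x. x \<notin> V \<longrightarrow> q x = 0)}"
  \<comment> \<open>The order is reversed, so that Zorn's lemma yields a minimal function.\<close>
  define R where "R q q' \<longleftrightarrow> (\<forall>x. q' x \<le> q x)" for q q' :: "'v \<Rightarrow> real"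
  have "\<exists>m\<in>A. \<forall>a\<in>A. R m a \<longrightarrow> a = m"
  proof (rule predicate_Zorn)
    show "partial_order_on A (relation_of R A)"
    proof (rule partial_order_on_relation_ofI)
      show "a = b" if "R a b" "R b a" for a b using that unfolding R_def by (auto intro: antisym)
    qed (auto simp: R_def intro: order_trans)
    fix C assume C: "C \<in> Chains (relation_of R A)"
    have CA: "C \<subseteq> A" using C by (auto simp: Chains_def relation_of_def)
    have chain: "R a b \<or> R b a" if "a \<in> C" "b \<in> C" for a b
      using C that unfolding Chains_def relation_of_def by auto
    show "\<exists>u\<in>A. \<forall>a\<in>C. R a u"
    proof (cases "C = {}")
      case True
      \<comment> \<open>For the empty chain a member of \<open>A\<close> must be exhibited:
        \<open>p\<close> lowered in the direction of \<open>v\<close>.\<close>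
      have "(\<lambda>y. if y \<in> V then (INF t\<in>{0..}. p (y + t *\<^sub>R v) - t * p v) else 0) \<in> A"
        unfolding A_def using sublinear_shift[OF V p v] by auto
      then show ?thesis using True by auto
    next
      case False
      define u where "u x = (if x \<in> V then (INF q\<in>C. q x) else 0)" for x
      have lb: "- p (- x) \<le> q x" if "q \<in> C" "x \<in> V" for q x
        using that CA sublinear_minus_le[of V q x] V subspace_neg[OF V, of x] unfolding A_def by force
      have bdd: "bdd_below ((\<lambda>q. q x) ` C)" if "x \<in> V" for x
        using lb that by (intro bdd_belowI2[of _ "- p (- x)"]) auto
      have low: "u x \<le> q x" if "q \<in> C" "x \<in> V" for q x
        using cINF_lower[OF bdd[OF that(2)] that(1)] that by (simp add: u_def)
      have great: "c \<le> u x" if "x \<in> V" "\<And>q. q \<in> C \<Longrightarrow> c \<le> q x" for c x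
        unfolding u_def using that False by (auto intro!: cINF_greatest)
      obtain q0 where q0: "q0 \<in> C" using False by auto
      have sl: "sublinear_on V q" if "q \<in> C" for q using that CA unfolding A_def by auto
      have sc: "u (r *\<^sub>R x) \<le> r * u x" if r: "r > 0" and x: "x \<in> V" for r x
      proof -
        have "inverse r * u (r *\<^sub>R x) \<le> u x"
        proof (rule great[OF x])
          fix q assume "q \<in> C"
          then have "u (r *\<^sub>R x) \<le> r * q x"
            using low[of q "r *\<^sub>R x"] sublinear_scale[OF sl, of q r x] r x subspace_scale[OF V] by auto
          then show "inverse r * u (r *\<^sub>R x) \<le> q x" using r by (simp add: field_simps)
        qed
        then show ?thesis using r by (simp add: field_simps)
      qed
      have "sublinear_on V u"
        unfolding sublinear_on_def
      proof (intro conjI ballI allI impI)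
        fix y z assume y: "y \<in> V" and z: "z \<in> V"
        have "u (y + z) - u z \<le> u y"
        proof (rule great[OF y])
          fix q assume q: "q \<in> C"
          have "u (y + z) - q y \<le> u z"
          proof (rule great[OF z])
            fix q' assume q': "q' \<in> C"
            consider "R q q'" | "R q' q" using chain[OF q q'] by auto
            then obtain q'' where q'': "q'' \<in> C" "R q q''" "R q' q''"
              using q q' by cases (auto simp: R_def)
            have "u (y + z) \<le> q'' y + q'' z"
              using low[OF q''(1), of "y + z"] sublinear_add[OF sl[OF q''(1)] y z] subspace_add[OF V y z] by simp
            also have "\<dots> \<le> q y + q' z" using q'' by (auto simp: R_def intro: add_mono)
            finally show "u (y + z) - q y \<le> q' z" by simp
          qed
          then show "u (y + z) - u z \<le> q y" by simp
        qed
        then show "u (y + z) \<le> u y + u z" by simp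
      next
        fix r :: real and y assume r: "r \<ge> 0" and y: "y \<in> V"
        show "u (r *\<^sub>R y) = r * u y"
        proof (cases "r = 0")
          case True
          have "q 0 = 0" if "q \<in> C" for q using sublinear_zero[OF sl[OF that] V] .
          then have "(\<lambda>q. q 0) ` C = {0}" using False by force
          then have "u 0 = 0" by (simp add: u_def)
          then show ?thesis using True by simp
        next
          case False
          with r have r: "r > 0" by simp
          have "u (inverse r *\<^sub>R (r *\<^sub>R y)) \<le> inverse r * u (r *\<^sub>R y)"
            by (rule sc) (use r y subspace_scale[OF V] in auto)
          then have "r * u y \<le> u (r *\<^sub>R y)" using r by (simp add: field_simps)
          then show ?thesis using sc[OF r y] by simp
        qed
      qed
      moreover have "u x \<le> p x" if "x \<in> V" for x
        using low[OF q0 that] q0 CA that unfolding A_def by force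
      moreover have "u (- v) \<le> - p v"
        using low[OF q0 subspace_neg[OF V v]] q0 CA unfolding A_def by force
      ultimately have "u \<in> A" unfolding A_def by (auto simp: u_def)
      moreover have "R q u" if "q \<in> C" for q
        unfolding R_def using low[OF that] that CA unfolding A_def by (auto simp: u_def)
      ultimately show ?thesis by blast
    qed
  qed
  then obtain f where f: "f \<in> A" and fmin: "\<And>a. a \<in> A \<Longrightarrow> R f a \<Longrightarrow> a = f" by auto
  have fs: "sublinear_on V f" and fp: "\<And>x. x \<in> V \<Longrightarrow> f x \<le> p x" and fv: "f (- v) \<le> - p v"
    and f0: "\<And>x. x \<notin> V \<Longrightarrow> f x = 0" using f unfolding A_def by auto
  have neg: "f (- x) = - f x" if x: "x \<in> V" for x
  proof -
    define s where "s = (\<lambda>y. if y \<in> V then (INF t\<in>{0..}. f (y + t *\<^sub>R x) - t * f x) else 0)"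
    note sh = sublinear_shift[OF V fs x, folded s_def]
    have "s \<in> A"
      unfolding A_def using sh(1) order_trans[OF sh(2) fp] order_trans[OF sh(2) fv] subspace_neg[OF V v]
      by (auto simp: s_def)
    moreover have "R f s" unfolding R_def using sh(2) f0 by (auto simp: s_def)
    ultimately have "s = f" by (rule fmin)
    moreover have "s (- x) \<le> - f x" using sh(3) by (simp add: s_def)
    ultimately have "f (- x) \<le> - f x" by simp
    then show ?thesis using sublinear_minus_le[OF fs V x] by simp
  qed
  have add: "f (x + y) = f x + f y" if x: "x \<in> V" and y: "y \<in> V" for x y
  proof -
    have "f (- x + - y) \<le> f (- x) + f (- y)" by (rule sublinear_add[OF fs]) (use x y subspace_neg[OF V] in auto)
    moreover have "f (- x + - y) = - f (x + y)" using neg[OF subspace_add[OF V x y]] by simp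
    ultimately show ?thesis using sublinear_add[OF fs x y] neg[OF x] neg[OF y] by simp
  qed
  have scale: "f (r *\<^sub>R x) = r * f x" if x: "x \<in> V" for r x
  proof (cases "r \<ge> 0")
    case False
    then have "f ((- r) *\<^sub>R x) = (- r) * f x" using sublinear_scale[OF fs _ x, of "- r"] by simp
    moreover have "f (- (r *\<^sub>R x)) = - f (r *\<^sub>R x)" by (rule neg) (use x subspace_scale[OF V] in auto)
    ultimately show ?thesis by simp
  qed (use sublinear_scale[OF fs _ x] in auto)
  have "f v = p v" using fv fp[OF v] neg[OF v] by simp
  then show ?thesis using that add scale fp by blast
qed

instantiation "fun" :: (type, real_vector) real_vector
begin
definition scaleR_fun :: "real \<Rightarrow> ('a \<Rightarrow> 'b) \<Rightarrow> 'a \<Rightarrow> 'b" where "scaleR_fun r f = (\<lambda>x. r *\<^sub>R f x)"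
instance
  by standard (auto simp: scaleR_fun_def plus_fun_def scaleR_add_right scaleR_add_left)
end

subsection \<open>Series representations of functionals\<close>

text \<open>Stands for a bound on the norm of a functional; \<open>m\<close> will be
  \<open>norm\<close> on the algebra or \<open>onorm\<close> on adjointable operators. A predicate
  takes the place of a norm because functions are total and only their values on \<open>X\<close>
  count.\<close>

definition dominated :: "'x set \<Rightarrow> ('x \<Rightarrow> real) \<Rightarrow> real \<Rightarrow> ('x \<Rightarrow> complex) \<Rightarrow> bool" where
  "dominated X m t g \<longleftrightarrow> (\<forall>x\<in>X. cmod (g x) \<le> t * m x)"

text \<open>The polar of \<open>E\<close> among the bounded real-linear functionals on dominated
  functions. Real scalars match the Hahn--Banach theorem above; \<open>complexify\<close> returns to
  complex ones.\<close>

definition unit_functional ::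
  "'x set \<Rightarrow> ('x \<Rightarrow> real) \<Rightarrow> ('x \<Rightarrow> complex) set \<Rightarrow> (('x \<Rightarrow> complex) \<Rightarrow> real) \<Rightarrow> bool" where
  "unit_functional X m E \<psi> \<longleftrightarrow>
     (\<forall>g h s s'. dominated X m s g \<longrightarrow> dominated X m s' h \<longrightarrow> \<psi> (g + h) = \<psi> g + \<psi> h) \<and>
     (\<forall>r g s. dominated X m s g \<longrightarrow> \<psi> (r *\<^sub>R g) = r * \<psi> g) \<and>
     (\<exists>B. \<forall>g s. s \<ge> 0 \<longrightarrow> dominated X m s g \<longrightarrow> \<bar>\<psi> g\<bar> \<le> B * s) \<and> (\<forall>e\<in>E. \<bar>\<psi> e\<bar> \<le> 1)"

lemma unit_functionalI:
  assumes "\<And>g h s s'. dominated X m s g \<Longrightarrow> dominated X m s' h \<Longrightarrow> \<psi> (g + h) = \<psi> g + \<psi> h"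
    "\<And>r g s. dominated X m s g \<Longrightarrow> \<psi> (r *\<^sub>R g) = r * \<psi> g"
    "\<And>g s. s \<ge> 0 \<Longrightarrow> dominated X m s g \<Longrightarrow> \<bar>\<psi> g\<bar> \<le> B * s"
    "\<And>e. e \<in> E \<Longrightarrow> \<bar>\<psi> e\<bar> \<le> 1"
  shows "unit_functional X m E \<psi>"
  unfolding unit_functional_def
proof (intro conjI allI impI ballI exI[of _ B])
qed (fact assms)+

definition combination :: "(real \<times> ('x \<Rightarrow> complex)) list \<Rightarrow> 'x \<Rightarrow> complex" where
  "combination L x = (\<Sum>(c, e)\<leftarrow>L. complex_of_real c * e x)"

definition weight :: "(real \<times> ('x \<Rightarrow> complex)) list \<Rightarrow> real" where
  "weight L = (\<Sum>(c, e)\<leftarrow>L. \<bar>c\<bar>)"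

lemma combination_simps [simp]:
  "combination [] = 0" "combination ((c, e) # L) = c *\<^sub>R e + combination L"
  "combination (L @ L') = combination L + combination L'"
  by (auto simp: combination_def fun_eq_iff scaleR_fun_def scaleR_conv_of_real)

lemma weight_simps [simp]:
  "weight [] = 0" "weight ((c, e) # L) = \<bar>c\<bar> + weight L" "weight (L @ L') = weight L + weight L'"
  by (auto simp: weight_def)

lemma weight_nonneg: "weight L \<ge> 0"
  by (induction L) auto

lemma dominated_add: "dominated X m s f \<Longrightarrow> dominated X m t g \<Longrightarrow> dominated X m (s + t) (f + g)"
  unfolding dominated_def by (auto simp: distrib_right intro: order_trans[OF norm_triangle_ineq] add_mono)

lemma dominated_scaleR: "dominated X m s f \<Longrightarrow> dominated X m (\<bar>r\<bar> * s) (r *\<^sub>R f)"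
  unfolding dominated_def scaleR_fun_def by (auto simp: mult.assoc intro: mult_left_mono)

text \<open>The functional \<open>p\<close> below is the infimal convolution of the gauge of the absolutely convex hull of
  \<open>E\<close> with a large multiple of the norm; Hahn--Banach and the hypothesis on \<open>\<psi>\<close> give \<open>p f \<le> C t\<close>.\<close>

lemma approximation_step:
  fixes X :: "'x set" and m :: "'x \<Rightarrow> real" and E :: "('x \<Rightarrow> complex) set"
  assumes m: "\<And>x. x \<in> X \<Longrightarrow> m x \<ge> 0" and E: "\<And>e. e \<in> E \<Longrightarrow> dominated X m 1 e"
    and C: "C > 0" and t: "t > 0" and f: "dominated X m t f"
    and H: "\<And>\<psi>. unit_functional X m E \<psi> \<Longrightarrow> \<bar>\<psi> f\<bar> \<le> C * t"
  shows "\<exists>L. snd ` set L \<subseteq> E \<and> weight L \<le> 2 * C * t \<and> dominated X m (t/2) (f - combination L)"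
proof -
  define V where "V = {g. \<exists>s. dominated X m s g}"
  have V: "subspace V"
    unfolding subspace_def V_def
  proof (intro conjI ballI allI)
    show "0 \<in> {g. \<exists>s. dominated X m s g}" by (auto simp: dominated_def intro!: exI[of _ 0])
    show "g + h \<in> {g. \<exists>s. dominated X m s g}"
      if "g \<in> {g. \<exists>s. dominated X m s g}" "h \<in> {g. \<exists>s. dominated X m s g}" for g h
      using that by (elim CollectE exE) (rule CollectI, rule exI, rule dominated_add)
    show "r *\<^sub>R g \<in> {g. \<exists>s. dominated X m s g}" if "g \<in> {g. \<exists>s. dominated X m s g}" for r g
      using that by (elim CollectE exE) (rule CollectI, rule exI, rule dominated_scaleR)
  qed
  \<comment> \<open>The weight of the norm part is chosen such that a total cost of at most
    \<open>2 * C * t\<close> forces a remainder of at most \<open>t/2\<close>.\<close>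
  define \<epsilon> where "\<epsilon> = 1 / (4 * C)"
  have \<epsilon>: "\<epsilon> > 0" using C by (simp add: \<epsilon>_def)
  define S where "S g = {weight L + s / \<epsilon> | L s. snd ` set L \<subseteq> E \<and> s \<ge> 0 \<and> dominated X m s (g - combination L)}" for g
  define p where "p g = Inf (S g)" for g
  have Spos: "x \<ge> 0" if "x \<in> S g" for x g proof -
    obtain L s where "x = weight L + s / \<epsilon>" "s \<ge> 0" "snd ` set L \<subseteq> E" using \<open>x \<in> S g\<close> unfolding S_def by blast
    then show ?thesis using weight_nonneg[of L] \<epsilon> by simp
  qed
  then have bdd: "bdd_below (S g)" for g by (intro bdd_belowI[of _ 0])
  have SI: "weight L + s / \<epsilon> \<in> S g" if "snd ` set L \<subseteq> E" "s \<ge> 0" "dominated X m s (g - combination L)" for L s g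
    unfolding S_def using that by auto
  have low: "p g \<le> x" if "x \<in> S g" for g x unfolding p_def by (rule cInf_lower[OF that bdd])
  have dom_abs: "dominated X m \<bar>s\<bar> g" if "dominated X m s g" for s g
    using that m unfolding dominated_def by (meson abs_ge_self mult_right_mono order_trans)
  have ne: "S g \<noteq> {}" if "g \<in> V" for g
  proof -
    obtain s where "dominated X m s g" using \<open>g \<in> V\<close> unfolding V_def by auto
    then have "weight ([] :: (real \<times> ('x \<Rightarrow> complex)) list) + \<bar>s\<bar> / \<epsilon> \<in> S g"
      by (intro SI) (auto simp: dom_abs)
    then show ?thesis by auto
  qed
  have great: "c \<le> p g" if "g \<in> V" "\<And>x. x \<in> S g \<Longrightarrow> c \<le> x" for c g
    unfolding p_def by (rule cInf_greatest[OF ne[OF that(1)] that(2)])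
  have pd: "p g \<le> s / \<epsilon>" if "s \<ge> 0" "dominated X m s g" for s g
    using low[OF SI[of "[]" s g]] that by simp
  have S_add: "x + y \<in> S (g + h)" if "x \<in> S g" "y \<in> S h" for x y g h
  proof -
    obtain L s where L: "x = weight L + s / \<epsilon>" "snd ` set L \<subseteq> E" "s \<ge> 0" "dominated X m s (g - combination L)"
      using \<open>x \<in> S g\<close> unfolding S_def by blast
    obtain L' s' where L': "y = weight L' + s' / \<epsilon>" "snd ` set L' \<subseteq> E" "s' \<ge> 0" "dominated X m s' (h - combination L')"
      using \<open>y \<in> S h\<close> unfolding S_def by blast
    have "dominated X m (s + s') (g + h - combination (L @ L'))"
      using dominated_add[OF L(4) L'(4)] by (simp add: algebra_simps)
    then have "weight (L @ L') + (s + s') / \<epsilon> \<in> S (g + h)" by (rule SI[rotated 2]) (use L L' in auto)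
    then show ?thesis using L L' by (simp add: add_divide_distrib algebra_simps)
  qed
  have S_scale: "\<bar>r\<bar> * x \<in> S (r *\<^sub>R g)" if "x \<in> S g" for r x g
  proof -
    obtain L s where L: "x = weight L + s / \<epsilon>" "snd ` set L \<subseteq> E" "s \<ge> 0" "dominated X m s (g - combination L)"
      using \<open>x \<in> S g\<close> unfolding S_def by blast
    define L' where "L' = map (\<lambda>(c, e). (r * c, e)) L"
    have "combination L' = r *\<^sub>R combination L" "weight L' = \<bar>r\<bar> * weight L"
      unfolding L'_def by (induction L) (auto simp: scaleR_add_right algebra_simps abs_mult)
    moreover have "snd ` set L' = snd ` set L" by (force simp: L'_def)
    moreover have "dominated X m (\<bar>r\<bar> * s) (r *\<^sub>R (g - combination L))" by (rule dominated_scaleR[OF L(4)])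
    ultimately have "weight L' + (\<bar>r\<bar> * s) / \<epsilon> \<in> S (r *\<^sub>R g)"
      using L by (intro SI) (auto simp: scaleR_diff_right)
    then show ?thesis using L \<open>weight L' = _\<close> by (simp add: algebra_simps)
  qed
  have psc: "p (r *\<^sub>R g) \<le> r * p g" if r: "r > 0" and g: "g \<in> V" for r g
  proof -
    have "inverse r * p (r *\<^sub>R g) \<le> p g"
    proof (rule great[OF g])
      fix x assume "x \<in> S g"
      then have "p (r *\<^sub>R g) \<le> r * x" using low[OF S_scale, of x g r] r by simp
      then show "inverse r * p (r *\<^sub>R g) \<le> x" using r by (simp add: field_simps)
    qed
    then show ?thesis using r by (simp add: field_simps)
  qed
  have p0: "p 0 = 0"
  proof (rule antisym)
    have "dominated X m 0 0" by (simp add: dominated_def)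
    then show "p 0 \<le> 0" using pd[of 0 0] by simp
    show "0 \<le> p 0" by (rule great[OF subspace_0[OF V] Spos])
  qed
  have p: "sublinear_on V p"
    unfolding sublinear_on_def
  proof (intro conjI ballI allI impI)
    fix g h assume g: "g \<in> V" and h: "h \<in> V"
    have "p (g + h) - p h \<le> p g"
    proof (rule great[OF g])
      fix x assume x: "x \<in> S g"
      have "p (g + h) - x \<le> p h"
      proof (rule great[OF h])
        fix y assume "y \<in> S h"
        then show "p (g + h) - x \<le> y" using low[OF S_add[OF x, of y h]] by simp
      qed
      then show "p (g + h) - p h \<le> x" by simp
    qed
    then show "p (g + h) \<le> p g + p h" by simp
  next
    fix r :: real and g assume r: "r \<ge> 0" and g: "g \<in> V"
    show "p (r *\<^sub>R g) = r * p g"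
    proof (cases "r = 0")
      case False
      with r have r: "r > 0" by simp
      have "p (inverse r *\<^sub>R (r *\<^sub>R g)) \<le> inverse r * p (r *\<^sub>R g)"
        by (rule psc) (use r g subspace_scale[OF V] in auto)
      then have "r * p g \<le> p (r *\<^sub>R g)" using r by (simp add: field_simps)
      then show ?thesis using psc[OF r g] by simp
    qed (use p0 in simp)
  qed
  have fV: "f \<in> V" using f unfolding V_def by auto
  obtain \<psi> where \<psi>: "\<And>x y. x \<in> V \<Longrightarrow> y \<in> V \<Longrightarrow> \<psi> (x + y) = \<psi> x + \<psi> y"
    "\<And>r x. x \<in> V \<Longrightarrow> \<psi> (r *\<^sub>R x) = r * \<psi> x" "\<And>x. x \<in> V \<Longrightarrow> \<psi> x \<le> p x" "\<psi> f = p f"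
    using hahn_banach[OF V p fV] by metis
  have \<psi>_abs: "\<bar>\<psi> g\<bar> \<le> c" if "g \<in> V" "p g \<le> c" "p (- g) \<le> c" for g c
    using \<psi>(3)[OF that(1)] \<psi>(3)[OF subspace_neg[OF V that(1)]] \<psi>(2)[OF that(1), of "-1"] that by simp
  have dom_neg: "dominated X m s (- g)" if "dominated X m s g" for s g
    using that by (simp add: dominated_def)
  have "unit_functional X m E \<psi>"
  proof (rule unit_functionalI)
    show "\<psi> (g + h) = \<psi> g + \<psi> h" if "dominated X m s g" "dominated X m s' h" for g h s s'
      by (rule \<psi>(1)) (use that in \<open>auto simp: V_def\<close>)
    show "\<psi> (r *\<^sub>R g) = r * \<psi> g" if "dominated X m s g" for r g s
      by (rule \<psi>(2)) (use that in \<open>auto simp: V_def\<close>)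
    show "\<bar>\<psi> g\<bar> \<le> 1 / \<epsilon> * s" if "s \<ge> 0" "dominated X m s g" for g s
      using pd[OF that(1) that(2)] pd[OF that(1) dom_neg[OF that(2)]] that(2)
      by (intro \<psi>_abs) (auto simp: V_def)
    show "\<bar>\<psi> e\<bar> \<le> 1" if e: "e \<in> E" for e
    proof -
      have "weight [(1, e)] + 0 / \<epsilon> \<in> S e" "weight [(-1, e)] + 0 / \<epsilon> \<in> S (- e)"
        by (rule SI; use e in \<open>simp add: dominated_def scaleR_fun_def\<close>)+
      then have "p e \<le> 1" "p (- e) \<le> 1" using low by fastforce+
      then show ?thesis using E[OF e] by (intro \<psi>_abs) (auto simp: V_def)
    qed
  qed
  then have "\<bar>\<psi> f\<bar> \<le> C * t" by (rule H)
  \<comment> \<open>The factor 2 creates the strict inequality from which a decomposition of nearly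
    minimal cost can be picked.\<close>
  then have "p f < 2 * C * t" using \<psi>(4) C t mult_pos_pos[OF C t] by linarith
  then obtain x where x: "x \<in> S f" "x < 2 * C * t"
    unfolding p_def using cInf_lessD[OF ne[OF fV]] by blast
  then obtain L s where L: "x = weight L + s / \<epsilon>" "snd ` set L \<subseteq> E" "s \<ge> 0" "dominated X m s (f - combination L)"
    unfolding S_def by auto
  have "s / \<epsilon> \<le> 2 * C * t" using x L weight_nonneg[of L] by linarith
  then have "s \<le> t / 2" using C by (simp add: \<epsilon>_def field_simps)
  then have "dominated X m (t/2) (f - combination L)"
    using L(4) m unfolding dominated_def by (meson mult_right_mono order_trans)
  moreover have "weight L \<le> 2 * C * t" using x L \<epsilon> divide_nonneg_pos[of s \<epsilon>] by linarith
  ultimately show ?thesis using L(2) by blast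
qed

text \<open>Iteration of \<open>approximation_step\<close>, as in the open mapping theorem: each
  step halves the remainder at a cost proportional to it, and the costs form a geometric series with
  sum \<open>4 * C * t\<close>. The class \<open>Fs\<close> contains all remainders, so that the
  hypothesis on functionals is available at every step.\<close>

lemma series_representation:
  fixes X :: "'x set" and m :: "'x \<Rightarrow> real" and E Fs :: "('x \<Rightarrow> complex) set"
  assumes m: "\<And>x. x \<in> X \<Longrightarrow> m x \<ge> 0" and E: "\<And>e. e \<in> E \<Longrightarrow> dominated X m 1 e" and ne: "E \<noteq> {}"
    and C: "C > 0" and t: "t > 0" and f: "dominated X m t f" "f \<in> Fs"
    and Fs: "\<And>g r e. g \<in> Fs \<Longrightarrow> e \<in> E \<Longrightarrow> g - r *\<^sub>R e \<in> Fs"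
    and H: "\<And>\<psi> f t. unit_functional X m E \<psi> \<Longrightarrow> f \<in> Fs \<Longrightarrow> t > 0 \<Longrightarrow> dominated X m t f \<Longrightarrow> \<bar>\<psi> f\<bar> \<le> C * t"
  obtains c e where "\<And>n. e n \<in> E" "summable (\<lambda>n. \<bar>c n\<bar>)" "(\<Sum>n. \<bar>c n\<bar>) \<le> 4 * C * t"
    "\<And>x. x \<in> X \<Longrightarrow> (\<lambda>n. complex_of_real (c n) * e n x) sums f x"
proof -
  obtain e0 where e0: "e0 \<in> E" using ne by auto
  have Fs': "g - combination L \<in> Fs" if "g \<in> Fs" "snd ` set L \<subseteq> E" for g L
    using that
  proof (induction L arbitrary: g)
    case (Cons a L)
    obtain r e where a: "a = (r, e)" by (cases a)
    have "(g - r *\<^sub>R e) - combination L \<in> Fs" using Cons a by (intro Cons.IH Fs) auto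
    then show ?case by (simp only: a combination_simps diff_diff_eq)
  qed simp
  \<comment> \<open>The weight allowed after \<open>k\<close> steps telescopes: the next step costs
    at most \<open>2 * C * (t / 2 ^ k)\<close>, half of the budget left.\<close>
  define P where "P k L \<longleftrightarrow> snd ` set L \<subseteq> E \<and> length L \<ge> k \<and> weight L \<le> 4 * C * t - 4 * C * (t / 2 ^ k) \<and>
    dominated X m (t / 2 ^ k) (f - combination L)" for k L
  have step: "\<exists>L'. P (Suc k) L' \<and> (\<exists>l. L' = L @ l)" if L: "P k L" for L k
  proof -
    have tk: "t / 2 ^ k > 0" using t by simp
    have fL: "f - combination L \<in> Fs" using Fs'[OF f(2)] L by (auto simp: P_def)
    have dL: "dominated X m (t / 2 ^ k) (f - combination L)" using L by (simp add: P_def)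
    have "\<exists>l. snd ` set l \<subseteq> E \<and> weight l \<le> 2 * C * (t / 2 ^ k) \<and>
        dominated X m (t / 2 ^ k / 2) (f - combination L - combination l)"
      by (rule approximation_step[where f = "f - combination L", OF m E C tk dL])
        (assumption | rule H[OF _ fL tk dL])+
    then obtain l where l: "snd ` set l \<subseteq> E" "weight l \<le> 2 * C * (t / 2 ^ k)"
        "dominated X m (t / 2 ^ k / 2) (f - combination L - combination l)"
      by blast
    have "4 * C * (t / 2 ^ Suc k) = 2 * C * (t / 2 ^ k)" by simp
    \<comment> \<open>The padding entry with coefficient 0 makes every list strictly longer, so that
      the lists are prefixes of one infinite sequence.\<close>
    then have h1: "weight (L @ l @ [(0, e0)]) \<le> 4 * C * t - 4 * C * (t / 2 ^ Suc k)"
      using L l(2) unfolding P_def weight_simps by linarith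
    have h2: "f - combination (L @ l @ [(0, e0)]) = f - combination L - combination l"
      by (simp add: diff_diff_eq)
    have h3: "snd ` set (L @ l @ [(0, e0)]) \<subseteq> E" "length (L @ l @ [(0, e0)]) \<ge> Suc k"
      using L l e0 by (auto simp: P_def)
    have h4: "t / 2 ^ k / 2 = t / 2 ^ Suc k" by simp
    have "P (Suc k) (L @ l @ [(0, e0)])"
      unfolding P_def h2 using h1 h3 l(3)[unfolded h4] by blast
    then show ?thesis by blast
  qed
  have start: "P 0 []" using f by (simp add: P_def)
  have "\<exists>L. \<forall>k. P k (L k) \<and> (\<exists>l. L (Suc k) = L k @ l)"
    by (rule dependent_nat_choice[of P "\<lambda>_ L L'. \<exists>l. L' = L @ l"]) (use start step in blast)+
  then obtain L where L: "\<And>k. P k (L k)" and app: "\<And>k. \<exists>l. L (Suc k) = L k @ l" by blast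
  have prefix: "\<exists>l. L j = L k @ l" if "k \<le> j" for k j
    using that
  proof (induction j rule: dec_induct)
    case (step j)
    obtain l l' where "L j = L k @ l" "L (Suc j) = L j @ l'" using step app by blast
    then show ?case by simp
  qed simp
  define c where "c n = fst (L (Suc n) ! n)" for n
  define e where "e n = snd (L (Suc n) ! n)" for n
  have len: "length (L k) \<ge> k" for k using L[of k] by (simp add: P_def)
  have nth: "L k ! n = (c n, e n)" if "n < length (L k)" for n k
  proof -
    have "L k ! n = L (Suc n) ! n"
    proof (cases "k \<le> Suc n")
      case True
      then show ?thesis using prefix[OF True] that by (metis nth_append)
    next
      case False
      then show ?thesis using prefix[of "Suc n" k] len[of "Suc n"] by (metis Suc_le_lessD nat_le_linear nth_append)
    qed
    then show ?thesis by (simp add: c_def e_def)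
  qed
  have Lmap: "L k = map (\<lambda>n. (c n, e n)) [0..<length (L k)]" for k
    by (rule nth_equalityI) (simp_all add: nth)
  have wt: "weight (L k) = (\<Sum>n<length (L k). \<bar>c n\<bar>)" for k
    by (subst Lmap) (simp add: weight_def sum_list_sum_nth comp_def atLeast0LessThan)
  have cb: "combination (L k) x = (\<Sum>n<length (L k). complex_of_real (c n) * e n x)" for k x
    by (subst Lmap) (simp add: combination_def sum_list_sum_nth comp_def atLeast0LessThan)
  have eE: "e n \<in> E" for n
    using L[of "Suc n"] len[of "Suc n"] nth_mem[of n "L (Suc n)"] by (force simp: P_def e_def)
  have bound: "(\<Sum>n<N. \<bar>c n\<bar>) \<le> 4 * C * t" for N
  proof -
    have "(\<Sum>n<N. \<bar>c n\<bar>) \<le> (\<Sum>n<length (L N). \<bar>c n\<bar>)" by (intro sum_mono2) (use len in auto)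
    also have "\<dots> \<le> 4 * C * t" using L[of N] C t mult_nonneg_nonneg[of "4 * C" "t / 2 ^ N"]
      unfolding wt[symmetric] P_def by (smt (verit) divide_nonneg_nonneg zero_le_power)
    finally show ?thesis .
  qed
  have sc: "summable (\<lambda>n. \<bar>c n\<bar>)" by (rule summableI_nonneg_bounded[OF _ bound]) simp
  show ?thesis
  proof (rule that[OF eE sc])
    show "(\<Sum>n. \<bar>c n\<bar>) \<le> 4 * C * t" by (rule suminf_le_const[OF sc bound])
    fix x assume x: "x \<in> X"
    have le: "norm (complex_of_real (c n) * e n x) \<le> \<bar>c n\<bar> * m x" for n
      using E[OF eE[of n]] x by (simp add: norm_mult dominated_def mult_left_mono)
    have "summable (\<lambda>n. complex_of_real (c n) * e n x)"
      by (rule summable_norm_cancel, rule summable_comparison_test'[OF summable_mult2[OF sc, of "m x"]])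
        (simp only: norm_ge_zero real_norm_def abs_of_nonneg le)
    then obtain S where S: "(\<lambda>n. complex_of_real (c n) * e n x) sums S" by (auto simp: summable_def)
    have "filterlim (\<lambda>k. length (L k)) at_top sequentially"
      by (rule filterlim_at_top_mono[OF filterlim_ident]) (simp add: len)
    then have "(\<lambda>k. combination (L k) x) \<longlonglongrightarrow> S"
      unfolding cb using S unfolding sums_def by (rule filterlim_compose[rotated])
    moreover have "(\<lambda>k. combination (L k) x) \<longlonglongrightarrow> f x"
    proof (rule LIM_zero_cancel, rule Lim_null_comparison[OF always_eventually])
      show "\<forall>k. norm (combination (L k) x - f x) \<le> (t * m x) * (1/2) ^ k"
        using L x by (auto simp: P_def dominated_def norm_minus_commute power_one_over field_simps)
      show "(\<lambda>k. (t * m x) * (1/2) ^ k) \<longlonglongrightarrow> 0"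
        by (intro tendsto_mult_right_zero LIMSEQ_power_zero) simp
    qed
    ultimately show "(\<lambda>n. complex_of_real (c n) * e n x) sums f x" using S LIMSEQ_unique by blast
  qed
qed

subsection \<open>Weak topologies\<close>

instantiation "fun" :: (type, cvector) cvector
begin
definition scaleC_fun :: "complex \<Rightarrow> ('a \<Rightarrow> 'b) \<Rightarrow> 'a \<Rightarrow> 'b" where "scaleC_fun c f = (\<lambda>x. c *\<^sub>C f x)"
instance
  by standard (auto simp: scaleC_fun_def scaleR_fun_def plus_fun_def scaleC_add_right scaleC_add_left
      scaleC_scaleC scaleR_scaleC)
end

definition clinear_on :: "'v::cvector set \<Rightarrow> ('v \<Rightarrow> complex) \<Rightarrow> bool" where
  "clinear_on S f \<longleftrightarrow> (\<forall>x\<in>S. \<forall>y\<in>S. f (x + y) = f x + f y) \<and> (\<forall>c. \<forall>x\<in>S. f (c *\<^sub>C x) = c * f x)"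

lemma clinear_on_subset: "clinear_on S f \<Longrightarrow> S' \<subseteq> S \<Longrightarrow> clinear_on S' f"
  unfolding clinear_on_def by blast

lemma clinear_on_add: "clinear_on S f \<Longrightarrow> x \<in> S \<Longrightarrow> y \<in> S \<Longrightarrow> f (x + y) = f x + f y"
  and clinear_on_scale: "clinear_on S f \<Longrightarrow> x \<in> S \<Longrightarrow> f (c *\<^sub>C x) = c * f x"
  unfolding clinear_on_def by auto

lemma clinear_on_diff_scale:
  assumes S: "csubspace S" and f: "clinear_on S f" and "x \<in> S" "y \<in> S"
  shows "f (x - c *\<^sub>C y) = f x - c * f y"
proof -
  have "x - c *\<^sub>C y = x + (- c) *\<^sub>C y" by (simp add: cvec.scale_minus_left)
  also have "f \<dots> = f x + f ((- c) *\<^sub>C y)"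
    by (rule clinear_on_add[OF f \<open>x \<in> S\<close> cvec.subspace_scale[OF S \<open>y \<in> S\<close>]])
  also have "f ((- c) *\<^sub>C y) = (- c) * f y" by (rule clinear_on_scale[OF f \<open>y \<in> S\<close>])
  finally show ?thesis by simp
qed

definition functional_space :: "('v::cvector \<Rightarrow> complex) set \<Rightarrow> bool" where
  "functional_space F \<longleftrightarrow> (\<lambda>x. 0) \<in> F \<and> (\<forall>f\<in>F. \<forall>g\<in>F. (\<lambda>x. f x + g x) \<in> F) \<and> (\<forall>c. \<forall>f\<in>F. (\<lambda>x. c * f x) \<in> F)"

lemma functional_space_zero: "functional_space F \<Longrightarrow> (\<lambda>x. 0) \<in> F"
  and functional_space_add: "functional_space F \<Longrightarrow> f \<in> F \<Longrightarrow> g \<in> F \<Longrightarrow> (\<lambda>x. f x + g x) \<in> F"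
  and functional_space_scale: "functional_space F \<Longrightarrow> f \<in> F \<Longrightarrow> (\<lambda>x. c * f x) \<in> F"
  unfolding functional_space_def by simp_all

lemma functional_space_add_scale:
  "functional_space F \<Longrightarrow> f \<in> F \<Longrightarrow> g \<in> F \<Longrightarrow> (\<lambda>x. f x + c * g x) \<in> F"
  by (rule functional_space_add[OF _ _ functional_space_scale])

text \<open>Induction on the list: on the kernel of the first functional the others suffice, and one
  multiple of the first corrects the value at a vector outside the kernel. Equality is confined to
  \<open>S\<close>, as the functionals are linear only there.\<close>

lemma kernel_combination:
  assumes F: "functional_space F" and lin: "\<And>f. f \<in> F \<Longrightarrow> clinear_on S f"
    and S: "csubspace S" and g: "clinear_on S g" and fs: "set fs \<subseteq> F"
    and ker: "\<And>x. x \<in> S \<Longrightarrow> (\<And>f. f \<in> set fs \<Longrightarrow> f x = 0) \<Longrightarrow> g x = 0"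
  shows "\<exists>h\<in>F. \<forall>x\<in>S. g x = h x"
  using fs ker S g lin
proof (induction fs arbitrary: S)
  case Nil
  then show ?case using F by (intro bexI[of _ "\<lambda>x. 0"]) (auto simp: functional_space_def)
next
  case (Cons f fs)
  note S = Cons.prems(3) and g = Cons.prems(4) and lin = Cons.prems(5)
  have f: "f \<in> F" using Cons.prems(1) by simp
  define S' where "S' = {x \<in> S. f x = 0}"
  have lf: "clinear_on S f" by (rule lin[OF f])
  have S': "csubspace S'"
    unfolding cvec.subspace_def S'_def using S clinear_on_scale[OF lf, of 0 0]
    by (auto simp: cvec.subspace_0 cvec.subspace_add cvec.subspace_scale clinear_on_add[OF lf] clinear_on_scale[OF lf])
  have sub: "S' \<subseteq> S" by (auto simp: S'_def)
  have "\<exists>h\<in>F. \<forall>x\<in>S'. g x = h x"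
  proof (rule Cons.IH)
    show "set fs \<subseteq> F" using Cons.prems(1) by simp
    show "g x = 0" if "x \<in> S'" "\<And>f. f \<in> set fs \<Longrightarrow> f x = 0" for x
      using Cons.prems(2)[of x] that by (auto simp: S'_def)
    show "clinear_on S' h" if "h \<in> F" for h by (rule clinear_on_subset[OF lin[OF that] sub])
  qed (fact S' clinear_on_subset[OF g sub])+
  then obtain h where h: "h \<in> F" "\<And>x. x \<in> S' \<Longrightarrow> g x = h x" by blast
  show ?case
  proof (cases "S' = S")
    case True
    then show ?thesis using h by auto
  next
    case False
    then obtain e where e: "e \<in> S" "f e \<noteq> 0" by (auto simp: S'_def)
    define k where "k = (g e - h e) / f e"
    have "g x = h x + k * f x" if x: "x \<in> S" for x
    proof -
      define c where "c = f x / f e"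
      have xe: "x - c *\<^sub>C e \<in> S" using x e S by (intro cvec.subspace_diff cvec.subspace_scale)
      have "f (x - c *\<^sub>C e) = 0" using e by (simp add: clinear_on_diff_scale[OF S lf x e(1)] c_def)
      then have "g (x - c *\<^sub>C e) = h (x - c *\<^sub>C e)" using xe by (intro h) (simp add: S'_def)
      then have "g x - c * g e = h x - c * h e"
        by (simp add: clinear_on_diff_scale[OF S g x e(1)] clinear_on_diff_scale[OF S lin[OF h(1)] x e(1)])
      then show ?thesis using e by (simp add: c_def k_def field_simps)
    qed
    moreover have "(\<lambda>x. h x + k * f x) \<in> F" by (rule functional_space_add_scale[OF F h(1) f])
    ultimately show ?thesis by (intro bexI[of _ "\<lambda>x. h x + k * f x"]) auto
  qed
qed

text \<open>Finite-dimensional duality: finitely many values at \<open>x\<close> can be met exactly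
  inside \<open>A\<close> unless some linear relation obstructs, and such a relation would
  annihilate \<open>A\<close> but not \<open>x\<close>.\<close>

lemma interpolation:
  assumes F: "functional_space F" and lin: "\<And>f. f \<in> F \<Longrightarrow> clinear_on D f"
    and A: "csubspace A" "A \<subseteq> D" and ann: "\<And>f. f \<in> F \<Longrightarrow> (\<And>a. a \<in> A \<Longrightarrow> f a = 0) \<Longrightarrow> f x = 0"
    and fs: "set fs \<subseteq> F"
  shows "\<exists>a\<in>A. \<forall>f\<in>set fs. f a = f x"
  using fs
proof (induction fs)
  case Nil
  then show ?case using cvec.subspace_0[OF A(1)] by auto
next
  case (Cons f fs)
  then obtain a where a: "a \<in> A" "\<And>g. g \<in> set fs \<Longrightarrow> g a = g x" by auto
  have f: "f \<in> F" and fsF: "set fs \<subseteq> F" using Cons.prems by auto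
  have linA: "clinear_on A g" if "g \<in> F" for g by (rule clinear_on_subset[OF lin[OF that] A(2)])
  show ?case
  proof (cases "\<exists>b\<in>A. (\<forall>g\<in>set fs. g b = 0) \<and> f b \<noteq> 0")
    case True
    then obtain b where b: "b \<in> A" "\<And>g. g \<in> set fs \<Longrightarrow> g b = 0" "f b \<noteq> 0" by blast
    define c where "c = (f a - f x) / f b"
    have "g (a - c *\<^sub>C b) = g x" if "g \<in> set (f # fs)" for g
    proof -
      have "g \<in> F" using that fsF f by auto
      then have "g (a - c *\<^sub>C b) = g a - c * g b" by (rule clinear_on_diff_scale[OF A(1) linA a(1) b(1)])
      then show ?thesis using that a(2)[of g] b(2)[of g] b(3) by (cases "g = f") (auto simp: c_def)
    qed
    moreover have "a - c *\<^sub>C b \<in> A" using a b A(1) by (intro cvec.subspace_diff cvec.subspace_scale)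
    ultimately show ?thesis by blast
  next
    case False
    \<comment> \<open>On \<open>A\<close> the functional \<open>f\<close> depends on those in
      \<open>fs\<close>. Working inside \<open>F'\<close> yields a combination \<open>h\<close> that
      also takes equal values at \<open>a\<close> and \<open>x\<close>; then \<open>f - h\<close>
      annihilates \<open>A\<close>.\<close>
    define F' where "F' = {g \<in> F. g a = g x}"
    have F': "functional_space F'" using F unfolding functional_space_def F'_def by auto
    have "\<exists>h\<in>F'. \<forall>y\<in>A. f y = h y"
    proof (rule kernel_combination[OF F'])
      show "clinear_on A g" if "g \<in> F'" for g using that linA by (auto simp: F'_def)
      show "csubspace A" "clinear_on A f" by (fact A(1), rule linA[OF f])
      show "set fs \<subseteq> F'" using a fsF by (auto simp: F'_def)
      show "f y = 0" if "y \<in> A" "\<And>g. g \<in> set fs \<Longrightarrow> g y = 0" for y using False that by auto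
    qed
    then obtain h where h: "h \<in> F" "h a = h x" "\<And>y. y \<in> A \<Longrightarrow> f y = h y" by (auto simp: F'_def)
    have "f x + (-1) * h x = 0"
      by (rule ann[OF functional_space_add_scale[OF F f h(1)]]) (simp add: h(3))
    then have "f a = f x" using h a by simp
    then show ?thesis using a by auto
  qed
qed

lemma openin_weak_topology: "f \<in> F \<Longrightarrow> open U \<Longrightarrow> openin (weak_topology F) (f -` U)"
  unfolding weak_topology_def by (rule topology_generated_by_Basis) blast

lemma topspace_weak_topology: "F \<noteq> {} \<Longrightarrow> topspace (weak_topology F) = UNIV"
  unfolding weak_topology_def topology_generated_by_topspace using open_UNIV by blast

lemma continuous_map_weak_topology: "f \<in> F \<Longrightarrow> continuous_map (weak_topology F) euclidean f"
  unfolding continuous_map_def using openin_weak_topology[of f F]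
  by (subst topspace_weak_topology) (auto simp: vimage_def)

lemma weak_topology_nbhd:
  assumes W: "openin (weak_topology F) W" "x \<in> W"
  shows "\<exists>fs e. set fs \<subseteq> F \<and> e > 0 \<and> (\<forall>y. (\<forall>f\<in>set fs. dist (f y) (f x) < e) \<longrightarrow> y \<in> W)"
proof -
  have "generate_topology_on {f -` U | f U. f \<in> F \<and> open U} W"
    using W(1) unfolding weak_topology_def openin_topology_generated_by_iff .
  then show ?thesis using W(2)
  proof (induction rule: generate_topology_on.induct)
    case (Int a b)
    obtain fs e where 1: "set fs \<subseteq> F" "e > 0" "\<And>y. (\<forall>f\<in>set fs. dist (f y) (f x) < e) \<Longrightarrow> y \<in> a"
      using Int.IH(1) Int.prems by blast
    obtain gs d where 2: "set gs \<subseteq> F" "d > 0" "\<And>y. (\<forall>f\<in>set gs. dist (f y) (f x) < d) \<Longrightarrow> y \<in> b"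
      using Int.IH(2) Int.prems by blast
    show ?case
    proof (intro exI[of _ "fs @ gs"] exI[of _ "min e d"] conjI allI impI)
      show "y \<in> a \<inter> b" if "\<forall>f\<in>set (fs @ gs). dist (f y) (f x) < min e d" for y
        using that 1(3)[of y] 2(3)[of y] by auto
    qed (use 1 2 in auto)
  next
    case (UN K)
    then obtain k where "k \<in> K" "x \<in> k" by blast
    then show ?case using UN.IH[of k] by blast
  next
    case (Basis s)
    then obtain f U where s: "s = f -` U" "f \<in> F" "open U" by blast
    have "f x \<in> U" using Basis.prems s by simp
    then obtain e where e: "e > 0" "\<forall>z. dist z (f x) < e \<longrightarrow> z \<in> U"
      using \<open>open U\<close> unfolding open_dist by blast
    show ?case using s e by (intro exI[of _ "[f]"] exI[of _ e]) simp
  qed auto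
qed

text \<open>The defining family \<open>F\<close> of the topology may fail to be a vector space of
  functions; it is compared with the space \<open>F'\<close> through values on \<open>D\<close>
  only. This is the situation of \<open>L_functionals\<close> and \<open>L_predual\<close>. One
  direction is openness of a nonvanishing set, the other is \<open>interpolation\<close>.\<close>

lemma closure_of_weak_topology_iff:
  assumes F: "functional_space F'" and lin: "\<And>f. f \<in> F' \<Longrightarrow> clinear_on D f"
    and FF: "F \<subseteq> F'" "\<And>f. f \<in> F' \<Longrightarrow> \<exists>g\<in>F. \<forall>x\<in>D. f x = g x"
    and D: "csubspace D" and A: "csubspace A" "A \<subseteq> D" and x: "x \<in> D"
  shows "x \<in> subtopology (weak_topology F) D closure_of A \<longleftrightarrow>
    (\<forall>f\<in>F'. (\<forall>a\<in>A. f a = 0) \<longrightarrow> f x = 0)"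
proof
  assume cl: "x \<in> subtopology (weak_topology F) D closure_of A"
  show "\<forall>f\<in>F'. (\<forall>a\<in>A. f a = 0) \<longrightarrow> f x = 0"
  proof (intro ballI impI, rule ccontr)
    fix g assume g: "g \<in> F'" "\<forall>a\<in>A. g a = 0" "g x \<noteq> 0"
    obtain f where fF: "f \<in> F" and fg: "\<forall>x\<in>D. g x = f x" using FF(2)[OF g(1)] by (elim bexE)
    have "f a = 0" if "a \<in> A" for a using bspec[OF fg, of a] bspec[OF g(2) that] A(2) that by auto
    moreover have "f x \<noteq> 0" using bspec[OF fg x] g(3) by simp
    ultimately have f: "f \<in> F" "\<forall>a\<in>A. f a = 0" "f x \<noteq> 0" using fF by simp_all
    have "openin (subtopology (weak_topology F) D) ((f -` (- {0})) \<inter> D)"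
      unfolding openin_subtopology
      by (intro exI[of _ "f -` (- {0})"] conjI openin_weak_topology[OF f(1)]) (simp_all add: open_Compl)
    then have "\<exists>a. a \<in> A \<and> a \<in> (f -` (- {0})) \<inter> D"
      using cl[unfolded in_closure_of, THEN conjunct2, THEN spec[of _ "(f -` (- {0})) \<inter> D"]] f(3) x by simp
    then show False using f by auto
  qed
next
  assume ann: "\<forall>f\<in>F'. (\<forall>a\<in>A. f a = 0) \<longrightarrow> f x = 0"
  have ne: "F \<noteq> {}" using FF(2)[OF functional_space_zero[OF F]] by blast
  show "x \<in> subtopology (weak_topology F) D closure_of A"
    unfolding in_closure_of
  proof (intro conjI allI impI)
    show "x \<in> topspace (subtopology (weak_topology F) D)"
      using x by (simp add: topspace_subtopology topspace_weak_topology[OF ne])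
    fix W assume W: "x \<in> W \<and> openin (subtopology (weak_topology F) D) W"
    then obtain T where T: "openin (weak_topology F) T" "W = T \<inter> D" unfolding openin_subtopology by auto
    have xT: "x \<in> T" using W T by simp
    obtain fs e where fs: "set fs \<subseteq> F \<and> e > 0 \<and> (\<forall>y. (\<forall>f\<in>set fs. dist (f y) (f x) < e) \<longrightarrow> y \<in> T)"
      using weak_topology_nbhd[OF T(1) xT] by (elim exE)
    have "\<exists>a\<in>A. \<forall>f\<in>set fs. f a = f x"
      by (rule interpolation[OF F lin A]) (use ann fs FF(1) in auto)
    then obtain a where a: "a \<in> A" "\<forall>f\<in>set fs. f a = f x" by (elim bexE)
    have "dist (f a) (f x) < e" if "f \<in> set fs" for f
      using bspec[OF a(2) that] fs by simp
    then have "a \<in> T" using fs[THEN conjunct2, THEN conjunct2, THEN spec[of _ a]] by blast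
    then show "\<exists>y. y \<in> A \<and> y \<in> W" using a(1) A(2) T(2) by (intro exI[of _ a]) auto
  qed
qed

text \<open>Continuity at 0 bounds \<open>g\<close> on a neighbourhood cut out by finitely many
  members of \<open>F\<close>. The neighbourhood contains their common kernel with all its
  multiples, so \<open>g\<close> vanishes on that kernel.\<close>

lemma weakly_continuous_functional:
  assumes F: "functional_space F" and lin: "\<And>f. f \<in> F \<Longrightarrow> clinear_on UNIV f"
    and g: "clinear_on UNIV g" and cont: "continuous_map (weak_topology F) euclidean g"
  shows "g \<in> F"
proof -
  have ne: "F \<noteq> {}" using F unfolding functional_space_def by auto
  have g0: "g 0 = 0" using clinear_on_scale[OF g, of 0 0] by simp
  have f0: "f 0 = 0" if "f \<in> F" for f using clinear_on_scale[OF lin[OF that], of 0 0] by simp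
  have "openin (weak_topology F) {x \<in> topspace (weak_topology F). g x \<in> ball 0 1}"
    by (rule openin_continuous_map_preimage[OF cont open_openin[THEN iffD1, OF open_ball]])
  then have op: "openin (weak_topology F) {x. g x \<in> ball 0 1}" by (simp add: topspace_weak_topology[OF ne])
  have g1: "0 \<in> {x. g x \<in> ball 0 1}" by (simp add: g0)
  obtain fs e where fse: "set fs \<subseteq> F \<and> e > 0 \<and>
      (\<forall>y. (\<forall>f\<in>set fs. dist (f y) (f 0) < e) \<longrightarrow> y \<in> {x. g x \<in> ball 0 1})"
    using weak_topology_nbhd[OF op g1] by (elim exE)
  then have fs: "set fs \<subseteq> F" "e > 0"
      "\<And>y. (\<forall>f\<in>set fs. dist (f y) (f 0) < e) \<Longrightarrow> y \<in> {x. g x \<in> ball 0 1}" by simp_all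
  have "\<exists>h\<in>F. \<forall>x\<in>UNIV. g x = h x"
  proof (rule kernel_combination[OF F lin _ g fs(1)])
    fix y assume y: "\<And>f. f \<in> set fs \<Longrightarrow> f y = 0"
    show "g y = 0"
    proof (rule ccontr)
      assume ny: "g y \<noteq> 0"
      define c where "c = 1 / g y"
      have "dist (f (c *\<^sub>C y)) (f 0) < e" if "f \<in> set fs" for f
      proof -
        have "f \<in> F" using that fs(1) by auto
        then show ?thesis using y[OF that] clinear_on_scale[OF lin, of f y c] f0[of f] fs(2) by simp
      qed
      then have "c *\<^sub>C y \<in> {x. g x \<in> ball 0 1}" by (intro fs(3) ballI)
      then show False using ny clinear_on_scale[OF g, of y c] by (simp add: c_def)
    qed
  qed auto
  then obtain h where h: "h \<in> F" "\<forall>x\<in>UNIV. g x = h x" by (elim bexE)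
  then have "g = h" by (intro ext) simp
  then show ?thesis using h by simp
qed

subsection \<open>Preduals\<close>

lemma
  assumes P: "is_predual P"
  shows predual_bounded: "f \<in> P \<Longrightarrow> bounded_clinear f"
    and predual_functional_space: "functional_space P"
    and predual_closed: "bounded_clinear f \<Longrightarrow> \<forall>e>0. \<exists>g\<in>P. onorm (\<lambda>x. f x - g x) < e \<Longrightarrow> f \<in> P"
    and predual_norm: "norm a = (SUP f\<in>{f \<in> P. onorm f \<le> 1}. cmod (f a))"
    and predual_dual: "\<forall>f\<in>P. \<forall>g\<in>P. \<Phi> (\<lambda>x. f x + g x) = \<Phi> f + \<Phi> g \<Longrightarrow>
      \<forall>c. \<forall>f\<in>P. \<Phi> (\<lambda>x. c * f x) = c * \<Phi> f \<Longrightarrow>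
      \<forall>f\<in>P. cmod (\<Phi> f) \<le> B * onorm f \<Longrightarrow> \<exists>a. \<forall>f\<in>P. \<Phi> f = f a"
proof -
  note p1 = P[unfolded is_predual_def, THEN conjunct1]
  note p2 = P[unfolded is_predual_def, THEN conjunct2]
  note p3 = p2[THEN conjunct2] note p4 = p3[THEN conjunct2] note p5 = p4[THEN conjunct2]
  note p6 = p5[THEN conjunct2] note p7 = p6[THEN conjunct2]
  show "f \<in> P \<Longrightarrow> bounded_clinear f" by (rule bspec[OF p1])
  show "functional_space P"
    unfolding functional_space_def by (intro conjI p2[THEN conjunct1] p3[THEN conjunct1] p4[THEN conjunct1])
  show "bounded_clinear f \<Longrightarrow> \<forall>e>0. \<exists>g\<in>P. onorm (\<lambda>x. f x - g x) < e \<Longrightarrow> f \<in> P"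
    by (rule p5[THEN conjunct1, THEN spec[of _ f], THEN mp, OF conjI])
  show "norm a = (SUP f\<in>{f \<in> P. onorm f \<le> 1}. cmod (f a))"
    by (rule p6[THEN conjunct1, THEN spec])
  assume a: "\<forall>f\<in>P. \<forall>g\<in>P. \<Phi> (\<lambda>x. f x + g x) = \<Phi> f + \<Phi> g" "\<forall>c. \<forall>f\<in>P. \<Phi> (\<lambda>x. c * f x) = c * \<Phi> f"
    "\<forall>f\<in>P. cmod (\<Phi> f) \<le> B * onorm f"
  show "\<exists>a. \<forall>f\<in>P. \<Phi> f = f a"
    by (rule p7[THEN spec[of _ \<Phi>], THEN mp]) (intro conjI exI[of _ B] a)
qed

lemma clinear_on_bounded: "bounded_clinear f \<Longrightarrow> clinear_on S f"
  unfolding clinear_on_def by (auto simp: clinear_add clinear_scaleC scaleC_complex_def)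

lemma predual_add: "is_predual P \<Longrightarrow> f \<in> P \<Longrightarrow> g \<in> P \<Longrightarrow> (\<lambda>x. f x + g x) \<in> P"
  and predual_scale: "is_predual P \<Longrightarrow> f \<in> P \<Longrightarrow> (\<lambda>x. c * f x) \<in> P"
  and predual_zero: "is_predual P \<Longrightarrow> (\<lambda>x. 0) \<in> P"
  by (rule functional_space_add functional_space_scale functional_space_zero; simp add: predual_functional_space)+

lemma predual_norm_le:
  assumes P: "is_predual P" and le: "\<And>f. f \<in> P \<Longrightarrow> onorm f \<le> 1 \<Longrightarrow> cmod (f a) \<le> B"
  shows "norm a \<le> B"
proof -
  have "(\<lambda>x. 0 :: complex) \<in> {f \<in> P. onorm f \<le> 1}" using predual_zero[OF P] onorm_zero[where 'a = 'a and 'b = complex] by simp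
  then have "{f \<in> P. onorm f \<le> 1} \<noteq> {}" by blast
  then show ?thesis unfolding predual_norm[OF P] using le by (intro cSUP_least) auto
qed

lemma predual_separates:
  assumes P: "is_predual P" and eq: "\<And>f. f \<in> P \<Longrightarrow> f a = f b" shows "a = b"
proof -
  have "norm (a - b) \<le> 0"
    by (rule predual_norm_le[OF P]) (simp add: clinear_diff[OF predual_bounded[OF P]] eq)
  then show ?thesis by simp
qed

subsection \<open>Complexification of real functionals\<close>

text \<open>The only complex-linear functional with real part \<open>\<psi>\<close>.\<close>

definition complexify :: "(('x \<Rightarrow> complex) \<Rightarrow> real) \<Rightarrow> ('x \<Rightarrow> complex) \<Rightarrow> complex" where
  "complexify \<psi> g = complex_of_real (\<psi> g) - \<i> * complex_of_real (\<psi> (\<lambda>x. \<i> * g x))"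

lemma dominated_mult: "dominated X m s g \<Longrightarrow> dominated X m (cmod c * s) (\<lambda>x. c * g x)"
  unfolding dominated_def by (auto simp: norm_mult mult.assoc intro: mult_left_mono)

lemma Re_complexify: "Re (complexify \<psi> g) = \<psi> g"
  by (simp add: complexify_def)

text \<open>The bound 2 on \<open>E\<close> comes from estimating real and imaginary part
  separately. It is the source of the constant \<open>C = 2\<close> in both uses of
  \<open>series_representation\<close>.\<close>

lemma
  assumes \<psi>: "unit_functional X m E \<psi>"
  shows complexify_add: "dominated X m s g \<Longrightarrow> dominated X m t h \<Longrightarrow>
      complexify \<psi> (\<lambda>x. g x + h x) = complexify \<psi> g + complexify \<psi> h"
    and complexify_scale: "dominated X m s g \<Longrightarrow> complexify \<psi> (\<lambda>x. c * g x) = c * complexify \<psi> g"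
    and complexify_bound: "\<exists>B. \<forall>g s. s \<ge> 0 \<longrightarrow> dominated X m s g \<longrightarrow> cmod (complexify \<psi> g) \<le> B * s"
    and complexify_unit: "e \<in> E \<Longrightarrow> (\<lambda>x. \<i> * e x) \<in> E \<Longrightarrow> cmod (complexify \<psi> e) \<le> 2"
proof -
  have add: "\<psi> (\<lambda>x. g x + h x) = \<psi> g + \<psi> h" if "dominated X m s g" "dominated X m t h" for g h s t
    using \<psi>[unfolded unit_functional_def, THEN conjunct1, rule_format, OF that] by (simp add: plus_fun_def)
  have scale: "\<psi> (\<lambda>x. complex_of_real r * g x) = r * \<psi> g" if "dominated X m s g" for g r s
    using \<psi>[unfolded unit_functional_def, THEN conjunct2, THEN conjunct1, rule_format, OF that, of r]
    by (simp add: scaleR_fun_def scaleR_conv_of_real)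
  note dm = dominated_mult
  show cadd: "complexify \<psi> (\<lambda>x. g x + h x) = complexify \<psi> g + complexify \<psi> h"
    if d: "dominated X m s g" "dominated X m t h" for g h s t
    using add[OF d] add[OF dm[OF d(1), of \<i>] dm[OF d(2), of \<i>]]
    by (simp add: complexify_def distrib_left right_diff_distrib)
  have rscale: "complexify \<psi> (\<lambda>x. complex_of_real r * g x) = complex_of_real r * complexify \<psi> g"
    if d: "dominated X m s g" for g r s
    using scale[OF d, of r] scale[OF dm[OF d, of \<i>], of r]
    by (simp add: complexify_def right_diff_distrib mult.left_commute[of \<i>])
  have iscale: "complexify \<psi> (\<lambda>x. \<i> * g x) = \<i> * complexify \<psi> g" if d: "dominated X m s g" for g s
    using scale[OF d, of "-1"]
    by (simp add: complexify_def right_diff_distrib mult.assoc[symmetric])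
  show "complexify \<psi> (\<lambda>x. c * g x) = c * complexify \<psi> g" if d: "dominated X m s g" for c g s
  proof -
    have "(\<lambda>x. c * g x) = (\<lambda>x. complex_of_real (Re c) * g x + \<i> * (complex_of_real (Im c) * g x))"
      by (rule ext) (metis complex_eq distrib_right mult.assoc)
    then have "complexify \<psi> (\<lambda>x. c * g x) =
        complexify \<psi> (\<lambda>x. complex_of_real (Re c) * g x) + complexify \<psi> (\<lambda>x. \<i> * (complex_of_real (Im c) * g x))"
      using cadd[OF dm[OF d] dm[OF dm[OF d]]] by simp
    also have "\<dots> = c * complexify \<psi> g"
      by (subst iscale[OF dm[OF d]], subst (1 2) rscale[OF d])
        (metis complex_eq distrib_right mult.assoc)
    finally show ?thesis .
  qed
  have tri: "cmod (complexify \<psi> g) \<le> \<bar>\<psi> g\<bar> + \<bar>\<psi> (\<lambda>x. \<i> * g x)\<bar>" for g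
    unfolding complexify_def by (rule order_trans[OF norm_triangle_ineq4]) (simp add: norm_mult)
  obtain B where B': "\<forall>g s. s \<ge> 0 \<longrightarrow> dominated X m s g \<longrightarrow> \<bar>\<psi> g\<bar> \<le> B * s"
    using \<psi>[unfolded unit_functional_def, THEN conjunct2, THEN conjunct2, THEN conjunct1] by (elim exE)
  note B = B'[rule_format]
  show "\<exists>B. \<forall>g s. s \<ge> 0 \<longrightarrow> dominated X m s g \<longrightarrow> cmod (complexify \<psi> g) \<le> B * s"
  proof (intro exI[of _ "2 * B"] allI impI)
    fix g :: "'a \<Rightarrow> complex" and s :: real assume s: "s \<ge> 0" "dominated X m s g"
    then have "\<bar>\<psi> g\<bar> \<le> B * s" "\<bar>\<psi> (\<lambda>x. \<i> * g x)\<bar> \<le> B * s"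
      using B[OF s] B[of s "\<lambda>x. \<i> * g x"] dm[OF s(2), of \<i>] by simp_all
    then show "cmod (complexify \<psi> g) \<le> 2 * B * s" using tri[of g] by simp
  qed
  show "cmod (complexify \<psi> e) \<le> 2" if "e \<in> E" "(\<lambda>x. \<i> * e x) \<in> E"
  proof -
    have "\<bar>\<psi> e\<bar> \<le> 1" "\<bar>\<psi> (\<lambda>x. \<i> * e x)\<bar> \<le> 1"
      using \<psi>[unfolded unit_functional_def, THEN conjunct2, THEN conjunct2, THEN conjunct2] that by simp_all
    then show ?thesis using tri[of e] by linarith
  qed
qed

subsection \<open>Normal representations\<close>

lemma proj_commute:
  assumes N: "csubspace N" "closed N" and A: "bounded_clinear A"
    and adj: "\<And>x y. cinner (A' x) y = cinner x (A y)"
    and inv: "\<And>n. n \<in> N \<Longrightarrow> A n \<in> N" "\<And>n. n \<in> N \<Longrightarrow> A' n \<in> N"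
  shows "proj N (A x) = A (proj N x)"
proof (rule proj_unique[OF N])
  show "A (proj N x) \<in> N" by (intro inv proj_in N)
  have "A x - A (proj N x) = A (x - proj N x)" by (simp add: clinear_diff[OF A])
  moreover have "cinner n (A (x - proj N x)) = 0" if "n \<in> N" for n
    using proj_orth[OF N, of x] inv(2)[OF that] adj unfolding orth_def by force
  ultimately show "A x - A (proj N x) \<in> orth N" unfolding orth_def by simp
qed

context star_rep
begin

lemma proj_orbit_commutant:
  "proj (ccspan {\<pi> a y | a. True}) \<in> commutant (range \<pi>)"
proof -
  define N where "N = ccspan {\<pi> a y | a. True}"
  have N: "csubspace N" "closed N" by (simp_all add: N_def)
  have inv: "\<pi> a n \<in> N" if "n \<in> N" for a n
  proof (rule clinear_image_ccspan[OF rep_bounded _ N])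
    show "\<pi> a x \<in> N" if "x \<in> {\<pi> a y | a. True}" for x
    proof -
      obtain b where "x = \<pi> b y" using \<open>x \<in> {\<pi> a y | a. True}\<close> by blast
      then have "\<pi> a x = \<pi> (a * b) y" by (simp add: rep_mult)
      then show ?thesis unfolding N_def by (intro ccspan_superset) blast
    qed
  qed (use that N_def in simp)
  have "proj N (\<pi> a x) = \<pi> a (proj N x)" for a x
    by (rule proj_commute[OF N rep_bounded rep_star]) (simp_all add: inv)
  then show ?thesis unfolding commutant_def N_def[symmetric] by (auto intro: bounded_clinear_proj N)
qed

text \<open>Von Neumann's argument at one vector: the projection to the cyclic subspace of
  \<open>y\<close> lies in the commutant, so \<open>S\<close> preserves its range, which contains
  \<open>y\<close>.\<close>

lemma bicommutant_orbit:
  assumes S: "S \<in> commutant (commutant (range \<pi>))"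
  shows "S y \<in> ccspan {\<pi> a y | a. True}"
proof -
  define N where "N = ccspan {\<pi> a y | a. True}"
  have N: "csubspace N" "closed N" by (simp_all add: N_def)
  have "proj N \<in> commutant (range \<pi>)" unfolding N_def by (rule proj_orbit_commutant)
  then have "S (proj N y) = proj N (S y)" using S unfolding commutant_def by blast
  moreover have "y \<in> {\<pi> a y | a. True}" using rep_one[of y] by (intro CollectI exI[of _ 1]) simp
  then have "y \<in> N" unfolding N_def by (rule ccspan_superset)
  then have "proj N y = y" by (simp add: proj_eq_iff[OF N])
  ultimately have "S y = proj N (S y)" by simp
  then show ?thesis unfolding N_def[symmetric] using proj_in[OF N] by metis
qed

lemma bicommutant_vector:
  assumes S: "S \<in> commutant (commutant (range \<pi>))" and x: "\<And>a. cinner x (\<pi> a y) = 0"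
  shows "cinner x (S y) = 0"
proof -
  have "x \<in> orth {\<pi> a y | a. True}" unfolding orth_def using x cinner_commute[of _ x] by auto
  then show ?thesis using bicommutant_orbit[OF S, of y] in_ccspan_iff by blast
qed

text \<open>\<open>P\<close> is closed in norm, and the vector functional depends continuously in
  norm on each of its vectors. Membership therefore extends from a total set, first in
  \<open>w\<close> and then in \<open>v\<close>.\<close>

lemma normal_of_total:
  assumes P: "is_predual P" and tot: "ccspan T = UNIV"
    and T: "\<And>v w. v \<in> T \<Longrightarrow> w \<in> T \<Longrightarrow> (\<lambda>a. cinner v (\<pi> a w)) \<in> P"
  shows "(\<lambda>a. cinner v (\<pi> a w)) \<in> P"
proof -
  have bc: "bounded_clinear (\<lambda>a. cinner v (\<pi> a w))" for v w
  proof (rule bounded_clinearI[where B = "norm v * norm w"])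
    show "norm (cinner v (\<pi> a w)) \<le> norm v * norm w * norm a" for a
      using cauchy_schwarz[of v "\<pi> a w"] mult_left_mono[OF rep_contractive[of a w], of "norm v"]
      by (simp add: mult_ac)
  qed (simp_all add: rep_add rep_scaleC cinner_add_right cinner_scaleC_right scaleC_complex_def)
  have on: "onorm (\<lambda>a. cinner v (\<pi> a w)) \<le> norm v * norm w" for v w
  proof (rule onorm_le)
    show "norm (cinner v (\<pi> a w)) \<le> norm v * norm w * norm a" for a
      using cauchy_schwarz[of v "\<pi> a w"] mult_left_mono[OF rep_contractive[of a w], of "norm v"]
      by (simp add: mult_ac)
  qed
  have lim: "(\<lambda>a. cinner v (\<pi> a w)) \<in> P"
    if s: "\<And>n::nat. (\<lambda>a. cinner (v' n) (\<pi> a (w' n))) \<in> P" and l: "v' \<longlonglongrightarrow> v" "w' \<longlonglongrightarrow> w"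
    for v w v' w'
  proof (rule predual_closed[OF P bc], intro allI impI)
    fix e :: real assume e: "e > 0"
    have "(\<lambda>n. norm (v - v' n) * norm w + norm (v' n) * norm (w - w' n)) \<longlonglongrightarrow> norm (v - v) * norm w + norm v * norm (w - w)"
      by (intro tendsto_intros l)
    then have "eventually (\<lambda>n. norm (v - v' n) * norm w + norm (v' n) * norm (w - w' n) < e) sequentially"
      by (rule order_tendstoD) (use e in simp)
    then obtain n where n: "norm (v - v' n) * norm w + norm (v' n) * norm (w - w' n) < e"
      unfolding eventually_sequentially by blast
    have "onorm (\<lambda>a. cinner v (\<pi> a w) - cinner (v' n) (\<pi> a (w' n))) =
        onorm (\<lambda>a. cinner (v - v' n) (\<pi> a w) + cinner (v' n) (\<pi> a (w - w' n)))"
      by (simp add: cinner_diff_left cinner_diff_right clinear_diff[OF rep_bounded])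
    also have "\<dots> \<le> onorm (\<lambda>a. cinner (v - v' n) (\<pi> a w)) + onorm (\<lambda>a. cinner (v' n) (\<pi> a (w - w' n)))"
      by (intro onorm_triangle bounded_clinear_linear bc)
    also have "\<dots> \<le> norm (v - v' n) * norm w + norm (v' n) * norm (w - w' n)"
      by (intro add_mono on)
    finally have "onorm (\<lambda>a. cinner v (\<pi> a w) - cinner (v' n) (\<pi> a (w' n))) < e" using n by simp
    then show "\<exists>g\<in>P. onorm (\<lambda>a. cinner v (\<pi> a w) - g a) < e"
      by (rule bexI[OF _ s])
  qed
  have right: "(\<lambda>a. cinner v (\<pi> a w)) \<in> P" if v: "v \<in> T" for v w
  proof -
    define N where "N = {w. (\<lambda>a. cinner v (\<pi> a w)) \<in> P}"
    have "csubspace N"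
      unfolding cvec.subspace_def N_def
      using predual_zero[OF P] predual_add[OF P] predual_scale[OF P]
      by (simp add: clinear_zero[OF rep_bounded] clinear_add[OF rep_bounded] clinear_scaleC[OF rep_bounded]
          cinner_add_right cinner_scaleC_right)
    moreover have "closed N"
      unfolding closed_sequential_limits N_def mem_Collect_eq
      by (intro allI impI, elim conjE) (rule lim[of "\<lambda>_. v"], simp_all)
    moreover have "T \<subseteq> N" using T[OF v] by (auto simp: N_def)
    ultimately have "ccspan T \<subseteq> N" by (intro ccspan_minimal)
    then show ?thesis using tot by (auto simp: N_def)
  qed
  define N where "N = {v. (\<lambda>a. cinner v (\<pi> a w)) \<in> P}"
  have "csubspace N"
    unfolding cvec.subspace_def N_def
    using predual_zero[OF P] predual_add[OF P] predual_scale[OF P]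
    by (simp add: cinner_add_left cinner_scaleC_left)
  moreover have "closed N"
    unfolding closed_sequential_limits N_def mem_Collect_eq
    by (intro allI impI, elim conjE) (rule lim[of _ "\<lambda>_. w"], simp_all)
  moreover have "T \<subseteq> N" using right by (auto simp: N_def)
  ultimately have "ccspan T \<subseteq> N" by (intro ccspan_minimal)
  then show ?thesis using tot by (auto simp: N_def)
qed

end

text \<open>Normality is recorded through vector functionals, a form that passes to amplifications;
  \<open>normal_representation_faithful\<close> derives it from ultraweak continuity.\<close>

locale normal_faithful_rep = faithful_rep \<pi>
  for P :: "('m::cstar_algebra \<Rightarrow> complex) set" and \<pi> :: "'m \<Rightarrow> 'h::chilbert \<Rightarrow> 'h" +
  assumes predual: "is_predual P"
    and rep_normal: "(\<lambda>a. cinner h (\<pi> a k)) \<in> P"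

abbreviation (input) ampl :: "('m \<Rightarrow> 'h::chilbert \<Rightarrow> 'h) \<Rightarrow> 'm \<Rightarrow> 'h ell2 \<Rightarrow> 'h ell2" where
  "ampl \<pi> \<equiv> (\<lambda>a. inflate (\<pi> a))"

lemma (in star_rep) star_rep_ampl: "star_rep (ampl \<pi>)"
proof
  note ci = coord_inflate[OF rep_bounded]
  show "bounded_clinear (inflate (\<pi> a))" for a by (rule bounded_clinear_inflate[OF rep_bounded])
  show "inflate (\<pi> (a + b)) h = inflate (\<pi> a) h + inflate (\<pi> b) h" for a b h
    by (rule ell2_eqI) (simp add: ci rep_add)
  show "inflate (\<pi> (c *\<^sub>C a)) h = c *\<^sub>C inflate (\<pi> a) h" for a c h
    by (rule ell2_eqI) (simp add: ci rep_scaleC)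
  show "inflate (\<pi> (a * b)) h = inflate (\<pi> a) (inflate (\<pi> b) h)" for a b h
    by (rule ell2_eqI) (simp add: ci rep_mult)
  show "inflate (\<pi> 1) h = h" for h by (rule ell2_eqI) (simp add: ci rep_one)
  show "cinner (inflate (\<pi> (star a)) h) k = cinner h (inflate (\<pi> a) k)" for a h k
    by (simp add: cinner_ell2_def ci rep_star)
qed

lemma (in normal_faithful_rep) normal_faithful_rep_ampl: "normal_faithful_rep P (ampl \<pi>)"
proof -
  interpret A: star_rep "ampl \<pi>" by (rule star_rep_ampl)
  show ?thesis
  proof
    fix a assume "\<And>h. inflate (\<pi> a) h = 0"
    then have "inflate (\<pi> a) (single 0 h) = 0" for h .
    then have "single 0 (\<pi> a h) = 0" for h by (simp add: inflate_single[OF rep_bounded])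
    then have "coord (single 0 (\<pi> a h)) 0 = 0" for h by simp
    then show "a = 0" by (intro rep_faithful) (simp add: coord_single)
  next
    fix h k
    show "(\<lambda>a. cinner h (inflate (\<pi> a) k)) \<in> P"
    proof (rule A.normal_of_total[OF predual ccspan_single])
      fix v w assume "v \<in> {single n (h :: 'h) | n h. True}" "w \<in> {single n (h :: 'h) | n h. True}"
      then obtain n h m k where vw: "v = single n h" "w = single m k" by blast
      have "(\<lambda>a. cinner v (inflate (\<pi> a) w)) = (\<lambda>a. if n = m then cinner h (\<pi> a k) else 0)"
        by (rule ext) (simp add: vw inflate_single[OF rep_bounded] cinner_single_left coord_single)
      then show "(\<lambda>a. cinner v (inflate (\<pi> a) w)) \<in> P"
        using rep_normal[of h k] predual_zero[OF predual] by (cases "n = m") simp_all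
    qed
  qed (fact predual)
qed

context normal_faithful_rep
begin

lemma predual_ext_bound:
  assumes a: "\<And>h k. norm h \<le> 1 \<Longrightarrow> norm k \<le> 1 \<Longrightarrow> cmod (cinner h (\<pi> a k)) \<le> B" and B: "B \<ge> 0"
  shows "norm a \<le> B"
proof (rule faithful_norm_le[OF B])
  fix k
  show "norm (\<pi> a k) \<le> B * norm k"
  proof (rule norm_le_cinnerI)
    fix h
    show "cmod (cinner h (\<pi> a k)) \<le> B * norm k * norm h"
    proof (cases "h = 0 \<or> k = 0")
      case False
      define h' k' where "h' = complex_of_real (inverse (norm h)) *\<^sub>C h"
        and "k' = complex_of_real (inverse (norm k)) *\<^sub>C k"
      have "norm h' = 1" "norm k' = 1" using False by (simp_all add: h'_def k'_def norm_scaleC norm_inverse)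
      then have "cmod (cinner h' (\<pi> a k')) \<le> B" by (intro a) simp_all
      moreover have "cmod (cinner h' (\<pi> a k')) = cmod (cinner h (\<pi> a k)) / (norm h * norm k)"
        by (simp add: h'_def k'_def clinear_scaleC[OF rep_bounded] cinner_scaleC_left cinner_scaleC_right
            norm_mult norm_inverse norm_divide field_simps)
      ultimately show ?thesis using False by (simp add: divide_le_eq mult_ac)
    qed (use clinear_zero[OF rep_bounded] in auto)
  qed (use B in simp)
qed

text \<open>A functional in the polar of the normalised vector functionals is, after
  complexification, evaluation at an element of the algebra, because \<open>P\<close> is a predual.
  Faithfulness bounds that element by 2, so a member of \<open>P\<close> is a series of vector
  functionals with absolute sum at most \<open>8 * t\<close>, which one pair of vectors in the
  amplification encodes.\<close>

lemma predual_vectors: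
  assumes \<omega>: "\<omega> \<in> P" and t: "t > 0" "onorm \<omega> \<le> t"
  shows "\<exists>x y. (\<forall>a. \<omega> a = cinner x (inflate (\<pi> a) y)) \<and> (norm x)\<^sup>2 \<le> 8 * t \<and> (norm y)\<^sup>2 \<le> 8 * t"
proof -
  define E where "E = {\<lambda>a. cinner h (\<pi> a k) | h k. norm h \<le> 1 \<and> norm k \<le> 1}"
  have EI: "(\<lambda>a. cinner h (\<pi> a k)) \<in> E" if "norm h \<le> 1" "norm k \<le> 1" for h k
    unfolding E_def using that by blast
  have iE: "(\<lambda>a. \<i> * cinner h (\<pi> a k)) \<in> E" if "norm h \<le> 1" "norm k \<le> 1" for h k
    using EI[of "(- \<i>) *\<^sub>C h" k] that by (simp add: norm_scaleC cinner_scaleC_left del: cvec.scale_minus_left)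
  have EP: "e \<in> P" if "e \<in> E" for e using that rep_normal unfolding E_def by blast
  have domE: "dominated UNIV norm 1 e" if "e \<in> E" for e
  proof -
    obtain h k where e: "e = (\<lambda>a. cinner h (\<pi> a k))" "norm h \<le> 1" "norm k \<le> 1"
      using \<open>e \<in> E\<close> unfolding E_def by blast
    have "cmod (cinner h (\<pi> a k)) \<le> norm a" for a
    proof -
      have "cmod (cinner h (\<pi> a k)) \<le> norm h * (norm a * norm k)"
        by (rule order_trans[OF cauchy_schwarz mult_left_mono[OF rep_contractive]]) simp
      also have "\<dots> \<le> 1 * (norm a * 1)" by (intro mult_mono e) auto
      finally show ?thesis by simp
    qed
    then show ?thesis by (simp add: dominated_def e)
  qed
  have domP: "dominated UNIV norm (onorm f) f" if "f \<in> P" for f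
    using clinear_bound[OF predual_bounded[OF predual that]] by (simp add: dominated_def)
  have H: "\<bar>\<psi> f\<bar> \<le> 2 * s"
    if \<psi>: "unit_functional UNIV norm E \<psi>" and f: "f \<in> P" and s: "s > 0" "dominated UNIV norm s f" for \<psi> f s
  proof -
    obtain B where B: "\<forall>g s. s \<ge> 0 \<longrightarrow> dominated UNIV norm s g \<longrightarrow> cmod (complexify \<psi> g) \<le> B * s"
      using complexify_bound[OF \<psi>] by (elim exE)
    have "\<exists>a. \<forall>f\<in>P. complexify \<psi> f = f a"
    proof (rule predual_dual[OF predual, where B = B])
      show "\<forall>f\<in>P. \<forall>g\<in>P. complexify \<psi> (\<lambda>x. f x + g x) = complexify \<psi> f + complexify \<psi> g"
        by (intro ballI) (rule complexify_add[OF \<psi> domP domP])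
      show "\<forall>c. \<forall>f\<in>P. complexify \<psi> (\<lambda>x. c * f x) = c * complexify \<psi> f"
        by (intro allI ballI) (rule complexify_scale[OF \<psi> domP])
      show "\<forall>f\<in>P. cmod (complexify \<psi> f) \<le> B * onorm f"
      proof
        fix f assume f: "f \<in> P"
        show "cmod (complexify \<psi> f) \<le> B * onorm f"
          by (rule B[rule_format, OF onorm_pos_le[OF bounded_clinear_linear[OF predual_bounded[OF predual f]]] domP[OF f]])
      qed
    qed
    then obtain a where a: "\<forall>f\<in>P. complexify \<psi> f = f a" by (elim exE)
    have na: "norm a \<le> 2"
    proof (rule predual_ext_bound)
      fix h k :: 'h assume hk: "norm h \<le> 1" "norm k \<le> 1"
      have "complexify \<psi> (\<lambda>a. cinner h (\<pi> a k)) = cinner h (\<pi> a k)"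
        by (rule bspec[OF a rep_normal])
      then show "cmod (cinner h (\<pi> a k)) \<le> 2"
        using complexify_unit[OF \<psi> EI[OF hk] iE[OF hk]] by simp
    qed simp
    have "\<bar>\<psi> f\<bar> = \<bar>Re (f a)\<bar>" using bspec[OF a f] Re_complexify[of \<psi> f] by simp
    also have "\<dots> \<le> cmod (f a)" by (rule abs_Re_le_cmod)
    also have "\<dots> \<le> s * norm a" using s by (simp add: dominated_def)
    also have "\<dots> \<le> s * 2" using na s by simp
    finally show ?thesis by (simp add: mult.commute)
  qed
  obtain c e where ce: "\<And>n. e n \<in> E" "summable (\<lambda>n. \<bar>c n\<bar>)" "(\<Sum>n. \<bar>c n\<bar>) \<le> 4 * 2 * t"
    "\<And>a. a \<in> UNIV \<Longrightarrow> (\<lambda>n. complex_of_real (c n) * e n a) sums \<omega> a"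
  proof (rule series_representation[where X = UNIV and m = norm and E = E and C = 2 and Fs = P and f = \<omega> and t = t])
    show "E \<noteq> {}" using EI[of 0 0] by auto
    show "dominated UNIV norm t \<omega>"
      using domP[OF \<omega>] t(2) unfolding dominated_def by (meson mult_right_mono norm_ge_zero order_trans)
    show "g - r *\<^sub>R e \<in> P" if "g \<in> P" "e \<in> E" for g r e
      using functional_space_add_scale[OF predual_functional_space[OF predual] that(1) EP[OF that(2)], of "- complex_of_real r"]
      by (simp add: fun_diff_def scaleR_fun_def scaleR_conv_of_real)
  qed (use domE H \<omega> t in auto)
  have "\<exists>h k. e n = (\<lambda>a. cinner h (\<pi> a k)) \<and> norm h \<le> 1 \<and> norm k \<le> 1" for n
    using ce(1)[of n] unfolding E_def by blast
  then obtain h k where hk: "\<And>n. e n = (\<lambda>a. cinner (h n) (\<pi> a (k n)))" "\<And>n. norm (h n) \<le> 1" "\<And>n. norm (k n) \<le> 1"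
    by metis
  \<comment> \<open>The coefficient \<open>c n\<close> is split evenly between both vectors, with
    its sign on the left one.\<close>
  define x where "x = Abs_ell2 (\<lambda>n. complex_of_real (sgn (c n) * sqrt \<bar>c n\<bar>) *\<^sub>C h n)"
  define y where "y = Abs_ell2 (\<lambda>n. complex_of_real (sqrt \<bar>c n\<bar>) *\<^sub>C k n)"
  have nx: "(norm (complex_of_real (sgn (c n) * sqrt \<bar>c n\<bar>) *\<^sub>C h n))\<^sup>2 \<le> \<bar>c n\<bar>" for n
    using power_le_one[OF norm_ge_zero hk(2)[of n], of 2]
    by (simp add: norm_scaleC power_mult_distrib norm_mult abs_mult sgn_if)
  have ny: "(norm (complex_of_real (sqrt \<bar>c n\<bar>) *\<^sub>C k n))\<^sup>2 \<le> \<bar>c n\<bar>" for n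
    using mult_left_mono[OF power_mono[OF hk(3)[of n], of 2], of "\<bar>c n\<bar>"]
    by (simp add: norm_scaleC power_mult_distrib)
  have cx: "coord x n = complex_of_real (sgn (c n) * sqrt \<bar>c n\<bar>) *\<^sub>C h n" for n
    unfolding x_def
    by (subst Abs_ell2_inverse, unfold mem_Collect_eq, rule summable_comparison_test'[OF ce(2), of 0])
      (simp_all only: real_norm_def abs_of_nonneg zero_le_power2 nx)
  have cy: "coord y n = complex_of_real (sqrt \<bar>c n\<bar>) *\<^sub>C k n" for n
    unfolding y_def
    by (subst Abs_ell2_inverse, unfold mem_Collect_eq, rule summable_comparison_test'[OF ce(2), of 0])
      (simp_all only: real_norm_def abs_of_nonneg zero_le_power2 ny)
  have "cinner (coord x n) (coord (inflate (\<pi> a) y) n) = complex_of_real (c n) * e n a" for a n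
  proof -
    have "sgn (c n) * sqrt \<bar>c n\<bar> * sqrt \<bar>c n\<bar> = c n" by (simp add: sgn_if)
    then have "complex_of_real (c n) = complex_of_real (sgn (c n) * sqrt \<bar>c n\<bar>) * complex_of_real (sqrt \<bar>c n\<bar>)"
      by (metis of_real_mult)
    then show ?thesis
      by (simp add: cx cy coord_inflate[OF rep_bounded] clinear_scaleC[OF rep_bounded] cinner_scaleC_left
          cinner_scaleC_right hk(1))
  qed
  then have "\<omega> a = cinner x (inflate (\<pi> a) y)" for a
    using cinner_ell2_sums[of x "inflate (\<pi> a) y"] ce(4)[of a] sums_unique2 by auto
  moreover have "(norm x)\<^sup>2 \<le> 8 * t"
    using suminf_le[OF _ summable_coord[of x] ce(2)] nx ce(3) unfolding norm_ell2_sq cx by fastforce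
  moreover have "(norm y)\<^sup>2 \<le> 8 * t"
    using suminf_le[OF _ summable_coord[of y] ce(2)] ny ce(3) unfolding norm_ell2_sq cy by fastforce
  ultimately show ?thesis by blast
qed

text \<open>For \<open>S\<close> in the bicommutant, \<open>\<langle>x, \<pi>(\<sqdot>) y\<rangle> \<mapsto> \<langle>x, S y\<rangle>\<close> is a bounded functional on the predual, hence
  evaluation at an element of the algebra. It is well defined by von Neumann's argument in an amplification.\<close>

lemma bicommutant_combination:
  assumes S: "S \<in> commutant (commutant (range \<pi>))"
    and zero: "\<And>a. cinner x1 (inflate (\<pi> a) y1) + c2 * cinner x2 (inflate (\<pi> a) y2) + c3 * cinner x3 (inflate (\<pi> a) y3) = 0"
  shows "cinner x1 (inflate S y1) + c2 * cinner x2 (inflate S y2) + c3 * cinner x3 (inflate S y3) = 0"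
proof -
  interpret A: normal_faithful_rep P "ampl \<pi>" by (rule normal_faithful_rep_ampl)
  interpret AA: normal_faithful_rep P "ampl (ampl \<pi>)" by (rule A.normal_faithful_rep_ampl)
  have S1: "inflate S \<in> commutant (commutant (range (ampl \<pi>)))"
    using inflate_bicommutant[OF _ S] rep_bounded by (auto simp: image_image)
  then have S2: "inflate (inflate S) \<in> commutant (commutant (range (ampl (ampl \<pi>))))"
    using inflate_bicommutant[OF _ S1] A.rep_bounded by (auto simp: image_image)
  have bS: "bounded_clinear (inflate S)" using S1 by (simp add: commutant_def)
  \<comment> \<open>The three terms occupy three coordinates of a second amplification, which turns
    the relation into orthogonality to a single orbit. The coefficients are conjugated because the
    left argument is antilinear.\<close>
  define X where "X = single 0 x1 + cnj c2 *\<^sub>C single 1 x2 + cnj c3 *\<^sub>C single 2 x3"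
  define Y where "Y = single 0 y1 + single 1 y2 + single (2::nat) y3"
  have XY: "cinner X (inflate V Y) = cinner x1 (V y1) + c2 * cinner x2 (V y2) + c3 * cinner x3 (V y3)"
    if V: "bounded_clinear V" for V
    by (simp add: X_def Y_def cinner_add_left cinner_scaleC_left cinner_single_left coord_inflate[OF V] coord_single)
  have "cinner X (inflate (inflate S) Y) = 0"
    by (rule AA.bicommutant_vector[OF S2]) (simp add: XY[OF A.rep_bounded] zero)
  then show ?thesis by (simp add: XY[OF bS])
qed

theorem double_commutant:
  assumes S: "S \<in> commutant (commutant (range \<pi>))"
  shows "\<exists>a. \<forall>h. S h = \<pi> a h"
proof -
  have bS: "bounded_clinear S" using S by (simp add: commutant_def)
  define rp where "rp \<omega> v \<longleftrightarrow> (\<forall>a. \<omega> a = cinner (fst v) (inflate (\<pi> a) (snd v)))" for \<omega> and v :: "'h ell2 \<times> 'h ell2"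
  have rpD: "\<omega> a = cinner (fst v) (inflate (\<pi> a) (snd v))" if "rp \<omega> v" for \<omega> v a
    using that by (simp add: rp_def)
  have ex: "\<exists>v. rp \<omega> v" if \<omega>: "\<omega> \<in> P" for \<omega>
  proof -
    have "onorm \<omega> + 1 > 0"
      using onorm_pos_le[OF bounded_clinear_linear[OF predual_bounded[OF predual \<omega>]]] by simp
    then obtain x y where "\<forall>a. \<omega> a = cinner x (inflate (\<pi> a) y)"
      using predual_vectors[OF \<omega>, of "onorm \<omega> + 1"] by auto
    then show ?thesis by (intro exI[of _ "(x, y)"]) (simp add: rp_def)
  qed
  \<comment> \<open>The representing vectors are an arbitrary choice; \<open>comb\<close> proves
    independence of it and linearity at the same time.\<close>
  define \<Phi> where "\<Phi> \<omega> = (let v = SOME v. rp \<omega> v in cinner (fst v) (inflate S (snd v)))" for \<omega>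
  have some: "rp \<omega> (SOME v. rp \<omega> v)" if "\<omega> \<in> P" for \<omega> by (rule someI_ex[OF ex[OF that]])
  have comb: "cinner (fst v) (inflate S (snd v)) = \<Phi> f + c * \<Phi> g"
    if v: "rp (\<lambda>a. f a + c * g a) v" and fg: "f \<in> P" "g \<in> P" for f g c v
  proof -
    have "cinner (fst v) (inflate S (snd v)) + (-1) * \<Phi> f + (- c) * \<Phi> g = 0"
      unfolding \<Phi>_def Let_def
    proof (rule bicommutant_combination[OF S])
      fix a
      show "cinner (fst v) (inflate (\<pi> a) (snd v))
          + - 1 * cinner (fst (SOME v. rp f v)) (inflate (\<pi> a) (snd (SOME v. rp f v)))
          + - c * cinner (fst (SOME v. rp g v)) (inflate (\<pi> a) (snd (SOME v. rp g v))) = 0"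
        unfolding rpD[OF v, symmetric] rpD[OF some[OF fg(1)], symmetric] rpD[OF some[OF fg(2)], symmetric] by simp
    qed
    then show ?thesis by (simp add: diff_eq_eq add.commute)
  qed
  have z: "(\<lambda>a. 0) \<in> P" by (rule predual_zero[OF predual])
  have wd: "\<Phi> f = cinner (fst v) (inflate S (snd v))" if v: "rp f v" and f: "f \<in> P" for f v
  proof -
    have "rp (\<lambda>a. f a + 0 * f a) v" using v by simp
    from comb[OF this f f] show ?thesis by simp
  qed
  have nS: "norm (inflate S y) \<le> onorm (inflate S) * norm y" for y
    by (rule clinear_bound[OF bounded_clinear_inflate[OF bS]])
  have o0: "onorm (inflate S) \<ge> 0" by (rule onorm_pos_le[OF bounded_clinear_linear[OF bounded_clinear_inflate[OF bS]]])
  have "\<exists>a. \<forall>f\<in>P. \<Phi> f = f a"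
  proof (rule predual_dual[OF predual, where B = "8 * onorm (inflate S)"])
    show "\<forall>f\<in>P. \<forall>g\<in>P. \<Phi> (\<lambda>x. f x + g x) = \<Phi> f + \<Phi> g"
    proof (intro ballI)
      fix f g assume fg: "f \<in> P" "g \<in> P"
      have s: "(\<lambda>x. f x + g x) \<in> P" by (rule predual_add[OF predual fg])
      show "\<Phi> (\<lambda>x. f x + g x) = \<Phi> f + \<Phi> g"
        unfolding \<Phi>_def[of "\<lambda>x. f x + g x"] Let_def
        using comb[of f 1 g, OF _ fg] some[OF s] by simp
    qed
    show "\<forall>c. \<forall>f\<in>P. \<Phi> (\<lambda>x. c * f x) = c * \<Phi> f"
    proof (intro ballI allI)
      fix c f assume f: "f \<in> P"
      have z0: "\<Phi> (\<lambda>a. 0) = 0" using wd[of "\<lambda>a. 0" "(0, 0)"] z by (simp add: rp_def)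
      have s: "(\<lambda>x. c * f x) \<in> P" by (rule predual_scale[OF predual f])
      show "\<Phi> (\<lambda>x. c * f x) = c * \<Phi> f"
        unfolding \<Phi>_def[of "\<lambda>x. c * f x"] Let_def
        using comb[of "\<lambda>a. 0" c f, OF _ z f] some[OF s] z0 by simp
    qed
    show "\<forall>f\<in>P. cmod (\<Phi> f) \<le> 8 * onorm (inflate S) * onorm f"
    proof
      fix f assume f: "f \<in> P"
      have bf: "bounded_linear f" by (rule bounded_clinear_linear[OF predual_bounded[OF predual f]])
      show "cmod (\<Phi> f) \<le> 8 * onorm (inflate S) * onorm f"
      proof (cases "onorm f = 0")
        case True
        then have "f = (\<lambda>a. 0)" using onorm_eq_0[OF bf] by auto
        then have "\<Phi> f = 0" using wd[of "\<lambda>a. 0" "(0, 0)"] z by (simp add: rp_def)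
        then show ?thesis using True by simp
      next
        case False
        then have t: "onorm f > 0" using onorm_pos_le[OF bf] by simp
        obtain x y where xy: "\<forall>a. f a = cinner x (inflate (\<pi> a) y)" "(norm x)\<^sup>2 \<le> 8 * onorm f" "(norm y)\<^sup>2 \<le> 8 * onorm f"
          using predual_vectors[OF f t] by auto
        have "norm x \<le> sqrt (8 * onorm f)" "norm y \<le> sqrt (8 * onorm f)"
          using xy by (simp_all add: real_le_rsqrt)
        then have "norm x * norm y \<le> sqrt (8 * onorm f) * sqrt (8 * onorm f)"
          using t by (intro mult_mono) auto
        then have nxy: "norm x * norm y \<le> 8 * onorm f" using t by simp
        have "\<Phi> f = cinner x (inflate S y)" using wd[of f "(x, y)"] xy f by (simp add: rp_def)
        also have "cmod \<dots> \<le> norm x * (onorm (inflate S) * norm y)"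
          by (rule order_trans[OF cauchy_schwarz mult_left_mono[OF nS]]) simp
        also have "\<dots> \<le> onorm (inflate S) * (8 * onorm f)"
          using mult_left_mono[OF nxy o0] by (simp add: mult_ac)
        finally show ?thesis by (simp add: mult_ac)
      qed
    qed
  qed
  then obtain a where a: "\<forall>f\<in>P. \<Phi> f = f a" by (elim exE)
  have "S k = \<pi> a k" for k
  proof (rule cinner_eqI)
    fix h
    have "rp (\<lambda>a. cinner h (\<pi> a k)) (single 0 h, single 0 k)"
      by (simp add: rp_def cinner_single_left coord_inflate[OF rep_bounded] coord_single)
    then have "\<Phi> (\<lambda>a. cinner h (\<pi> a k)) = cinner h (S k)"
      by (simp add: wd[OF _ rep_normal] cinner_single_left coord_inflate[OF bS] coord_single)
    then show "cinner h (S k) = cinner h (\<pi> a k)" using bspec[OF a rep_normal] by metis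
  qed
  then show ?thesis by blast
qed

end

lemma continuous_map_ultraweak_B: "continuous_map ultraweak_B euclidean (\<lambda>T. cinner h (T k))"
proof -
  define x where "x n = (if n = 0 then h else 0)" for n :: nat
  define y where "y n = (if n = 0 then k else 0)" for n :: nat
  have "(\<lambda>n. cinner (x n) (T (y n))) sums cinner h (T k)" for T
    using sums_single[of 0 "\<lambda>_. cinner h (T k)"] by (rule sums_cong[THEN iffD1, rotated]) (simp add: x_def y_def)
  then have eq: "(\<lambda>T. cinner h (T k)) = (\<lambda>T. \<Sum>n. cinner (x n) (T (y n)))"
    by (intro ext) (simp add: sums_unique)
  have "summable (\<lambda>n. (norm (x n))\<^sup>2)" "summable (\<lambda>n. (norm (y n))\<^sup>2)"
    by (rule summable_finite[of "{0}"]; simp add: x_def y_def)+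
  then have "(\<lambda>T. cinner h (T k)) \<in> {\<lambda>T. (\<Sum>n. cinner (x n) (T (y n))) | x y.
        summable (\<lambda>n. (norm (x n))\<^sup>2) \<and> summable (\<lambda>n. (norm (y n))\<^sup>2)}"
    unfolding eq by (intro CollectI exI[of _ x] exI[of _ y]) simp
  then show ?thesis
    unfolding ultraweak_B_def by (intro continuous_map_from_subtopology continuous_map_weak_topology)
qed

text \<open>Nondegeneracy makes the unit act as the identity. A vector functional is weakly
  continuous by normality, and weakly continuous linear functionals belong to
  \<open>P\<close>.\<close>

lemma normal_representation_faithful:
  assumes P: "is_predual P" and \<pi>: "normal_representation P \<pi>" and inj: "inj \<pi>"
  shows "normal_faithful_rep P \<pi>"
proof -
  interpret N: normal_representation P \<pi> by (fact \<pi>)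
  have one: "\<pi> 1 h = h" for h
  proof (rule clinear_eq_on_ccspan[OF N.bounded bounded_clinear_id, of "{\<pi> a h | a h. True}"])
    show "\<pi> 1 x = x" if "x \<in> {\<pi> a h | a h. True}" for x
    proof -
      obtain a k where "x = \<pi> a k" using \<open>x \<in> _\<close> by blast
      then show ?thesis using N.mult[of 1 a k] by simp
    qed
  qed (use N.nondegenerate in blast)
  show ?thesis
  proof
    fix a assume *: "\<And>h. \<pi> a h = 0"
    have "\<pi> 0 h = 0" for h using N.scaleC[of 0 0 h] by simp
    then have "\<pi> a = \<pi> 0" using * by (intro ext) simp
    then show "a = 0" using inj by (simp add: inj_eq)
  next
    fix h k
    show "(\<lambda>a. cinner h (\<pi> a k)) \<in> P"
    proof (rule weakly_continuous_functional[OF predual_functional_space[OF P]])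
      show "clinear_on UNIV f" if "f \<in> P" for f by (rule clinear_on_bounded[OF predual_bounded[OF P that]])
      show "clinear_on UNIV (\<lambda>a. cinner h (\<pi> a k))"
        unfolding clinear_on_def by (simp add: N.add N.scaleC cinner_add_right cinner_scaleC_right)
      show "continuous_map (weak_topology P) euclidean (\<lambda>a. cinner h (\<pi> a k))"
        using continuous_map_compose[OF N.normal continuous_map_ultraweak_B[of h k]] by (simp add: comp_def)
    qed
  qed (fact N.bounded N.add N.scaleC N.mult N.star one P)+
qed

subsection \<open>Hilbert modules\<close>

context hilbert_module
begin

lemma ip_add_left: "ip (x + y) z = ip x z + ip y z"
  by (metis ip_add_right ip_star star_add)

lemma ip_scaleC_left: "ip (c *\<^sub>C x) y = cnj c *\<^sub>C ip x y"
  by (metis ip_scaleC_right ip_star star_scaleC)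

lemma ip_act_left: "ip (act x a) y = star a * ip x y"
  by (metis ip_act_right ip_star star_mult)

lemma ip_zero_right [simp]: "ip x 0 = 0"
  using ip_scaleC_right[of x 0 0] by simp

lemma ip_zero_left [simp]: "ip 0 x = 0"
  using ip_scaleC_left[of 0 0 x] by simp

lemma ip_diff_right: "ip x (y - z) = ip x y - ip x z"
  using ip_add_right[of x "y - z" z] by simp

lemma ip_diff_left: "ip (x - y) z = ip x z - ip y z"
  using ip_add_left[of "x - y" y z] by simp

lemma ip_self_eq_0: "ip x x = 0 \<Longrightarrow> x = 0"
  using norm_ip[of x] by simp

lemma ip_eqI: "(\<And>y. ip x y = ip z y) \<Longrightarrow> x = z"
  using ip_self_eq_0[of "x - z"] by (simp add: ip_diff_left)

lemma ip_eqI': "(\<And>y. ip y x = ip y z) \<Longrightarrow> x = z"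
  using ip_self_eq_0[of "x - z"] by (simp add: ip_diff_right)

lemma adjointable_adjoint:
  assumes "T \<in> adjointable ip"
  obtains S where "S \<in> adjointable ip" "\<And>x y. ip (T x) y = ip x (S y)" "\<And>x y. ip (S x) y = ip x (T y)"
proof -
  obtain S where S: "\<forall>x y. ip (T x) y = ip x (S y)" using assms unfolding adjointable_def by blast
  then have S': "ip (S x) y = ip x (T y)" for x y by (metis ip_star)
  then have "S \<in> adjointable ip" unfolding adjointable_def by blast
  then show ?thesis using that S S' by blast
qed

lemma
  assumes T: "T \<in> adjointable ip"
  shows adjointable_add: "T (x + y) = T x + T y"
    and adjointable_scaleC: "T (c *\<^sub>C x) = c *\<^sub>C T x"
    and adjointable_act: "T (act x a) = act (T x) a"
proof -
  obtain S where S: "\<And>x y. ip (T x) y = ip x (S y)" using adjointable_adjoint[OF T] by metis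
  show "T (x + y) = T x + T y" by (rule ip_eqI) (simp add: S ip_add_left)
  show "T (c *\<^sub>C x) = c *\<^sub>C T x" by (rule ip_eqI) (simp add: S ip_scaleC_left)
  show "T (act x a) = act (T x) a" by (rule ip_eqI) (simp add: S ip_act_left)
qed

lemma adjointableI: "(\<And>x y. ip (T x) y = ip x (S y)) \<Longrightarrow> T \<in> adjointable ip"
  unfolding adjointable_def by (intro CollectI exI[of _ S]) simp

lemma adjointable_comp:
  assumes S: "S \<in> adjointable ip" and T: "T \<in> adjointable ip"
  shows "(\<lambda>x. S (T x)) \<in> adjointable ip"
proof -
  obtain S' where S': "\<And>x y. ip (S x) y = ip x (S' y)" using adjointable_adjoint[OF S] by metis
  obtain T' where T': "\<And>x y. ip (T x) y = ip x (T' y)" using adjointable_adjoint[OF T] by metis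
  show ?thesis by (rule adjointableI[of _ "\<lambda>y. T' (S' y)"]) (simp add: S' T')
qed

lemma adjointable_id: "(\<lambda>x. x) \<in> adjointable ip"
  by (rule adjointableI) simp

lemma csubspace_adjointable: "csubspace (adjointable ip)"
  unfolding cvec.subspace_def
proof (intro conjI ballI allI)
  show "0 \<in> adjointable ip" by (rule adjointableI[of _ "\<lambda>x. 0"]) simp
  fix T S c assume T: "T \<in> adjointable ip"
  obtain T' where T': "\<And>x y. ip (T x) y = ip x (T' y)" using adjointable_adjoint[OF T] by metis
  show "c *\<^sub>C T \<in> adjointable ip"
    by (rule adjointableI[of _ "\<lambda>y. cnj c *\<^sub>C T' y"])
      (simp add: scaleC_fun_def ip_scaleC_left ip_scaleC_right T')
  assume S: "S \<in> adjointable ip"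
  obtain S' where S': "\<And>x y. ip (S x) y = ip x (S' y)" using adjointable_adjoint[OF S] by metis
  show "T + S \<in> adjointable ip"
    by (rule adjointableI[of _ "\<lambda>y. T' y + S' y"]) (simp add: ip_add_left ip_add_right T' S')
qed

end

text \<open>Baire category: the closed sets where the norm of \<open>f\<close> is at most
  \<open>n\<close> cover the space, so one of them contains a ball, and additivity moves this ball
  to the origin. It serves to show that adjointable operators are bounded.\<close>

lemma additive_bounded_of_closed_balls:
  fixes f :: "'a::banach \<Rightarrow> 'b::real_normed_vector"
  assumes add: "\<And>x y. f (x + y) = f x + f y" and scale: "\<And>r x. f (r *\<^sub>R x) = r *\<^sub>R f x"
    and cl: "\<And>c. closed {x. norm (f x) \<le> c}"
  shows "\<exists>B\<ge>0. \<forall>x. norm (f x) \<le> B * norm x"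
proof -
  define E where "E n = {x. norm (f x) \<le> real n}" for n
  have "\<exists>n. interior (E n) \<noteq> {}"
  proof (rule ccontr)
    assume *: "\<nexists>n. interior (E n) \<noteq> {}"
    have "euclidean interior_of \<Union> (range E) = {}"
    proof (rule Baire_category_alt)
      show "closedin euclidean T \<and> euclidean interior_of T = {}" if "T \<in> range E" for T
        using that * cl by (auto simp: E_def)
    qed (auto simp: completely_metrizable_space_euclidean)
    moreover have "\<Union> (range E) = UNIV"
      using real_arch_simple by (auto simp: E_def)
    ultimately show False by simp
  qed
  then obtain n x0 where "x0 \<in> interior (E n)" by auto
  then obtain r where r: "r > 0" "ball x0 r \<subseteq> E n" by (auto simp: mem_interior)
  have small: "norm (f v) \<le> 2 * real n" if "norm v < r" for v
  proof -
    have "f v = f (x0 + v) + (-1) *\<^sub>R f x0" by (simp add: add)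
    moreover have "x0 + v \<in> E n" "x0 \<in> E n" using r that by (auto simp: dist_norm)
    ultimately show ?thesis using norm_triangle_ineq4[of "f (x0 + v)" "f x0"] by (auto simp: E_def)
  qed
  have "norm (f x) \<le> (4 * real n / r) * norm x" for x
  proof (cases "x = 0")
    case True
    then show ?thesis using scale[of 0 0] by simp
  next
    case False
    define t where "t = r / (2 * norm x)"
    have t: "t > 0" using r False by (simp add: t_def)
    have "norm (t *\<^sub>R x) < r" using r False by (simp add: t_def)
    then have "t * norm (f x) \<le> 2 * real n" using small[of "t *\<^sub>R x"] t by (simp add: scale)
    then have "norm (f x) \<le> 2 * real n / t" using t by (simp add: field_simps)
    also have "\<dots> = (4 * real n / r) * norm x" using r False by (simp add: t_def)
    finally show ?thesis .
  qed
  then show ?thesis using r by (intro exI[of _ "4 * real n / r"]) auto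
qed

subsection \<open>Operators from Gram matrices of powers\<close>

text \<open>Repeated squaring gives \<open>b 0 * (b 1 / b 0) ^ (2 ^ k) \<le> b (2 ^ k)\<close>. If
  the quotient exceeded \<open>r\<close>, the left side would outgrow
  \<open>C * r ^ (2 ^ k)\<close>. The constant \<open>C\<close> disappears in the limit, as in the
  spectral radius formula.\<close>

lemma power_growth:
  fixes b :: "nat \<Rightarrow> real"
  assumes b: "\<And>n. b n \<ge> 0" and sq: "\<And>n. (b n)\<^sup>2 \<le> b 0 * b (2 * n)" and g: "\<And>n. b n \<le> C * r ^ n" and r: "r \<ge> 0"
  shows "b 1 \<le> r * b 0"
proof (rule ccontr)
  assume "\<not> b 1 \<le> r * b 0"
  then have gt: "b 1 > r * b 0" by simp
  have b0: "b 0 > 0"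
  proof (rule ccontr)
    assume "\<not> b 0 > 0"
    then have "b 0 = 0" using b[of 0] by simp
    then show False using sq[of 1] gt by simp
  qed
  have pow: "b 0 * (b 1 / b 0) ^ (2 ^ k) \<le> b (2 ^ k)" for k
  proof (induction k)
    case (Suc k)
    have "(b 0 * (b 1 / b 0) ^ (2 ^ k))\<^sup>2 \<le> (b (2 ^ k))\<^sup>2"
      using Suc b b0 by (intro power_mono) auto
    also have "\<dots> \<le> b 0 * b (2 * 2 ^ k)" by (rule sq)
    finally have "b 0 * (b 0 * ((b 1 / b 0) ^ (2 ^ k))\<^sup>2) \<le> b 0 * b (2 ^ Suc k)"
      by (simp add: power_mult_distrib power2_eq_square mult_ac)
    then have "b 0 * ((b 1 / b 0) ^ (2 ^ k))\<^sup>2 \<le> b (2 ^ Suc k)" using b0 by simp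
    then show ?case by (simp add: power_mult[symmetric] mult.commute)
  qed (use b0 in simp)
  define q where "q = b 1 / b 0"
  have q: "q > r" using gt b0 by (simp add: q_def field_simps)
  have r0: "r > 0"
  proof (rule ccontr)
    assume "\<not> r > 0"
    then have "b 1 \<le> 0" using g[of 1] r by simp
    then show False using gt b0 r by (smt (verit) mult_nonneg_nonneg)
  qed
  have "(q / r) ^ (2 ^ k) \<le> C / b 0" for k
  proof -
    have "b 0 * q ^ (2 ^ k) \<le> C * r ^ (2 ^ k)" using pow[of k] g[of "2 ^ k"] unfolding q_def by linarith
    then show ?thesis using b0 r0 by (simp add: power_divide field_simps)
  qed
  moreover obtain n where n: "C / b 0 < (q / r) ^ n"
    using real_arch_pow[of "q / r" "C / b 0"] q r0 by auto
  moreover have "(q / r) ^ n \<le> (q / r) ^ (2 ^ n)"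
    using q r0 by (intro power_increasing) (auto simp: less_imp_le)
  ultimately show False by (metis linorder_not_le order_trans)
qed

text \<open>\<open>V n i\<close> plays the role of the n-th power of a positive operator at
  \<open>V 0 i\<close>, and \<open>W i\<close> that of an operator whose product with its adjoint,
  adjoint first, is this positive operator. Powers are estimated on single vectors only, with
  constants depending on the vector; \<open>power_growth\<close> turns this into a bound on all
  finite combinations.\<close>

lemma operator_from_powers:
  fixes V :: "nat \<Rightarrow> 'i \<Rightarrow> 'a::chilbert" and W :: "'i \<Rightarrow> 'b::chilbert"
  assumes V: "\<And>m n i j. cinner (V m i) (V n j) = cinner (V 0 i) (V (m + n) j)"
    and W: "\<And>i j. cinner (W i) (W j) = cinner (V 0 i) (V 1 j)"
    and g: "\<And>n i. norm (V n i) \<le> C i * r ^ n" and r: "r \<ge> 0"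
  shows "\<exists>T. bounded_clinear T \<and> (\<forall>i. T (V 0 i) = W i) \<and> (\<forall>x. norm (T x) \<le> sqrt r * norm x)"
proof -
  have B: "norm (\<Sum>i\<in>F. c i *\<^sub>C W i) \<le> sqrt r * norm (\<Sum>i\<in>F. c i *\<^sub>C V 0 i)" if F: "finite F" for F c
  proof -
    define v where "v n = (\<Sum>i\<in>F. c i *\<^sub>C V n i)" for n
    have vv: "cinner (v m) (v n) = cinner (v 0) (v (m + n))" for m n
      unfolding v_def by (simp add: cinner_sum_left cinner_sum_right cinner_scaleC_left cinner_scaleC_right V[of m _ n])
    have "norm (v 1) \<le> r * norm (v 0)"
    proof (rule power_growth[where C = "\<Sum>i\<in>F. cmod (c i) * C i"])
      show "(norm (v n))\<^sup>2 \<le> norm (v 0) * norm (v (2 * n))" for n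
      proof -
        have "(norm (v n))\<^sup>2 = Re (cinner (v 0) (v (2 * n)))"
          using vv[of n n] by (simp add: norm_sq_cinner mult_2)
        also have "\<dots> \<le> cmod (cinner (v 0) (v (2 * n)))" by (rule complex_Re_le_cmod)
        finally show ?thesis using cauchy_schwarz order_trans by blast
      qed
      show "norm (v n) \<le> (\<Sum>i\<in>F. cmod (c i) * C i) * r ^ n" for n
      proof -
        have "norm (v n) \<le> (\<Sum>i\<in>F. norm (c i *\<^sub>C V n i))" unfolding v_def by (rule norm_sum)
        also have "\<dots> \<le> (\<Sum>i\<in>F. cmod (c i) * (C i * r ^ n))"
          by (intro sum_mono) (simp add: norm_scaleC mult_left_mono g)
        finally show ?thesis by (simp add: sum_distrib_right mult.assoc)
      qed
    qed (use r in auto)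
    have "cinner (\<Sum>i\<in>F. c i *\<^sub>C W i) (\<Sum>i\<in>F. c i *\<^sub>C W i) = cinner (v 0) (v 1)"
      unfolding v_def by (simp add: cinner_sum_left cinner_sum_right cinner_scaleC_left cinner_scaleC_right W)
    then have "(norm (\<Sum>i\<in>F. c i *\<^sub>C W i))\<^sup>2 \<le> cmod (cinner (v 0) (v 1))"
      by (simp add: norm_sq_cinner complex_Re_le_cmod)
    also have "\<dots> \<le> norm (v 0) * norm (v 1)" by (rule cauchy_schwarz)
    also have "\<dots> \<le> norm (v 0) * (r * norm (v 0))"
      by (intro mult_left_mono \<open>norm (v 1) \<le> r * norm (v 0)\<close>) simp
    also have "\<dots> = (sqrt r * norm (v 0))\<^sup>2" using r by (simp add: power_mult_distrib power2_eq_square)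
    finally have "norm (\<Sum>i\<in>F. c i *\<^sub>C W i) \<le> sqrt r * norm (v 0)" by (rule power2_le_imp_le) (use r in simp)
    then show ?thesis by (simp add: v_def)
  qed
  show ?thesis
    by (rule operator_extension[of "sqrt r" W "V 0", OF _ B]) (use r in auto)
qed

subsection \<open>Induced Hilbert spaces\<close>

context star_rep
begin

lemma adjoint_commutant:
  assumes S: "S \<in> commutant (range \<pi>)" and S': "bounded_clinear S'" "\<And>x y. cinner (S' x) y = cinner x (S y)"
  shows "S' \<in> commutant (range \<pi>)"
proof -
  have SS: "S (\<pi> a x) = \<pi> a (S x)" for a x using S by (auto simp: commutant_def)
  have "S' (\<pi> a x) = \<pi> a (S' x)" for a x
  proof (rule cinner_eqI)
    fix y
    have "cinner (S' (\<pi> a x)) y = cinner (\<pi> a (S' x)) y"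
      using rep_star'[of "S' x" a y] by (simp add: S'(2) rep_star'[symmetric] SS)
    then show "cinner y (S' (\<pi> a x)) = cinner y (\<pi> a (S' x))" by (metis cinner_commute)
  qed
  then show ?thesis using S'(1) by (auto simp: commutant_def)
qed

end

section \<open>The Hilbert space induced from a module, and the operators acting on either tensor
  factor\<close>

locale tensor_space = normal_faithful_rep P \<pi> + F: hilbert_wstar_module ipF actF + T: induced_hilbert_space ipF \<pi> tensH
  for P :: "('m::cstar_algebra \<Rightarrow> complex) set" and \<pi> :: "'m \<Rightarrow> 'h::chilbert \<Rightarrow> 'h"
    and ipF :: "'f::cbanach \<Rightarrow> 'f \<Rightarrow> 'm" and actF :: "'f \<Rightarrow> 'm \<Rightarrow> 'f"
    and tensH :: "'f \<Rightarrow> 'h \<Rightarrow> 'k::chilbert"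
begin

lemma ccspan_tensH: "ccspan {tensH x h | x h. True} = UNIV"
  by (rule T.dense)

lemma tensH_eqI:
  assumes "\<And>y k. cinner (tensH y k) u = cinner (tensH y k) v" shows "u = v"
proof -
  have "u - v \<in> orth {tensH x h | x h. True}"
    using assms by (auto simp: orth_def cinner_diff_right)
  then have "u - v = 0" using ccspan_tensH unfolding ccspan_eq_UNIV_iff by blast
  then show ?thesis by simp
qed

lemma tensH_operator_eqI:
  assumes "bounded_clinear S" "bounded_clinear T" "\<And>x h. S (tensH x h) = T (tensH x h)"
  shows "S u = T u"
  by (rule clinear_eq_on_ccspan[OF assms(1,2), of "{tensH x h | x h. True}"])
    (use assms(3) ccspan_tensH in auto)

lemma tensH_add_left: "tensH (x + y) h = tensH x h + tensH y h"
  by (rule tensH_eqI) (simp add: T.cinner_tensH cinner_add_right F.ip_add_right rep_add)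

lemma tensH_scaleC_left: "tensH (c *\<^sub>C x) h = c *\<^sub>C tensH x h"
  by (rule tensH_eqI) (simp add: T.cinner_tensH cinner_scaleC_right F.ip_scaleC_right rep_scaleC)

lemma tensH_add_right: "tensH x (h + k) = tensH x h + tensH x k"
  by (rule tensH_eqI) (simp add: T.cinner_tensH cinner_add_right clinear_add[OF rep_bounded])

lemma tensH_scaleC_right: "tensH x (c *\<^sub>C h) = c *\<^sub>C tensH x h"
  by (rule tensH_eqI) (simp add: T.cinner_tensH cinner_scaleC_right clinear_scaleC[OF rep_bounded])

lemma tensH_act: "tensH (actF x a) h = tensH x (\<pi> a h)"
  by (rule tensH_eqI) (simp add: T.cinner_tensH F.ip_act_right rep_mult)

lemma norm_tensH_le: "norm (tensH x h) \<le> norm x * norm h"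
proof (rule power2_le_imp_le)
  have "(norm (tensH x h))\<^sup>2 \<le> cmod (cinner h (\<pi> (ipF x x) h))"
    unfolding norm_sq_cinner T.cinner_tensH by (rule complex_Re_le_cmod)
  also have "\<dots> \<le> norm h * (norm (ipF x x) * norm h)"
    by (rule order_trans[OF cauchy_schwarz mult_left_mono[OF rep_contractive]]) simp
  also have "\<dots> = (norm x * norm h)\<^sup>2" by (simp add: F.norm_ip power2_eq_square mult_ac)
  finally show "(norm (tensH x h))\<^sup>2 \<le> (norm x * norm h)\<^sup>2" .
qed simp

lemma bounded_clinear_tensH_right: "bounded_clinear (tensH x)"
  by (rule bounded_clinearI[OF tensH_add_right tensH_scaleC_right norm_tensH_le])

lemma bounded_clinear_tensH_left: "bounded_clinear (\<lambda>x. tensH x h)"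
  by (rule bounded_clinearI[where B = "norm h"])
    (use norm_tensH_le[of _ h] in \<open>simp_all add: tensH_add_left tensH_scaleC_left mult.commute\<close>)

lemma rep_eqI: "(\<And>h k. cinner h (\<pi> a k) = cinner h (\<pi> b k)) \<Longrightarrow> a = b"
proof -
  assume *: "\<And>h k. cinner h (\<pi> a k) = cinner h (\<pi> b k)"
  have "\<pi> (a - b) k = 0" for k using cinner_eqI[OF *] by (simp add: rep_diff)
  then have "a - b = 0" by (rule rep_faithful)
  then show "a = b" by simp
qed

lemma tensH_eq_0: assumes "\<And>h. tensH x h = 0" shows "x = 0"
proof -
  have "ipF x x = 0" using T.cinner_tensH[of x _ x] assms by (intro rep_eqI) (metis cinner_zero_right rep_zero)
  then show ?thesis by (rule F.ip_self_eq_0)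
qed

lemma tensH_inj: assumes "\<And>h. tensH x h = tensH y h" shows "x = y"
proof -
  have "tensH (x - y) h = 0" for h
    using assms clinear_diff[OF bounded_clinear_tensH_left, of x y h] by simp
  then show ?thesis using tensH_eq_0[of "x - y"] by simp
qed

text \<open>The Cauchy--Schwarz inequality of the module is read off from that of the induced space,
  where the faithful representation detects norms.\<close>

lemma norm_ipF_le: "norm (ipF x y) \<le> norm x * norm y"
proof (rule predual_ext_bound)
  fix h k :: 'h assume hk: "norm h \<le> 1" "norm k \<le> 1"
  have "cmod (cinner h (\<pi> (ipF x y) k)) \<le> norm (tensH x h) * norm (tensH y k)"
    unfolding T.cinner_tensH[symmetric] by (rule cauchy_schwarz)
  also have "\<dots> \<le> (norm x * norm h) * (norm y * norm k)"
    by (intro mult_mono norm_tensH_le) auto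
  also have "\<dots> \<le> (norm x * 1) * (norm y * 1)"
    by (intro mult_mono hk order_refl) auto
  finally show "cmod (cinner h (\<pi> (ipF x y) k)) \<le> norm x * norm y" by simp
qed simp

text \<open>With an adjoint \<open>S\<close> at hand, the preimage of a ball is an intersection of
  conditions on \<open>ipF x (S y)\<close>, each of them closed in \<open>x\<close>; the Baire
  argument applies.\<close>

lemma adjointable_bounded:
  assumes T: "T \<in> adjointable ipF" shows "bounded_clinear T"
proof -
  obtain S where S: "\<And>x y. ipF (T x) y = ipF x (S y)" using F.adjointable_adjoint[OF T] by metis
  note add = F.adjointable_add[OF T] and sc = F.adjointable_scaleC[OF T]
  have "\<exists>B\<ge>0. \<forall>x. norm (T x) \<le> B * norm x"
  proof (rule additive_bounded_of_closed_balls[OF add])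
    show "T (r *\<^sub>R x) = r *\<^sub>R T x" for r x by (simp add: scaleR_scaleC sc)
    fix c
    have "closed {x. norm (ipF x (S y)) \<le> c * norm y}" for y
    proof (intro closed_Collect_le continuous_on_norm continuous_on_const)
      have "bounded_linear (\<lambda>x. ipF x (S y))"
        by (rule bounded_linear_intro[where K = "norm (S y)"])
          (simp_all add: F.ip_add_left scaleR_scaleC F.ip_scaleC_left norm_ipF_le)
      then show "continuous_on UNIV (\<lambda>x. ipF x (S y))" by (rule linear_continuous_on)
    qed
    then have cl: "closed (\<Inter>y. {x. norm (ipF x (S y)) \<le> c * norm y})" by blast
    have "{x. norm (T x) \<le> c} = (if c \<ge> 0 then (\<Inter>y. {x. norm (ipF x (S y)) \<le> c * norm y}) else {})"
    proof (cases "c \<ge> 0")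
      case True
      have "norm (T x) \<le> c \<longleftrightarrow> (\<forall>y. norm (ipF x (S y)) \<le> c * norm y)" for x
      proof
        assume "norm (T x) \<le> c"
        then show "\<forall>y. norm (ipF x (S y)) \<le> c * norm y"
          unfolding S[symmetric] by (intro allI order_trans[OF norm_ipF_le] mult_right_mono) auto
      next
        assume "\<forall>y. norm (ipF x (S y)) \<le> c * norm y"
        then have "norm (ipF (T x) (T x)) \<le> c * norm (T x)" by (simp add: S)
        then show "norm (T x) \<le> c" unfolding F.norm_ip by (rule norm_le_of_sq[OF _ True])
      qed
      then show ?thesis using True by auto
    next
      case False
      then have "\<not> norm (T x) \<le> c" for x using norm_ge_zero[of "T x"] by linarith
      then show ?thesis using False by simp
    qed
    then show "closed {x. norm (T x) \<le> c}" using cl by simp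
  qed
  then obtain B where B: "\<And>x. norm (T x) \<le> B * norm x" by blast
  show ?thesis by (rule bounded_clinearI[OF add sc B])
qed

text \<open>Existence of the operator acting as \<open>X\<close> on the first factor. With
  \<open>Y\<close> the adjoint of \<open>X\<close> times \<open>X\<close>, the Gram matrices of the
  vectors \<open>(Y ^^ n) x\<close> tensored with \<open>h\<close> depend on the sum of the
  exponents only, as \<open>operator_from_powers\<close> demands.\<close>

lemma adjointable_tensor:
  assumes X: "X \<in> adjointable ipF"
  obtains R where "bounded_clinear R" "\<And>x h. R (tensH x h) = tensH (X x) h"
    "\<And>u. norm (R u) \<le> onorm X * norm u"
proof -
  obtain S where S: "S \<in> adjointable ipF" "\<And>x y. ipF (X x) y = ipF x (S y)" "\<And>x y. ipF (S x) y = ipF x (X y)"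
    using F.adjointable_adjoint[OF X] by metis
  define Y where "Y x = S (X x)" for x
  have Ya: "Y \<in> adjointable ipF" unfolding Y_def by (rule F.adjointable_comp[OF S(1) X])
  have bY: "bounded_clinear Y" by (rule adjointable_bounded[OF Ya])
  have YY: "ipF ((Y ^^ m) x) ((Y ^^ n) y) = ipF x ((Y ^^ (m + n)) y)" for m n x y
  proof (induction m arbitrary: n)
    case (Suc m)
    have "ipF ((Y ^^ Suc m) x) ((Y ^^ n) y) = ipF ((Y ^^ m) x) ((Y ^^ Suc n) y)"
      by (simp add: Y_def S)
    then show ?case using Suc[of "Suc n"] by simp
  qed simp
  have nY: "norm ((Y ^^ n) x) \<le> onorm Y ^ n * norm x" for n x
  proof (induction n)
    case (Suc n)
    have "norm (Y ((Y ^^ n) x)) \<le> onorm Y * norm ((Y ^^ n) x)" by (rule clinear_bound[OF bY])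
    also have "\<dots> \<le> onorm Y * (onorm Y ^ n * norm x)"
      by (intro mult_left_mono Suc onorm_pos_le bounded_clinear_linear bY)
    finally show ?case by (simp add: mult.assoc)
  qed simp
  define V where "V n i = tensH ((Y ^^ n) (fst i)) (snd i)" for n i
  have "\<exists>R. bounded_clinear R \<and> (\<forall>i. R (V 0 i) = tensH (X (fst i)) (snd i)) \<and> (\<forall>x. norm (R x) \<le> sqrt (onorm Y) * norm x)"
  proof (rule operator_from_powers[where V = V and W = "\<lambda>i. tensH (X (fst i)) (snd i)"
        and C = "\<lambda>i. norm (fst i) * norm (snd i)" and r = "onorm Y"])
    show "cinner (V m i) (V n j) = cinner (V 0 i) (V (m + n) j)" for m n i j
      by (simp add: V_def T.cinner_tensH YY)
    show "cinner (tensH (X (fst i)) (snd i)) (tensH (X (fst j)) (snd j)) = cinner (V 0 i) (V 1 j)" for i j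
      by (simp add: V_def T.cinner_tensH S(2) Y_def)
    show "norm (V n i) \<le> norm (fst i) * norm (snd i) * onorm Y ^ n" for n i
      using order_trans[OF norm_tensH_le mult_right_mono[OF nY norm_ge_zero]]
      by (simp add: V_def mult_ac)
    show "onorm Y \<ge> 0" by (rule onorm_pos_le[OF bounded_clinear_linear[OF bY]])
  qed
  then obtain R where R: "bounded_clinear R" "\<forall>i. R (V 0 i) = tensH (X (fst i)) (snd i)"
    "\<forall>x. norm (R x) \<le> sqrt (onorm Y) * norm x" by blast
  have 1: "R (tensH x h) = tensH (X x) h" for x h using R(2)[rule_format, of "(x, h)"] by (simp add: V_def)
  have bX: "bounded_clinear X" by (rule adjointable_bounded[OF X])
  have o: "onorm X \<ge> 0" by (rule onorm_pos_le[OF bounded_clinear_linear[OF bX]])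
  have nS: "norm (S x) \<le> onorm X * norm x" for x
  proof (rule norm_le_of_sq)
    have "(norm (S x))\<^sup>2 = norm (ipF (X (S x)) x)" by (simp add: S F.norm_ip[symmetric])
    also have "\<dots> \<le> (onorm X * norm (S x)) * norm x"
      by (rule order_trans[OF norm_ipF_le mult_right_mono[OF clinear_bound[OF bX]]]) simp
    finally show "(norm (S x))\<^sup>2 \<le> onorm X * norm x * norm (S x)" by (simp add: mult_ac)
  qed (use o in simp)
  have "onorm Y \<le> (onorm X)\<^sup>2"
  proof (rule onorm_bound)
    show "norm (Y x) \<le> (onorm X)\<^sup>2 * norm x" for x
      using order_trans[OF nS mult_left_mono[OF clinear_bound[OF bX] o]]
      by (simp add: Y_def power2_eq_square mult.assoc)
  qed simp
  then have "sqrt (onorm Y) \<le> onorm X" using o by (simp add: real_le_lsqrt)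
  then have "norm (R u) \<le> onorm X * norm u" for u
    using R(3) by (meson mult_right_mono norm_ge_zero order_trans)
  then show ?thesis using that R(1) 1 by blast
qed

abbreviation \<rho> :: "('f \<Rightarrow> 'f) \<Rightarrow> 'k \<Rightarrow> 'k" where "\<rho> \<equiv> induced_rep tensH"

lemma induced_rep_eqI:
  assumes R: "bounded_clinear R" "\<And>x h. R (tensH x h) = tensH (X x) h"
  shows "\<rho> X = R"
  unfolding induced_rep_def
proof (rule the_equality[where P = "\<lambda>R. bounded_clinear R \<and> (\<forall>x h. R (tensH x h) = tensH (X x) h)"])
  show "bounded_clinear R \<and> (\<forall>x h. R (tensH x h) = tensH (X x) h)" using R by simp
  fix R' assume R': "bounded_clinear R' \<and> (\<forall>x h. R' (tensH x h) = tensH (X x) h)"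
  show "R' = R"
  proof
    fix u
    show "R' u = R u"
      by (rule tensH_operator_eqI[of R' R]) (simp_all add: R R')
  qed
qed

lemma
  assumes X: "X \<in> adjointable ipF"
  shows bounded_clinear_induced_rep: "bounded_clinear (\<rho> X)"
    and induced_rep_tensH: "\<rho> X (tensH x h) = tensH (X x) h"
    and norm_induced_rep_le: "norm (\<rho> X u) \<le> onorm X * norm u"
proof -
  obtain R where R: "bounded_clinear R" "\<And>x h. R (tensH x h) = tensH (X x) h"
    "\<And>u. norm (R u) \<le> onorm X * norm u"
    using adjointable_tensor[OF X] by metis
  have "\<rho> X = R" by (rule induced_rep_eqI[OF R(1,2)])
  then show "bounded_clinear (\<rho> X)" "\<rho> X (tensH x h) = tensH (X x) h" "norm (\<rho> X u) \<le> onorm X * norm u"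
    by (simp_all add: R)
qed

lemma induced_rep_adjoint:
  assumes X: "X \<in> adjointable ipF" and Y: "Y \<in> adjointable ipF" and XY: "\<And>x y. ipF (Y x) y = ipF x (X y)"
  shows "cinner (\<rho> Y u) v = cinner u (\<rho> X v)"
proof -
  note bX = bounded_clinear_induced_rep[OF X] and bY = bounded_clinear_induced_rep[OF Y]
  obtain Z where Z: "bounded_clinear Z" "\<And>x y. cinner (Z x) y = cinner x (\<rho> X y)"
    using adjoint_exists[OF bX] by metis
  have "Z u = \<rho> Y u"
  proof (rule tensH_operator_eqI[OF Z(1) bY])
    fix x h
    show "Z (tensH x h) = \<rho> Y (tensH x h)"
    proof (rule tensH_eqI)
      fix y k
      have "cinner (Z (tensH x h)) (tensH y k) = cinner (\<rho> Y (tensH x h)) (tensH y k)"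
        by (simp add: Z induced_rep_tensH X Y T.cinner_tensH XY)
      then show "cinner (tensH y k) (Z (tensH x h)) = cinner (tensH y k) (\<rho> Y (tensH x h))"
        by (metis cinner_commute)
    qed
  qed
  then show ?thesis using Z(2)[of u v] by simp
qed

lemma induced_rep_comp:
  assumes X: "X \<in> adjointable ipF" and Y: "Y \<in> adjointable ipF"
  shows "\<rho> (\<lambda>x. X (Y x)) = (\<lambda>u. \<rho> X (\<rho> Y u))"
proof (rule induced_rep_eqI)
  show "bounded_clinear (\<lambda>u. \<rho> X (\<rho> Y u))"
    by (rule bounded_clinear_comp[OF bounded_clinear_induced_rep[OF X] bounded_clinear_induced_rep[OF Y]])
qed (simp add: induced_rep_tensH[OF X] induced_rep_tensH[OF Y])

lemma induced_rep_add:
  assumes X: "X \<in> adjointable ipF" and Y: "Y \<in> adjointable ipF"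
  shows "\<rho> (\<lambda>x. X x + Y x) = (\<lambda>u. \<rho> X u + \<rho> Y u)"
proof (rule induced_rep_eqI)
  show "bounded_clinear (\<lambda>u. \<rho> X u + \<rho> Y u)"
    by (rule bounded_clinear_add[OF bounded_clinear_induced_rep[OF X] bounded_clinear_induced_rep[OF Y]])
qed (simp add: induced_rep_tensH[OF X] induced_rep_tensH[OF Y] tensH_add_left)

lemma induced_rep_scaleC:
  assumes X: "X \<in> adjointable ipF"
  shows "\<rho> (\<lambda>x. c *\<^sub>C X x) = (\<lambda>u. c *\<^sub>C \<rho> X u)"
proof (rule induced_rep_eqI)
  show "bounded_clinear (\<lambda>u. c *\<^sub>C \<rho> X u)"
    by (rule bounded_clinear_scaleC[OF bounded_clinear_induced_rep[OF X]])
qed (simp add: induced_rep_tensH[OF X] tensH_scaleC_left)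

lemma induced_rep_id: "\<rho> (\<lambda>x. x) = (\<lambda>u. u)"
  by (rule induced_rep_eqI[OF bounded_clinear_id]) simp

text \<open>This is \<open>I \<otimes> S\<close>; it exists only for \<open>S\<close> in the commutant of \<open>\<pi>\<close>.\<close>

definition right_op :: "('h \<Rightarrow> 'h) \<Rightarrow> 'k \<Rightarrow> 'k" where
  "right_op S = (SOME R. bounded_clinear R \<and> (\<forall>x h. R (tensH x h) = tensH x (S h)))"

text \<open>The argument of \<open>adjointable_tensor\<close> on the other factor. Commuting with
  \<open>\<pi>\<close> is what allows powers of \<open>Y\<close> to move across the inner
  product.\<close>

lemma
  assumes S: "S \<in> commutant (range \<pi>)"
  shows bounded_clinear_right_op: "bounded_clinear (right_op S)"
    and right_op_tensH: "right_op S (tensH x h) = tensH x (S h)"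
proof -
  have bS: "bounded_clinear S" using S by (simp add: commutant_def)
  obtain S' where S': "bounded_clinear S'" "\<And>x y. cinner (S' x) y = cinner x (S y)" "\<And>x y. cinner x (S' y) = cinner (S x) y"
    using adjoint_exists[OF bS] by metis
  have SS: "S (\<pi> a x) = \<pi> a (S x)" for a x using S by (auto simp: commutant_def)
  have SS': "S' (\<pi> a x) = \<pi> a (S' x)" for a x
    using adjoint_commutant[OF S S'(1,2)] by (auto simp: commutant_def)
  define Y where "Y x = S' (S x)" for x
  have bY: "bounded_clinear Y" unfolding Y_def by (rule bounded_clinear_comp[OF S'(1) bS])
  have Ypi: "Y (\<pi> a x) = \<pi> a (Y x)" for a x by (simp add: Y_def SS SS')
  have Yn: "(Y ^^ n) (\<pi> a x) = \<pi> a ((Y ^^ n) x)" for n a x by (induction n) (simp_all add: Ypi)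
  have YY: "cinner ((Y ^^ m) x) (\<pi> a ((Y ^^ n) y)) = cinner x (\<pi> a ((Y ^^ (m + n)) y))" for m n x y a
  proof (induction m arbitrary: n)
    case (Suc m)
    have "cinner ((Y ^^ Suc m) x) (\<pi> a ((Y ^^ n) y)) = cinner ((Y ^^ m) x) (\<pi> a ((Y ^^ Suc n) y))"
      by (simp add: Y_def S'(2,3) SS SS'[symmetric])
    then show ?case using Suc[of "Suc n"] by simp
  qed simp
  have nY: "norm ((Y ^^ n) x) \<le> onorm Y ^ n * norm x" for n x
  proof (induction n)
    case (Suc n)
    have "norm (Y ((Y ^^ n) x)) \<le> onorm Y * norm ((Y ^^ n) x)" by (rule clinear_bound[OF bY])
    also have "\<dots> \<le> onorm Y * (onorm Y ^ n * norm x)"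
      by (intro mult_left_mono Suc onorm_pos_le bounded_clinear_linear bY)
    finally show ?case by (simp add: mult.assoc)
  qed simp
  define V where "V n i = tensH (fst i) ((Y ^^ n) (snd i))" for n i
  have "\<exists>R. bounded_clinear R \<and> (\<forall>i. R (V 0 i) = tensH (fst i) (S (snd i))) \<and> (\<forall>x. norm (R x) \<le> sqrt (onorm Y) * norm x)"
  proof (rule operator_from_powers[where V = V and W = "\<lambda>i. tensH (fst i) (S (snd i))"
        and C = "\<lambda>i. norm (fst i) * norm (snd i)" and r = "onorm Y"])
    show "cinner (V m i) (V n j) = cinner (V 0 i) (V (m + n) j)" for m n i j
      by (simp add: V_def T.cinner_tensH YY)
    show "cinner (tensH (fst i) (S (snd i))) (tensH (fst j) (S (snd j))) = cinner (V 0 i) (V 1 j)" for i j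
      by (simp add: V_def T.cinner_tensH SS[symmetric] S'(3)[symmetric] SS'[symmetric] Y_def)
    show "norm (V n i) \<le> norm (fst i) * norm (snd i) * onorm Y ^ n" for n i
      using order_trans[OF norm_tensH_le mult_left_mono[OF nY norm_ge_zero]]
      by (simp add: V_def mult_ac)
    show "onorm Y \<ge> 0" by (rule onorm_pos_le[OF bounded_clinear_linear[OF bY]])
  qed
  then obtain R where R: "bounded_clinear R" "\<forall>i. R (V 0 i) = tensH (fst i) (S (snd i))" by blast
  have "R (tensH x h) = tensH x (S h)" for x h using R(2)[rule_format, of "(x, h)"] by (simp add: V_def)
  with R(1) have "\<exists>R. bounded_clinear R \<and> (\<forall>x h. R (tensH x h) = tensH x (S h))" by blast
  from someI_ex[OF this] show "bounded_clinear (right_op S)" "right_op S (tensH x h) = tensH x (S h)"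
    unfolding right_op_def by simp_all
qed

lemma right_op_adjoint:
  assumes S: "S \<in> commutant (range \<pi>)" and S': "S' \<in> commutant (range \<pi>)"
    and adj: "\<And>x y. cinner (S' x) y = cinner x (S y)"
  shows "cinner (right_op S' u) v = cinner u (right_op S v)"
proof -
  note b = bounded_clinear_right_op[OF S] and b' = bounded_clinear_right_op[OF S']
  have SS: "S (\<pi> a x) = \<pi> a (S x)" for a x using S by (auto simp: commutant_def)
  obtain Z where Z: "bounded_clinear Z" "\<And>x y. cinner (Z x) y = cinner x (right_op S y)"
    using adjoint_exists[OF b] by metis
  have "Z u = right_op S' u"
  proof (rule tensH_operator_eqI[OF Z(1) b'])
    fix x h
    show "Z (tensH x h) = right_op S' (tensH x h)"
    proof (rule tensH_eqI)
      fix y k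
      have "cinner (Z (tensH x h)) (tensH y k) = cinner (right_op S' (tensH x h)) (tensH y k)"
        by (simp add: Z right_op_tensH S S' T.cinner_tensH adj SS)
      then show "cinner (tensH y k) (Z (tensH x h)) = cinner (tensH y k) (right_op S' (tensH x h))"
        by (metis cinner_commute)
    qed
  qed
  then show ?thesis using Z(2)[of u v] by simp
qed

lemma right_op_commutes:
  assumes S: "S \<in> commutant (range \<pi>)" and X: "X \<in> adjointable ipF"
  shows "right_op S (\<rho> X u) = \<rho> X (right_op S u)"
  by (rule tensH_operator_eqI[OF bounded_clinear_comp[OF bounded_clinear_right_op[OF S] bounded_clinear_induced_rep[OF X]]
        bounded_clinear_comp[OF bounded_clinear_induced_rep[OF X] bounded_clinear_right_op[OF S]]])
    (simp add: right_op_tensH S induced_rep_tensH X)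

text \<open>An operator commuting with all \<open>I \<otimes> S\<close> has the form \<open>X \<otimes> I\<close>: its matrix coefficients between the
  maps \<open>h \<mapsto> y \<otimes> h\<close> lie in the bicommutant, and self-duality produces \<open>X\<close>.\<close>

lemma right_commutant_map:
  assumes T: "bounded_clinear T" and com: "\<And>S u. S \<in> commutant (range \<pi>) \<Longrightarrow> right_op S (T u) = T (right_op S u)"
  shows "\<exists>X. \<forall>x h. T (tensH x h) = tensH (X x) h"
proof -
  have ex: "\<exists>a. \<forall>h k. cinner (tensH y k) (T (tensH x h)) = cinner k (\<pi> a h)" for x y
  proof -
    obtain L where L: "bounded_clinear L" "\<And>u h. cinner (L u) h = cinner u (tensH y h)" "\<And>u h. cinner h (L u) = cinner (tensH y h) u"
      using adjoint_exists[OF bounded_clinear_tensH_right[of y]] by metis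
    define R where "R h = L (T (tensH x h))" for h
    have bR: "bounded_clinear R"
      unfolding R_def by (rule bounded_clinear_comp[OF L(1) bounded_clinear_comp[OF T bounded_clinear_tensH_right]])
    have Rk: "cinner k (R h) = cinner (tensH y k) (T (tensH x h))" for h k by (simp add: R_def L(3))
    have "R (S h) = S (R h)" if S: "S \<in> commutant (range \<pi>)" for S h
    proof (rule cinner_eqI)
      fix k
      have bS: "bounded_clinear S" using S by (simp add: commutant_def)
      obtain S' where S': "bounded_clinear S'" "\<And>x y. cinner (S' x) y = cinner x (S y)"
        using adjoint_exists[OF bS] by metis
      have cS': "S' \<in> commutant (range \<pi>)" by (rule adjoint_commutant[OF S S'])
      have "cinner k (R (S h)) = cinner (tensH y k) (T (right_op S (tensH x h)))"
        by (simp add: Rk right_op_tensH[OF S])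
      also have "\<dots> = cinner (tensH y k) (right_op S (T (tensH x h)))" by (simp add: com[OF S])
      also have "\<dots> = cinner (right_op S' (tensH y k)) (T (tensH x h))"
        by (rule right_op_adjoint[OF S cS' S'(2), symmetric])
      also have "\<dots> = cinner k (S (R h))" by (simp add: right_op_tensH[OF cS'] Rk[symmetric] S'(2))
      finally show "cinner k (R (S h)) = cinner k (S (R h))" .
    qed
    then have "R \<in> commutant (commutant (range \<pi>))" using bR by (simp add: commutant_def)
    then obtain a where "\<forall>h. R h = \<pi> a h" using double_commutant by blast
    then show ?thesis using Rk by (intro exI[of _ a]) metis
  qed
  then obtain a where a: "\<And>x y h k. cinner (tensH y k) (T (tensH x h)) = cinner k (\<pi> (a y x) h)" by metis
  have bound: "norm (a y x) \<le> onorm T * norm x * norm y" for x y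
  proof (rule predual_ext_bound)
    have o: "onorm T \<ge> 0" by (rule onorm_pos_le[OF bounded_clinear_linear[OF T]])
    then show "onorm T * norm x * norm y \<ge> 0" by simp
    fix h k :: 'h assume hk: "norm k \<le> 1" "norm h \<le> 1"
    have "cmod (cinner (tensH y k) (T (tensH x h))) \<le> norm (tensH y k) * norm (T (tensH x h))"
      by (rule cauchy_schwarz)
    also have "\<dots> \<le> (norm y * norm k) * (onorm T * (norm x * norm h))"
      by (intro mult_mono norm_tensH_le order_trans[OF clinear_bound[OF T] mult_left_mono[OF norm_tensH_le o]]) (use o in auto)
    also have "\<dots> \<le> (norm y * 1) * (onorm T * (norm x * 1))"
      by (intro mult_mono hk order_refl) (use o in auto)
    finally show "cmod (cinner k (\<pi> (a y x) h)) \<le> onorm T * norm x * norm y" by (simp add: a mult_ac)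
  qed
  have "\<exists>z. \<forall>y. star (a y x) = ipF z y" for x
  proof -
    have "module_functional actF UNIV (\<lambda>y. star (a y x))"
      unfolding module_functional_def
    proof (intro conjI ballI allI exI[of _ "onorm T * norm x"])
      show "star (a (y + y') x) = star (a y x) + star (a y' x)" for y y'
      proof -
        have "a (y + y') x = a y x + a y' x"
          by (rule rep_eqI) (simp add: a[symmetric] rep_add cinner_add_right tensH_add_left cinner_add_left)
        then show ?thesis by (simp add: star_add)
      qed
      show "star (a (actF y b) x) = star (a y x) * b" for y b
      proof -
        have "a (actF y b) x = star b * a y x"
          by (rule rep_eqI) (simp add: a[symmetric] rep_mult rep_star' tensH_act)
        then show ?thesis by (simp add: star_mult star_star)
      qed
      show "norm (star (a y x)) \<le> onorm T * norm x * norm y" for y using bound by simp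
    qed
    then show ?thesis using F.self_dual unfolding self_dual_def by blast
  qed
  then obtain X where X: "\<And>x y. star (a y x) = ipF (X x) y" by metis
  have "a y x = ipF y (X x)" for x y using X[of y x] F.ip_star[of y "X x"] by (metis star_star)
  then have "T (tensH x h) = tensH (X x) h" for x h
    by (intro tensH_eqI) (simp add: a T.cinner_tensH)
  then show ?thesis by blast
qed

text \<open>The adjoint of \<open>T\<close> commutes with the same operators, so it also comes from
  a module map, and the two maps are adjoint to each other.\<close>

theorem right_commutant:
  assumes T: "bounded_clinear T" and com: "\<And>S u. S \<in> commutant (range \<pi>) \<Longrightarrow> right_op S (T u) = T (right_op S u)"
  shows "\<exists>X\<in>adjointable ipF. T = \<rho> X"
proof -
  obtain T' where T': "bounded_clinear T'" "\<And>x y. cinner (T' x) y = cinner x (T y)"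
    using adjoint_exists[OF T] by metis
  have com': "right_op S (T' u) = T' (right_op S u)" if S: "S \<in> commutant (range \<pi>)" for S u
  proof -
    have bS: "bounded_clinear S" using S by (simp add: commutant_def)
    obtain S' where S': "bounded_clinear S'" "\<And>x y. cinner (S' x) y = cinner x (S y)" "\<And>x y. cinner x (S' y) = cinner (S x) y"
      using adjoint_exists[OF bS] by metis
    have cS': "S' \<in> commutant (range \<pi>)" by (rule adjoint_commutant[OF S S'(1,2)])
    have adj: "cinner (S x) y = cinner x (S' y)" for x y by (simp add: S'(3))
    have "cinner (right_op S (T' u)) v = cinner (T' (right_op S u)) v" for v
      by (simp add: right_op_adjoint[OF cS' S adj] T'(2) com[OF cS'])
    then show ?thesis by (intro cinner_eqI) (metis cinner_commute)
  qed
  obtain X where X: "\<And>x h. T (tensH x h) = tensH (X x) h" using right_commutant_map[OF T com] by metis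
  obtain Y where Y: "\<And>x h. T' (tensH x h) = tensH (Y x) h" using right_commutant_map[OF T'(1) com'] by metis
  have "X \<in> adjointable ipF"
  proof (rule F.adjointableI)
    fix x y
    show "ipF (X x) y = ipF x (Y y)"
    proof (rule rep_eqI)
      fix h k
      have "cinner (tensH (X x) h) (tensH y k) = cinner (tensH x h) (tensH (Y y) k)"
        by (simp add: X[symmetric] Y[symmetric]) (metis T'(2) cinner_commute)
      then show "cinner h (\<pi> (ipF (X x) y) k) = cinner h (\<pi> (ipF x (Y y)) k)"
        by (simp add: T.cinner_tensH)
    qed
  qed
  moreover have "T = \<rho> X" using induced_rep_eqI[OF T X] by simp
  ultimately show ?thesis by blast
qed

end

subsection \<open>Amplification of induced spaces\<close>

context tensor_space
begin

text \<open>Amplifying the representation amplifies the induced space, while the module and its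
  operators stay the same.\<close>

lemma tensor_space_ampl: "tensor_space P (ampl \<pi>) ipF actF (\<lambda>x. inflate (tensH x))"
proof -
  interpret A: normal_faithful_rep P "ampl \<pi>" by (rule normal_faithful_rep_ampl)
  show ?thesis
  proof
    note bt = bounded_clinear_tensH_right
    show "cinner (inflate (tensH x) h) (inflate (tensH y) k) = cinner h (inflate (\<pi> (ipF x y)) k)" for x y h k
      unfolding cinner_ell2_def by (simp add: coord_inflate[OF bt] coord_inflate[OF rep_bounded] T.cinner_tensH)
    have "y = 0" if y: "y \<in> orth {inflate (tensH x) h | x h. True}" for y
    proof (rule ell2_eqI)
      fix n
      have "coord y n = 0"
      proof (rule tensH_eqI)
        fix x h
        have "cinner (inflate (tensH x) (single n h)) y = 0" using y unfolding orth_def by blast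
        then show "cinner (tensH x h) (coord y n) = cinner (tensH x h) 0"
          by (simp add: inflate_single[OF bt] cinner_single_left)
      qed
      then show "coord y n = coord 0 n" by simp
    qed
    then have "orth {inflate (tensH x) h | x h. True} = {0}"
      using cvec.subspace_0[OF csubspace_orth] by auto
    then show "ccspan {inflate (tensH x) h | x h. True} = UNIV" unfolding ccspan_eq_UNIV_iff .
  qed
qed

lemma induced_rep_ampl:
  assumes X: "X \<in> adjointable ipF"
  shows "induced_rep (\<lambda>x. inflate (tensH x)) X = inflate (\<rho> X)"
proof -
  interpret A: tensor_space P "ampl \<pi>" ipF actF "\<lambda>x. inflate (tensH x)" by (rule tensor_space_ampl)
  note bX = bounded_clinear_induced_rep[OF X]
  show ?thesis
    by (rule A.induced_rep_eqI[OF bounded_clinear_inflate[OF bX]], rule ell2_eqI)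
      (simp add: coord_inflate[OF bX] coord_inflate[OF bounded_clinear_tensH_right] induced_rep_tensH[OF X])
qed

end

lemma sums_if_complex:
  fixes f g :: "nat \<Rightarrow> complex"
  assumes "g sums x" "f sums y"
  shows "(\<lambda>n. if even n then f (n div 2) else g ((n - 1) div 2)) sums (x + y)"
  using sums_if[of "\<lambda>n. Re (g n)" "Re x" "\<lambda>n. Re (f n)" "Re y"]
    sums_if[of "\<lambda>n. Im (g n)" "Im x" "\<lambda>n. Im (f n)" "Im y"] assms
  unfolding sums_complex_iff by (simp add: if_distrib)

subsection \<open>The predual of the adjointable operators\<close>

definition L_functionals ::
  "('m::cstar_algebra \<Rightarrow> complex) set \<Rightarrow> ('e::cbanach \<Rightarrow> 'e \<Rightarrow> 'm) \<Rightarrow> (('e \<Rightarrow> 'e) \<Rightarrow> complex) set" where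
  "L_functionals P ip = {\<lambda>T. (\<Sum>n. \<omega> n (ip (\<eta> n) (T (\<zeta> n)))) | \<omega> \<eta> \<zeta>.
     range \<omega> \<subseteq> P \<and> summable (\<lambda>n. onorm (\<omega> n) * norm (\<eta> n) * norm (\<zeta> n))}"

text \<open>Functionals are identified when they agree on adjointable operators. Elsewhere the
  series may diverge and its value is arbitrary, so \<open>L_functionals\<close> itself need not be
  closed under addition.\<close>

definition L_predual ::
  "('m::cstar_algebra \<Rightarrow> complex) set \<Rightarrow> ('e::cbanach \<Rightarrow> 'e \<Rightarrow> 'm) \<Rightarrow> (('e \<Rightarrow> 'e) \<Rightarrow> complex) set" where
  "L_predual P ip = {f. \<exists>g\<in>L_functionals P ip. \<forall>T\<in>adjointable ip. f T = g T}"

lemma L_functionalsI: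
  assumes "\<And>n. \<omega> n \<in> P" "summable (\<lambda>n. onorm (\<omega> n) * norm (\<eta> n) * norm (\<zeta> n))"
  shows "(\<lambda>T. (\<Sum>n. \<omega> n (ip (\<eta> n) (T (\<zeta> n))))) \<in> L_functionals P ip"
  unfolding L_functionals_def using assms
  by (intro CollectI exI[of _ \<omega>] exI[of _ \<eta>] exI[of _ \<zeta>]) (auto simp: image_subset_iff)

context tensor_space
begin

lemma L_sums:
  assumes \<omega>: "\<And>n. \<omega> n \<in> P" and s: "summable (\<lambda>n. onorm (\<omega> n) * norm (\<eta> n) * norm (\<zeta> n))"
    and T: "T \<in> adjointable ipF"
  shows "(\<lambda>n. \<omega> n (ipF (\<eta> n) (T (\<zeta> n)))) sums (\<Sum>n. \<omega> n (ipF (\<eta> n) (T (\<zeta> n))))"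
proof (rule summable_sums, rule summable_norm_cancel, rule summable_comparison_test'[where N = 0])
  show "summable (\<lambda>n. onorm T * (onorm (\<omega> n) * norm (\<eta> n) * norm (\<zeta> n)))" by (rule summable_mult[OF s])
  fix n
  have b: "bounded_clinear (\<omega> n)" by (rule predual_bounded[OF predual \<omega>])
  have "cmod (\<omega> n (ipF (\<eta> n) (T (\<zeta> n)))) \<le> onorm (\<omega> n) * norm (ipF (\<eta> n) (T (\<zeta> n)))"
    by (rule clinear_bound[OF b])
  also have "\<dots> \<le> onorm (\<omega> n) * (norm (\<eta> n) * (onorm T * norm (\<zeta> n)))"
    by (intro mult_left_mono order_trans[OF norm_ipF_le] clinear_bound[OF adjointable_bounded[OF T]]
        onorm_pos_le bounded_clinear_linear b) auto
  finally show "norm (norm (\<omega> n (ipF (\<eta> n) (T (\<zeta> n))))) \<le> onorm T * (onorm (\<omega> n) * norm (\<eta> n) * norm (\<zeta> n))"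
    by (simp add: mult_ac)
qed

lemma L_predualE:
  assumes "f \<in> L_predual P ipF"
  obtains \<omega> \<eta> \<zeta> where "\<And>n. \<omega> n \<in> P" "summable (\<lambda>n. onorm (\<omega> n) * norm (\<eta> n) * norm (\<zeta> n))"
    "\<And>T. T \<in> adjointable ipF \<Longrightarrow> (\<lambda>n. \<omega> n (ipF (\<eta> n) (T (\<zeta> n)))) sums f T"
proof -
  obtain g where g: "g \<in> L_functionals P ipF" "\<forall>T\<in>adjointable ipF. f T = g T"
    using assms unfolding L_predual_def by (elim CollectE bexE)
  obtain \<omega> \<eta> \<zeta> where *: "g = (\<lambda>T. (\<Sum>n. \<omega> n (ipF (\<eta> n) (T (\<zeta> n)))))" "range \<omega> \<subseteq> P"
    "summable (\<lambda>n. onorm (\<omega> n) * norm (\<eta> n) * norm (\<zeta> n))"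
    using g(1) unfolding L_functionals_def by (elim CollectE exE conjE)
  have \<omega>: "\<omega> n \<in> P" for n using *(2) by auto
  show ?thesis
  proof (rule that[OF \<omega> *(3)])
    show "(\<lambda>n. \<omega> n (ipF (\<eta> n) (T (\<zeta> n)))) sums f T" if "T \<in> adjointable ipF" for T
      using L_sums[OF \<omega> *(3) that] bspec[OF g(2) that] *(1) by simp
  qed
qed

lemma L_predualI:
  assumes \<omega>: "\<And>n. \<omega> n \<in> P" and s: "summable (\<lambda>n. onorm (\<omega> n) * norm (\<eta> n) * norm (\<zeta> n))"
    and f: "\<And>T. T \<in> adjointable ipF \<Longrightarrow> (\<lambda>n. \<omega> n (ipF (\<eta> n) (T (\<zeta> n)))) sums f T"
  shows "f \<in> L_predual P ipF"
  unfolding L_predual_def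
  by (rule CollectI, rule bexI[OF _ L_functionalsI[OF \<omega> s]]) (simp add: sums_unique[OF f])

lemma functional_space_L_predual: "functional_space (L_predual P ipF)"
  unfolding functional_space_def
proof (intro conjI ballI allI)
  show "(\<lambda>T. 0) \<in> L_predual P ipF"
    by (rule L_predualI[of "\<lambda>n a. 0" "\<lambda>_. 0" "\<lambda>_. 0"]) (simp_all add: predual_zero[OF predual])
  fix f assume f: "f \<in> L_predual P ipF"
  obtain \<omega> \<eta> \<zeta> where 1: "\<And>n. \<omega> n \<in> P" "summable (\<lambda>n. onorm (\<omega> n) * norm (\<eta> n) * norm (\<zeta> n))"
    "\<And>T. T \<in> adjointable ipF \<Longrightarrow> (\<lambda>n. \<omega> n (ipF (\<eta> n) (T (\<zeta> n)))) sums f T"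
    using L_predualE[OF f] by metis
  note bl = bounded_clinear_linear[OF predual_bounded[OF predual 1(1)]]
  show "(\<lambda>T. c * f T) \<in> L_predual P ipF" for c
  proof (rule L_predualI[of "\<lambda>n a. c * \<omega> n a" \<eta> \<zeta>])
    show "(\<lambda>a. c * \<omega> n a) \<in> P" for n by (rule predual_scale[OF predual 1(1)])
    show "summable (\<lambda>n. onorm (\<lambda>a. c * \<omega> n a) * norm (\<eta> n) * norm (\<zeta> n))"
    proof (rule summable_comparison_test'[OF summable_mult[OF 1(2), of "cmod c"], where N = 0])
      fix n
      have "onorm (\<lambda>a. c * \<omega> n a) \<le> cmod c * onorm (\<omega> n)"
        by (rule onorm_bound) (use onorm[OF bl, of n] onorm_pos_le[OF bl, of n]
            in \<open>simp_all add: norm_mult mult.assoc mult_left_mono\<close>)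
      moreover have "onorm (\<lambda>a. c * \<omega> n a) \<ge> 0"
        by (rule onorm_pos_le[OF bounded_clinear_linear[OF predual_bounded[OF predual predual_scale[OF predual 1(1)]]]])
      ultimately show "norm (onorm (\<lambda>a. c * \<omega> n a) * norm (\<eta> n) * norm (\<zeta> n)) \<le> cmod c * (onorm (\<omega> n) * norm (\<eta> n) * norm (\<zeta> n))"
        by (simp add: mult.assoc[symmetric] mult_right_mono)
    qed
    show "(\<lambda>n. c * \<omega> n (ipF (\<eta> n) (T (\<zeta> n)))) sums (c * f T)" if "T \<in> adjointable ipF" for T
      by (rule sums_mult[OF 1(3)[OF that]])
  qed
  fix g assume g: "g \<in> L_predual P ipF"
  obtain \<omega>' \<eta>' \<zeta>' where 2: "\<And>n. \<omega>' n \<in> P" "summable (\<lambda>n. onorm (\<omega>' n) * norm (\<eta>' n) * norm (\<zeta>' n))"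
    "\<And>T. T \<in> adjointable ipF \<Longrightarrow> (\<lambda>n. \<omega>' n (ipF (\<eta>' n) (T (\<zeta>' n)))) sums g T"
    using L_predualE[OF g] by metis
  show "(\<lambda>T. f T + g T) \<in> L_predual P ipF"
  proof (rule L_predualI[of "\<lambda>n. if even n then \<omega>' (n div 2) else \<omega> ((n - 1) div 2)"
        "\<lambda>n. if even n then \<eta>' (n div 2) else \<eta> ((n - 1) div 2)" "\<lambda>n. if even n then \<zeta>' (n div 2) else \<zeta> ((n - 1) div 2)"])
    show "(if even n then \<omega>' (n div 2) else \<omega> ((n - 1) div 2)) \<in> P" for n using 1 2 by simp
    have "summable (\<lambda>n. if even n then onorm (\<omega>' (n div 2)) * norm (\<eta>' (n div 2)) * norm (\<zeta>' (n div 2))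
        else onorm (\<omega> ((n - 1) div 2)) * norm (\<eta> ((n - 1) div 2)) * norm (\<zeta> ((n - 1) div 2)))"
      using sums_if[OF summable_sums[OF 1(2)] summable_sums[OF 2(2)]] by (rule sums_summable)
    then show "summable (\<lambda>n. onorm (if even n then \<omega>' (n div 2) else \<omega> ((n - 1) div 2)) *
        norm (if even n then \<eta>' (n div 2) else \<eta> ((n - 1) div 2)) *
        norm (if even n then \<zeta>' (n div 2) else \<zeta> ((n - 1) div 2)))"
      by (rule summable_cong[THEN iffD1, rotated]) (simp add: eventually_sequentially)
    fix T assume T: "T \<in> adjointable ipF"
    have "(\<lambda>n. if even n then \<omega>' (n div 2) (ipF (\<eta>' (n div 2)) (T (\<zeta>' (n div 2))))
        else \<omega> ((n - 1) div 2) (ipF (\<eta> ((n - 1) div 2)) (T (\<zeta> ((n - 1) div 2))))) sums (f T + g T)"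
      by (rule sums_if_complex[OF 1(3)[OF T] 2(3)[OF T]])
    then show "(\<lambda>n. (if even n then \<omega>' (n div 2) else \<omega> ((n - 1) div 2))
        (ipF (if even n then \<eta>' (n div 2) else \<eta> ((n - 1) div 2)) (T (if even n then \<zeta>' (n div 2) else \<zeta> ((n - 1) div 2))))) sums (f T + g T)"
      by (rule sums_cong[THEN iffD1, rotated]) simp
  qed
qed

lemma clinear_on_L_predual:
  assumes f: "f \<in> L_predual P ipF" shows "clinear_on (adjointable ipF) f"
proof -
  obtain \<omega> \<eta> \<zeta> where 1: "\<And>n. \<omega> n \<in> P" "summable (\<lambda>n. onorm (\<omega> n) * norm (\<eta> n) * norm (\<zeta> n))"
    "\<And>T. T \<in> adjointable ipF \<Longrightarrow> (\<lambda>n. \<omega> n (ipF (\<eta> n) (T (\<zeta> n)))) sums f T"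
    using L_predualE[OF f] by metis
  note b = predual_bounded[OF predual 1(1)]
  show ?thesis
    unfolding clinear_on_def
  proof (intro conjI ballI allI)
    fix S T assume S: "S \<in> adjointable ipF" and T: "T \<in> adjointable ipF"
    have "(\<lambda>n. \<omega> n (ipF (\<eta> n) ((S + T) (\<zeta> n)))) sums (f S + f T)"
      using sums_add[OF 1(3)[OF S] 1(3)[OF T]] by (simp add: F.ip_add_right clinear_add[OF b])
    then show "f (S + T) = f S + f T"
      using 1(3)[OF cvec.subspace_add[OF F.csubspace_adjointable S T]] sums_unique2 by blast
  next
    fix c T assume T: "T \<in> adjointable ipF"
    have "(\<lambda>n. \<omega> n (ipF (\<eta> n) ((c *\<^sub>C T) (\<zeta> n)))) sums (c * f T)"
      using sums_mult[OF 1(3)[OF T], of c]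
      by (simp add: scaleC_fun_def F.ip_scaleC_right clinear_scaleC[OF b] scaleC_complex_def)
    then show "f (c *\<^sub>C T) = c * f T"
      using 1(3)[OF cvec.subspace_scale[OF F.csubspace_adjointable T]] sums_unique2 by blast
  qed
qed

lemma closure_of_ultraweak_L_iff:
  assumes A: "csubspace A" "A \<subseteq> adjointable ipF" and X: "X \<in> adjointable ipF"
  shows "X \<in> ultraweak_L P ipF closure_of A \<longleftrightarrow>
    (\<forall>f\<in>L_predual P ipF. (\<forall>a\<in>A. f a = 0) \<longrightarrow> f X = 0)"
  unfolding ultraweak_L_def L_functionals_def[symmetric]
proof (rule closure_of_weak_topology_iff[OF functional_space_L_predual clinear_on_L_predual _ _ F.csubspace_adjointable A X])
  show "L_functionals P ipF \<subseteq> L_predual P ipF" unfolding L_predual_def by blast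
  show "\<exists>g\<in>L_functionals P ipF. \<forall>x\<in>adjointable ipF. f x = g x" if "f \<in> L_predual P ipF" for f
    using that unfolding L_predual_def by (elim CollectE)
qed

end

text \<open>Rescaling the two vectors of index \<open>n\<close> by reciprocal factors makes both
  squared norms equal to the product of the norms, which is summable. Where one vector is 0, both
  are replaced by 0.\<close>

lemma balanced_vectors:
  fixes W U :: "nat \<Rightarrow> 'a::chilbert"
  assumes s: "summable (\<lambda>n. norm (W n) * norm (U n))"
  shows "\<exists>w u. \<forall>n Z. bounded_clinear Z \<longrightarrow> cinner (coord w n) (Z (coord u n)) = cinner (W n) (Z (U n))"
proof -
  define z where "z n \<longleftrightarrow> W n = 0 \<or> U n = 0" for n
  define c where "c n = sqrt (norm (U n) / norm (W n))" for n
  define w' where "w' n = (if z n then 0 else complex_of_real (c n) *\<^sub>C W n)" for n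
  define u' where "u' n = (if z n then 0 else complex_of_real (inverse (c n)) *\<^sub>C U n)" for n
  have "(norm (w' n))\<^sup>2 = (if z n then 0 else norm (W n) * norm (U n))" for n
    by (simp add: w'_def c_def z_def norm_scaleC power_mult_distrib power2_eq_square[of "norm (W n)"] flip: of_real_power)
  then have 1: "(norm (w' n))\<^sup>2 \<le> norm (W n) * norm (U n)" for n by simp
  have "(norm (u' n))\<^sup>2 = (if z n then 0 else norm (W n) * norm (U n))" for n
    by (simp add: u'_def c_def z_def norm_scaleC norm_inverse power_mult_distrib power_inverse power2_eq_square[of "norm (U n)"])
  then have 2: "(norm (u' n))\<^sup>2 \<le> norm (W n) * norm (U n)" for n by simp
  have sw: "summable (\<lambda>n. (norm (w' n))\<^sup>2)"
    by (rule summable_comparison_test'[OF s, where N = 0]) (simp only: real_norm_def abs_of_nonneg zero_le_power2 1)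
  have su: "summable (\<lambda>n. (norm (u' n))\<^sup>2)"
    by (rule summable_comparison_test'[OF s, where N = 0]) (simp only: real_norm_def abs_of_nonneg zero_le_power2 2)
  show ?thesis
  proof (rule exI[of _ "Abs_ell2 w'"], rule exI[of _ "Abs_ell2 u'"], intro allI impI)
    fix n and Z :: "'a \<Rightarrow> 'a" assume Z: "bounded_clinear Z"
    have "coord (Abs_ell2 w') n = w' n" "coord (Abs_ell2 u') n = u' n"
      using sw su by (simp_all add: Abs_ell2_inverse)
    moreover have "cinner (w' n) (Z (u' n)) = cinner (W n) (Z (U n))"
    proof (cases "z n")
      case True
      then show ?thesis by (auto simp: w'_def z_def clinear_zero[OF Z])
    next
      case False
      then have "c n \<noteq> 0" by (simp add: c_def z_def)
      then show ?thesis
        using False by (simp add: w'_def u'_def clinear_scaleC[OF Z] cinner_scaleC_left cinner_scaleC_right)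
    qed
    ultimately show "cinner (coord (Abs_ell2 w') n) (Z (coord (Abs_ell2 u') n)) = cinner (W n) (Z (U n))" by simp
  qed
qed

section \<open>Functionals on adjointable operators as vector functionals, and conversely\<close>

context tensor_space
begin

text \<open>The inner amplification represents each \<open>\<omega> n\<close> by vectors, the outer
  one collects the series over \<open>n\<close>.\<close>

lemma L_predual_vectors:
  assumes f: "f \<in> L_predual P ipF"
  shows "\<exists>w u. \<forall>T\<in>adjointable ipF. f T = cinner w (inflate (inflate (\<rho> T)) u)"
proof -
  obtain \<omega> \<eta> \<zeta> where f: "\<And>n. \<omega> n \<in> P" "summable (\<lambda>n. onorm (\<omega> n) * norm (\<eta> n) * norm (\<zeta> n))"
    "\<And>T. T \<in> adjointable ipF \<Longrightarrow> (\<lambda>n. \<omega> n (ipF (\<eta> n) (T (\<zeta> n)))) sums f T"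
    using L_predualE[OF f] by metis
  have "\<exists>x y. (\<forall>a. \<omega> n a = cinner x (inflate (\<pi> a) y)) \<and> norm x * norm y \<le> 8 * onorm (\<omega> n)" for n
  proof (cases "onorm (\<omega> n) = 0")
    case True
    then have "\<omega> n a = 0" for a using clinear_bound[OF predual_bounded[OF predual f(1)], of n a] by simp
    then show ?thesis using True by (intro exI[of _ 0]) simp
  next
    case False
    then have t: "onorm (\<omega> n) > 0"
      using onorm_pos_le[OF bounded_clinear_linear[OF predual_bounded[OF predual f(1)]], of n] by simp
    obtain x y where xy: "\<forall>a. \<omega> n a = cinner x (inflate (\<pi> a) y)" "(norm x)\<^sup>2 \<le> 8 * onorm (\<omega> n)" "(norm y)\<^sup>2 \<le> 8 * onorm (\<omega> n)"
      using predual_vectors[OF f(1)[of n] t order_refl] by blast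
    have "norm x * norm y \<le> 8 * onorm (\<omega> n)"
      using xy(2,3) sum_squares_bound[of "norm x" "norm y"] by linarith
    then show ?thesis using xy(1) by blast
  qed
  then obtain x y where xy: "\<And>n a. \<omega> n a = cinner (x n) (inflate (\<pi> a) (y n))" "\<And>n. norm (x n) * norm (y n) \<le> 8 * onorm (\<omega> n)"
    by metis
  note bt = bounded_clinear_tensH_right
  interpret A: tensor_space P "ampl \<pi>" ipF actF "\<lambda>x. inflate (tensH x)" by (rule tensor_space_ampl)
  define W where "W n = inflate (tensH (\<eta> n)) (x n)" for n
  define U where "U n = inflate (tensH (\<zeta> n)) (y n)" for n
  have "summable (\<lambda>n. norm (W n) * norm (U n))"
  proof (rule summable_comparison_test'[OF summable_mult[OF f(2), of 8], where N = 0])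
    fix n
    have "norm (W n) * norm (U n) \<le> (norm (\<eta> n) * norm (x n)) * (norm (\<zeta> n) * norm (y n))"
      unfolding W_def U_def by (intro mult_mono A.norm_tensH_le) auto
    also have "\<dots> = (norm (\<eta> n) * norm (\<zeta> n)) * (norm (x n) * norm (y n))" by simp
    also have "\<dots> \<le> (norm (\<eta> n) * norm (\<zeta> n)) * (8 * onorm (\<omega> n))" by (intro mult_left_mono xy) simp
    finally show "norm (norm (W n) * norm (U n)) \<le> 8 * (onorm (\<omega> n) * norm (\<eta> n) * norm (\<zeta> n))"
      by (simp add: mult_ac)
  qed
  then obtain w u where wu: "\<And>n Z. bounded_clinear Z \<Longrightarrow> cinner (coord w n) (Z (coord u n)) = cinner (W n) (Z (U n))"
    using balanced_vectors[of W U] by blast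
  have "f T = cinner w (inflate (inflate (\<rho> T)) u)" if T: "T \<in> adjointable ipF" for T
  proof -
    have eq: "inflate (\<rho> T) = A.\<rho> T" by (rule induced_rep_ampl[OF T, symmetric])
    have b: "bounded_clinear (inflate (\<rho> T))" by (rule bounded_clinear_inflate[OF bounded_clinear_induced_rep[OF T]])
    have "cinner (coord w n) (coord (inflate (inflate (\<rho> T)) u) n) = \<omega> n (ipF (\<eta> n) (T (\<zeta> n)))" for n
      unfolding coord_inflate[OF b] wu[OF b] xy(1)
      unfolding W_def U_def eq A.induced_rep_tensH[OF T] A.T.cinner_tensH ..
    then have "(\<lambda>n. \<omega> n (ipF (\<eta> n) (T (\<zeta> n)))) sums cinner w (inflate (inflate (\<rho> T)) u)"
      using cinner_ell2_sums[of w "inflate (inflate (\<rho> T)) u"] by simp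
    then show ?thesis using f(3)[OF T] sums_unique2 by blast
  qed
  then show ?thesis by blast
qed

text \<open>In the vector form of \<open>\<omega>\<close> the fixed factor is absorbed into one of
  the vectors.\<close>

lemma predual_star_mult:
  assumes \<omega>: "\<omega> \<in> P" shows "(\<lambda>c. \<omega> (star b * c)) \<in> P"
proof -
  interpret A: normal_faithful_rep P "ampl \<pi>" by (rule normal_faithful_rep_ampl)
  have "onorm \<omega> + 1 > 0"
    using onorm_pos_le[OF bounded_clinear_linear[OF predual_bounded[OF predual \<omega>]]] by simp
  then obtain x y where xy: "\<forall>a. \<omega> a = cinner x (inflate (\<pi> a) y)"
    using predual_vectors[OF \<omega>, of "onorm \<omega> + 1"] by auto
  have "(\<lambda>c. \<omega> (star b * c)) = (\<lambda>c. cinner (inflate (\<pi> b) x) (inflate (\<pi> c) y))"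
    by (rule ext) (simp add: xy A.rep_mult A.rep_star')
  then show ?thesis using A.rep_normal by simp
qed

lemma predual_mult_right:
  assumes \<omega>: "\<omega> \<in> P" shows "(\<lambda>c. \<omega> (c * b)) \<in> P"
proof -
  interpret A: normal_faithful_rep P "ampl \<pi>" by (rule normal_faithful_rep_ampl)
  have "onorm \<omega> + 1 > 0"
    using onorm_pos_le[OF bounded_clinear_linear[OF predual_bounded[OF predual \<omega>]]] by simp
  then obtain x y where xy: "\<forall>a. \<omega> a = cinner x (inflate (\<pi> a) y)"
    using predual_vectors[OF \<omega>, of "onorm \<omega> + 1"] by auto
  have "(\<lambda>c. \<omega> (c * b)) = (\<lambda>c. cinner x (inflate (\<pi> c) (inflate (\<pi> b) y)))"
    by (rule ext) (simp add: xy A.rep_mult)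
  then show ?thesis using A.rep_normal by simp
qed

text \<open>The bipolar argument for the predual of the adjointable operators: a functional on the closed span
  of the elementary functionals is a bounded sesquilinear module form on the self-dual module, hence
  evaluation at an adjointable operator. Therefore the members of \<open>L_closure\<close>, among them all vector
  functionals of \<open>\<rho>\<close>, are norm-convergent series of elementary functionals.\<close>

definition L_unit :: "(('f \<Rightarrow> 'f) \<Rightarrow> complex) set" where
  "L_unit = {\<lambda>T. \<omega> (ipF \<eta> (T \<zeta>)) | \<omega> \<eta> \<zeta>. \<omega> \<in> P \<and> onorm \<omega> \<le> 1 \<and> norm \<eta> \<le> 1 \<and> norm \<zeta> \<le> 1}"

abbreviation L_dom :: "real \<Rightarrow> (('f \<Rightarrow> 'f) \<Rightarrow> complex) \<Rightarrow> bool" where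
  "L_dom \<equiv> dominated (adjointable ipF) onorm"

definition L_closure :: "(('f \<Rightarrow> 'f) \<Rightarrow> complex) set" where
  "L_closure = {g. \<forall>\<epsilon>>0. \<exists>L. snd ` set L \<subseteq> L_unit \<and> L_dom \<epsilon> (g - combination L)}"

lemma onorm_adjointable_nonneg: "T \<in> adjointable ipF \<Longrightarrow> onorm T \<ge> 0"
  by (rule onorm_pos_le[OF bounded_clinear_linear[OF adjointable_bounded]])

lemma elementary_dominated:
  assumes \<omega>: "\<omega> \<in> P" shows "L_dom (onorm \<omega> * norm \<eta> * norm \<zeta>) (\<lambda>T. \<omega> (ipF \<eta> (T \<zeta>)))"
  unfolding dominated_def
proof
  fix T assume T: "T \<in> adjointable ipF"
  have b: "bounded_clinear \<omega>" by (rule predual_bounded[OF predual \<omega>])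
  have "cmod (\<omega> (ipF \<eta> (T \<zeta>))) \<le> onorm \<omega> * norm (ipF \<eta> (T \<zeta>))" by (rule clinear_bound[OF b])
  also have "\<dots> \<le> onorm \<omega> * (norm \<eta> * (onorm T * norm \<zeta>))"
    by (intro mult_left_mono order_trans[OF norm_ipF_le] clinear_bound[OF adjointable_bounded[OF T]]
        onorm_pos_le bounded_clinear_linear b) auto
  finally show "cmod (\<omega> (ipF \<eta> (T \<zeta>))) \<le> onorm \<omega> * norm \<eta> * norm \<zeta> * onorm T" by (simp add: mult_ac)
qed

lemma L_unit_dominated: assumes "e \<in> L_unit" shows "L_dom 1 e"
proof -
  obtain \<omega> \<eta> \<zeta> where e: "e = (\<lambda>T. \<omega> (ipF \<eta> (T \<zeta>)))" "\<omega> \<in> P" "onorm \<omega> \<le> 1" "norm \<eta> \<le> 1" "norm \<zeta> \<le> 1"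
    using assms unfolding L_unit_def by blast
  have o: "onorm \<omega> \<ge> 0" by (rule onorm_pos_le[OF bounded_clinear_linear[OF predual_bounded[OF predual e(2)]]])
  have "onorm \<omega> * norm \<eta> * norm \<zeta> \<le> 1 * 1 * 1" using e o by (intro mult_mono) auto
  then have "onorm \<omega> * norm \<eta> * norm \<zeta> * onorm T \<le> 1 * onorm T" if "T \<in> adjointable ipF" for T
    using onorm_adjointable_nonneg[OF that] by (intro mult_right_mono) auto
  then show ?thesis
    using elementary_dominated[OF e(2), of \<eta> \<zeta>] unfolding dominated_def e(1) by (blast intro: order_trans)
qed

lemma L_unitI: "\<omega> \<in> P \<Longrightarrow> onorm \<omega> \<le> 1 \<Longrightarrow> norm \<eta> \<le> 1 \<Longrightarrow> norm \<zeta> \<le> 1 \<Longrightarrow> (\<lambda>T. \<omega> (ipF \<eta> (T \<zeta>))) \<in> L_unit"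
  unfolding L_unit_def by blast

lemma onorm_predual_mult:
  assumes \<omega>: "\<omega> \<in> P" shows "onorm (\<lambda>a. c * \<omega> a) \<le> cmod c * onorm \<omega>"
proof (rule onorm_bound)
  note b = bounded_clinear_linear[OF predual_bounded[OF predual \<omega>]]
  show "cmod c * onorm \<omega> \<ge> 0" using onorm_pos_le[OF b] by simp
  show "norm (c * \<omega> a) \<le> cmod c * onorm \<omega> * norm a" for a
    using onorm[OF b, of a] by (simp add: norm_mult mult.assoc mult_left_mono)
qed

lemma L_unit_mult: assumes "e \<in> L_unit" "cmod c \<le> 1" shows "(\<lambda>T. c * e T) \<in> L_unit"
proof -
  obtain \<omega> \<eta> \<zeta> where e: "e = (\<lambda>T. \<omega> (ipF \<eta> (T \<zeta>)))" "\<omega> \<in> P" "onorm \<omega> \<le> 1" "norm \<eta> \<le> 1" "norm \<zeta> \<le> 1"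
    using assms(1) unfolding L_unit_def by blast
  have o: "onorm \<omega> \<ge> 0" by (rule onorm_pos_le[OF bounded_clinear_linear[OF predual_bounded[OF predual e(2)]]])
  have "onorm (\<lambda>a. c * \<omega> a) \<le> 1"
    using onorm_predual_mult[OF e(2), of c] mult_mono[OF assms(2) e(3)] o by simp
  then show ?thesis unfolding e(1) using L_unitI[OF predual_scale[OF predual e(2), of c]] e by blast
qed

lemma L_unit_functional_eval:
  assumes \<psi>: "unit_functional (adjointable ipF) onorm L_unit \<psi>"
  shows "\<exists>X\<in>adjointable ipF. onorm X \<le> 2 \<and> (\<forall>e\<in>L_unit. complexify \<psi> e = e X)"
proof -
  define \<Phi> where "\<Phi> = complexify \<psi>"
  obtain B where B: "\<And>g s. s \<ge> 0 \<Longrightarrow> L_dom s g \<Longrightarrow> cmod (\<Phi> g) \<le> B * s"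
    using complexify_bound[OF \<psi>] unfolding \<Phi>_def by metis
  have add: "\<Phi> (\<lambda>x. g x + h x) = \<Phi> g + \<Phi> h" if "L_dom s g" "L_dom t h" for g h s t
    unfolding \<Phi>_def by (rule complexify_add[OF \<psi> that])
  have scale: "\<Phi> (\<lambda>x. c * g x) = c * \<Phi> g" if "L_dom s g" for g s c
    unfolding \<Phi>_def by (rule complexify_scale[OF \<psi> that])
  \<comment> \<open>The difference of functions that agree on adjointable operators is dominated
    with constant 0, so boundedness of \<open>\<Phi>\<close> identifies them.\<close>
  have cong: "\<Phi> g = \<Phi> h" if gh: "\<And>T. T \<in> adjointable ipF \<Longrightarrow> g T = h T" and d: "L_dom s h" for g h s
  proof -
    have d0: "L_dom 0 (\<lambda>T. g T - h T)" unfolding dominated_def by (simp add: gh)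
    have "g = (\<lambda>T. (g T - h T) + h T)" by simp
    then have "\<Phi> g = \<Phi> (\<lambda>T. g T - h T) + \<Phi> h" using add[OF d0 d] by simp
    moreover have "\<Phi> (\<lambda>T. g T - h T) = 0" using B[OF _ d0] by simp
    ultimately show ?thesis by simp
  qed
  have unit: "cmod (\<Phi> e) \<le> 2" if "e \<in> L_unit" for e
    unfolding \<Phi>_def by (rule complexify_unit[OF \<psi> that L_unit_mult[OF that]]) simp
  note ed = elementary_dominated
  have ex: "\<exists>a. \<forall>\<omega>\<in>P. \<Phi> (\<lambda>T. \<omega> (ipF \<eta> (T \<zeta>))) = \<omega> a" for \<eta> \<zeta>
  proof (rule predual_dual[OF predual, where \<Phi> = "\<lambda>\<omega>. \<Phi> (\<lambda>T. \<omega> (ipF \<eta> (T \<zeta>)))" and B = "B * (norm \<eta> * norm \<zeta>)"])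
    show "\<forall>f\<in>P. \<forall>g\<in>P. \<Phi> (\<lambda>T. f (ipF \<eta> (T \<zeta>)) + g (ipF \<eta> (T \<zeta>))) = \<Phi> (\<lambda>T. f (ipF \<eta> (T \<zeta>))) + \<Phi> (\<lambda>T. g (ipF \<eta> (T \<zeta>)))"
      by (intro ballI) (rule add[OF ed ed])
    show "\<forall>c. \<forall>f\<in>P. \<Phi> (\<lambda>T. c * f (ipF \<eta> (T \<zeta>))) = c * \<Phi> (\<lambda>T. f (ipF \<eta> (T \<zeta>)))"
      by (intro ballI allI) (rule scale[OF ed])
    show "\<forall>f\<in>P. cmod (\<Phi> (\<lambda>T. f (ipF \<eta> (T \<zeta>)))) \<le> B * (norm \<eta> * norm \<zeta>) * onorm f"
    proof
      fix f assume f: "f \<in> P"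
      have "onorm f \<ge> 0" by (rule onorm_pos_le[OF bounded_clinear_linear[OF predual_bounded[OF predual f]]])
      then have "cmod (\<Phi> (\<lambda>T. f (ipF \<eta> (T \<zeta>)))) \<le> B * (onorm f * norm \<eta> * norm \<zeta>)" by (intro B ed[OF f]) simp
      then show "cmod (\<Phi> (\<lambda>T. f (ipF \<eta> (T \<zeta>)))) \<le> B * (norm \<eta> * norm \<zeta>) * onorm f" by (simp add: mult_ac)
    qed
  qed
  have "\<exists>a. \<forall>\<eta> \<zeta>. \<forall>\<omega>\<in>P. \<Phi> (\<lambda>T. \<omega> (ipF \<eta> (T \<zeta>))) = \<omega> (a \<eta> \<zeta>)"
    by (intro choice allI ex)
  then obtain a where a: "\<And>\<omega> \<eta> \<zeta>. \<omega> \<in> P \<Longrightarrow> \<Phi> (\<lambda>T. \<omega> (ipF \<eta> (T \<zeta>))) = \<omega> (a \<eta> \<zeta>)" by blast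
  have na: "norm (a \<eta> \<zeta>) \<le> 2 * norm \<eta> * norm \<zeta>" for \<eta> \<zeta>
  proof (rule predual_norm_le[OF predual])
    fix \<omega> assume \<omega>: "\<omega> \<in> P" "onorm \<omega> \<le> 1"
    note b = predual_bounded[OF predual \<omega>(1)]
    show "cmod (\<omega> (a \<eta> \<zeta>)) \<le> 2 * norm \<eta> * norm \<zeta>"
    proof (cases "\<eta> = 0 \<or> \<zeta> = 0")
      case True
      have "\<Phi> (\<lambda>T. \<omega> (ipF \<eta> (T \<zeta>))) = 0"
        using B[OF _ ed[OF \<omega>(1), of \<eta> \<zeta>]] True by auto
      then show ?thesis using a[OF \<omega>(1)] by simp
    next
      case False
      define r where "r = complex_of_real (norm \<eta> * norm \<zeta>)"
      define \<eta>' where "\<eta>' = complex_of_real (inverse (norm \<eta>)) *\<^sub>C \<eta>"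
      define \<zeta>' where "\<zeta>' = complex_of_real (inverse (norm \<zeta>)) *\<^sub>C \<zeta>"
      have n: "norm \<eta>' \<le> 1" "norm \<zeta>' \<le> 1" using False by (simp_all add: \<eta>'_def \<zeta>'_def norm_scaleC norm_inverse)
      have \<eta>: "\<eta> = complex_of_real (norm \<eta>) *\<^sub>C \<eta>'" and \<zeta>: "\<zeta> = complex_of_real (norm \<zeta>) *\<^sub>C \<zeta>'"
        using False by (simp_all add: \<eta>'_def \<zeta>'_def scaleC_scaleC)
      have "\<omega> (ipF \<eta> (T \<zeta>)) = r * \<omega> (ipF \<eta>' (T \<zeta>'))" if T: "T \<in> adjointable ipF" for T
        by (subst \<eta>, subst \<zeta>)
          (simp add: F.adjointable_scaleC[OF T] F.ip_scaleC_left F.ip_scaleC_right clinear_scaleC[OF b] scaleC_complex_def r_def)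
      then have "\<Phi> (\<lambda>T. \<omega> (ipF \<eta> (T \<zeta>))) = \<Phi> (\<lambda>T. r * \<omega> (ipF \<eta>' (T \<zeta>')))"
        by (rule cong[OF _ dominated_mult[OF ed[OF \<omega>(1)]]])
      also have "\<dots> = r * \<Phi> (\<lambda>T. \<omega> (ipF \<eta>' (T \<zeta>')))" by (rule scale[OF ed[OF \<omega>(1)]])
      finally have "cmod (\<omega> (a \<eta> \<zeta>)) = (norm \<eta> * norm \<zeta>) * cmod (\<Phi> (\<lambda>T. \<omega> (ipF \<eta>' (T \<zeta>'))))"
        by (simp add: a[OF \<omega>(1), symmetric] norm_mult r_def)
      also have "\<dots> \<le> (norm \<eta> * norm \<zeta>) * 2" by (intro mult_left_mono unit L_unitI \<omega> n) simp
      finally show ?thesis by (simp add: mult_ac)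
    qed
  qed
  have "\<exists>z. \<forall>y. star (a y \<zeta>) = ipF z y" for \<zeta>
  proof -
    have "module_functional actF UNIV (\<lambda>y. star (a y \<zeta>))"
      unfolding module_functional_def
    proof (intro conjI ballI allI exI[of _ "2 * norm \<zeta>"])
      show "star (a (y + y') \<zeta>) = star (a y \<zeta>) + star (a y' \<zeta>)" for y y'
      proof -
        have "a (y + y') \<zeta> = a y \<zeta> + a y' \<zeta>"
          by (rule predual_separates[OF predual])
            (simp add: a[symmetric] F.ip_add_left clinear_add[OF predual_bounded[OF predual]] add[OF ed ed])
        then show ?thesis by (simp add: star_add)
      qed
      show "star (a (actF y b) \<zeta>) = star (a y \<zeta>) * b" for y b
      proof -
        have "a (actF y b) \<zeta> = star b * a y \<zeta>"
        proof (rule predual_separates[OF predual])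
          fix \<omega> assume \<omega>: "\<omega> \<in> P"
          have "\<omega> (a (actF y b) \<zeta>) = \<Phi> (\<lambda>T. \<omega> (star b * ipF y (T \<zeta>)))" by (simp add: a[OF \<omega>, symmetric] F.ip_act_left)
          also have "\<dots> = \<omega> (star b * a y \<zeta>)" by (rule a[OF predual_star_mult[OF \<omega>]])
          finally show "\<omega> (a (actF y b) \<zeta>) = \<omega> (star b * a y \<zeta>)" .
        qed
        then show ?thesis by (simp add: star_mult star_star)
      qed
      show "norm (star (a y \<zeta>)) \<le> 2 * norm \<zeta> * norm y" for y using na[of y \<zeta>] by (simp add: mult_ac)
    qed
    then show ?thesis using F.self_dual unfolding self_dual_def by blast
  qed
  then obtain X where "\<And>\<zeta> y. star (a y \<zeta>) = ipF (X \<zeta>) y" by metis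
  then have X: "a y \<zeta> = ipF y (X \<zeta>)" for y \<zeta> by (metis star_star F.ip_star)
  \<comment> \<open>Self-duality in the other variable; the representing vectors \<open>Y y\<close>
    form the adjoint of \<open>X\<close>.\<close>
  have "\<exists>z. \<forall>\<zeta>. a y \<zeta> = ipF z \<zeta>" for y
  proof -
    have "module_functional actF UNIV (a y)"
      unfolding module_functional_def
    proof (intro conjI ballI allI exI[of _ "2 * norm y"])
      fix \<zeta> \<zeta>'
      show "a y (\<zeta> + \<zeta>') = a y \<zeta> + a y \<zeta>'"
      proof (rule predual_separates[OF predual])
        fix \<omega> assume \<omega>: "\<omega> \<in> P"
        note b = predual_bounded[OF predual \<omega>]
        have "\<Phi> (\<lambda>T. \<omega> (ipF y (T (\<zeta> + \<zeta>')))) = \<Phi> (\<lambda>T. \<omega> (ipF y (T \<zeta>)) + \<omega> (ipF y (T \<zeta>')))"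
        proof (rule cong)
          show "L_dom (onorm \<omega> * norm y * norm \<zeta> + onorm \<omega> * norm y * norm \<zeta>') (\<lambda>T. \<omega> (ipF y (T \<zeta>)) + \<omega> (ipF y (T \<zeta>')))"
            using dominated_add[OF ed[OF \<omega>] ed[OF \<omega>]] by (simp add: plus_fun_def)
        qed (simp add: F.adjointable_add F.ip_add_right clinear_add[OF b])
        then show "\<omega> (a y (\<zeta> + \<zeta>')) = \<omega> (a y \<zeta> + a y \<zeta>')"
          by (simp add: add[OF ed[OF \<omega>] ed[OF \<omega>]] a[OF \<omega>] clinear_add[OF b])
      qed
    next
      fix \<zeta> c
      show "a y (actF \<zeta> c) = a y \<zeta> * c"
      proof (rule predual_separates[OF predual])
        fix \<omega> assume \<omega>: "\<omega> \<in> P"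
        have "\<Phi> (\<lambda>T. \<omega> (ipF y (T (actF \<zeta> c)))) = \<Phi> (\<lambda>T. \<omega> (ipF y (T \<zeta>) * c))"
          by (rule cong[OF _ ed[OF predual_mult_right[OF \<omega>]]]) (simp add: F.adjointable_act F.ip_act_right)
        also have "\<dots> = \<omega> (a y \<zeta> * c)" by (rule a[OF predual_mult_right[OF \<omega>]])
        finally show "\<omega> (a y (actF \<zeta> c)) = \<omega> (a y \<zeta> * c)" by (simp add: a[OF \<omega>])
      qed
    qed (rule na)
    then show ?thesis using F.self_dual unfolding self_dual_def by blast
  qed
  then obtain Y where Y: "\<And>\<zeta> y. a y \<zeta> = ipF (Y y) \<zeta>" by metis
  have Xa: "X \<in> adjointable ipF"
    by (rule F.adjointableI[of _ Y]) (metis X Y F.ip_star star_star)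
  have "onorm X \<le> 2"
  proof (rule onorm_bound)
    show "norm (X \<zeta>) \<le> 2 * norm \<zeta>" for \<zeta>
    proof (rule norm_le_of_sq)
      show "(norm (X \<zeta>))\<^sup>2 \<le> 2 * norm \<zeta> * norm (X \<zeta>)"
        using na[of "X \<zeta>" \<zeta>] by (simp add: X F.norm_ip mult_ac)
    qed simp
  qed simp
  moreover have "\<Phi> e = e X" if "e \<in> L_unit" for e
  proof -
    obtain \<omega> \<eta> \<zeta> where e: "e = (\<lambda>T. \<omega> (ipF \<eta> (T \<zeta>)))" "\<omega> \<in> P"
      using \<open>e \<in> L_unit\<close> unfolding L_unit_def by blast
    show ?thesis unfolding e(1) a[OF e(2)] X ..
  qed
  ultimately show ?thesis using Xa unfolding \<Phi>_def by blast
qed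

lemma combination_L_dominated: "snd ` set L \<subseteq> L_unit \<Longrightarrow> \<exists>s\<ge>0. L_dom s (combination L)"
proof (induction L)
  case Nil
  then show ?case by (intro exI[of _ 0]) (simp add: dominated_def)
next
  case (Cons a L)
  obtain c e where a: "a = (c, e)" by (cases a)
  obtain s where s: "s \<ge> 0" "L_dom s (combination L)" using Cons by auto
  have "L_dom (\<bar>c\<bar> * 1) (c *\<^sub>R e)" by (rule dominated_scaleR[OF L_unit_dominated]) (use Cons.prems a in auto)
  from dominated_add[OF this s(2)] have "L_dom (\<bar>c\<bar> * 1 + s) (combination (a # L))"
    unfolding a combination_simps .
  then show ?case using s(1) by (intro exI[of _ "\<bar>c\<bar> * 1 + s"] conjI) simp_all
qed

text \<open>On combinations of unit functionals \<open>\<psi>\<close> is the real part of evaluation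
  at one operator \<open>X\<close>. Both sides are bounded, so this persists for norm limits, and
  the bound 2 on \<open>X\<close> gives the estimate.\<close>

lemma L_closure_eval:
  assumes \<psi>: "unit_functional (adjointable ipF) onorm L_unit \<psi>" and f: "f \<in> L_closure" and s: "s > 0" "L_dom s f"
  shows "\<bar>\<psi> f\<bar> \<le> 2 * s"
proof -
  obtain X where X: "X \<in> adjointable ipF" "onorm X \<le> 2" and eX: "\<forall>e\<in>L_unit. complexify \<psi> e = e X"
    using L_unit_functional_eval[OF \<psi>] by blast
  have add: "\<psi> (g + h) = \<psi> g + \<psi> h" if "L_dom s g" "L_dom t h" for g h s t
    using \<psi>[unfolded unit_functional_def, THEN conjunct1, rule_format, OF that] .
  have scale: "\<psi> (r *\<^sub>R g) = r * \<psi> g" if "L_dom s g" for g r s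
    using \<psi>[unfolded unit_functional_def, THEN conjunct2, THEN conjunct1, rule_format, OF that] .
  obtain B where B': "\<forall>g s. s \<ge> 0 \<longrightarrow> L_dom s g \<longrightarrow> \<bar>\<psi> g\<bar> \<le> B * s"
    using \<psi>[unfolded unit_functional_def, THEN conjunct2, THEN conjunct2, THEN conjunct1] by (elim exE)
  note B = B'[rule_format]
  have comb: "\<psi> (combination L) = Re (combination L X)" if "snd ` set L \<subseteq> L_unit" for L
    using that
  proof (induction L)
    case Nil
    then show ?case using scale[of 0 0 0] by (simp add: dominated_def zero_fun_def)
  next
    case (Cons a L)
    obtain c e where a: "a = (c, e)" by (cases a)
    have e: "e \<in> L_unit" and L: "snd ` set L \<subseteq> L_unit" using Cons.prems a by auto
    have "\<psi> e = Re (e X)" using bspec[OF eX e] Re_complexify[of \<psi> e] by simp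
    moreover obtain t where "L_dom t (combination L)" using combination_L_dominated[OF L] by blast
    then have "\<psi> (c *\<^sub>R e + combination L) = c * \<psi> e + \<psi> (combination L)"
      using add[OF dominated_scaleR[OF L_unit_dominated[OF e]]] scale[OF L_unit_dominated[OF e]] by simp
    ultimately show ?case using Cons.IH[OF L] by (simp add: a scaleR_fun_def plus_fun_def)
  qed
  have oX: "onorm X \<ge> 0" by (rule onorm_adjointable_nonneg[OF X(1)])
  have "\<bar>\<psi> f - Re (f X)\<bar> \<le> e" if e: "e > 0" for e
  proof -
    define d where "d = e / (\<bar>B\<bar> + 2)"
    have d: "d > 0" using e by (simp add: d_def add_nonneg_pos)
    obtain L where L: "snd ` set L \<subseteq> L_unit" "L_dom d (f - combination L)" using f d unfolding L_closure_def by blast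
    obtain t where t: "L_dom t (combination L)" using combination_L_dominated[OF L(1)] by blast
    have "\<psi> f = \<psi> (f - combination L) + Re (combination L X)"
      using add[OF L(2) t] comb[OF L(1)] by simp
    then have "\<psi> f - Re (f X) = \<psi> (f - combination L) - Re ((f - combination L) X)" by simp
    moreover have "\<bar>\<psi> (f - combination L)\<bar> \<le> \<bar>B\<bar> * d"
      using B[OF less_imp_le[OF d] L(2)] mult_right_mono[OF abs_ge_self less_imp_le[OF d], of B] by linarith
    moreover have "\<bar>Re ((f - combination L) X)\<bar> \<le> 2 * d"
    proof -
      have "\<bar>Re ((f - combination L) X)\<bar> \<le> cmod ((f - combination L) X)" by (rule abs_Re_le_cmod)
      also have "\<dots> \<le> d * onorm X" using L(2) X(1) by (auto simp: dominated_def)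
      also have "\<dots> \<le> d * 2" using X(2) d by simp
      finally show ?thesis by simp
    qed
    ultimately have "\<bar>\<psi> f - Re (f X)\<bar> \<le> (\<bar>B\<bar> + 2) * d" by (simp add: distrib_right)
    also have "\<dots> = e" using abs_ge_zero[of B] by (simp add: d_def)
    finally show ?thesis .
  qed
  then have "\<psi> f = Re (f X)" using field_le_epsilon[of "\<bar>\<psi> f - Re (f X)\<bar>" 0] by simp
  then have "\<bar>\<psi> f\<bar> \<le> cmod (f X)" using abs_Re_le_cmod by simp
  also have "\<dots> \<le> s * onorm X" using s(2) X(1) by (auto simp: dominated_def)
  also have "\<dots> \<le> s * 2" using X(2) s(1) by simp
  finally show ?thesis by simp
qed

lemma L_closure_subset_predual:
  assumes f: "f \<in> L_closure" and t: "t > 0" "L_dom t f"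
  shows "f \<in> L_predual P ipF"
proof -
  obtain c e where ce: "\<And>n. e n \<in> L_unit" "summable (\<lambda>n. \<bar>c n\<bar>)"
    "\<And>T. T \<in> adjointable ipF \<Longrightarrow> (\<lambda>n. complex_of_real (c n) * e n T) sums f T"
  proof (rule series_representation[where X = "adjointable ipF" and m = onorm and E = L_unit and C = 2
        and Fs = L_closure and f = f and t = t])
    have "(\<lambda>T. (\<lambda>a. 0) (ipF 0 (T 0))) \<in> L_unit"
      using L_unitI[OF predual_zero[OF predual], of 0 0] by (simp add: onorm_zero)
    then show "L_unit \<noteq> {}" by blast
    show "g - r *\<^sub>R e \<in> L_closure" if g: "g \<in> L_closure" and e: "e \<in> L_unit" for g r e
      unfolding L_closure_def
    proof (intro CollectI allI impI)
      fix \<epsilon> :: real assume "\<epsilon> > 0"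
      then obtain L where L: "snd ` set L \<subseteq> L_unit" "L_dom \<epsilon> (g - combination L)" using g unfolding L_closure_def by blast
      have "g - r *\<^sub>R e - combination ((- r, e) # L) = g - combination L"
        unfolding combination_simps by (rule ext) (simp add: scaleR_fun_def)
      then show "\<exists>L. snd ` set L \<subseteq> L_unit \<and> L_dom \<epsilon> (g - r *\<^sub>R e - combination L)"
        using L e by (intro exI[of _ "(- r, e) # L"]) simp
    qed
  qed (use L_unit_dominated L_closure_eval f t onorm_adjointable_nonneg in auto)
  have "\<exists>\<omega> \<eta> \<zeta>. e n = (\<lambda>T. \<omega> (ipF \<eta> (T \<zeta>))) \<and> \<omega> \<in> P \<and> onorm \<omega> \<le> 1 \<and> norm \<eta> \<le> 1 \<and> norm \<zeta> \<le> 1" for n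
    using ce(1)[of n] unfolding L_unit_def by blast
  then obtain \<omega> \<eta> \<zeta> where e: "\<And>n. e n = (\<lambda>T. \<omega> n (ipF (\<eta> n) (T (\<zeta> n))))" "\<And>n. \<omega> n \<in> P" "\<And>n. onorm (\<omega> n) \<le> 1"
    "\<And>n. norm (\<eta> n) \<le> 1" "\<And>n. norm (\<zeta> n) \<le> 1" by metis
  show ?thesis
  proof (rule L_predualI[of "\<lambda>n a. complex_of_real (c n) * \<omega> n a" \<eta> \<zeta>])
    show P: "(\<lambda>a. complex_of_real (c n) * \<omega> n a) \<in> P" for n by (rule predual_scale[OF predual e(2)])
    show "summable (\<lambda>n. onorm (\<lambda>a. complex_of_real (c n) * \<omega> n a) * norm (\<eta> n) * norm (\<zeta> n))"
    proof (rule summable_comparison_test'[OF ce(2), where N = 0])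
      fix n
      have o: "onorm (\<lambda>a. complex_of_real (c n) * \<omega> n a) \<ge> 0"
        by (rule onorm_pos_le[OF bounded_clinear_linear[OF predual_bounded[OF predual P]]])
      have "onorm (\<lambda>a. complex_of_real (c n) * \<omega> n a) \<le> \<bar>c n\<bar> * 1"
        using onorm_predual_mult[OF e(2), of "complex_of_real (c n)" n] mult_left_mono[OF e(3)[of n], of "\<bar>c n\<bar>"] by simp
      then have "onorm (\<lambda>a. complex_of_real (c n) * \<omega> n a) * norm (\<eta> n) * norm (\<zeta> n) \<le> (\<bar>c n\<bar> * 1) * 1 * 1"
        using e(4,5) o by (intro mult_mono) auto
      then show "norm (onorm (\<lambda>a. complex_of_real (c n) * \<omega> n a) * norm (\<eta> n) * norm (\<zeta> n)) \<le> \<bar>c n\<bar>"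
        using o by (simp add: abs_mult)
    qed
    show "(\<lambda>n. complex_of_real (c n) * \<omega> n (ipF (\<eta> n) (T (\<zeta> n)))) sums f T" if "T \<in> adjointable ipF" for T
      using ce(3)[OF that] by (simp add: e(1))
  qed
qed


lemma L_closure_lim:
  assumes lim: "\<And>\<epsilon>. \<epsilon> > 0 \<Longrightarrow> \<exists>g\<in>L_closure. L_dom \<epsilon> (f - g)"
  shows "f \<in> L_closure"
  unfolding L_closure_def
proof (intro CollectI allI impI)
  fix \<epsilon> :: real assume "\<epsilon> > 0"
  then have e: "\<epsilon> / 2 > 0" by simp
  obtain g where g: "g \<in> L_closure" "L_dom (\<epsilon> / 2) (f - g)" using lim[OF e] by blast
  obtain L where L: "snd ` set L \<subseteq> L_unit" "L_dom (\<epsilon> / 2) (g - combination L)"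
    using g(1) e unfolding L_closure_def by blast
  have "L_dom (\<epsilon> / 2 + \<epsilon> / 2) ((f - g) + (g - combination L))" by (rule dominated_add[OF g(2) L(2)])
  then have "L_dom \<epsilon> (f - combination L)" by (simp add: dominated_def)
  then show "\<exists>L. snd ` set L \<subseteq> L_unit \<and> L_dom \<epsilon> (f - combination L)" using L(1) by blast
qed

lemma L_closure_add:
  assumes "f \<in> L_closure" "g \<in> L_closure" shows "(\<lambda>T. f T + g T) \<in> L_closure"
  unfolding L_closure_def
proof (intro CollectI allI impI)
  fix \<epsilon> :: real assume "\<epsilon> > 0"
  then have e: "\<epsilon> / 2 > 0" by simp
  obtain L where L: "snd ` set L \<subseteq> L_unit" "L_dom (\<epsilon> / 2) (f - combination L)"
    using assms(1) e unfolding L_closure_def by blast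
  obtain L' where L': "snd ` set L' \<subseteq> L_unit" "L_dom (\<epsilon> / 2) (g - combination L')"
    using assms(2) e unfolding L_closure_def by blast
  have "L_dom (\<epsilon> / 2 + \<epsilon> / 2) ((f - combination L) + (g - combination L'))" by (rule dominated_add[OF L(2) L'(2)])
  then have "L_dom \<epsilon> ((\<lambda>T. f T + g T) - combination (L @ L'))"
    by (simp add: dominated_def algebra_simps)
  then show "\<exists>L. snd ` set L \<subseteq> L_unit \<and> L_dom \<epsilon> ((\<lambda>T. f T + g T) - combination L)"
    using L(1) L'(1) by (intro exI[of _ "L @ L'"] conjI) auto
qed

text \<open>Combinations carry real coefficients, so a complex factor is split into its real and
  imaginary part; \<open>L_unit\<close> is stable under multiplication by
  \<open>\<i>\<close>.\<close>

lemma combination_mult: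
  assumes "snd ` set L \<subseteq> L_unit"
  shows "\<exists>L'. snd ` set L' \<subseteq> L_unit \<and> (\<forall>T. combination L' T = c * combination L T)"
  using assms
proof (induction L)
  case Nil
  then show ?case by (intro exI[of _ "[]"]) simp
next
  case (Cons a L)
  obtain r e where a: "a = (r, e)" by (cases a)
  obtain L' where L': "snd ` set L' \<subseteq> L_unit" "\<And>T. combination L' T = c * combination L T" using Cons by auto
  have e: "e \<in> L_unit" using Cons.prems a by simp
  have ie: "(\<lambda>T. \<i> * e T) \<in> L_unit" by (rule L_unit_mult[OF e]) simp
  have "complex_of_real (r * Re c) * z + complex_of_real (r * Im c) * (\<i> * z) = c * (complex_of_real r * z)" for z
  proof -
    have "complex_of_real (r * Re c) * z + complex_of_real (r * Im c) * (\<i> * z) = (complex_of_real (Re c) + \<i> * complex_of_real (Im c)) * (complex_of_real r * z)"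
      by (simp add: algebra_simps)
    then show ?thesis by (simp add: complex_eq[symmetric])
  qed
  then have "combination ((r * Re c, e) # (r * Im c, \<lambda>T. \<i> * e T) # L') T = c * combination (a # L) T" for T
    by (simp add: a L' scaleR_fun_def scaleR_conv_of_real distrib_left add.assoc[symmetric])
  then show ?case using e ie L'(1) by (intro exI[of _ "(r * Re c, e) # (r * Im c, \<lambda>T. \<i> * e T) # L'"]) simp
qed

lemma L_closure_scale:
  assumes "f \<in> L_closure" shows "(\<lambda>T. c * f T) \<in> L_closure"
  unfolding L_closure_def
proof (intro CollectI allI impI)
  fix \<epsilon> :: real assume e: "\<epsilon> > 0"
  then have e': "\<epsilon> / (cmod c + 1) > 0" by (simp add: add_nonneg_pos)
  obtain L where L: "snd ` set L \<subseteq> L_unit" "L_dom (\<epsilon> / (cmod c + 1)) (f - combination L)"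
    using assms e' unfolding L_closure_def by blast
  obtain L' where L': "snd ` set L' \<subseteq> L_unit" "\<And>T. combination L' T = c * combination L T"
    using combination_mult[OF L(1)] by blast
  have "L_dom \<epsilon> ((\<lambda>T. c * f T) - combination L')"
    unfolding dominated_def
  proof
    fix T assume T: "T \<in> adjointable ipF"
    have "cmod (((\<lambda>T. c * f T) - combination L') T) = cmod c * cmod ((f - combination L) T)"
      by (simp add: L'(2) right_diff_distrib[symmetric] norm_mult)
    also have "\<dots> \<le> (cmod c + 1) * (\<epsilon> / (cmod c + 1) * onorm T)"
      using L(2) T by (intro mult_mono) (auto simp: dominated_def)
    also have "\<dots> = \<epsilon> * onorm T" using norm_ge_zero[of c] by (simp add: add_nonneg_eq_0_iff)
    finally show "cmod (((\<lambda>T. c * f T) - combination L') T) \<le> \<epsilon> * onorm T" .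
  qed
  then show "\<exists>L. snd ` set L \<subseteq> L_unit \<and> L_dom \<epsilon> ((\<lambda>T. c * f T) - combination L)" using L'(1) by blast
qed

lemma L_closure_cong:
  assumes "g \<in> L_closure" "\<And>T. T \<in> adjointable ipF \<Longrightarrow> f T = g T" shows "f \<in> L_closure"
  by (rule L_closure_lim, rule bexI[OF _ assms(1)])
    (simp add: dominated_def assms(2) onorm_adjointable_nonneg)

lemma L_unit_closure: "e \<in> L_unit \<Longrightarrow> e \<in> L_closure"
  unfolding L_closure_def
  by (intro CollectI allI impI exI[of _ "[(1, e)]"]) (simp add: dominated_def scaleR_fun_def onorm_adjointable_nonneg)

lemma elementary_closure:
  assumes \<omega>: "\<omega> \<in> P" shows "(\<lambda>T. \<omega> (ipF \<eta> (T \<zeta>))) \<in> L_closure"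
proof -
  \<comment> \<open>Upper bounds for the three norms, made positive so that division is
    possible.\<close>
  define p q r where "p = onorm \<omega> + 1" and "q = norm \<eta> + 1" and "r = norm \<zeta> + 1"
  note b = predual_bounded[OF predual \<omega>]
  have p: "p > 0" "onorm \<omega> \<le> p" using onorm_pos_le[OF bounded_clinear_linear[OF b]] by (simp_all add: p_def)
  have q: "q > 0" "norm \<eta> \<le> q" and r: "r > 0" "norm \<zeta> \<le> r"
    by (simp_all add: q_def r_def add_nonneg_pos)
  have "(\<lambda>T. complex_of_real (inverse p) * \<omega> (ipF (complex_of_real (inverse q) *\<^sub>C \<eta>) (T (complex_of_real (inverse r) *\<^sub>C \<zeta>)))) \<in> L_unit"
  proof (rule L_unitI[of "\<lambda>a. complex_of_real (inverse p) * \<omega> a"])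
    show "(\<lambda>a. complex_of_real (inverse p) * \<omega> a) \<in> P" by (rule predual_scale[OF predual \<omega>])
    have "onorm (\<lambda>a. complex_of_real (inverse p) * \<omega> a) \<le> cmod (complex_of_real (inverse p)) * onorm \<omega>"
      by (rule onorm_predual_mult[OF \<omega>])
    also have "cmod (complex_of_real (inverse p)) = inverse p" using p by (simp add: norm_inverse)
    also have "inverse p * onorm \<omega> \<le> 1" using p by (simp add: field_simps)
    finally show "onorm (\<lambda>a. complex_of_real (inverse p) * \<omega> a) \<le> 1" .
    have "inverse q * norm \<eta> \<le> 1" "inverse r * norm \<zeta> \<le> 1" using q r by (simp_all add: field_simps)
    then show "norm (complex_of_real (inverse q) *\<^sub>C \<eta>) \<le> 1" "norm (complex_of_real (inverse r) *\<^sub>C \<zeta>) \<le> 1"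
      using q r by (simp_all add: norm_scaleC norm_inverse)
  qed
  from L_closure_scale[OF L_unit_closure[OF this], of "complex_of_real (p * q * r)"]
  show ?thesis
  proof (rule L_closure_cong)
    fix T assume T: "T \<in> adjointable ipF"
    show "\<omega> (ipF \<eta> (T \<zeta>)) = complex_of_real (p * q * r) * (complex_of_real (inverse p) *
        \<omega> (ipF (complex_of_real (inverse q) *\<^sub>C \<eta>) (T (complex_of_real (inverse r) *\<^sub>C \<zeta>))))"
      using p(1) q(1) r(1)
      by (simp add: F.adjointable_scaleC[OF T] F.ip_scaleC_left F.ip_scaleC_right clinear_scaleC[OF b]
          scaleC_complex_def divide_simps)
  qed
qed

lemma vector_functional_dominated: "L_dom (norm w * norm u) (\<lambda>T. cinner w (\<rho> T u))"
  unfolding dominated_def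
proof
  fix T assume T: "T \<in> adjointable ipF"
  have "cmod (cinner w (\<rho> T u)) \<le> norm w * (onorm T * norm u)"
    by (rule order_trans[OF cauchy_schwarz mult_left_mono[OF norm_induced_rep_le[OF T]]]) simp
  then show "cmod (cinner w (\<rho> T u)) \<le> norm w * norm u * onorm T" by (simp add: mult_ac)
qed

text \<open>For elementary tensors in both places the functional is elementary, with a vector
  functional of \<open>\<pi>\<close> as its member of \<open>P\<close>. Linearity and norm limits
  extend this, first in \<open>u\<close>, then in \<open>w\<close>.\<close>

lemma vector_functional_closure: "(\<lambda>T. cinner w (\<rho> T u)) \<in> L_closure"
proof -
  have lim: "(\<lambda>T. cinner w (\<rho> T u)) \<in> L_closure"
    if s: "\<And>n::nat. (\<lambda>T. cinner (w' n) (\<rho> T (u' n))) \<in> L_closure" and l: "w' \<longlonglongrightarrow> w" "u' \<longlonglongrightarrow> u" for w u w' u'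
  proof (rule L_closure_lim)
    fix e :: real assume e: "e > 0"
    have "(\<lambda>n. norm (w - w' n) * norm u + norm (w' n) * norm (u - u' n)) \<longlonglongrightarrow> norm (w - w) * norm u + norm w * norm (u - u)"
      by (intro tendsto_intros l)
    then have "eventually (\<lambda>n. norm (w - w' n) * norm u + norm (w' n) * norm (u - u' n) < e) sequentially"
      by (rule order_tendstoD) (use e in simp)
    then obtain n where n: "norm (w - w' n) * norm u + norm (w' n) * norm (u - u' n) < e"
      unfolding eventually_sequentially by blast
    have "L_dom e ((\<lambda>T. cinner w (\<rho> T u)) - (\<lambda>T. cinner (w' n) (\<rho> T (u' n))))"
      unfolding dominated_def
    proof
      fix T assume T: "T \<in> adjointable ipF"
      have "((\<lambda>T. cinner w (\<rho> T u)) - (\<lambda>T. cinner (w' n) (\<rho> T (u' n)))) T =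
          cinner (w - w' n) (\<rho> T u) + cinner (w' n) (\<rho> T (u - u' n))"
        by (simp add: cinner_diff_left cinner_diff_right clinear_diff[OF bounded_clinear_induced_rep[OF T]])
      also have "cmod \<dots> \<le> norm (w - w' n) * norm u * onorm T + norm (w' n) * norm (u - u' n) * onorm T"
        using vector_functional_dominated[of "w - w' n" u] vector_functional_dominated[of "w' n" "u - u' n"] T
        unfolding dominated_def by (intro order_trans[OF norm_triangle_ineq] add_mono) auto
      also have "\<dots> = (norm (w - w' n) * norm u + norm (w' n) * norm (u - u' n)) * onorm T" by (simp add: distrib_right)
      also have "\<dots> \<le> e * onorm T" using n onorm_adjointable_nonneg[OF T] by (intro mult_right_mono) auto
      finally show "cmod (((\<lambda>T. cinner w (\<rho> T u)) - (\<lambda>T. cinner (w' n) (\<rho> T (u' n)))) T) \<le> e * onorm T" .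
    qed
    then show "\<exists>g\<in>L_closure. L_dom e ((\<lambda>T. cinner w (\<rho> T u)) - g)" by (rule bexI[OF _ s])
  qed
  have zero: "(\<lambda>T. 0) \<in> L_closure"
    unfolding L_closure_def
    by (intro CollectI allI impI exI[of _ "[]"]) (simp add: dominated_def onorm_adjointable_nonneg)
  have right: "(\<lambda>T. cinner (tensH \<eta> h) (\<rho> T u)) \<in> L_closure" for \<eta> h u
  proof -
    define N where "N = {u. (\<lambda>T. cinner (tensH \<eta> h) (\<rho> T u)) \<in> L_closure}"
    have "csubspace N"
      unfolding cvec.subspace_def N_def mem_Collect_eq
    proof (intro conjI ballI allI)
      show "(\<lambda>T. cinner (tensH \<eta> h) (\<rho> T 0)) \<in> L_closure"
        by (rule L_closure_cong[OF zero]) (simp add: clinear_zero[OF bounded_clinear_induced_rep])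
      fix x c assume x: "x \<in> {u. (\<lambda>T. cinner (tensH \<eta> h) (\<rho> T u)) \<in> L_closure}"
      show "(\<lambda>T. cinner (tensH \<eta> h) (\<rho> T (c *\<^sub>C x))) \<in> L_closure"
        by (rule L_closure_cong[OF L_closure_scale[OF CollectD[OF x], of c]])
          (simp add: clinear_scaleC[OF bounded_clinear_induced_rep] cinner_scaleC_right)
      fix y assume y: "y \<in> {u. (\<lambda>T. cinner (tensH \<eta> h) (\<rho> T u)) \<in> L_closure}"
      show "(\<lambda>T. cinner (tensH \<eta> h) (\<rho> T (x + y))) \<in> L_closure"
        by (rule L_closure_cong[OF L_closure_add[OF CollectD[OF x] CollectD[OF y]]])
          (simp add: clinear_add[OF bounded_clinear_induced_rep] cinner_add_right)
    qed
    moreover have "closed N"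
      unfolding closed_sequential_limits N_def mem_Collect_eq
      by (intro allI impI, elim conjE) (rule lim[of "\<lambda>_. tensH \<eta> h"], simp_all)
    moreover have "tensH \<zeta> k \<in> N" for \<zeta> k
      unfolding N_def mem_Collect_eq
      by (rule L_closure_cong[OF elementary_closure[OF rep_normal[of h k], of \<eta> \<zeta>]])
        (simp add: induced_rep_tensH T.cinner_tensH)
    then have "{tensH x h | x h. True} \<subseteq> N" by blast
    ultimately have "ccspan {tensH x h | x h. True} \<subseteq> N" by (intro ccspan_minimal)
    then show ?thesis using ccspan_tensH by (auto simp: N_def)
  qed
  define N where "N = {w. (\<lambda>T. cinner w (\<rho> T u)) \<in> L_closure}"
  have "csubspace N"
    unfolding cvec.subspace_def N_def
    using zero L_closure_add L_closure_scale by (simp add: cinner_add_left cinner_scaleC_left)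
  moreover have "closed N"
    unfolding closed_sequential_limits N_def mem_Collect_eq
    by (intro allI impI, elim conjE) (rule lim[of _ "\<lambda>_. u"], simp_all)
  moreover have "{tensH x h | x h. True} \<subseteq> N" using right unfolding N_def by blast
  ultimately have "ccspan {tensH x h | x h. True} \<subseteq> N" by (intro ccspan_minimal)
  then show ?thesis using ccspan_tensH by (auto simp: N_def)
qed

theorem vector_functional_L_predual: "(\<lambda>T. cinner w (\<rho> T u)) \<in> L_predual P ipF"
proof (rule L_closure_subset_predual[OF vector_functional_closure])
  show "norm w * norm u + 1 > 0" by (simp add: add_nonneg_pos)
  show "L_dom (norm w * norm u + 1) (\<lambda>T. cinner w (\<rho> T u))"
    using vector_functional_dominated[of w u] onorm_adjointable_nonneg
    unfolding dominated_def by (auto simp: distrib_right add_increasing2)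
qed

end

subsection \<open>Elementary tensors\<close>

context wstar_correspondence
begin

lemma left_adjointable: "\<phi> a \<in> adjointable ip"
  by (rule adjointableI[of _ "\<phi> (star a)"]) (use left_star[of "star a"] in \<open>simp add: star_star\<close>)

text \<open>Additivity in the first tensor factor, the one on which the left action
  operates.\<close>

lemma tensor_ip_add: "tensor_ip ip \<phi> xs ((y + z) # ys) = tensor_ip ip \<phi> xs (y # ys) + tensor_ip ip \<phi> xs (z # ys)"
proof (induction xs arbitrary: y z ys)
  case (Cons x xs)
  show ?case
  proof (cases xs)
    case Nil
    then show ?thesis by (cases ys) (simp_all add: ip_add_right)
  next
    case (Cons x' xs')
    then show ?thesis using Cons.IH by (cases ys) (simp_all add: ip_add_right left_add)
  qed
qed simp

lemma tensor_ip_scaleC: "tensor_ip ip \<phi> xs ((c *\<^sub>C y) # ys) = c *\<^sub>C tensor_ip ip \<phi> xs (y # ys)"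
proof (induction xs arbitrary: y ys)
  case (Cons x xs)
  show ?case
  proof (cases xs)
    case Nil
    then show ?thesis by (cases ys) (simp_all add: ip_scaleC_right)
  next
    case (Cons x' xs')
    then show ?thesis using Cons.IH by (cases ys) (simp_all add: ip_scaleC_right left_scaleC)
  qed
qed simp

lemma tensor_ip_left_star: "tensor_ip ip \<phi> (\<phi> (star a) x # xs) (y # ys) = tensor_ip ip \<phi> (x # xs) (\<phi> a y # ys)"
  by (cases xs; cases ys) (simp_all add: left_star)

text \<open>An elementary functional is a series with one nonzero term, hence ultraweakly
  continuous; composing it with the normal left action gives a weakly continuous functional on the
  algebra.\<close>

lemma left_vector_normal:
  assumes \<omega>: "\<omega> \<in> P" and P: "is_predual P" shows "(\<lambda>a. \<omega> (ip x (\<phi> a y))) \<in> P"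
proof (rule weakly_continuous_functional[OF predual_functional_space[OF P]])
  note b = predual_bounded[OF P \<omega>]
  show "clinear_on UNIV f" if "f \<in> P" for f by (rule clinear_on_bounded[OF predual_bounded[OF P that]])
  show "clinear_on UNIV (\<lambda>a. \<omega> (ip x (\<phi> a y)))"
    unfolding clinear_on_def
    by (simp add: left_add left_scaleC ip_add_right ip_scaleC_right clinear_add[OF b] clinear_scaleC[OF b] scaleC_complex_def)
  define w where "w n = (if n = 0 then \<omega> else (\<lambda>a. 0))" for n :: nat
  have sums: "(\<lambda>n. w n (ip x (T y))) sums \<omega> (ip x (T y))" for T
    using sums_single[of 0 "\<lambda>_. \<omega> (ip x (T y))"] by (rule sums_cong[THEN iffD1, rotated]) (simp add: w_def)
  have "(\<lambda>T. \<Sum>n. w n (ip x (T y))) \<in> L_functionals P ip"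
  proof (rule L_functionalsI)
    show "w n \<in> P" for n using \<omega> predual_zero[OF P] by (simp add: w_def)
    show "summable (\<lambda>n. onorm (w n) * norm x * norm y)"
      by (rule summable_finite[of "{0}"]) (simp_all add: w_def onorm_zero)
  qed
  then have "(\<lambda>T. \<omega> (ip x (T y))) \<in> L_functionals P ip" by (simp only: sums_unique[OF sums])
  then have "continuous_map (ultraweak_L P ip) euclidean (\<lambda>T. \<omega> (ip x (T y)))"
    unfolding ultraweak_L_def L_functionals_def
    by (intro continuous_map_from_subtopology continuous_map_weak_topology)
  from continuous_map_compose[OF left_normal this]
  show "continuous_map (weak_topology P) euclidean (\<lambda>a. \<omega> (ip x (\<phi> a y)))" by (simp add: comp_def)
qed

text \<open>\<open>\<phi> 1\<close> fixes the span of the ranges of the left action. For each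
  \<open>\<omega>\<close> and \<open>\<eta>\<close> the pairing with
  \<open>\<phi> 1 \<eta> - \<eta>\<close> is continuous in the sigma-topology and vanishes on that
  span, hence everywhere by essentiality.\<close>

lemma left_one:
  assumes P: "is_predual P" shows "\<phi> 1 x = x"
proof -
  have "\<omega> (ip (\<phi> 1 \<eta> - \<eta>) x) = 0" if \<omega>: "\<omega> \<in> P" for \<omega> \<eta>
  proof (rule ccontr)
    assume nz: "\<omega> (ip (\<phi> 1 \<eta> - \<eta>) x) \<noteq> 0"
    note b = predual_bounded[OF P \<omega>]
    define f where "f y = \<omega> (ip (\<phi> 1 \<eta> - \<eta>) y)" for y
    define w where "w n = (if n = 0 then \<omega> else (\<lambda>a. 0))" for n :: nat
    have sums: "(\<lambda>n. w n (ip (\<phi> 1 \<eta> - \<eta>) y)) sums f y" for y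
      using sums_single[of 0 "\<lambda>_. f y"] by (rule sums_cong[THEN iffD1, rotated]) (simp add: w_def f_def)
    have wP: "range w \<subseteq> P" using \<omega> predual_zero[OF P] by (auto simp: w_def)
    have ws: "summable (\<lambda>n. onorm (w n) * norm (\<phi> 1 \<eta> - \<eta>))"
      by (rule summable_finite[of "{0}"]) (simp_all add: w_def onorm_zero)
    have "f = (\<lambda>y. \<Sum>n. w n (ip (\<phi> 1 \<eta> - \<eta>) y))" by (rule ext) (rule sums_unique[OF sums])
    then have "f \<in> {\<lambda>x. (\<Sum>n. \<omega> n (ip (\<eta> n) x)) | \<omega> \<eta>. range \<omega> \<subseteq> P \<and> summable (\<lambda>n. onorm (\<omega> n) * norm (\<eta> n))}"
      using wP ws by (intro CollectI exI[of _ w] exI[of _ "\<lambda>_. \<phi> 1 \<eta> - \<eta>"] conjI)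
    then have "openin (sigma_topology P ip) (f -` (- {0}))"
      unfolding sigma_topology_def by (rule openin_weak_topology) (simp add: open_Compl)
    moreover have "x \<in> sigma_topology P ip closure_of cspan {\<phi> a x | a x. True}"
      by (rule essential[THEN equalityD2, THEN subsetD, OF UNIV_I])
    moreover have "x \<in> f -` (- {0})" using nz by (simp add: f_def)
    ultimately obtain y where y: "y \<in> cspan {\<phi> a x | a x. True}" "y \<in> f -` (- {0})"
      unfolding in_closure_of by meson
    have "f y = 0" using y(1)
    proof (induction rule: cvec.span_induct)
      case base
      show "csubspace {y. f y = 0}"
        unfolding cvec.subspace_def f_def
        by (simp add: ip_add_right ip_scaleC_right clinear_add[OF b] clinear_scaleC[OF b] clinear_zero[OF b])
    next
      case (step y)
      then obtain a z where y: "y = \<phi> a z" by blast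
      have "ip (\<phi> 1 \<eta>) y = ip \<eta> y" using left_star[of 1 \<eta> y] left_mult[of 1 a z] by (simp add: y)
      then show ?case by (simp add: f_def ip_diff_left clinear_zero[OF b])
    qed
    then show False using y(2) by simp
  qed
  then have "ip (\<phi> 1 \<eta> - \<eta>) x = 0" for \<eta>
    using predual_separates[OF P, of "ip (\<phi> 1 \<eta> - \<eta>) x" 0] clinear_zero[OF predual_bounded[OF P]] by metis
  then have "ip \<eta> (\<phi> 1 x) = ip \<eta> x" for \<eta> using left_star[of 1 \<eta> x] by (simp add: ip_diff_left)
  then show ?thesis by (rule ip_eqI')
qed

end

locale fock_tensor = tensor_space P \<pi> ipF actF tensH + E: wstar_correspondence P ip act \<phi> +
    K: fock_space ip \<phi> ipF actF pow vac tens
  for P :: "('m::cstar_algebra \<Rightarrow> complex) set" and \<pi> :: "'m \<Rightarrow> 'h::chilbert \<Rightarrow> 'h"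
    and ip :: "'e::cbanach \<Rightarrow> 'e \<Rightarrow> 'm" and act :: "'e \<Rightarrow> 'm \<Rightarrow> 'e" and \<phi> :: "'m \<Rightarrow> 'e \<Rightarrow> 'e"
    and ipF :: "'f::cbanach \<Rightarrow> 'f \<Rightarrow> 'm" and actF :: "'f \<Rightarrow> 'm \<Rightarrow> 'f"
    and pow :: "nat \<Rightarrow> 'f set" and vac :: "'m \<Rightarrow> 'f" and tens :: "'e list \<Rightarrow> 'f"
    and tensH :: "'f \<Rightarrow> 'h \<Rightarrow> 'k::chilbert"
begin

text \<open>Generators of the Fock space: \<open>Inl b\<close> stands for the vacuum vector of \<open>b\<close> and \<open>Inr (x, xs)\<close> for the
  elementary tensor of the nonempty list \<open>x # xs\<close>.\<close>

fun gen :: "'m + 'e \<times> 'e list \<Rightarrow> 'f" where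
  "gen (Inl b) = vac b"
| "gen (Inr (x, xs)) = tens (x # xs)"

fun deg :: "'m + 'e \<times> 'e list \<Rightarrow> nat" where
  "deg (Inl b) = 0"
| "deg (Inr (x, xs)) = Suc (length xs)"

fun lact :: "'m \<Rightarrow> 'm + 'e \<times> 'e list \<Rightarrow> 'm + 'e \<times> 'e list" where
  "lact a (Inl b) = Inl (a * b)"
| "lact a (Inr (x, xs)) = Inr (\<phi> a x, xs)"

fun cre :: "'e \<Rightarrow> 'm + 'e \<times> 'e list \<Rightarrow> 'm + 'e \<times> 'e list" where
  "cre \<xi> (Inl b) = Inr (act \<xi> b, [])"
| "cre \<xi> (Inr (x, xs)) = Inr (\<xi>, x # xs)"

lemma deg_lact [simp]: "deg (lact a g) = deg g"
  by (cases "(a, g)" rule: lact.cases) auto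

lemma deg_cre [simp]: "deg (cre \<xi> g) = Suc (deg g)"
  by (cases "(\<xi>, g)" rule: cre.cases) auto

lemma gen_in_pow: "gen g \<in> pow (deg g)"
proof (cases g rule: gen.cases)
  case (1 b)
  then show ?thesis by (simp add: K.pow_0)
next
  case (2 x xs)
  have "tens (x # xs) \<in> cspan {tens ys | ys. length ys = Suc (length xs)}"
    by (rule cvec.span_base) (rule CollectI, rule exI[of _ "x # xs"], simp)
  moreover have "cspan {tens ys | ys. length ys = Suc (length xs)} \<subseteq> pow (Suc (length xs))"
    using K.pow_Suc[of "Suc (length xs)"] unfolding self_dual_completion_def by simp
  ultimately show ?thesis using 2 by auto
qed

lemma gen_orthogonal: "deg g \<noteq> deg g' \<Longrightarrow> ipF (gen g) (gen g') = 0"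
  by (rule K.pow_orthogonal[OF _ gen_in_pow gen_in_pow])

lemma ip_gen_lact: "ipF (gen g) (gen (lact a g')) = ipF (gen (lact (star a) g)) (gen g')"
proof (cases "deg g = deg g'")
  case True
  then show ?thesis
    by (cases g rule: gen.cases; cases g' rule: gen.cases)
      (simp_all add: K.ip_vac K.ip_tens E.tensor_ip_left_star star_mult star_star mult.assoc)
qed (simp add: gen_orthogonal)

text \<open>The relation behind all later computations, on generators: the adjoint of one creation
  operator times another is the left action of their inner product.\<close>

lemma ip_gen_cre: "ipF (gen (cre \<xi> g)) (gen (cre \<xi>' g')) = ipF (gen g) (gen (lact (ip \<xi> \<xi>') g'))"
proof (cases "deg g = deg g'")
  case True
  then show ?thesis
    by (cases g rule: gen.cases; cases g' rule: gen.cases)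
      (simp_all add: K.ip_vac K.ip_tens E.ip_act_left E.ip_act_right mult.assoc)
qed (simp add: gen_orthogonal)

lemma lact_mult: "lact (a * b) g = lact a (lact b g)"
  by (cases g rule: gen.cases) (simp_all add: mult.assoc E.left_mult)

lemma lact_one: "lact 1 g = g"
  by (cases g rule: gen.cases) (simp_all add: E.left_one[OF predual])

lemma lact_cre: "lact a (cre \<xi> g) = cre (\<phi> a \<xi>) g"
  by (cases g rule: gen.cases) (simp_all add: E.adjointable_act[OF E.left_adjointable])

text \<open>Multilinearity of \<open>tens\<close> has to be extracted from inner products: the
  defect \<open>D\<close> is orthogonal to all generators and is itself a combination of
  generators.\<close>

lemma gen_lact_add: "gen (lact (a + b) g) = gen (lact a g) + gen (lact b g)"
proof -
  define D where "D = gen (lact (a + b) g) - gen (lact a g) - gen (lact b g)"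
  have "ipF (gen g') D = 0" for g'
  proof (cases "deg g' = deg g")
    case True
    then show ?thesis
      by (cases g rule: gen.cases; cases g' rule: gen.cases)
        (simp_all add: D_def F.ip_diff_right K.ip_vac K.ip_tens E.left_add E.tensor_ip_add distrib_left distrib_right)
  qed (simp add: D_def F.ip_diff_right gen_orthogonal)
  then have "ipF D D = 0" by (subst (1) D_def) (simp add: F.ip_diff_left)
  then have "D = 0" by (rule F.ip_self_eq_0)
  then show ?thesis by (simp add: D_def algebra_simps)
qed

lemma gen_lact_scaleC: "gen (lact (c *\<^sub>C a) g) = c *\<^sub>C gen (lact a g)"
proof -
  define D where "D = gen (lact (c *\<^sub>C a) g) - c *\<^sub>C gen (lact a g)"
  have "ipF (gen g') D = 0" for g'
  proof (cases "deg g' = deg g")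
    case True
    then show ?thesis
      by (cases g rule: gen.cases; cases g' rule: gen.cases)
        (simp_all add: D_def F.ip_diff_right F.ip_scaleC_right K.ip_vac K.ip_tens E.left_scaleC
          E.tensor_ip_scaleC mult_scaleC_left mult_scaleC_right)
  qed (simp add: D_def F.ip_diff_right F.ip_scaleC_right gen_orthogonal)
  then have "ipF D D = 0" by (subst (1) D_def) (simp add: F.ip_diff_left F.ip_scaleC_left)
  then have "D = 0" by (rule F.ip_self_eq_0)
  then show ?thesis by (simp add: D_def)
qed

text \<open>Removing the first tensor factor turns the functional into a member of \<open>P\<close>,
  by induction, evaluated at \<open>ip x (\<phi> a y)\<close>; so normality of the left action is
  used once per factor.\<close>

lemma lact_normal: "(\<lambda>a. cinner h (\<pi> (ipF (gen g) (gen (lact a g'))) k)) \<in> P"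
proof (cases "deg g = deg g'")
  case False
  then show ?thesis by (simp add: gen_orthogonal predual_zero[OF predual])
next
  case True
  have tn: "(\<lambda>a. cinner h (\<pi> (tensor_ip ip \<phi> xs (\<phi> a y # ys)) k)) \<in> P" for xs y ys
  proof (induction xs arbitrary: y ys)
    case Nil
    then show ?case by (simp add: predual_zero[OF predual])
  next
    case (Cons x xs)
    show ?case
    proof (cases xs)
      case Nil
      then show ?thesis
        using E.left_vector_normal[OF rep_normal[of h k] predual, of x y] predual_zero[OF predual]
        by (cases ys) simp_all
    next
      case (Cons x' xs')
      show ?thesis
      proof (cases ys)
        case Nil
        then show ?thesis using \<open>xs = x' # xs'\<close> by (simp add: predual_zero[OF predual])
      next
        case (Cons y' ys')
        show ?thesis
          using E.left_vector_normal[OF Cons.IH[of y' ys'] predual, of x y] \<open>xs = x' # xs'\<close> Cons by simp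
      qed
    qed
  qed
  show ?thesis
  proof (cases g rule: gen.cases)
    case (1 b)
    then obtain c where g': "g' = Inl c" using True by (cases g' rule: gen.cases) auto
    show ?thesis
      using rep_normal[of "\<pi> b h" "\<pi> c k"] by (simp add: 1 g' K.ip_vac rep_mult rep_star' )
  next
    case (2 x xs)
    then obtain y ys where g': "g' = Inr (y, ys)" using True by (cases g' rule: gen.cases) auto
    show ?thesis using tn[of "x # xs" y ys] True by (simp add: 2 g' K.ip_tens)
  qed
qed

end

section \<open>Generators separate points and are total in the induced space\<close>

context fock_tensor
begin

text \<open>The uniqueness clauses of self-dual completions are used twice: from elementary tensors
  to each tensor power, and from the tensor powers to the whole Fock space.\<close>

lemma gen_separating:
  assumes y: "\<And>g. ipF y (gen g) = 0" shows "y = 0"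
proof -
  have bl: "bounded_clinear (ipF y)"
    by (rule bounded_clinearI[where B = "norm y"]) (simp_all add: F.ip_add_right F.ip_scaleC_right norm_ipF_le)
  have p: "ipF y v = 0" if v: "v \<in> pow n" for n v
  proof (cases n)
    case 0
    then show ?thesis using v y[of "Inl b" for b] by (auto simp: K.pow_0)
  next
    case (Suc k)
    let ?D = "cspan {tens xs | xs. length xs = n}"
    have sdc: "self_dual_completion ipF actF ?D (pow n)" by (rule K.pow_Suc) (simp add: Suc)
    then have sd: "self_dual ipF actF (pow n)" and sub: "?D \<subseteq> pow n" and zero: "0 \<in> pow n"
      unfolding self_dual_completion_def submodule_def using cvec.subspace_0 by blast+
    have "module_functional actF S (ipF y)" for S
      unfolding module_functional_def
      by (auto simp: F.ip_add_right F.ip_act_right intro!: exI[of _ "norm y"] norm_ipF_le)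
    \<comment> \<open>Uniqueness speaks about elements of the tensor power, but \<open>y\<close>
      need not be one. Self-duality supplies \<open>y'\<close>, in effect the component of
      \<open>y\<close> there.\<close>
    then obtain y' where y': "y' \<in> pow n" "\<And>v. v \<in> pow n \<Longrightarrow> ipF y v = ipF y' v"
      using sd unfolding self_dual_def by meson
    have "module_functional actF ?D (\<lambda>_. 0)"
      unfolding module_functional_def by (auto intro!: exI[of _ 0])
    then have ex1: "\<exists>!z. z \<in> pow n \<and> (\<forall>x\<in>?D. 0 = ipF z x)"
      using sdc unfolding self_dual_completion_def by (elim conjE) (drule spec, drule mp, assumption)
    have D0: "ipF y x = 0" if "x \<in> ?D" for x using that
    proof (induction rule: cvec.span_induct)
      case base
      show "csubspace {x. ipF y x = 0}"
        by (simp add: cvec.subspace_def F.ip_add_right F.ip_scaleC_right)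
    next
      case (step x)
      then obtain xs where "x = tens xs" "length xs = n" by blast
      then show ?case using y[of "Inr (hd xs, tl xs)"] Suc by (cases xs) simp_all
    qed
    have "y' = 0"
    proof (rule ex1E[OF ex1])
      fix z assume z: "\<forall>w. w \<in> pow n \<and> (\<forall>x\<in>?D. 0 = ipF w x) \<longrightarrow> w = z"
      have "\<forall>x\<in>?D. 0 = ipF y' x"
      proof
        fix x assume x: "x \<in> ?D"
        show "0 = ipF y' x" using y'(2)[OF subsetD[OF sub x]] D0[OF x] by simp
      qed
      then have "y' = z" by (intro z[rule_format] conjI y'(1))
      moreover have "0 = z" by (rule z[rule_format]) (simp add: zero)
      ultimately show ?thesis by simp
    qed
    then show ?thesis using y'(2)[OF v] by simp
  qed
  let ?D = "ccspan (\<Union>n. pow n)"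
  have "?D \<subseteq> {v. ipF y v = 0}"
  proof (rule ccspan_minimal)
    show "(\<Union>n. pow n) \<subseteq> {v. ipF y v = 0}" using p by auto
    show "csubspace {x. ipF y x = 0}"
      by (simp add: cvec.subspace_def F.ip_add_right F.ip_scaleC_right)
    show "closed {v. ipF y v = 0}"
      using closed_Collect_eq[OF clinear_continuous[OF bl, of UNIV] continuous_on_const] by simp
  qed
  then have D0: "\<forall>v\<in>?D. 0 = ipF y v" by auto
  have "module_functional actF ?D (\<lambda>_. 0)"
    unfolding module_functional_def by (auto intro!: exI[of _ 0])
  then have ex1: "\<exists>!z. z \<in> UNIV \<and> (\<forall>x\<in>?D. 0 = ipF z x)"
    using K.direct_sum unfolding self_dual_completion_def by (elim conjE) (drule spec, drule mp, assumption)
  show "y = 0"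
  proof (rule ex1E[OF ex1])
    fix z assume z: "\<forall>w. w \<in> UNIV \<and> (\<forall>x\<in>?D. 0 = ipF w x) \<longrightarrow> w = z"
    have "y = z" by (rule z[rule_format]) (use D0 in simp)
    moreover have "0 = z" by (rule z[rule_format]) simp
    ultimately show ?thesis by simp
  qed
qed

lemma adjointable_gen_eqI:
  assumes X: "X \<in> adjointable ipF" and Y: "Y \<in> adjointable ipF" and eq: "\<And>g. X (gen g) = Y (gen g)"
  shows "X = Y"
proof
  fix x
  obtain X' where X': "\<And>x y. ipF (X' x) y = ipF x (X y)" using F.adjointable_adjoint[OF X] by metis
  obtain Y' where Y': "\<And>x y. ipF (Y' x) y = ipF x (Y y)" using F.adjointable_adjoint[OF Y] by metis
  have "X' z - Y' z = 0" for z
    by (rule gen_separating) (simp add: F.ip_diff_left X' Y' eq)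
  then have "ipF z (X x) = ipF z (Y x)" for z using X'[of z x] Y'[of z x] by simp
  then show "X x = Y x" by (rule F.ip_eqI')
qed

text \<open>Self-dual completions do not give norm density of the generators in the module, but
  density holds after inducing: the projection to the closed span commutes with all
  \<open>right_op S\<close>, so it comes from an adjointable operator, which fixes the generators
  and is therefore the identity.\<close>

lemma ccspan_gen: "ccspan {tensH (gen g) h | g h. True} = UNIV"
proof -
  define L where "L = ccspan {tensH (gen g) h | g h. True}"
  have L: "csubspace L" "closed L" by (simp_all add: L_def)
  have gL: "tensH (gen g) h \<in> L" for g h unfolding L_def by (rule ccspan_superset) blast
  have inv: "right_op S u \<in> L" if S: "S \<in> commutant (range \<pi>)" and u: "u \<in> L" for S u
  proof (rule clinear_image_ccspan[OF bounded_clinear_right_op[OF S] _ L, of "{tensH (gen g) h | g h. True}"])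
    show "u \<in> ccspan {tensH (gen g) h |g h. True}" using u by (simp add: L_def)
  qed (auto simp: right_op_tensH[OF S] gL)
  have com: "right_op S (proj L u) = proj L (right_op S u)" if S: "S \<in> commutant (range \<pi>)" for S u
  proof -
    have "bounded_clinear S" using S by (simp add: commutant_def)
    from adjoint_exists[OF this] obtain S' where S': "bounded_clinear S'" "\<And>x y. cinner (S' x) y = cinner x (S y)"
      by metis
    have S'c: "S' \<in> commutant (range \<pi>)" by (rule adjoint_commutant[OF S S'])
    show ?thesis
      by (rule proj_commute[OF L bounded_clinear_right_op[OF S] right_op_adjoint[OF S S'c S'(2)] inv[OF S] inv[OF S'c], symmetric])
  qed
  from right_commutant[OF bounded_clinear_proj[OF L] com] obtain q where q: "q \<in> adjointable ipF" "proj L = \<rho> q"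
    by metis
  have "q = (\<lambda>x. x)"
  proof (rule adjointable_gen_eqI[OF q(1) F.adjointable_id])
    fix g
    show "q (gen g) = gen g"
    proof (rule tensH_inj)
      fix h
      have "tensH (q (gen g)) h = proj L (tensH (gen g) h)" by (simp add: q(2) induced_rep_tensH[OF q(1)])
      also have "\<dots> = tensH (gen g) h" using proj_eq_iff[OF L] gL by blast
      finally show "tensH (q (gen g)) h = tensH (gen g) h" .
    qed
  qed
  then have "proj L = (\<lambda>u. u)" using q(2) induced_rep_id by simp
  then have "u \<in> L" for u using proj_eq_iff[OF L, of u] by simp
  then show ?thesis unfolding L_def by blast
qed

lemma gen_operator_eqI:
  assumes "bounded_clinear S" "bounded_clinear T" "\<And>g h. S (tensH (gen g) h) = T (tensH (gen g) h)"
  shows "S u = T u"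
proof (rule clinear_eq_on_ccspan[OF assms(1,2)])
  show "u \<in> ccspan {tensH (gen g) h | g h. True}" unfolding ccspan_gen by (rule UNIV_I)
qed (use assms(3) in blast)

text \<open>The means of constructing module operators: a bounded operator on the induced space that
  acts on the first factor of generators commutes with every \<open>right_op S\<close>, so
  \<open>right_commutant\<close> applies.\<close>

lemma gen_operator_adjointable:
  assumes T: "bounded_clinear T" and Tg: "\<And>g h. T (tensH (gen g) h) = tensH (y g) h"
  shows "\<exists>X\<in>adjointable ipF. \<forall>g. X (gen g) = y g"
proof -
  have com: "right_op S (T u) = T (right_op S u)" if S: "S \<in> commutant (range \<pi>)" for S u
    by (rule gen_operator_eqI[where S = "\<lambda>u. right_op S (T u)" and T = "\<lambda>u. T (right_op S u)"])
      (simp_all add: Tg right_op_tensH[OF S] bounded_clinear_comp[OF bounded_clinear_right_op[OF S] T]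
        bounded_clinear_comp[OF T bounded_clinear_right_op[OF S]])
  from right_commutant[OF T com] obtain X where X: "X \<in> adjointable ipF" "T = \<rho> X" by metis
  have "X (gen g) = y g" for g
    by (rule tensH_inj) (use Tg[of g] in \<open>simp add: X(2) induced_rep_tensH[OF X(1)]\<close>)
  then show ?thesis using X(1) by blast
qed

section \<open>Existence and relations of the left action and the creation operators\<close>

abbreviation pa :: "'m \<Rightarrow> 'f \<Rightarrow> 'f" where "pa \<equiv> phi_infinity \<phi> ipF vac tens"

abbreviation cr :: "'e \<Rightarrow> 'f \<Rightarrow> 'f" where "cr \<equiv> creation act ipF vac tens"

lemma phi_infinity_gen: "pa a \<in> adjointable ipF \<and> (\<forall>g. pa a (gen g) = gen (lact a g))"
proof -
  define U where "U b = (\<lambda>(g, h). tensH (gen (lact b g)) h)" for b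
  have U_scale: "U (r *\<^sub>R b) i = complex_of_real r *\<^sub>C U b i" for r b i
    by (cases i) (simp add: U_def scaleR_scaleC gen_lact_scaleC tensH_scaleC_left)
  have U_add: "U (b + c) i = U b i + U c i" for b c i
    by (cases i) (simp add: U_def gen_lact_add tensH_add_left)
  have U_ip: "cinner (U b i) (U b j) = cinner (U 1 i) (U (star b * b) j)" for b i j
    by (cases i; cases j)
      (simp add: U_def T.cinner_tensH ip_gen_lact[of "lact b g" b for g] lact_mult lact_one ip_gen_lact[of g "star b" "lact b g'" for g g'] star_star)
  have bound: "norm (\<Sum>i\<in>A. c i *\<^sub>C U a i) \<le> norm a * norm (\<Sum>i\<in>A. c i *\<^sub>C U 1 i)" if "finite A" for A c
  proof -
    define s where "s b = (\<Sum>i\<in>A. c i *\<^sub>C U b i)" for b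
    have s_ip: "cinner (s b) (s b) = cinner (s 1) (s (star b * b))" for b
      by (simp add: s_def cinner_sum_left cinner_sum_right cinner_scaleC_left cinner_scaleC_right U_ip[of b])
    have s_add: "s (b + d) = s b + s d" for b d
      by (simp add: s_def U_add scaleC_add_right sum.distrib)
    have s_scale: "s (r *\<^sub>R b) = complex_of_real r *\<^sub>C s b" for r b
      by (simp add: s_def U_scale cvec.scale_sum_right scaleC_scaleC mult.commute)
    obtain d where d: "star d * d = ((norm a)\<^sup>2) *\<^sub>R 1 - star a * a" by (rule norm_sq_minus_star_mult)
    have "s (star d * d) + s (star a * a) = complex_of_real ((norm a)\<^sup>2) *\<^sub>C s 1"
      unfolding s_add[symmetric] s_scale[symmetric] d by simp
    then have "cinner (s 1) (s (star d * d)) + cinner (s 1) (s (star a * a)) = complex_of_real ((norm a)\<^sup>2) * cinner (s 1) (s 1)"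
      by (metis cinner_add_right cinner_scaleC_right)
    then have "cinner (s d) (s d) + cinner (s a) (s a) = complex_of_real ((norm a)\<^sup>2) * cinner (s 1) (s 1)"
      by (simp add: s_ip[of d] s_ip[of a])
    then have "complex_of_real ((norm (s d))\<^sup>2 + (norm (s a))\<^sup>2) = complex_of_real ((norm a)\<^sup>2 * (norm (s 1))\<^sup>2)"
      by (simp only: cinner_self of_real_add of_real_mult)
    then have "(norm (s d))\<^sup>2 + (norm (s a))\<^sup>2 = (norm a * norm (s 1))\<^sup>2"
      by (simp only: of_real_eq_iff power_mult_distrib)
    then have "(norm (s a))\<^sup>2 \<le> (norm a * norm (s 1))\<^sup>2" using zero_le_power2[of "norm (s d)"] by linarith
    then show ?thesis unfolding s_def[symmetric] by (rule power2_le_imp_le) simp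
  qed
  from operator_extension[where v = "U 1" and w = "U a", OF norm_ge_zero bound]
  obtain T where T: "bounded_clinear T" "\<And>i. T (U 1 i) = U a i" by metis
  have "T (tensH (gen g) h) = tensH (gen (lact a g)) h" for g h
    using T(2)[of "(g, h)"] by (simp add: U_def lact_one)
  from gen_operator_adjointable[OF T(1) this]
  obtain X where X: "X \<in> adjointable ipF" "\<And>g. X (gen g) = gen (lact a g)" by metis
  have "pa a = X"
    unfolding phi_infinity_def
  proof (rule the_equality)
    show "X \<in> adjointable ipF \<and> (\<forall>b. X (vac b) = vac (a * b)) \<and> (\<forall>\<eta> \<eta>s. X (tens (\<eta> # \<eta>s)) = tens (\<phi> a \<eta> # \<eta>s))"
      using X(1) X(2)[of "Inl b" for b] X(2)[of "Inr (x, xs)" for x xs] by simp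
  next
    fix Y assume Y: "Y \<in> adjointable ipF \<and> (\<forall>b. Y (vac b) = vac (a * b)) \<and> (\<forall>\<eta> \<eta>s. Y (tens (\<eta> # \<eta>s)) = tens (\<phi> a \<eta> # \<eta>s))"
    have "Y (gen g) = X (gen g)" for g
      using Y X(2)[of g] by (cases g rule: gen.cases) simp_all
    then show "Y = X" using adjointable_gen_eqI[of Y X] Y X(1) by blast
  qed
  then show ?thesis using X by simp
qed

lemma pa_adjointable: "pa a \<in> adjointable ipF" and pa_gen: "pa a (gen g) = gen (lact a g)"
  using phi_infinity_gen by blast+

text \<open>By \<open>ip_gen_cre\<close> the Gram matrix of the shifted generators is that of the
  generators twisted by the left action of \<open>ip \<xi> \<xi>\<close>, a bounded operator, so
  \<open>gram_extension\<close> applies.\<close>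

lemma creation_gen: "cr \<xi> \<in> adjointable ipF \<and> (\<forall>g. cr \<xi> (gen g) = gen (cre \<xi> g))"
proof -
  define v where "v = (\<lambda>(g, h). tensH (gen g) h)"
  define w where "w = (\<lambda>(g, h). tensH (gen (cre \<xi> g)) h)"
  have "cinner (w i) (w j) = cinner (v i) (\<rho> (pa (ip \<xi> \<xi>)) (v j))" for i j
    by (cases i; cases j) (simp add: v_def w_def T.cinner_tensH induced_rep_tensH[OF pa_adjointable] pa_gen ip_gen_cre)
  from gram_extension[OF bounded_clinear_induced_rep[OF pa_adjointable] this]
  obtain T where T: "bounded_clinear T" "\<And>i. T (v i) = w i" by metis
  have "T (tensH (gen g) h) = tensH (gen (cre \<xi> g)) h" for g h
    using T(2)[of "(g, h)"] by (simp add: v_def w_def)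
  from gen_operator_adjointable[OF T(1) this]
  obtain X where X: "X \<in> adjointable ipF" "\<And>g. X (gen g) = gen (cre \<xi> g)" by metis
  have "cr \<xi> = X"
    unfolding creation_def
  proof (rule the_equality)
    have "X (tens \<eta>s) = tens (\<xi> # \<eta>s)" if "\<eta>s \<noteq> []" for \<eta>s
      using X(2)[of "Inr (hd \<eta>s, tl \<eta>s)"] that by simp
    then show "X \<in> adjointable ipF \<and> (\<forall>a. X (vac a) = tens [act \<xi> a]) \<and> (\<forall>\<eta>s. \<eta>s \<noteq> [] \<longrightarrow> X (tens \<eta>s) = tens (\<xi> # \<eta>s))"
      using X(1) X(2)[of "Inl b" for b] by simp
  next
    fix Y assume Y: "Y \<in> adjointable ipF \<and> (\<forall>a. Y (vac a) = tens [act \<xi> a]) \<and> (\<forall>\<eta>s. \<eta>s \<noteq> [] \<longrightarrow> Y (tens \<eta>s) = tens (\<xi> # \<eta>s))"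
    have "Y (gen g) = X (gen g)" for g
      using Y X(2)[of g] by (cases g rule: gen.cases) simp_all
    then show "Y = X" using adjointable_gen_eqI[of Y X] Y X(1) by blast
  qed
  then show ?thesis using X by simp
qed

lemma cr_adjointable: "cr \<xi> \<in> adjointable ipF" and cr_gen: "cr \<xi> (gen g) = gen (cre \<xi> g)"
  using creation_gen by blast+

lemma ip_pa: "ipF (pa (star a) x) y = ipF x (pa a y)"
proof -
  obtain X where X: "X \<in> adjointable ipF" "\<And>x y. ipF (X x) y = ipF x (pa a y)"
    using F.adjointable_adjoint[OF pa_adjointable] by metis
  have "X = pa (star a)"
  proof (rule adjointable_gen_eqI[OF X(1) pa_adjointable])
    fix g
    have "X (gen g) - pa (star a) (gen g) = 0"
      by (rule gen_separating) (simp add: F.ip_diff_left X(2) pa_gen ip_gen_lact)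
    then show "X (gen g) = pa (star a) (gen g)" by simp
  qed
  then show ?thesis using X(2) by simp
qed

lemma pa_mult: "pa (a * b) x = pa a (pa b x)"
  using adjointable_gen_eqI[OF pa_adjointable F.adjointable_comp[OF pa_adjointable pa_adjointable], of "a * b" a b]
  by (simp add: pa_gen lact_mult fun_eq_iff)

lemma pa_one: "pa 1 x = x"
  using adjointable_gen_eqI[OF pa_adjointable F.adjointable_id, of 1] by (simp add: pa_gen lact_one fun_eq_iff)

lemma pa_add: "pa (a + b) = (\<lambda>x. pa a x + pa b x)"
  using cvec.subspace_add[OF F.csubspace_adjointable pa_adjointable[of a] pa_adjointable[of b]]
  by (intro adjointable_gen_eqI pa_adjointable) (simp_all add: pa_gen gen_lact_add plus_fun_def)

lemma pa_scaleC: "pa (c *\<^sub>C a) = (\<lambda>x. c *\<^sub>C pa a x)"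
  using cvec.subspace_scale[OF F.csubspace_adjointable pa_adjointable[of a], of c]
  by (intro adjointable_gen_eqI pa_adjointable) (simp_all add: pa_gen gen_lact_scaleC scaleC_fun_def)

lemma pa_cr: "pa a (cr \<xi> x) = cr (\<phi> a \<xi>) x"
  using adjointable_gen_eqI[OF F.adjointable_comp[OF pa_adjointable cr_adjointable] cr_adjointable, of a \<xi> "\<phi> a \<xi>"]
  by (simp add: pa_gen cr_gen lact_cre fun_eq_iff)

lemma ip_cr: "ipF (cr \<xi> x) (cr \<xi>' y) = ipF x (pa (ip \<xi> \<xi>') y)"
proof -
  obtain X where X: "X \<in> adjointable ipF" "\<And>x y. ipF (X x) y = ipF x (cr \<xi> y)" "\<And>x y. ipF (cr \<xi> x) y = ipF x (X y)"
    using F.adjointable_adjoint[OF cr_adjointable] by metis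
  have "(\<lambda>y. X (cr \<xi>' y)) = pa (ip \<xi> \<xi>')"
  proof (rule adjointable_gen_eqI[OF F.adjointable_comp[OF X(1) cr_adjointable] pa_adjointable])
    fix g
    have "X (cr \<xi>' (gen g)) - pa (ip \<xi> \<xi>') (gen g) = 0" (is "?D = 0")
    proof (rule gen_separating)
      fix g'
      have "ipF (gen g') ?D = 0"
        by (simp add: F.ip_diff_right X(3)[symmetric] cr_gen pa_gen ip_gen_cre)
      then show "ipF ?D (gen g') = 0" using F.ip_star[of ?D "gen g'"] by simp
    qed
    then show "X (cr \<xi>' (gen g)) = pa (ip \<xi> \<xi>') (gen g)" by simp
  qed
  then show ?thesis using X(3)[of x "cr \<xi>' y"] by (simp add: fun_eq_iff)
qed

abbreviation left_rep :: "'m \<Rightarrow> 'k \<Rightarrow> 'k" where "left_rep a \<equiv> \<rho> (pa a)"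

lemma left_rep_star_rep: "star_rep left_rep"
proof
  show "bounded_clinear (left_rep a)" for a by (rule bounded_clinear_induced_rep[OF pa_adjointable])
  show "left_rep (a + b) u = left_rep a u + left_rep b u" for a b u
    by (simp add: pa_add induced_rep_add[OF pa_adjointable pa_adjointable])
  show "left_rep (c *\<^sub>C a) u = c *\<^sub>C left_rep a u" for c a u
    by (simp add: pa_scaleC induced_rep_scaleC[OF pa_adjointable])
  show "left_rep (a * b) u = left_rep a (left_rep b u)" for a b u
    by (simp only: pa_mult[abs_def] induced_rep_comp[OF pa_adjointable pa_adjointable])
  show "cinner (left_rep (star a) u) v = cinner u (left_rep a v)" for a u v
    by (rule induced_rep_adjoint[OF pa_adjointable pa_adjointable ip_pa])
  show "left_rep 1 u = u" for u
    by (simp only: pa_one[abs_def] induced_rep_id)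
qed

lemma left_rep_normal: "(\<lambda>a. cinner u (left_rep a v)) \<in> P"
  by (rule star_rep.normal_of_total[OF left_rep_star_rep predual ccspan_gen])
    (auto simp: induced_rep_tensH[OF pa_adjointable] pa_gen T.cinner_tensH lact_normal)

end

subsection \<open>Fej\'er sums in graded Hilbert spaces\<close>

lemma bounded_tendsto_on_ccspan:
  fixes f :: "nat \<Rightarrow> 'a::cbanach \<Rightarrow> 'b::cbanach"
  assumes f: "\<And>n. bounded_clinear (f n)" "\<And>n x. norm (f n x) \<le> B * norm x" and g: "bounded_clinear g"
    and S: "\<And>x. x \<in> S \<Longrightarrow> (\<lambda>n. f n x) \<longlonglongrightarrow> g x" and x: "x \<in> ccspan S"
  shows "(\<lambda>n. f n x) \<longlonglongrightarrow> g x"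
proof (rule LIMSEQ_I)
  fix e :: real assume e: "e > 0"
  obtain C where C: "C > 0" "\<And>x. norm (g x) \<le> C * norm x" using clinear_bound_ex[OF g] by metis
  \<comment> \<open>An equicontinuity estimate. On a trivial space \<open>B\<close> could be
    negative, hence the maximum.\<close>
  define \<delta> where "\<delta> = e / (3 * (max B 0 + C))"
  have BC: "max B 0 + C > 0" using C(1) by simp
  then have \<delta>: "\<delta> > 0" using e by (simp add: \<delta>_def)
  then obtain y where y: "y \<in> cspan S" "dist y x < \<delta>" using x by (meson closure_approachable)
  have "(\<lambda>n. f n y) \<longlonglongrightarrow> g y" using y(1)
  proof (induction rule: cvec.span_induct)
    case base
    show "csubspace {y. (\<lambda>n. f n y) \<longlonglongrightarrow> g y}"
      by (auto simp: cvec.subspace_def clinear_zero[OF f(1)] clinear_zero[OF g] clinear_add[OF f(1)] clinear_add[OF g]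
          clinear_scaleC[OF f(1)] clinear_scaleC[OF g] intro: tendsto_add tendsto_scaleC)
  qed (rule S)
  then obtain n0 where n0: "\<And>n. n \<ge> n0 \<Longrightarrow> norm (f n y - g y) < e / 3" using LIMSEQ_D[of _ _ "e/3"] e by (metis zero_less_divide_iff zero_less_numeral)
  have small: "(max B 0 + C) * norm (x - y) \<le> e / 3"
  proof -
    have "(max B 0 + C) * norm (x - y) \<le> (max B 0 + C) * \<delta>"
      using y(2) BC by (intro mult_left_mono) (simp_all add: dist_norm norm_minus_commute)
    also have "\<dots> = e / 3" using BC unfolding \<delta>_def by (subst times_divide_eq_right) (simp del: distrib_left_numeral)
    finally show ?thesis .
  qed
  have "norm (f n x - g x) < e" if n: "n \<ge> n0" for n
  proof -
    have eq: "f n x - g x = f n (x - y) + (f n y - g y) - g (x - y)" by (simp add: clinear_diff[OF f(1)] clinear_diff[OF g])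
    have "norm (f n x - g x) \<le> norm (f n (x - y)) + norm (f n y - g y) + norm (g (x - y))"
      unfolding eq
      using norm_triangle_ineq[of "f n (x - y)" "f n y - g y"] norm_triangle_ineq4[of "f n (x - y) + (f n y - g y)" "g (x - y)"]
      by linarith
    also have "\<dots> < max B 0 * norm (x - y) + e / 3 + C * norm (x - y)"
    proof -
      have "norm (f n (x - y)) \<le> max B 0 * norm (x - y)"
        using f(2)[of n "x - y"] mult_right_mono[of B "max B 0" "norm (x - y)"] by simp
      then show ?thesis using n0[OF n] C(2)[of "x - y"] by linarith
    qed
    also have "\<dots> \<le> e" using small e by (simp add: distrib_right)
    finally show ?thesis .
  qed
  then show "\<exists>no. \<forall>n\<ge>no. norm (f n x - g x) < e" by blast
qed

lemma bounded_clinear_sum: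
  assumes "\<And>i. i \<in> A \<Longrightarrow> bounded_clinear (f i)" shows "bounded_clinear (\<lambda>x. \<Sum>i\<in>A. f i x)"
  using assms
proof (induction A rule: infinite_finite_induct)
  case (insert i A)
  then show ?case by (simp add: bounded_clinear_add)
qed (simp_all add: bounded_clinear_zero)

locale hilbert_grading =
  fixes Q :: "nat \<Rightarrow> 'k::chilbert \<Rightarrow> 'k"
  assumes Q_bounded: "bounded_clinear (Q n)"
    and Q_selfadjoint: "cinner (Q n x) y = cinner x (Q n y)"
    and Q_Q: "Q m (Q n x) = (if m = n then Q n x else 0)"
    and Q_total: "(\<And>n. Q n x = 0) \<Longrightarrow> x = 0"
begin

lemma cinner_Q_Q: "cinner (Q m x) (Q n y) = (if m = n then cinner (Q n x) y else 0)"
  by (simp add: Q_selfadjoint Q_Q)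

lemma norm_sum_Q: "finite A \<Longrightarrow> (norm (\<Sum>i\<in>A. Q i x))\<^sup>2 = (\<Sum>i\<in>A. (norm (Q i x))\<^sup>2)"
  by (simp add: norm_sq_cinner cinner_sum_left cinner_sum_right cinner_Q_Q)

lemma bessel: "finite A \<Longrightarrow> (\<Sum>i\<in>A. (norm (Q i x))\<^sup>2) \<le> (norm x)\<^sup>2"
proof -
  assume A: "finite A"
  define y where "y = (\<Sum>i\<in>A. Q i x)"
  have "cinner x y = (\<Sum>i\<in>A. cinner (Q i x) x)" by (simp add: y_def cinner_sum_right Q_selfadjoint)
  also have "\<dots> = cinner y y" by (simp add: y_def cinner_sum_left cinner_sum_right cinner_Q_Q A)
  finally have "cinner x y = cinner y y" .
  then have "(norm (x - y))\<^sup>2 = (norm x)\<^sup>2 - (norm y)\<^sup>2" by (simp add: norm_diff_sq norm_sq_cinner[of y])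
  then have "(norm y)\<^sup>2 \<le> (norm x)\<^sup>2" using zero_le_power2[of "norm (x - y)"] by linarith
  then show ?thesis by (simp add: y_def norm_sum_Q A)
qed

lemma norm_sum_Q_le: "finite A \<Longrightarrow> norm (\<Sum>i\<in>A. Q i x) \<le> norm x"
  using bessel[of A x] by (intro power2_le_imp_le[of "norm (\<Sum>i\<in>A. Q i x)"]) (simp_all add: norm_sum_Q)

lemma ccspan_range_Q: "ccspan {Q n x | n x. True} = UNIV"
  unfolding ccspan_eq_UNIV_iff
proof (rule equalityI; rule subsetI)
  fix x assume x: "x \<in> orth {Q n x | n x. True}"
  have "Q n x = 0" for n
  proof -
    have "cinner (Q n (Q n x)) x = 0" using x unfolding orth_def by blast
    then have "cinner (Q n x) (Q n x) = 0" by (simp add: Q_selfadjoint Q_Q)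
    then show ?thesis by (simp add: cinner_self_eq_0)
  qed
  then show "x \<in> {0}" using Q_total by simp
qed (simp add: orth_def)

lemma sums_Q: "(\<lambda>n. Q n x) sums x"
  unfolding sums_def
proof (rule bounded_tendsto_on_ccspan[where f = "\<lambda>n x. \<Sum>i<n. Q i x" and g = "\<lambda>x. x" and B = 1 and S = "{Q n x | n x. True}"])
  show "bounded_clinear (\<lambda>x. \<Sum>i<n. Q i x)" for n by (rule bounded_clinear_sum) (rule Q_bounded)
  show "norm (\<Sum>i<n. Q i x) \<le> 1 * norm x" for n x using norm_sum_Q_le[of "{..<n}" x] by simp
  show "x \<in> ccspan {Q n x | n x. True}" unfolding ccspan_range_Q by (rule UNIV_I)
  fix y assume "y \<in> {Q n x | n x. True}"
  then obtain m z where y: "y = Q m z" by blast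
  have "(\<lambda>i. if i = m then Q i z else 0) sums Q m z" by (rule sums_single)
  then show "(\<lambda>n. \<Sum>i<n. Q i y) \<longlonglongrightarrow> y" unfolding sums_def y Q_Q by (simp cong: if_cong)
qed (rule bounded_clinear_id)

text \<open>A vector \<open>T u\<close> is approximated by the Fej\'er means of its components \<open>v j\<close> of degree \<open>j\<close> relative
  to \<open>u\<close>. The means are uniformly bounded since \<open>N - \<bar>l - m\<bar>\<close> counts the windows of length \<open>N\<close> that contain
  \<open>l\<close> and \<open>m\<close>.\<close>

lemma fejer_orthogonal:
  assumes T: "bounded_clinear T" and tri: "\<And>l m x. l < m \<Longrightarrow> Q l (T (Q m x)) = 0"
    and v: "\<And>l j. Q l (v j) = (if j \<le> l then Q l (T (Q (l - j) u)) else 0)"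
    and y: "\<And>j. cinner y (v j) = 0"
  shows "cinner y (T u) = 0"
proof -
  define d where "d N = (\<Sum>j<N. (of_nat (N - j) / of_nat N) *\<^sub>C v j)" for N
  \<comment> \<open>Extending the sum to all \<open>j \<le> l\<close> is harmless:
    \<open>N - j\<close> is truncated to 0 for \<open>j \<ge> N\<close>.\<close>
  have Qd: "Q l (d N) = (\<Sum>j\<le>l. (of_nat (N - j) / of_nat N) *\<^sub>C Q l (T (Q (l - j) u)))" for l N
  proof -
    have "Q l (d N) = (\<Sum>j<N. (of_nat (N - j) / of_nat N) *\<^sub>C (if j \<le> l then Q l (T (Q (l - j) u)) else 0))"
      unfolding d_def by (simp add: clinear_sum[OF Q_bounded] clinear_scaleC[OF Q_bounded] v cong: sum.cong)
    also have "\<dots> = (\<Sum>j\<in>{..<N} \<inter> {..l}. (of_nat (N - j) / of_nat N) *\<^sub>C Q l (T (Q (l - j) u)))"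
      by (rule sum.mono_neutral_cong_right) auto
    also have "\<dots> = (\<Sum>j\<le>l. (of_nat (N - j) / of_nat N) *\<^sub>C Q l (T (Q (l - j) u)))"
      by (rule sum.mono_neutral_left) auto
    finally show ?thesis .
  qed
  \<comment> \<open>Indicator of the window of the \<open>N\<close> integers ending at
    \<open>k\<close>; for fixed \<open>i\<close> exactly \<open>N\<close> values of \<open>k\<close>
    qualify.\<close>
  define ch where "ch N k i = (of_bool (i \<le> k \<and> k < i + N) :: complex)" for N k i :: nat
  define Pw where "Pw N k A z = (\<Sum>i\<in>A. ch N k i *\<^sub>C Q i z)" for N k and A :: "nat set" and z
  have window: "(\<Sum>k<M + N. ch N k l * ch N k m) = of_nat (m + N - l)" if "m \<le> l" "l < M" for M N l m
  proof -
    have "(\<Sum>k<M + N. ch N k l * ch N k m) = (\<Sum>k\<in>{l..<m + N}. 1)"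
      using that by (intro sum.mono_neutral_cong_right) (auto simp: ch_def)
    then show ?thesis by simp
  qed
  have Pw_norm: "(\<Sum>k<L. (norm (Pw N k A z))\<^sup>2) \<le> real N * (norm z)\<^sup>2" if A: "finite A" for N L A z
  proof -
    have "(norm (Pw N k A z))\<^sup>2 = (\<Sum>i\<in>A. of_bool (i \<le> k \<and> k < i + N) * (norm (Q i z))\<^sup>2)" for k
    proof -
      have "Pw N k A z = (\<Sum>i\<in>{i \<in> A. i \<le> k \<and> k < i + N}. Q i z)"
        unfolding Pw_def by (rule sum.mono_neutral_cong_right) (auto simp: A ch_def)
      then have "(norm (Pw N k A z))\<^sup>2 = (\<Sum>i\<in>{i \<in> A. i \<le> k \<and> k < i + N}. (norm (Q i z))\<^sup>2)"
        using A by (simp add: norm_sum_Q)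
      also have "\<dots> = (\<Sum>i\<in>A. of_bool (i \<le> k \<and> k < i + N) * (norm (Q i z))\<^sup>2)"
        by (rule sum.mono_neutral_cong_left) (auto simp: A)
      finally show ?thesis .
    qed
    then have "(\<Sum>k<L. (norm (Pw N k A z))\<^sup>2) = (\<Sum>i\<in>A. (\<Sum>k<L. of_bool (i \<le> k \<and> k < i + N)) * (norm (Q i z))\<^sup>2)"
      unfolding sum_distrib_right by (subst sum.swap) simp
    also have "\<dots> \<le> (\<Sum>i\<in>A. real N * (norm (Q i z))\<^sup>2)"
    proof (intro sum_mono mult_right_mono zero_le_power2)
      fix i
      have "(\<Sum>k<L. of_bool (i \<le> k \<and> k < i + N)) = (\<Sum>k\<in>{..<L} \<inter> {i..<i + N}. 1 :: real)"
        by (rule sum.mono_neutral_cong_right) auto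
      also have "\<dots> \<le> (\<Sum>k\<in>{i..<i + N}. 1)" by (rule sum_mono2) auto
      finally show "(\<Sum>k<L. of_bool (i \<le> k \<and> k < i + N)) \<le> real N" by simp
    qed
    also have "\<dots> \<le> real N * (norm z)\<^sup>2"
      unfolding sum_distrib_left[symmetric] by (intro mult_left_mono bessel A) simp
    finally show ?thesis .
  qed
  have bound: "norm (d N) \<le> onorm T * norm u" if N: "N > 0" for N
  proof -
    \<comment> \<open>The truncation \<open>e\<close> is tested against itself. Writing the weights
      as window counts turns the pairing into a sum over windows of inner products with
      \<open>T\<close> in between, each bounded by the norm of \<open>T\<close>; the factors
      \<open>N\<close> cancel.\<close>
    have trunc: "norm (\<Sum>l<M. Q l (d N)) \<le> onorm T * norm u" for M
    proof -
      define e where "e = (\<Sum>l<M. Q l (d N))"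
      have Qe: "Q l e = (if l < M then Q l (d N) else 0)" for l
        by (simp add: e_def clinear_sum[OF Q_bounded] Q_Q)
      define b where "b l m = cinner (Q l e) (T (Q m u))" for l m
      have b0: "b l m = 0" if "l < m" for l m
      proof -
        have "b l m = cinner (Q l (Q l e)) (T (Q m u))" by (simp add: b_def Q_Q)
        also have "\<dots> = 0" by (simp only: Q_selfadjoint tri[OF that] cinner_zero_right)
        finally show ?thesis .
      qed
      have "of_nat N * cinner e e = of_nat N * (\<Sum>l<M. cinner (Q l e) (Q l (d N)))"
      proof -
        have "cinner e e = (\<Sum>l<M. cinner e (Q l (d N)))" by (subst (2) e_def) (rule cinner_sum_right)
        also have "\<dots> = (\<Sum>l<M. cinner (Q l e) (Q l (d N)))" by (simp add: Q_selfadjoint Q_Q)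
        finally show ?thesis by simp
      qed
      also have "\<dots> = (\<Sum>l<M. \<Sum>j\<le>l. of_nat (N - j) * b l (l - j))"
      proof (unfold sum_distrib_left, rule sum.cong[OF refl])
        fix l
        have "cinner (Q l e) (Q l z) = cinner (Q l e) z" for z by (simp add: cinner_Q_Q)
        then have "cinner (Q l e) (Q l (d N)) = (\<Sum>j\<le>l. (of_nat (N - j) / of_nat N) * b l (l - j))"
          unfolding Qd by (simp add: cinner_sum_right cinner_scaleC_right b_def)
        then show "of_nat N * cinner (Q l e) (Q l (d N)) = (\<Sum>j\<le>l. of_nat (N - j) * b l (l - j))"
          using N by (simp add: sum_distrib_left)
      qed
      also have "\<dots> = (\<Sum>l<M. \<Sum>m\<le>l. of_nat (m + N - l) * b l m)"
      proof (rule sum.cong[OF refl])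
        fix l
        show "(\<Sum>j\<le>l. of_nat (N - j) * b l (l - j)) = (\<Sum>m\<le>l. of_nat (m + N - l) * b l m)"
          by (rule sum.reindex_bij_witness[of _ "\<lambda>m. l - m" "\<lambda>j. l - j"]) auto
      qed
      also have "\<dots> = (\<Sum>l<M. \<Sum>m<M + N. (\<Sum>k<M + N. ch N k l * ch N k m) * b l m)"
      proof (rule sum.cong[OF refl])
        fix l assume l: "l \<in> {..<M}"
        show "(\<Sum>m\<le>l. of_nat (m + N - l) * b l m) = (\<Sum>m<M + N. (\<Sum>k<M + N. ch N k l * ch N k m) * b l m)"
          using l by (intro sum.mono_neutral_cong_left) (auto simp: window b0)
      qed
      also have "\<dots> = (\<Sum>k<M + N. \<Sum>l<M. \<Sum>m<M + N. ch N k l * ch N k m * b l m)"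
      proof -
        have "(\<Sum>l<M. \<Sum>m<M + N. (\<Sum>k<M + N. ch N k l * ch N k m) * b l m) = (\<Sum>l<M. \<Sum>k<M + N. \<Sum>m<M + N. ch N k l * ch N k m * b l m)"
          unfolding sum_distrib_right by (intro sum.cong[OF refl] sum.swap)
        also have "\<dots> = (\<Sum>k<M + N. \<Sum>l<M. \<Sum>m<M + N. ch N k l * ch N k m * b l m)" by (rule sum.swap)
        finally show ?thesis .
      qed
      also have "\<dots> = (\<Sum>k<M + N. cinner (Pw N k {..<M} e) (T (Pw N k {..<M + N} u)))"
      proof (rule sum.cong[OF refl])
        fix k
        have "cnj (ch N k l) = ch N k l" for l by (simp add: ch_def)
        then have "cinner (Pw N k {..<M} e) (T (Pw N k {..<M + N} u)) = (\<Sum>m<M + N. \<Sum>l<M. ch N k m * (ch N k l * b l m))"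
          unfolding Pw_def b_def
          by (simp only: clinear_sum[OF T] clinear_scaleC[OF T] cinner_sum_left cinner_sum_right cinner_scaleC_left
              cinner_scaleC_right sum_distrib_left)
        also have "\<dots> = (\<Sum>l<M. \<Sum>m<M + N. ch N k l * ch N k m * b l m)"
          by (subst sum.swap) (simp only: mult_ac)
        finally show "(\<Sum>l<M. \<Sum>m<M + N. ch N k l * ch N k m * b l m) = cinner (Pw N k {..<M} e) (T (Pw N k {..<M + N} u))" ..
      qed
      finally have eq: "of_nat N * cinner e e = (\<Sum>k<M + N. cinner (Pw N k {..<M} e) (T (Pw N k {..<M + N} u)))" .
      have "real N * (norm e)\<^sup>2 = cmod (of_nat N * cinner e e)" by (simp add: cinner_self norm_mult norm_power)
      also have "\<dots> \<le> (\<Sum>k<M + N. cmod (cinner (Pw N k {..<M} e) (T (Pw N k {..<M + N} u))))"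
        unfolding eq by (rule norm_sum)
      also have "\<dots> \<le> (\<Sum>k<M + N. onorm T * (norm (Pw N k {..<M} e) * norm (Pw N k {..<M + N} u)))"
      proof (rule sum_mono)
        fix k
        have "cmod (cinner (Pw N k {..<M} e) (T (Pw N k {..<M + N} u))) \<le> norm (Pw N k {..<M} e) * norm (T (Pw N k {..<M + N} u))"
          by (rule cauchy_schwarz)
        also have "\<dots> \<le> norm (Pw N k {..<M} e) * (onorm T * norm (Pw N k {..<M + N} u))"
          by (intro mult_left_mono clinear_bound[OF T] norm_ge_zero)
        finally show "cmod (cinner (Pw N k {..<M} e) (T (Pw N k {..<M + N} u))) \<le> onorm T * (norm (Pw N k {..<M} e) * norm (Pw N k {..<M + N} u))"
          by (simp add: mult_ac)
      qed
      also have "\<dots> = onorm T * (\<Sum>k<M + N. \<bar>norm (Pw N k {..<M} e)\<bar> * \<bar>norm (Pw N k {..<M + N} u)\<bar>)"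
        by (simp add: sum_distrib_left)
      also have "\<dots> \<le> onorm T * (L2_set (\<lambda>k. norm (Pw N k {..<M} e)) {..<M + N} * L2_set (\<lambda>k. norm (Pw N k {..<M + N} u)) {..<M + N})"
        by (intro mult_left_mono L2_set_mult_ineq onorm_pos_le bounded_clinear_linear T)
      also have "\<dots> \<le> onorm T * ((sqrt (real N) * norm e) * (sqrt (real N) * norm u))"
      proof (intro mult_left_mono mult_mono L2_set_nonneg)
        show "L2_set (\<lambda>k. norm (Pw N k {..<M} e)) {..<M + N} \<le> sqrt (real N) * norm e"
          unfolding L2_set_def using Pw_norm[of "{..<M}" N e "M + N"] real_sqrt_le_mono by (fastforce simp: real_sqrt_mult)
        show "L2_set (\<lambda>k. norm (Pw N k {..<M + N} u)) {..<M + N} \<le> sqrt (real N) * norm u"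
          unfolding L2_set_def using Pw_norm[of "{..<M + N}" N u "M + N"] real_sqrt_le_mono by (fastforce simp: real_sqrt_mult)
      qed (simp_all add: onorm_pos_le bounded_clinear_linear T)
      also have "\<dots> = real N * (onorm T * norm u * norm e)" by (simp add: algebra_simps)
      finally have "(norm e)\<^sup>2 \<le> (onorm T * norm u) * norm e" using N by simp
      then show ?thesis unfolding e_def[symmetric]
        by (rule norm_le_of_sq) (simp add: onorm_pos_le bounded_clinear_linear T)
    qed
    have "(\<lambda>M. norm (\<Sum>l<M. Q l (d N))) \<longlonglongrightarrow> norm (d N)"
      by (intro tendsto_norm sums_Q[unfolded sums_def])
    then show ?thesis by (rule LIMSEQ_le_const2) (use trunc in blast)
  qed
  have coeff: "(\<lambda>n. of_nat (Suc n - j) / of_nat (Suc n) :: complex) \<longlonglongrightarrow> 1" for j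
  proof -
    have "(\<lambda>n. 1 - of_nat j * (1 / of_nat (Suc n)) :: complex) \<longlonglongrightarrow> 1 - of_nat j * 0"
      by (intro tendsto_intros LIMSEQ_Suc[OF lim_1_over_n])
    then have "(\<lambda>n. 1 - of_nat j * (1 / of_nat (Suc n)) :: complex) \<longlonglongrightarrow> 1" by simp
    moreover have "\<forall>\<^sub>F n in sequentially. 1 - of_nat j * (1 / of_nat (Suc n)) = (of_nat (Suc n - j) / of_nat (Suc n) :: complex)"
      using eventually_ge_at_top[of j]
    proof eventually_elim
      case (elim n)
      then show ?case by (subst of_nat_diff) (simp_all add: divide_simps del: of_nat_Suc)
    qed
    ultimately show ?thesis by (rule Lim_transform_eventually)
  qed
  \<comment> \<open>By \<open>tri\<close> only degrees up to \<open>l\<close> of \<open>u\<close>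
    contribute, so each component of \<open>T u\<close> is a finite sum and the weights tend to 1
    termwise.\<close>
  have QT: "(\<Sum>j\<le>l. Q l (T (Q (l - j) u))) = Q l (T u)" for l
  proof -
    have "(\<lambda>M. Q l (T (\<Sum>m<M. Q m u))) \<longlonglongrightarrow> Q l (T u)"
      by (intro clinear_tendsto[OF Q_bounded] clinear_tendsto[OF T] sums_Q[unfolded sums_def])
    moreover have "\<forall>\<^sub>F M in sequentially. Q l (T (\<Sum>m<M. Q m u)) = (\<Sum>j\<le>l. Q l (T (Q (l - j) u)))"
      using eventually_gt_at_top[of l]
    proof eventually_elim
      case (elim M)
      have "Q l (T (\<Sum>m<M. Q m u)) = (\<Sum>m<M. Q l (T (Q m u)))" by (simp add: clinear_sum[OF Q_bounded] clinear_sum[OF T])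
      also have "\<dots> = (\<Sum>m\<le>l. Q l (T (Q m u)))"
        using elim tri by (intro sum.mono_neutral_right) auto
      also have "\<dots> = (\<Sum>j\<le>l. Q l (T (Q (l - j) u)))"
        by (rule sum.reindex_bij_witness[of _ "\<lambda>m. l - m" "\<lambda>j. l - j"]) auto
      finally show ?case .
    qed
    ultimately have "(\<lambda>M. (\<Sum>j\<le>l. Q l (T (Q (l - j) u)))) \<longlonglongrightarrow> Q l (T u)" by (rule Lim_transform_eventually)
    then show ?thesis by (simp add: LIMSEQ_const_iff)
  qed
  have "(\<lambda>n. cinner (d (Suc n)) y) \<longlonglongrightarrow> cinner (T u) y"
  proof (rule bounded_tendsto_on_ccspan[where S = "{Q n x | n x. True}" and B = "onorm T * norm u"])
    show "bounded_clinear (cinner (d (Suc n)))" "bounded_clinear (cinner (T u))" for n by (rule bounded_clinear_cinner)+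
    show "norm (cinner (d (Suc n)) x) \<le> onorm T * norm u * norm x" for n x
      using cauchy_schwarz[of "d (Suc n)" x] bound[of "Suc n"] mult_right_mono[of "norm (d (Suc n))" "onorm T * norm u" "norm x"] by simp
    show "y \<in> ccspan {Q n x | n x. True}" unfolding ccspan_range_Q by (rule UNIV_I)
    fix z assume "z \<in> {Q n x | n x. True}"
    then obtain l x where z: "z = Q l x" by blast
    have "(\<lambda>n. Q l (d (Suc n))) \<longlonglongrightarrow> (\<Sum>j\<le>l. 1 *\<^sub>C Q l (T (Q (l - j) u)))"
      unfolding Qd
    proof (intro tendsto_sum)
      fix j
      have "(\<lambda>n. norm ((of_nat (Suc n - j) / of_nat (Suc n)) *\<^sub>C Q l (T (Q (l - j) u)) - 1 *\<^sub>C Q l (T (Q (l - j) u)))) \<longlonglongrightarrow> 0 * norm (Q l (T (Q (l - j) u)))"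
        unfolding cvec.scale_left_diff_distrib[symmetric] norm_scaleC
        using tendsto_norm[OF LIM_zero[OF coeff]] by (intro tendsto_mult tendsto_const) simp
      then show "(\<lambda>n. (of_nat (Suc n - j) / of_nat (Suc n)) *\<^sub>C Q l (T (Q (l - j) u))) \<longlonglongrightarrow> 1 *\<^sub>C Q l (T (Q (l - j) u))"
        unfolding mult_zero_left tendsto_norm_zero_iff by (rule LIM_zero_cancel)
    qed
    then have "(\<lambda>n. Q l (d (Suc n))) \<longlonglongrightarrow> Q l (T u)" by (simp add: QT)
    then have "(\<lambda>n. cinner (Q l (d (Suc n))) x) \<longlonglongrightarrow> cinner (Q l (T u)) x" by (intro tendsto_cinner tendsto_const)
    then show "(\<lambda>n. cinner (d (Suc n)) z) \<longlonglongrightarrow> cinner (T u) z" by (simp add: z Q_selfadjoint)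
  qed
  moreover have "cinner (d (Suc n)) y = 0" for n
    unfolding d_def cinner_commute[of _ y] cinner_sum_right cinner_scaleC_right y by simp
  ultimately have "cinner (T u) y = 0" by (simp add: LIMSEQ_const_iff)
  then show ?thesis using cinner_commute[of y "T u"] by simp
qed

end

subsection \<open>The bicommutant of the generated algebra\<close>

text \<open>Domination makes the assignment from the orbit of \<open>z\<close> to the orbit of
  \<open>u\<close> well defined and bounded. Extended by 0 it still intertwines, because the
  complement of the orbit is invariant under \<open>\<pi>\<close> as well.\<close>

lemma star_rep_intertwiner:
  assumes \<pi>: "star_rep \<pi>" and \<sigma>: "star_rep \<sigma>" and le: "\<And>a. norm (\<sigma> a u) \<le> norm (\<pi> a z)"
  obtains W where "bounded_clinear W" "\<And>a h. W (\<pi> a h) = \<sigma> a (W h)" "W z = u"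
proof -
  interpret A: star_rep \<pi> by (rule \<pi>)
  interpret B: star_rep \<sigma> by (rule \<sigma>)
  have bound: "norm (\<Sum>a\<in>F. c a *\<^sub>C \<sigma> a u) \<le> 1 * norm (\<Sum>a\<in>F. c a *\<^sub>C \<pi> a z)" if "finite F" for F c
  proof -
    have "\<sigma> (\<Sum>a\<in>F. c a *\<^sub>C a) u = (\<Sum>a\<in>F. c a *\<^sub>C \<sigma> a u)" "\<pi> (\<Sum>a\<in>F. c a *\<^sub>C a) z = (\<Sum>a\<in>F. c a *\<^sub>C \<pi> a z)"
      using that by (induction F rule: finite_induct) (simp_all add: A.rep_add B.rep_add A.rep_scaleC B.rep_scaleC)
    then show ?thesis using le[of "\<Sum>a\<in>F. c a *\<^sub>C a"] by simp
  qed
  from operator_extension[where v = "\<lambda>a. \<pi> a z" and w = "\<lambda>a. \<sigma> a u", OF zero_le_one bound]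
  obtain W where W: "bounded_clinear W" "\<And>a. W (\<pi> a z) = \<sigma> a u" "\<And>x. x \<in> orth (range (\<lambda>a. \<pi> a z)) \<Longrightarrow> W x = 0"
    by metis
  define N where "N = ccspan (range (\<lambda>a. \<pi> a z))"
  have N: "csubspace N" "closed N" by (simp_all add: N_def)
  have "W (\<pi> a h) = \<sigma> a (W h)" for a h
  proof -
    have "W (\<pi> a (proj N h)) = \<sigma> a (W (proj N h))"
    proof (rule clinear_eq_on_ccspan[where f = "\<lambda>x. W (\<pi> a x)" and g = "\<lambda>x. \<sigma> a (W x)"])
      show "bounded_clinear (\<lambda>x. W (\<pi> a x))" by (rule bounded_clinear_comp[OF W(1) A.rep_bounded])
      show "bounded_clinear (\<lambda>x. \<sigma> a (W x))" by (rule bounded_clinear_comp[OF B.rep_bounded W(1)])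
      show "proj N h \<in> ccspan (range (\<lambda>a. \<pi> a z))" using proj_in[OF N] by (simp add: N_def)
      fix x assume "x \<in> range (\<lambda>a. \<pi> a z)"
      then obtain b where x: "x = \<pi> b z" by blast
      show "W (\<pi> a x) = \<sigma> a (W x)" unfolding x A.rep_mult[symmetric] W(2) B.rep_mult ..
    qed
    moreover have q: "h - proj N h \<in> orth (range (\<lambda>a. \<pi> a z))"
      using proj_orth[OF N, of h] by (simp add: N_def orth_ccspan)
    moreover have "\<pi> a (h - proj N h) \<in> orth (range (\<lambda>a. \<pi> a z))"
      unfolding orth_def
    proof (intro CollectI ballI)
      fix x assume "x \<in> range (\<lambda>a. \<pi> a z)"
      then obtain b where x: "x = \<pi> b z" by blast
      have "cinner x (\<pi> a (h - proj N h)) = cinner (\<pi> (star a * b) z) (h - proj N h)"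
        by (simp add: x A.rep_mult A.rep_star)
      also have "\<dots> = 0" using q unfolding orth_def by blast
      finally show "cinner x (\<pi> a (h - proj N h)) = 0" .
    qed
    ultimately have "W (\<pi> a (proj N h)) + W (\<pi> a (h - proj N h)) = \<sigma> a (W (proj N h)) + \<sigma> a (W (h - proj N h))"
      using W(3) clinear_zero[OF B.rep_bounded] by simp
    then show ?thesis
      by (simp add: clinear_add[OF W(1), symmetric] clinear_add[OF A.rep_bounded, symmetric] clinear_add[OF B.rep_bounded, symmetric])
  qed
  moreover have "W z = u" using W(2)[of 1] by (simp add: A.rep_one B.rep_one)
  ultimately show ?thesis
    by (rule \<open>\<And>W. bounded_clinear W \<Longrightarrow> (\<And>a h. W (\<pi> a h) = \<sigma> a (W h)) \<Longrightarrow> W z = u \<Longrightarrow> thesis\<close>[OF W(1)])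
qed

context fock_tensor
begin

primrec tcr :: "'e list \<Rightarrow> 'f \<Rightarrow> 'f" where
  "tcr [] = (\<lambda>\<eta>. \<eta>)"
| "tcr (x # xs) = (\<lambda>\<eta>. cr x (tcr xs \<eta>))"

text \<open>Agrees with \<open>tens\<close> on nonempty lists and gives the vacuum for
  \<open>[]\<close>, where \<open>tens\<close> is unspecified. All degrees are thus treated
  alike.\<close>

definition elt :: "'e list \<Rightarrow> 'f" where "elt xs = tcr xs (vac 1)"

definition ev :: "'e list \<Rightarrow> 'h \<Rightarrow> 'k" where "ev xs h = tensH (elt xs) h"

definition C :: "'e list \<Rightarrow> 'k \<Rightarrow> 'k" where "C xs = \<rho> (tcr xs)"

lemma tcr_adjointable: "tcr xs \<in> adjointable ipF"
  by (induction xs) (simp_all add: F.adjointable_id F.adjointable_comp[OF cr_adjointable])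

lemma tcr_append: "tcr (xs @ ys) \<eta> = tcr xs (tcr ys \<eta>)"
  by (induction xs) simp_all

lemma elt_Cons: "elt (x # xs) = gen (Inr (x, xs))"
proof (induction xs arbitrary: x)
  case Nil
  show ?case using cr_gen[of x "Inl 1"] by (simp add: elt_def E.act_one)
next
  case (Cons y ys)
  have "elt (x # y # ys) = cr x (elt (y # ys))" by (simp add: elt_def)
  then show ?case using cr_gen[of x "Inr (y, ys)"] by (simp add: Cons)
qed

lemma elt_Nil: "elt [] = gen (Inl 1)"
  by (simp add: elt_def)

lemma ip_elt_orthogonal: "length xs \<noteq> length ys \<Longrightarrow> ipF (elt xs) (elt ys) = 0"
  by (cases xs; cases ys) (simp_all add: elt_Cons elt_Nil gen_orthogonal del: gen.simps)

lemma pa_elt: "pa a (elt (x # xs)) = elt (\<phi> a x # xs)"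
  unfolding elt_Cons pa_gen by simp

lemma vac_eq: "vac b = actF (elt []) b"
proof -
  have "ipF (gen g) (vac b - actF (elt []) b) = 0" for g
  proof (cases g rule: gen.cases)
    case (1 c)
    then show ?thesis by (simp add: F.ip_diff_right F.ip_act_right elt_def K.ip_vac)
  next
    case (2 x xs)
    then show ?thesis using gen_orthogonal[of g "Inl c" for c] by (simp add: F.ip_diff_right F.ip_act_right elt_def)
  qed
  then have "ipF (vac b - actF (elt []) b) (gen g) = 0" for g using F.ip_star[of _ "gen g"] by (metis star_zero)
  then have "vac b - actF (elt []) b = 0" by (rule gen_separating)
  then show ?thesis by simp
qed

lemma tensH_vac: "tensH (vac b) h = ev [] (\<pi> b h)"
  by (simp add: vac_eq tensH_act ev_def)

lemma ccspan_ev: "ccspan {ev xs h | xs h. True} = UNIV"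
proof -
  have "ccspan {tensH (gen g) h | g h. True} \<subseteq> ccspan {ev xs h | xs h. True}"
  proof (rule ccspan_minimal)
    show "{tensH (gen g) h | g h. True} \<subseteq> ccspan {ev xs h | xs h. True}"
    proof
      fix u assume "u \<in> {tensH (gen g) h | g h. True}"
      then obtain g h where u: "u = tensH (gen g) h" by blast
      have "u \<in> {ev xs h | xs h. True}"
      proof (cases g rule: gen.cases)
        case (1 b)
        then show ?thesis using tensH_vac[of b h] u by auto
      next
        case (2 x xs)
        then have "u = ev (x # xs) h" using u elt_Cons[of x xs] by (simp add: ev_def)
        then show ?thesis by blast
      qed
      then show "u \<in> ccspan {ev xs h | xs h. True}" by (rule ccspan_superset)
    qed
  qed simp_all
  then show ?thesis unfolding ccspan_gen by blast
qed

lemma ev_operator_eqI: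
  assumes "bounded_clinear S" "bounded_clinear T" "\<And>xs h. S (ev xs h) = T (ev xs h)"
  shows "S u = T u"
proof (rule clinear_eq_on_ccspan[OF assms(1,2)])
  show "u \<in> ccspan {ev xs h | xs h. True}" unfolding ccspan_ev by (rule UNIV_I)
qed (use assms(3) in blast)

lemma left_rep_ev_Cons: "left_rep a (ev (x # xs) h) = ev (\<phi> a x # xs) h"
  by (simp add: ev_def induced_rep_tensH[OF pa_adjointable] pa_elt)

lemma left_rep_ev_Nil: "left_rep a (ev [] h) = ev [] (\<pi> a h)"
proof -
  have "pa a (elt []) = vac a" using pa_gen[of a "Inl 1"] by (simp add: elt_def)
  then show ?thesis unfolding ev_def induced_rep_tensH[OF pa_adjointable] by (simp only: tensH_vac ev_def)
qed

lemma left_rep_ev: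
  obtains ys k where "left_rep a (ev xs h) = ev ys k" "length ys = length xs"
proof (cases xs)
  case Nil
  then show ?thesis using \<open>\<And>ys k. left_rep a (ev xs h) = ev ys k \<Longrightarrow> length ys = length xs \<Longrightarrow> thesis\<close> left_rep_ev_Nil by blast
next
  case (Cons x xs')
  then show ?thesis using \<open>\<And>ys k. left_rep a (ev xs h) = ev ys k \<Longrightarrow> length ys = length xs \<Longrightarrow> thesis\<close>
      left_rep_ev_Cons[of a x xs' h] by simp
qed

lemma bounded_clinear_left_rep: "bounded_clinear (left_rep a)"
  by (rule bounded_clinear_induced_rep[OF pa_adjointable])

lemma bounded_clinear_C: "bounded_clinear (C xs)"
  unfolding C_def by (rule bounded_clinear_induced_rep[OF tcr_adjointable])

lemma C_Nil: "C [] u = u"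
  by (simp add: C_def induced_rep_id)

lemma C_Cons: "C (x # xs) u = \<rho> (cr x) (C xs u)"
  unfolding C_def tcr.simps induced_rep_comp[OF cr_adjointable tcr_adjointable] ..

lemma C_ev: "C xs (ev ys h) = ev (xs @ ys) h"
  by (simp add: C_def ev_def induced_rep_tensH[OF tcr_adjointable] elt_def tcr_append)

lemma left_rep_C: "left_rep a (C (x # xs) u) = C (\<phi> a x # xs) u"
proof -
  have "left_rep a (C (x # xs) u) = \<rho> (\<lambda>\<eta>. pa a (tcr (x # xs) \<eta>)) u"
    unfolding C_def induced_rep_comp[OF pa_adjointable tcr_adjointable] ..
  then show ?thesis by (simp add: C_def pa_cr)
qed

text \<open>The relation \<open>ip_cr\<close>, iterated along words of equal length: the innermost
  coefficient is the inner product of the two elementary tensors.\<close>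

lemma ip_tcr: "length xs = length ys \<Longrightarrow> ipF (tcr xs \<eta>) (tcr ys \<zeta>) = ipF \<eta> (pa (ipF (elt xs) (elt ys)) \<zeta>)"
proof (induction xs arbitrary: ys \<eta> \<zeta>)
  case Nil
  then show ?case by (simp add: elt_def K.ip_vac pa_one)
next
  case (Cons x xs)
  from Cons.prems obtain y zs where ys: "ys = y # zs" "length xs = length zs" by (cases ys) auto
  have eq: "ipF (elt (x # xs)) (elt ys) = ipF (elt xs) (pa (ip x y) (elt zs))"
    by (simp add: elt_def ip_cr ys)
  have "ipF (tcr (x # xs) \<eta>) (tcr ys \<zeta>) = ipF (tcr xs \<eta>) (pa (ip x y) (tcr zs \<zeta>))" by (simp add: ip_cr ys)
  also have "\<dots> = ipF \<eta> (pa (ipF (elt xs) (pa (ip x y) (elt zs))) \<zeta>)"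
  proof (cases zs)
    case Nil
    then have "xs = []" using ys(2) by simp
    then show ?thesis
      using pa_gen[of "ip x y" "Inl 1"] by (simp add: Nil elt_def K.ip_vac)
  next
    case zs: (Cons z zs')
    have "length xs = length (\<phi> (ip x y) z # zs')" using zs ys(2) by simp
    from Cons.IH[OF this] show ?thesis by (simp add: zs pa_cr pa_elt)
  qed
  finally show ?case unfolding eq .
qed

end

section \<open>Grading by tensor degree, and operators commuting with the generated algebra\<close>

context fock_tensor
begin

lemma cinner_C:
  assumes len: "length xs = length ys"
  shows "cinner (C xs u) (C ys v) = cinner u (left_rep (ipF (elt xs) (elt ys)) v)"
proof -
  obtain X where X: "X \<in> adjointable ipF" "\<And>x y. ipF (X x) y = ipF x (tcr xs y)" "\<And>x y. ipF (tcr xs x) y = ipF x (X y)"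
    using F.adjointable_adjoint[OF tcr_adjointable] by metis
  have "X (tcr ys \<zeta>) = pa (ipF (elt xs) (elt ys)) \<zeta>" for \<zeta>
    by (rule F.ip_eqI') (simp add: X(3)[symmetric] ip_tcr[OF len])
  then have eq: "(\<lambda>\<zeta>. X (tcr ys \<zeta>)) = pa (ipF (elt xs) (elt ys))" by (rule ext)
  have "cinner (C xs u) (C ys v) = cinner u (\<rho> X (C ys v))"
    unfolding C_def by (rule induced_rep_adjoint[OF X(1) tcr_adjointable X(3)])
  also have "\<rho> X (C ys v) = left_rep (ipF (elt xs) (elt ys)) v"
    unfolding C_def eq[symmetric] induced_rep_comp[OF X(1) tcr_adjointable] ..
  finally show ?thesis .
qed

definition degree :: "nat \<Rightarrow> 'k set" where "degree n = ccspan {ev xs h | xs h. length xs = n}"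

definition Q :: "nat \<Rightarrow> 'k \<Rightarrow> 'k" where "Q n = proj (degree n)"

lemma degree_subspace: "csubspace (degree n)" "closed (degree n)"
  by (simp_all add: degree_def)

lemma Q_ev: "Q n (ev xs h) = (if length xs = n then ev xs h else 0)"
proof (cases "length xs = n")
  case True
  then have "ev xs h \<in> degree n" unfolding degree_def by (intro ccspan_superset) blast
  then show ?thesis using True proj_eq_iff[OF degree_subspace] by (simp add: Q_def)
next
  case False
  then have "ev xs h \<in> orth (degree n)"
    unfolding degree_def orth_ccspan by (auto simp: orth_def ev_def T.cinner_tensH ip_elt_orthogonal)
  then show ?thesis using False proj_eq_0_iff[OF degree_subspace] by (simp add: Q_def)
qed

lemma bounded_clinear_Q: "bounded_clinear (Q n)"
  unfolding Q_def by (rule bounded_clinear_proj[OF degree_subspace])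

lemma Q_grading: "hilbert_grading Q"
proof
  show "bounded_clinear (Q n)" for n by (rule bounded_clinear_Q)
  show sa: "cinner (Q n x) y = cinner x (Q n y)" for n x y
    unfolding Q_def by (rule proj_selfadjoint[OF degree_subspace])
  show "Q m (Q n x) = (if m = n then Q n x else 0)" for m n x
  proof (rule ev_operator_eqI[where S = "\<lambda>x. Q m (Q n x)" and T = "\<lambda>x. if m = n then Q n x else 0"])
    show "bounded_clinear (\<lambda>x. Q m (Q n x))" by (rule bounded_clinear_comp[OF bounded_clinear_Q bounded_clinear_Q])
    show "bounded_clinear (\<lambda>x. if m = n then Q n x else 0)"
      by (cases "m = n") (simp_all add: bounded_clinear_Q bounded_clinear_zero)
  qed (simp add: Q_ev clinear_zero[OF bounded_clinear_Q])
  fix x assume x: "\<And>n. Q n x = 0"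
  have "x \<in> orth {ev xs h | xs h. True}"
    unfolding orth_def
  proof (intro CollectI ballI)
    fix y assume "y \<in> {ev xs h | xs h. True}"
    then obtain xs h where y: "y = ev xs h" by blast
    have "cinner y x = cinner (Q (length xs) y) x" by (simp add: y Q_ev)
    then show "cinner y x = 0" by (simp add: sa x)
  qed
  then show "x = 0" using ccspan_ev ccspan_eq_UNIV_iff by blast
qed

sublocale Q: hilbert_grading Q by (rule Q_grading)

lemma Q_left_rep: "Q n (left_rep a u) = left_rep a (Q n u)"
proof (rule ev_operator_eqI[where S = "\<lambda>u. Q n (left_rep a u)" and T = "\<lambda>u. left_rep a (Q n u)"])
  show "bounded_clinear (\<lambda>u. Q n (left_rep a u))" "bounded_clinear (\<lambda>u. left_rep a (Q n u))"
    by (rule bounded_clinear_comp[OF bounded_clinear_Q bounded_clinear_left_rep]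
        bounded_clinear_comp[OF bounded_clinear_left_rep bounded_clinear_Q])+
  fix xs h
  obtain ys k where "left_rep a (ev xs h) = ev ys k" "length ys = length xs" by (rule left_rep_ev)
  then show "Q n (left_rep a (ev xs h)) = left_rep a (Q n (ev xs h))"
    by (simp add: Q_ev clinear_zero[OF bounded_clinear_left_rep])
qed

lemma Q_C: "Q l (C xs u) = (if length xs \<le> l then C xs (Q (l - length xs) u) else 0)"
proof (rule ev_operator_eqI[where S = "\<lambda>u. Q l (C xs u)" and T = "\<lambda>u. if length xs \<le> l then C xs (Q (l - length xs) u) else 0"])
  show "bounded_clinear (\<lambda>u. Q l (C xs u))" by (rule bounded_clinear_comp[OF bounded_clinear_Q bounded_clinear_C])
  show "bounded_clinear (\<lambda>u. if length xs \<le> l then C xs (Q (l - length xs) u) else 0)"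
    by (cases "length xs \<le> l") (simp_all add: bounded_clinear_zero bounded_clinear_comp[OF bounded_clinear_C bounded_clinear_Q])
  fix ys h
  show "Q l (C xs (ev ys h)) = (if length xs \<le> l then C xs (Q (l - length xs) (ev ys h)) else 0)"
    by (auto simp: C_ev Q_ev clinear_zero[OF bounded_clinear_C])
qed

abbreviation alg0 :: "('f \<Rightarrow> 'f) set" where "alg0 \<equiv> generated_algebra (range cr \<union> range pa)"

lemma alg0_adjointable: "A \<in> alg0 \<Longrightarrow> A \<in> adjointable ipF"
proof (induction rule: generated_algebra.induct)
  case (base T)
  then show ?case using cr_adjointable pa_adjointable by blast
next
  case (add S T)
  then show ?case using cvec.subspace_add[OF F.csubspace_adjointable, of S T] by (simp add: plus_fun_def)
next
  case (scaleC T c)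
  then show ?case using cvec.subspace_scale[OF F.csubspace_adjointable, of T c] by (simp add: scaleC_fun_def)
next
  case (comp S T)
  then show ?case using F.adjointable_comp[of S T] by (simp add: comp_def)
qed

lemma csubspace_alg0: "csubspace alg0"
proof -
  have "(\<lambda>x. 0 *\<^sub>C pa 0 x) \<in> alg0" by (intro generated_algebra.intros) blast
  then have "0 \<in> alg0" by (simp add: zero_fun_def)
  then show ?thesis
    unfolding cvec.subspace_def plus_fun_def scaleC_fun_def using generated_algebra.add generated_algebra.scaleC by blast
qed

lemma pa_alg0: "pa a \<in> alg0" and cr_alg0: "cr x \<in> alg0"
  by (auto intro: generated_algebra.base)

lemma tcr_alg0: "tcr xs \<in> alg0"
proof (induction xs)
  case Nil
  have "pa 1 = (\<lambda>x. x)" by (rule ext) (rule pa_one)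
  then show ?case using pa_alg0[of 1] by simp
next
  case (Cons x xs)
  from generated_algebra.comp[OF cr_alg0[of x] this] show ?case by (simp add: comp_def)
qed

lemma alg0_commutantI:
  assumes S: "bounded_clinear S" and cr: "\<And>x u. S (\<rho> (cr x) u) = \<rho> (cr x) (S u)"
    and left: "\<And>a u. S (left_rep a u) = left_rep a (S u)"
  shows "S \<in> commutant (\<rho> ` alg0)"
proof -
  have "\<forall>u. S (\<rho> A u) = \<rho> A (S u)" if "A \<in> alg0" for A using that
  proof (induction rule: generated_algebra.induct)
    case (base T)
    then show ?case using cr left by blast
  next
    case (add S' T)
    then show ?case
      unfolding induced_rep_add[OF alg0_adjointable[OF add.hyps(1)] alg0_adjointable[OF add.hyps(2)]]
      by (simp add: clinear_add[OF S])
  next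
    case (scaleC T c)
    then show ?case
      unfolding induced_rep_scaleC[OF alg0_adjointable[OF scaleC.hyps]] by (simp add: clinear_scaleC[OF S])
  next
    case (comp S' T)
    then show ?case
      unfolding comp_def induced_rep_comp[OF alg0_adjointable[OF comp.hyps(1)] alg0_adjointable[OF comp.hyps(2)]] by simp
  qed
  then show ?thesis using S unfolding commutant_def by blast
qed

lemma right_op_commutant:
  assumes S: "S \<in> commutant (range \<pi>)" shows "right_op S \<in> commutant (\<rho> ` alg0)"
  by (rule alg0_commutantI[OF bounded_clinear_right_op[OF S]])
    (simp_all add: right_op_commutes[OF S] cr_adjointable pa_adjointable)

text \<open>For words of equal length the Gram matrix is twisted by the adjoint of \<open>V\<close>
  times \<open>V\<close>, which lies in the commutant of \<open>\<pi>\<close>; different lengths are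
  orthogonal on both sides. It is used with all words when \<open>V\<close> has values in one
  degree, and with words of one fixed length for arbitrary \<open>V\<close>.\<close>

lemma creation_extension:
  assumes V: "bounded_clinear V" "\<And>a h. V (\<pi> a h) = left_rep a (V h)"
    and orth: "\<And>xs ys h k. xs \<in> I \<Longrightarrow> ys \<in> I \<Longrightarrow> length xs \<noteq> length ys \<Longrightarrow> cinner (C xs (V h)) (C ys (V k)) = 0"
  shows "\<exists>S. bounded_clinear S \<and> (\<forall>xs\<in>I. \<forall>h. S (ev xs h) = C xs (V h))"
proof -
  obtain V' where V': "bounded_clinear V'" "\<And>x y. cinner x (V' y) = cinner (V x) y" using adjoint_exists[OF V(1)] by metis
  have comm: "(\<lambda>h. V' (V h)) \<in> commutant (range \<pi>)"
    unfolding commutant_def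
  proof (intro CollectI conjI ballI allI)
    show "bounded_clinear (\<lambda>h. V' (V h))" by (rule bounded_clinear_comp[OF V'(1) V(1)])
    fix A h assume "A \<in> range \<pi>"
    then obtain a where A: "A = \<pi> a" by blast
    have "cinner k (V' (left_rep a u)) = cinner k (\<pi> a (V' u))" for k u
    proof -
      have "cinner k (V' (left_rep a u)) = cinner (left_rep (star a) (V k)) u"
        by (simp add: V'(2) star_rep.rep_star[OF left_rep_star_rep])
      also have "\<dots> = cinner k (\<pi> a (V' u))" by (simp add: V(2)[symmetric] V'(2)[symmetric] rep_star)
      finally show ?thesis .
    qed
    then show "V' (V (A h)) = A (V' (V h))" unfolding A V(2) by (rule cinner_eqI)
  qed
  define v where "v = (\<lambda>(xs, h). if xs \<in> I then ev xs h else 0)"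
  define w where "w = (\<lambda>(xs, h). if xs \<in> I then C xs (V h) else 0)"
  have "cinner (w i) (w j) = cinner (v i) (right_op (\<lambda>h. V' (V h)) (v j))" for i j
  proof -
    obtain xs h ys k where ij: "i = (xs, h)" "j = (ys, k)" by (cases i; cases j)
    show ?thesis
    proof (cases "xs \<in> I \<and> ys \<in> I")
      case False
      then show ?thesis by (auto simp: ij v_def w_def clinear_zero[OF bounded_clinear_right_op[OF comm]])
    next
      case True
      then have "cinner (v i) (right_op (\<lambda>h. V' (V h)) (v j)) = cinner h (\<pi> (ipF (elt xs) (elt ys)) (V' (V k)))"
        by (simp add: ij v_def ev_def right_op_tensH[OF comm] T.cinner_tensH)
      also have "\<dots> = cinner (w i) (w j)"
      proof (cases "length xs = length ys")
        case False
        then show ?thesis using True by (simp add: ij w_def orth ip_elt_orthogonal)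
      next
        case len: True
        let ?c = "ipF (elt xs) (elt ys)"
        have "\<pi> ?c (V' (V k)) = V' (V (\<pi> ?c k))" using comm by (simp add: commutant_def)
        then show ?thesis using True by (simp add: ij w_def cinner_C[OF len] V'(2) V(2))
      qed
      finally show ?thesis ..
    qed
  qed
  from gram_extension[OF bounded_clinear_right_op[OF comm] this]
  obtain S where S: "bounded_clinear S" "\<And>i. S (v i) = w i" by metis
  have "S (ev xs h) = C xs (V h)" if "xs \<in> I" for xs h
    using S(2)[of "(xs, h)"] that by (simp add: v_def w_def)
  then show ?thesis using S(1) by blast
qed

end

context fock_tensor
begin

text \<open>\<open>left_rep\<close> is normal, so \<open>vec\<close> makes its functional at
  \<open>u\<close> a single vector functional of \<open>\<pi>\<close>. This is what the
  amplification in the final argument is for.\<close>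

lemma vacuum_factorization:
  assumes vec: "\<And>\<omega>. \<omega> \<in> P \<Longrightarrow> \<exists>x y. \<forall>a. \<omega> a = cinner x (\<pi> a y)"
  obtains z W where "bounded_clinear W" "\<And>a h. W (\<pi> a h) = left_rep a (W h)" "W z = u"
proof -
  interpret L: star_rep left_rep by (rule left_rep_star_rep)
  obtain x y where xy: "\<And>a. cinner u (left_rep a u) = cinner x (\<pi> a y)"
    using vec[OF left_rep_normal] by metis
  \<comment> \<open>\<open>\<langle>x, \<pi>(a\<^sup>* a) y\<rangle> = \<parallel>left_rep a u\<parallel>\<^sup>2\<close> is real, so it is at most \<open>\<parallel>\<pi> a ((x + y) / 2)\<parallel>\<^sup>2\<close>.\<close>
  define z where "z = (1/2) *\<^sub>R (x + y)"
  have "norm (left_rep a u) \<le> norm (\<pi> a z)" for a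
  proof (rule power2_le_imp_le)
    have "complex_of_real ((norm (left_rep a u))\<^sup>2) = cinner (\<pi> a x) (\<pi> a y)"
      unfolding L.norm_rep_sq xy rep_mult rep_star' ..
    then have "(norm (left_rep a u))\<^sup>2 = Re (cinner (\<pi> a x) (\<pi> a y))" by (metis Re_complex_of_real)
    moreover have "4 * (norm (\<pi> a z))\<^sup>2 = (norm (\<pi> a x + \<pi> a y))\<^sup>2"
      by (simp add: z_def bounded_clinear_linear[OF rep_bounded, THEN linear_simps(5)] clinear_add[OF rep_bounded] power_divide)
    moreover have "2 * Re (cinner (\<pi> a x) (\<pi> a y)) \<le> (norm (\<pi> a x))\<^sup>2 + (norm (\<pi> a y))\<^sup>2"
      using norm_diff_sq[of "\<pi> a x" "\<pi> a y"] zero_le_power2[of "norm (\<pi> a x - \<pi> a y)"] by linarith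
    ultimately show "(norm (left_rep a u))\<^sup>2 \<le> (norm (\<pi> a z))\<^sup>2" by (simp add: norm_add_sq)
  qed simp
  from star_rep_intertwiner[OF star_rep_axioms left_rep_star_rep this]
  obtain W where "bounded_clinear W" "\<And>a h. W (\<pi> a h) = left_rep a (W h)" "W z = u" by metis
  then show ?thesis
    by (rule \<open>\<And>W z. bounded_clinear W \<Longrightarrow> (\<And>a h. W (\<pi> a h) = left_rep a (W h)) \<Longrightarrow> W z = u \<Longrightarrow> thesis\<close>)
qed

text \<open>\<open>Q k\<close> commutes with the left action, so \<open>Q k\<close> after
  \<open>W\<close> still intertwines. Its values have degree \<open>k\<close>, so words of different
  lengths are sent to different degrees; the extension raises degrees by \<open>k\<close>.\<close>

lemma shift_operator:
  assumes W: "bounded_clinear W" "\<And>a h. W (\<pi> a h) = left_rep a (W h)"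
  shows "\<exists>S\<in>commutant (\<rho> ` alg0). (\<forall>xs h. S (ev xs h) = C xs (Q k (W h))) \<and>
    (\<forall>l u. Q l (S u) = (if k \<le> l then S (Q (l - k) u) else 0))"
proof -
  have CQ: "C xs (Q k w) = Q (length xs + k) (C xs w)" for xs w by (simp add: Q_C)
  have "\<exists>S. bounded_clinear S \<and> (\<forall>xs\<in>UNIV. \<forall>h. S (ev xs h) = C xs (Q k (W h)))"
  proof (rule creation_extension)
    show "bounded_clinear (\<lambda>h. Q k (W h))" by (rule bounded_clinear_comp[OF bounded_clinear_Q W(1)])
    show "Q k (W (\<pi> a h)) = left_rep a (Q k (W h))" for a h by (simp add: W(2) Q_left_rep)
    show "cinner (C xs (Q k (W h))) (C ys (Q k (W h'))) = 0" if "length xs \<noteq> length ys" for xs ys h h'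
      using that by (simp add: CQ Q.cinner_Q_Q)
  qed
  then obtain S where S: "bounded_clinear S" "\<And>xs h. S (ev xs h) = C xs (Q k (W h))" by blast
  have "S \<in> commutant (\<rho> ` alg0)"
  proof (rule alg0_commutantI[OF S(1)])
    have b: "bounded_clinear (\<rho> (cr x))" for x by (rule bounded_clinear_induced_rep[OF cr_adjointable])
    show "S (\<rho> (cr x) u) = \<rho> (cr x) (S u)" for x u
    proof (rule ev_operator_eqI[where S = "\<lambda>u. S (\<rho> (cr x) u)" and T = "\<lambda>u. \<rho> (cr x) (S u)"])
      show "bounded_clinear (\<lambda>u. S (\<rho> (cr x) u))" "bounded_clinear (\<lambda>u. \<rho> (cr x) (S u))"
        by (rule bounded_clinear_comp[OF S(1) b] bounded_clinear_comp[OF b S(1)])+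
      show "S (\<rho> (cr x) (ev xs h)) = \<rho> (cr x) (S (ev xs h))" for xs h
        using C_ev[of "[x]" xs h] by (simp add: C_Cons C_Nil S(2))
    qed
    show "S (left_rep a u) = left_rep a (S u)" for a u
    proof (rule ev_operator_eqI[where S = "\<lambda>u. S (left_rep a u)" and T = "\<lambda>u. left_rep a (S u)"])
      show "bounded_clinear (\<lambda>u. S (left_rep a u))" "bounded_clinear (\<lambda>u. left_rep a (S u))"
        by (rule bounded_clinear_comp[OF S(1) bounded_clinear_left_rep] bounded_clinear_comp[OF bounded_clinear_left_rep S(1)])+
      show "S (left_rep a (ev xs h)) = left_rep a (S (ev xs h))" for xs h
        by (cases xs) (simp_all add: left_rep_ev_Nil left_rep_ev_Cons S(2) C_Nil W(2) Q_left_rep left_rep_C)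
    qed
  qed
  moreover have "Q l (S u) = (if k \<le> l then S (Q (l - k) u) else 0)" for l u
  proof (rule ev_operator_eqI[where S = "\<lambda>u. Q l (S u)" and T = "\<lambda>u. if k \<le> l then S (Q (l - k) u) else 0"])
    show "bounded_clinear (\<lambda>u. Q l (S u))" by (rule bounded_clinear_comp[OF bounded_clinear_Q S(1)])
    show "bounded_clinear (\<lambda>u. if k \<le> l then S (Q (l - k) u) else 0)"
      by (cases "k \<le> l") (simp_all add: bounded_clinear_zero bounded_clinear_comp[OF S(1) bounded_clinear_Q])
    show "Q l (S (ev xs h)) = (if k \<le> l then S (Q (l - k) (ev xs h)) else 0)" for xs h
      by (auto simp: S(2) Q_C Q_ev Q.Q_Q clinear_zero[OF S(1)] clinear_zero[OF bounded_clinear_C])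
  qed
  ultimately show ?thesis using S(2) by blast
qed

text \<open>For \<open>u = W z\<close> the operators of \<open>shift_operator\<close> determine the components of \<open>T u\<close> from the single
  vector \<open>T (ev [] z)\<close>.\<close>

theorem bicommutant_orthogonal:
  assumes vec: "\<And>\<omega>. \<omega> \<in> P \<Longrightarrow> \<exists>x y. \<forall>a. \<omega> a = cinner x (\<pi> a y)"
    and T: "T \<in> commutant (commutant (\<rho> ` alg0))"
    and y: "\<And>A. A \<in> alg0 \<Longrightarrow> cinner y (\<rho> A u) = 0"
  shows "cinner y (T u) = 0"
proof -
  have Tb: "bounded_clinear T" and TS: "\<And>S x. S \<in> commutant (\<rho> ` alg0) \<Longrightarrow> T (S x) = S (T x)"
    using T unfolding commutant_def by auto
  \<comment> \<open>Any vector of degree \<open>m\<close> is the image of a vacuum vector under a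
    shift by \<open>m\<close> that commutes with \<open>T\<close>, so \<open>T\<close> cannot lower
    degrees.\<close>
  have tri: "Q l (T (Q m x)) = 0" if "l < m" for l m x
  proof -
    obtain z W where W: "bounded_clinear W" "\<And>a h. W (\<pi> a h) = left_rep a (W h)" "W z = x"
      using vacuum_factorization[OF vec] by metis
    obtain S where S: "S \<in> commutant (\<rho> ` alg0)" "\<And>xs h. S (ev xs h) = C xs (Q m (W h))"
      "\<And>l u. Q l (S u) = (if m \<le> l then S (Q (l - m) u) else 0)"
      using shift_operator[OF W(1,2), of m] by metis
    have "Q m x = S (ev [] z)" by (simp add: S(2) C_Nil W(3))
    then show ?thesis using that by (simp add: TS[OF S(1)] S(3))
  qed
  obtain z W where W: "bounded_clinear W" "\<And>a h. W (\<pi> a h) = left_rep a (W h)" "W z = u"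
    using vacuum_factorization[OF vec] by metis
  have "\<forall>k. \<exists>S. S \<in> commutant (\<rho> ` alg0) \<and> (\<forall>xs h. S (ev xs h) = C xs (Q k (W h))) \<and>
      (\<forall>l u. Q l (S u) = (if k \<le> l then S (Q (l - k) u) else 0))"
    using shift_operator[OF W(1,2)] by blast
  from choice[OF this] obtain S where S: "\<And>k. S k \<in> commutant (\<rho> ` alg0)"
    "\<And>k xs h. S k (ev xs h) = C xs (Q k (W h))"
    "\<And>k l u. Q l (S k u) = (if k \<le> l then S k (Q (l - k) u) else 0)" by blast
  have Sb: "bounded_clinear (S k)" for k using S(1)[of k] by (simp add: commutant_def)
  have "\<forall>j. \<exists>V. bounded_clinear V \<and> (\<forall>xs\<in>{xs. length xs = j}. \<forall>h. V (ev xs h) = C xs (W h))"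
    by (intro allI creation_extension[OF W(1,2)]) simp
  from choice[OF this] obtain V where Vb: "\<And>j. bounded_clinear (V j)"
    and V: "\<And>xs h. V (length xs) (ev xs h) = C xs (W h)" by auto
  have QV: "Q l (V j x) = (if j \<le> l then S (l - j) x else 0)" if x: "x \<in> degree j" for l j x
  proof (rule clinear_eq_on_ccspan[where f = "\<lambda>x. Q l (V j x)" and g = "\<lambda>x. if j \<le> l then S (l - j) x else 0"])
    show "bounded_clinear (\<lambda>x. Q l (V j x))" by (rule bounded_clinear_comp[OF bounded_clinear_Q Vb])
    show "bounded_clinear (\<lambda>x. if j \<le> l then S (l - j) x else 0)"
      by (cases "j \<le> l") (simp_all add: Sb bounded_clinear_zero)
    show "x \<in> ccspan {ev xs h | xs h. length xs = j}" using x by (simp add: degree_def)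
  qed (auto simp: V Q_C S(2))
  define t where "t = T (ev [] z)"
  have TQ: "T (Q k u) = S k t" for k
    unfolding t_def TS[OF S(1), symmetric] S(2) by (simp add: C_Nil W(3))
  \<comment> \<open>The projection to the cyclic subspace of \<open>z\<close> fixes the vacuum
    vector, hence also \<open>t\<close>. So \<open>Q j t\<close> is approximated by combinations of
    \<open>ev xs (\<pi> a z)\<close>, which \<open>V j\<close> maps into the orbit of
    \<open>u\<close>.\<close>
  define p where "p = proj (ccspan {\<pi> a z | a. True})"
  have p: "p \<in> commutant (range \<pi>)" unfolding p_def by (rule proj_orbit_commutant)
  have "ev [] z = right_op p (ev [] z)"
  proof -
    have "z \<in> {\<pi> a z | a. True}" using rep_one[of z] by (intro CollectI exI[of _ 1]) simp
    then have "p z = z" unfolding p_def by (subst proj_eq_iff) (simp_all add: ccspan_superset)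
    then show ?thesis by (simp add: ev_def right_op_tensH[OF p])
  qed
  then have pt: "right_op p t = t"
    unfolding t_def TS[OF right_op_commutant[OF p], symmetric] by simp
  define L where "L j = ccspan {ev xs (\<pi> a z) | xs a. length xs = j}" for j
  have QpL: "Q j (right_op p x) \<in> L j" for j x
  proof (rule clinear_image_ccspan[where f = "\<lambda>x. Q j (right_op p x)"])
    show "bounded_clinear (\<lambda>x. Q j (right_op p x))" by (rule bounded_clinear_comp[OF bounded_clinear_Q bounded_clinear_right_op[OF p]])
    show "csubspace (L j)" "closed (L j)" by (simp_all add: L_def)
    show "x \<in> ccspan {ev xs h | xs h. True}" unfolding ccspan_ev by (rule UNIV_I)
    fix w assume "w \<in> {ev xs h | xs h. True}"
    then obtain xs h where w: "w = ev xs h" by blast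
    have "ev xs (p h) \<in> L (length xs)"
    proof (rule clinear_image_ccspan[where f = "ev xs"])
      show "bounded_clinear (ev xs)" using bounded_clinear_tensH_right[of "elt xs"] by (simp add: ev_def[abs_def])
      show "p h \<in> ccspan {\<pi> a z | a. True}" unfolding p_def by (rule proj_in) simp_all
      show "csubspace (L (length xs))" "closed (L (length xs))" by (simp_all add: L_def)
      fix x assume "x \<in> {\<pi> a z | a. True}"
      then show "ev xs x \<in> L (length xs)" unfolding L_def by (intro ccspan_superset) blast
    qed
    moreover have "right_op p w = ev xs (p h)" by (simp add: w ev_def right_op_tensH[OF p])
    moreover have "0 \<in> L j" by (simp add: L_def cvec.subspace_0)
    ultimately show "Q j (right_op p w) \<in> L j" by (auto simp: Q_ev)
  qed
  have yV: "cinner y (V j x) = 0" if x: "x \<in> L j" for j x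
  proof (rule clinear_eq_on_ccspan[where f = "\<lambda>x. cinner y (V j x)" and g = "\<lambda>x. 0"])
    show "bounded_clinear (\<lambda>x. cinner y (V j x))" by (rule bounded_clinear_comp[OF bounded_clinear_cinner Vb])
    show "bounded_clinear (\<lambda>x. 0 :: complex)" by (rule bounded_clinear_zero)
    show "x \<in> ccspan {ev xs (\<pi> a z) | xs a. length xs = j}" using x by (simp add: L_def)
    fix w assume "w \<in> {ev xs (\<pi> a z) | xs a. length xs = j}"
    then obtain xs a where w: "w = ev xs (\<pi> a z)" "j = length xs" by blast
    have "V j w = \<rho> (\<lambda>x. tcr xs (pa a x)) u"
      unfolding w V W(2) W(3) induced_rep_comp[OF tcr_adjointable pa_adjointable] C_def ..
    moreover have "(\<lambda>x. tcr xs (pa a x)) \<in> alg0"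
      using generated_algebra.comp[OF tcr_alg0[of xs] pa_alg0[of a]] by (simp add: comp_def)
    ultimately show "cinner y (V j w) = 0" using y by simp
  qed
  show ?thesis
  \<comment> \<open>In degree \<open>l\<close>, \<open>V j\<close> acts on \<open>Q j t\<close> as
    the shift by \<open>l - j\<close>, and that shift applied to \<open>t\<close> is
    \<open>T (Q (l - j) u)\<close>.\<close>
  proof (rule Q.fejer_orthogonal[OF Tb tri, where v = "\<lambda>j. V j (Q j t)"])
    show "cinner y (V j (Q j t)) = 0" for j using yV[OF QpL[of j t]] by (simp add: pt)
    show "Q l (V j (Q j t)) = (if j \<le> l then Q l (T (Q (l - j) u)) else 0)" for l j
    proof -
      have "Q j t \<in> degree j" unfolding Q_def by (rule proj_in[OF degree_subspace])
      then show ?thesis by (simp add: QV TQ S(3))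
    qed
  qed
qed

end

subsection \<open>Reflexivity\<close>

lemma commutant_comp: "S \<in> commutant \<A> \<Longrightarrow> S' \<in> commutant \<A> \<Longrightarrow> (\<lambda>x. S (S' x)) \<in> commutant \<A>"
  unfolding commutant_def by (simp add: bounded_clinear_comp)

lemma commutant_id: "(\<lambda>x. x) \<in> commutant \<A>"
  by (simp add: commutant_def bounded_clinear_id)

lemma commutant_diff:
  assumes \<A>: "\<forall>A\<in>\<A>. bounded_clinear A" and S: "S \<in> commutant \<A>" "S' \<in> commutant \<A>"
  shows "(\<lambda>x. S x - S' x) \<in> commutant \<A>"
  using S unfolding commutant_def by (auto simp: bounded_clinear_diff clinear_diff[OF bspec[OF \<A>]])

context
  fixes \<A> :: "('k::cbanach \<Rightarrow> 'k) set" and T :: "'k \<Rightarrow> 'k"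
  assumes \<A>: "\<forall>A\<in>\<A>. bounded_clinear A" and T: "T \<in> Alg (Lat \<A>)"
begin

lemma Alg_Lat_bounded: "bounded_clinear T"
  using T by (simp add: Alg_def)

text \<open>Kernels of commutant elements are invariant subspaces; ranges of idempotents and graphs
  of corners will be written as such kernels.\<close>

lemma Alg_Lat_kernel:
  assumes R: "R \<in> commutant \<A>" and v: "R v = 0" shows "R (T v) = 0"
proof -
  have Rb: "bounded_clinear R" and RA: "\<And>A x. A \<in> \<A> \<Longrightarrow> R (A x) = A (R x)" using R by (auto simp: commutant_def)
  have "{x. R x = 0} \<in> Lat \<A>"
    unfolding Lat_def
  proof (intro CollectI conjI ballI)
    show "csubspace {x. R x = 0}"
      by (simp add: cvec.subspace_def clinear_zero[OF Rb] clinear_add[OF Rb] clinear_scaleC[OF Rb])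
    show "closed {x. R x = 0}"
      using closed_Collect_eq[OF clinear_continuous[OF Rb, of UNIV] continuous_on_const] by simp
    show "A ` {x. R x = 0} \<subseteq> {x. R x = 0}" if "A \<in> \<A>" for A
      using that by (auto simp: RA clinear_zero[OF bspec[OF \<A>]])
  qed
  then have "T ` {x. R x = 0} \<subseteq> {x. R x = 0}" using T by (simp add: Alg_def)
  then show ?thesis using v by blast
qed

lemma Alg_Lat_idempotent:
  assumes p: "p \<in> commutant \<A>" and pp: "\<And>x. p (p x) = p x" shows "T (p x) = p (T x)"
proof -
  have pb: "bounded_clinear p" using p by (simp add: commutant_def)
  have "T (p x) - p (T (p x)) = 0"
    by (rule Alg_Lat_kernel[OF commutant_diff[OF \<A> commutant_id p]]) (simp_all add: pp)
  moreover have "p (T (x - p x)) = 0" by (rule Alg_Lat_kernel[OF p]) (simp add: clinear_diff[OF pb] pp)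
  ultimately show ?thesis by (simp add: clinear_diff[OF pb] clinear_diff[OF Alg_Lat_bounded])
qed

text \<open>The graph of an operator from the range of \<open>p\<close> to its complement is the kernel of \<open>D - (1 - p)\<close>.\<close>

lemma Alg_Lat_corner:
  assumes p: "p \<in> commutant \<A>" "\<And>x. p (p x) = p x" and D: "D \<in> commutant \<A>" "\<And>x. D (p x) = D x" "\<And>x. p (D x) = 0"
  shows "T (D x) = D (T x)"
proof -
  have pb: "bounded_clinear p" and Db: "bounded_clinear D" using p D by (simp_all add: commutant_def)
  note Tp = Alg_Lat_idempotent[OF p]
  have DD: "D (D y) = 0" for y using D(2)[of "D y"] by (simp add: D(3) clinear_zero[OF Db])
  \<comment> \<open>A point of the graph; that \<open>T v\<close> lies on it as well gives the
    claim.\<close>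
  define v where "v = p x + D x"
  have "(\<lambda>y. D y - (y - p y)) \<in> commutant \<A>"
    by (intro commutant_diff[OF \<A>] D(1) p(1) commutant_id)
  then have "D (T v) - (T v - p (T v)) = 0"
    by (rule Alg_Lat_kernel) (simp add: v_def clinear_add[OF Db] clinear_add[OF pb] D p(2) DD)
  moreover have "p (T v) = T (p x)"
    by (simp add: Tp[symmetric] v_def clinear_add[OF pb] p(2) D(3))
  moreover have "D (T v) = D (T x)"
  proof -
    have "D (T v) = D (p (T v))" by (simp add: D(2))
    then show ?thesis by (simp add: \<open>p (T v) = T (p x)\<close> Tp D(2))
  qed
  moreover have "T v = T (p x) + T (D x)" by (simp add: v_def clinear_add[OF Alg_Lat_bounded])
  ultimately show ?thesis by simp
qed

end

text \<open>The closed span \<open>L\<close> is invariant under \<open>\<pi>\<close> and under its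
  commutant, so its projection is central and hence scalar; as it fixes a nonzero vector, it is the
  identity.\<close>

lemma (in normal_faithful_rep) factor_commutant_total:
  assumes center: "(center :: 'm set) = range (\<lambda>c. c *\<^sub>C 1)" and f: "f \<in> commutant (range \<pi>)" "f h0 \<noteq> 0"
  shows "ccspan {v (f h) | v h. v \<in> commutant (range \<pi>)} = UNIV"
proof -
  define L where "L = ccspan {v (f h) | v h. v \<in> commutant (range \<pi>)}"
  have L: "csubspace L" "closed L" by (simp_all add: L_def)
  have gen: "v (f h) \<in> L" if "v \<in> commutant (range \<pi>)" for v h
    unfolding L_def by (rule ccspan_superset) (use that in blast)
  have fb: "bounded_clinear f" using f(1) by (simp add: commutant_def)
  have inv1: "\<pi> a n \<in> L" if n: "n \<in> L" for a n
  proof (rule clinear_image_ccspan[OF rep_bounded _ L n[unfolded L_def]])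
    fix x assume "x \<in> {v (f h) | v h. v \<in> commutant (range \<pi>)}"
    then obtain v h where x: "x = v (f h)" "v \<in> commutant (range \<pi>)" by blast
    then have "\<pi> a x = v (f (\<pi> a h))" using f(1) by (simp add: commutant_def)
    then show "\<pi> a x \<in> L" using gen[OF x(2)] by simp
  qed
  have inv2: "w n \<in> L" if n: "n \<in> L" and w: "w \<in> commutant (range \<pi>)" for w n
  proof (rule clinear_image_ccspan[OF _ _ L n[unfolded L_def]])
    show "bounded_clinear w" using w by (simp add: commutant_def)
    fix x assume "x \<in> {v (f h) | v h. v \<in> commutant (range \<pi>)}"
    then obtain v h where x: "x = v (f h)" "v \<in> commutant (range \<pi>)" by blast
    then show "w x \<in> L" using gen[OF commutant_comp[OF w x(2)]] by simp
  qed
  have c1: "proj L (\<pi> a x) = \<pi> a (proj L x)" for a x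
    by (rule proj_commute[OF L rep_bounded rep_star inv1 inv1])
  have "proj L \<in> commutant (commutant (range \<pi>))"
    unfolding commutant_def[of "commutant (range \<pi>)"]
  proof (intro CollectI conjI ballI allI)
    show "bounded_clinear (proj L)" by (rule bounded_clinear_proj[OF L])
    fix w x assume w: "w \<in> commutant (range \<pi>)"
    then have wb: "bounded_clinear w" by (simp add: commutant_def)
    from adjoint_exists[OF this] obtain w' where w': "bounded_clinear w'" "\<And>x y. cinner (w' x) y = cinner x (w y)" by metis
    show "proj L (w x) = w (proj L x)"
      by (rule proj_commute[OF L wb w'(2) inv2[OF _ w] inv2[OF _ adjoint_commutant[OF w w']]])
  qed
  from double_commutant[OF this] obtain a where a: "\<And>h. proj L h = \<pi> a h" by blast
  have "a * b = b * a" for b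
  proof -
    have "\<pi> (a * b - b * a) h = 0" for h by (simp add: rep_diff rep_mult a[symmetric] c1)
    then have "a * b - b * a = 0" by (rule rep_faithful)
    then show ?thesis by simp
  qed
  then have "a \<in> center" by (simp add: center_def)
  then obtain c where c: "a = c *\<^sub>C 1" using center by auto
  have ph: "proj L h = c *\<^sub>C h" for h by (simp add: a c rep_scaleC rep_one)
  have "f h0 \<in> L" using gen[OF commutant_id] .
  then have "c *\<^sub>C f h0 = f h0" using proj_eq_iff[OF L] ph by metis
  then have "(c - 1) *\<^sub>C f h0 = 0" by (simp add: cvec.scale_left_diff_distrib)
  then have "c = 1" using f(2) by simp
  then have "h \<in> L" for h using proj_in[OF L, of h] by (simp add: ph)
  then show ?thesis unfolding L_def by blast
qed

context tensor_space
begin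

lemma right_op_comp:
  assumes S: "S \<in> commutant (range \<pi>)" and S': "S' \<in> commutant (range \<pi>)"
  shows "right_op (\<lambda>h. S (S' h)) u = right_op S (right_op S' u)"
  by (rule tensH_operator_eqI[where S = "right_op (\<lambda>h. S (S' h))" and T = "\<lambda>u. right_op S (right_op S' u)"])
    (simp_all add: right_op_tensH S S' commutant_comp bounded_clinear_right_op
      bounded_clinear_comp[OF bounded_clinear_right_op[OF S] bounded_clinear_right_op[OF S']])

end

section \<open>From invariant subspaces to the bicommutant, and from there to the Hardy
  algebra\<close>

context fock_tensor
begin

abbreviation hardy :: "('f \<Rightarrow> 'f) set" where "hardy \<equiv> hardy_algebra P act \<phi> ipF vac tens"

lemma hardy_adjointable: "X \<in> hardy \<Longrightarrow> X \<in> adjointable ipF"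
  unfolding hardy_algebra_def ultraweak_L_def using closure_of_subset_topspace topspace_subtopology by fastforce

lemma hardy_iff:
  assumes X: "X \<in> adjointable ipF"
  shows "X \<in> hardy \<longleftrightarrow> (\<forall>f\<in>L_predual P ipF. (\<forall>A\<in>alg0. f A = 0) \<longrightarrow> f X = 0)"
  unfolding hardy_algebra_def
  by (rule closure_of_ultraweak_L_iff[OF csubspace_alg0 _ X]) (use alg0_adjointable in blast)

text \<open>Membership is tested on annihilating functionals. After two amplifications such a
  functional is given by vectors \<open>w\<close> and \<open>u\<close>, and the amplified data are
  again a Fock space over the same correspondence, in which \<open>bicommutant_orthogonal\<close>
  applies.\<close>

lemma bicommutant_hardy:
  assumes X: "X \<in> adjointable ipF" and bc: "\<rho> X \<in> commutant (commutant (\<rho> ` alg0))"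
  shows "X \<in> hardy"
  unfolding hardy_iff[OF X]
proof (intro ballI impI)
  fix f assume f: "f \<in> L_predual P ipF" "\<forall>A\<in>alg0. f A = 0"
  obtain w u where wu: "\<And>A. A \<in> adjointable ipF \<Longrightarrow> f A = cinner w (inflate (inflate (\<rho> A)) u)"
    using L_predual_vectors[OF f(1)] by blast
  interpret A1: tensor_space P "ampl \<pi>" ipF actF "\<lambda>x. inflate (tensH x)" by (rule tensor_space_ampl)
  interpret A2: fock_tensor P "ampl (ampl \<pi>)" ip act \<phi> ipF actF pow vac tens "\<lambda>x. inflate (inflate (tensH x))"
    by (rule fock_tensor.intro[OF A1.tensor_space_ampl E.wstar_correspondence_axioms K.fock_space_axioms])
  have rep: "A2.\<rho> A = inflate (inflate (\<rho> A))" if "A \<in> adjointable ipF" for A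
    by (simp add: A1.induced_rep_ampl[OF that] induced_rep_ampl[OF that])
  have vec: "\<exists>x y. \<forall>a. \<omega> a = cinner x (inflate (inflate (\<pi> a)) y)" if \<omega>: "\<omega> \<in> P" for \<omega>
  proof -
    have "onorm \<omega> \<le> onorm \<omega> + 1" "onorm \<omega> + 1 > 0"
      using onorm_pos_le[OF bounded_clinear_linear[OF predual_bounded[OF predual \<omega>]]] by simp_all
    then obtain x y where xy: "\<And>a. \<omega> a = cinner x (inflate (\<pi> a) y)" using predual_vectors[OF \<omega>] by blast
    have "\<omega> a = cinner (single 0 x) (inflate (inflate (\<pi> a)) (single 0 y))" for a
      by (simp add: inflate_single[OF bounded_clinear_inflate[OF rep_bounded]] cinner_single_left coord_single xy)
    then show ?thesis by blast
  qed
  have rep_alg0: "A2.\<rho> ` alg0 = inflate ` inflate ` \<rho> ` alg0"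
    unfolding image_image by (rule image_cong[OF refl]) (rule rep[OF alg0_adjointable])
  have b: "bounded_clinear A" if "A \<in> \<rho> ` alg0" for A
    using that bounded_clinear_induced_rep[OF alg0_adjointable] by blast
  have bc2: "inflate (inflate (\<rho> X)) \<in> commutant (commutant (A2.\<rho> ` alg0))"
    unfolding rep_alg0
    by (intro inflate_bicommutant bc) (auto intro: bounded_clinear_inflate b)
  have orth: "cinner w (A2.\<rho> A u) = 0" if "A \<in> alg0" for A
    using f(2) wu[OF alg0_adjointable[OF that]] that by (simp add: rep[OF alg0_adjointable[OF that]])
  have "cinner w (inflate (inflate (\<rho> X)) u) = 0"
    by (rule A2.bicommutant_orthogonal[where T = "inflate (inflate (\<rho> X))" and u = u and y = w, OF vec bc2 orth])
  then show "f X = 0" by (simp add: wu[OF X])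
qed

lemma Lat_alg0: "Lat (\<rho> ` alg0) \<subseteq> Lat (\<rho> ` hardy)"
proof
  fix N assume "N \<in> Lat (\<rho> ` alg0)"
  then have N: "csubspace N" "closed N" and inv: "\<And>A u. A \<in> alg0 \<Longrightarrow> u \<in> N \<Longrightarrow> \<rho> A u \<in> N"
    unfolding Lat_def by auto
  have "\<rho> X u \<in> N" if X: "X \<in> hardy" and u: "u \<in> N" for X u
    unfolding closed_subspace_eq_orth_orth[OF N]
  proof
    fix w assume w: "w \<in> orth N"
    have "\<forall>A\<in>alg0. cinner w (\<rho> A u) = 0" by (intro ballI orth_sym[OF w] inv u)
    then show "cinner w (\<rho> X u) = 0"
      by (rule X[unfolded hardy_iff[OF hardy_adjointable[OF X]], THEN bspec, OF vector_functional_L_predual, THEN mp])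
  qed
  then show "N \<in> Lat (\<rho> ` hardy)" using N unfolding Lat_def by auto
qed

context
  fixes T :: "'k \<Rightarrow> 'k"
  assumes center: "(center :: 'm set) = range (\<lambda>c. c *\<^sub>C 1)" and T: "T \<in> Alg (Lat (\<rho> ` alg0))"
begin

lemma rep_alg0_bounded: "\<forall>A\<in>\<rho> ` alg0. bounded_clinear A"
  using bounded_clinear_induced_rep[OF alg0_adjointable] by blast

text \<open>Let \<open>D\<close> be a diagonal corner and \<open>R\<close> the off-diagonal corner of \<open>right_op v\<close>. Then \<open>T\<close> commutes with
  the off-diagonal corners \<open>D R\<close> and \<open>R\<close>, hence \<open>T D = D T\<close> on the range of \<open>R\<close>. These ranges are total in
  the range of \<open>right_op e\<close> since the algebra is a factor.\<close>

lemma Alg_Lat_corners: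
  assumes e: "e \<in> commutant (range \<pi>)" "\<And>h. e (e h) = e h" and h0: "e h0 \<noteq> h0" and S: "S \<in> commutant (\<rho> ` alg0)"
  defines "E \<equiv> right_op e" and "F \<equiv> right_op (\<lambda>h. h - e h)"
  shows "T (F (S (E x))) = F (S (E (T x)))" and "T (E (S (E x))) = E (S (E (T x)))" and "F x = x - E x"
proof -
  let ?f = "\<lambda>h. h - e h"
  have eb: "bounded_clinear e" using e(1) by (simp add: commutant_def)
  have f: "?f \<in> commutant (range \<pi>)"
    by (rule commutant_diff[OF _ commutant_id e(1)]) (use rep_bounded in blast)
  have Eb: "bounded_clinear E" and Fb: "bounded_clinear F"
    unfolding E_def F_def by (rule bounded_clinear_right_op[OF e(1)], rule bounded_clinear_right_op[OF f])
  have Ec: "E \<in> commutant (\<rho> ` alg0)" and Fc: "F \<in> commutant (\<rho> ` alg0)"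
    unfolding E_def F_def by (rule right_op_commutant[OF e(1)], rule right_op_commutant[OF f])
  have tens_diff: "tensH y (h - k) = tensH y h - tensH y k" for y h k
    by (rule clinear_diff[OF bounded_clinear_tensH_right])
  have FE': "F x = x - E x" for x
    by (rule tensH_operator_eqI[where S = F and T = "\<lambda>x. x - E x"])
      (simp_all add: Fb bounded_clinear_diff[OF bounded_clinear_id Eb],
        simp add: E_def F_def right_op_tensH[OF e(1)] right_op_tensH[OF f] tens_diff)
  then show "F x = x - E x" .
  have EE: "E (E x) = E x" for x
    unfolding E_def right_op_comp[OF e(1) e(1), symmetric] e(2) ..
  have FF: "F (F x) = F x" and EF: "E (F x) = 0" and FE: "F (E x) = 0" for x
    by (simp_all add: FE' clinear_diff[OF Eb] EE)
  note corner = Alg_Lat_corner[OF rep_alg0_bounded T]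
  have off: "T (F (S (E x))) = F (S (E (T x)))" for x
    by (rule corner[OF Ec EE, where D = "\<lambda>x. F (S (E x))"]) (simp_all add: EE EF commutant_comp[OF Fc commutant_comp[OF S Ec]])
  then show "T (F (S (E x))) = F (S (E (T x)))" .
  have off': "T (E (S' (F x))) = E (S' (F (T x)))" if S': "S' \<in> commutant (\<rho> ` alg0)" for S' x
    by (rule corner[OF Fc FF, where D = "\<lambda>x. E (S' (F x))"]) (simp_all add: FF FE commutant_comp[OF Ec commutant_comp[OF S' Fc]])
  have Tb: "bounded_clinear T" by (rule Alg_Lat_bounded[OF rep_alg0_bounded T])
  have Sb: "bounded_clinear S" using S by (simp add: commutant_def)
  define D where "D x = E (S (E x))" for x
  have Db: "bounded_clinear D" unfolding D_def[abs_def]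
    by (rule bounded_clinear_comp[OF Eb bounded_clinear_comp[OF Sb Eb]])
  have TD: "T (D (E x)) = D (T (E x))" for x
  proof (rule tensH_operator_eqI[where S = "\<lambda>x. T (D (E x))" and T = "\<lambda>x. D (T (E x))"])
    show "bounded_clinear (\<lambda>x. T (D (E x)))" by (rule bounded_clinear_comp[OF Tb bounded_clinear_comp[OF Db Eb]])
    show "bounded_clinear (\<lambda>x. D (T (E x)))" by (rule bounded_clinear_comp[OF Db bounded_clinear_comp[OF Tb Eb]])
    fix y h
    have be: "bounded_clinear (\<lambda>h. E (tensH y h))" by (rule bounded_clinear_comp[OF Eb bounded_clinear_tensH_right])
    show "T (D (E (tensH y h))) = D (T (E (tensH y h)))"
    proof (rule clinear_eq_on_ccspan[where f = "\<lambda>h. T (D (E (tensH y h)))" and g = "\<lambda>h. D (T (E (tensH y h)))"])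
      show "bounded_clinear (\<lambda>h. T (D (E (tensH y h))))" by (rule bounded_clinear_comp[OF Tb bounded_clinear_comp[OF Db be]])
      show "bounded_clinear (\<lambda>h. D (T (E (tensH y h))))" by (rule bounded_clinear_comp[OF Db bounded_clinear_comp[OF Tb be]])
      have "h0 - e h0 \<noteq> 0" using h0 by simp
      from factor_commutant_total[OF center f this]
      show "h \<in> ccspan {v (k - e k) | v k. v \<in> commutant (range \<pi>)}" by simp
      fix k assume "k \<in> {v (k - e k) | v k. v \<in> commutant (range \<pi>)}"
      then obtain v j where k: "k = v (j - e j)" "v \<in> commutant (range \<pi>)" by blast
      define V where "V = right_op v"
      have V: "V \<in> commutant (\<rho> ` alg0)" unfolding V_def by (rule right_op_commutant[OF k(2)])
      have "tensH y k = V (F (tensH y j))"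
        by (simp add: k(1) V_def F_def right_op_tensH[OF f] right_op_tensH[OF k(2)])
      \<comment> \<open>Both \<open>E V F\<close> and \<open>D E V F\<close> are corners covered by
        \<open>off'\<close>, the second with \<open>S E V\<close> as the middle operator.\<close>
      moreover have "T (D (E (V (F x)))) = D (T (E (V (F x))))" for x
        using off'[OF V, of x] off'[OF commutant_comp[OF S commutant_comp[OF Ec V]], of x] by (simp add: D_def EE)
      ultimately show "T (D (E (tensH y k))) = D (T (E (tensH y k)))" by simp
    qed
  qed
  show "T (E (S (E x))) = E (S (E (T x)))"
    using TD[of x] by (simp add: D_def EE Alg_Lat_idempotent[OF rep_alg0_bounded T Ec EE])
qed

text \<open>The four corners of \<open>S\<close> come from applying \<open>Alg_Lat_corners\<close>
  to \<open>p\<close> and to its complement \<open>q\<close>. Each must differ from the identity,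
  which is where both parts of nontriviality of the subspace enter.\<close>

lemma Alg_Lat_bicommutant:
  assumes red: "reducible \<pi>" shows "T \<in> commutant (commutant (\<rho> ` alg0))"
proof -
  obtain N where N: "csubspace N" "closed N" and inv: "\<And>a n. n \<in> N \<Longrightarrow> \<pi> a n \<in> N" and nt: "N \<noteq> {0}" "N \<noteq> UNIV"
    using red unfolding reducible_def by blast
  define p where "p = proj N"
  have p: "p \<in> commutant (range \<pi>)"
    unfolding commutant_def p_def
    using bounded_clinear_proj[OF N] proj_commute[OF N rep_bounded rep_star inv inv] by auto
  have pb: "bounded_clinear p" using p by (simp add: commutant_def)
  have pp: "p (p h) = p h" for h
    unfolding p_def using proj_in[OF N] proj_eq_iff[OF N] by blast
  obtain h1 where "p h1 \<noteq> h1" using nt(2) proj_eq_iff[OF N] unfolding p_def by blast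
  obtain h2 where "h2 \<in> N" "h2 \<noteq> 0" using nt(1) cvec.subspace_0[OF N(1)] by blast
  then have h2: "h2 - p h2 \<noteq> h2" using proj_eq_iff[OF N, of h2] by (simp add: p_def)
  define q where "q h = h - p h" for h
  have q: "q \<in> commutant (range \<pi>)"
    unfolding q_def[abs_def] by (rule commutant_diff[OF _ commutant_id p]) (use rep_bounded in blast)
  have qq: "q (q h) = q h" for h by (simp add: q_def clinear_diff[OF pb] pp)
  have qp: "(\<lambda>h. h - q h) = p" by (simp add: q_def)
  have pq: "(\<lambda>h. h - p h) = q" by (rule ext) (simp add: q_def)
  have "T (S x) = S (T x)" if S: "S \<in> commutant (\<rho> ` alg0)" for S x
  proof -
    note 1 = Alg_Lat_corners[OF p pp \<open>p h1 \<noteq> h1\<close> S, unfolded pq]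
    note 2 = Alg_Lat_corners[OF q qq _ S, of h2, unfolded qp, unfolded q_def[of h2], OF h2, folded q_def]
    have Sb: "bounded_clinear S" using S by (simp add: commutant_def)
    have Tb: "bounded_clinear T" by (rule Alg_Lat_bounded[OF rep_alg0_bounded T])
    let ?P = "right_op p" and ?Q = "right_op q"
    have split: "y = ?P y + ?Q y" for y using 1(3)[of y] by simp
    have S_split: "S y = ?P (S (?P y)) + ?Q (S (?P y)) + (?P (S (?Q y)) + ?Q (S (?Q y)))" for y
      using split[of "S (?P y)"] split[of "S (?Q y)"] split[of y] clinear_add[OF Sb, of "?P y" "?Q y"] by simp
    show ?thesis
      unfolding S_split[of x] S_split[of "T x"] clinear_add[OF Tb] 1(1,2) 2(1,2) ..
  qed
  then show ?thesis using Alg_Lat_bounded[OF rep_alg0_bounded T] by (simp add: commutant_def[of "commutant (\<rho> ` alg0)"])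
qed

end

theorem reflexive_hardy:
  assumes center: "(center :: 'm set) = range (\<lambda>c. c *\<^sub>C 1)" and red: "reducible \<pi>"
  shows "reflexive (\<rho> ` hardy)"
  unfolding reflexive_def
proof (rule equalityI; rule subsetI)
  fix R assume R: "R \<in> \<rho> ` hardy"
  then obtain X where X: "R = \<rho> X" "X \<in> hardy" by blast
  show "R \<in> Alg (Lat (\<rho> ` hardy))"
    using R bounded_clinear_induced_rep[OF hardy_adjointable[OF X(2)]] unfolding Alg_def Lat_def X(1) by blast
next
  fix T assume "T \<in> Alg (Lat (\<rho> ` hardy))"
  then have T: "T \<in> Alg (Lat (\<rho> ` alg0))" using Lat_alg0 unfolding Alg_def by blast
  have bc: "T \<in> commutant (commutant (\<rho> ` alg0))" by (rule Alg_Lat_bicommutant[OF center T red])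
  have com: "right_op S (T u) = T (right_op S u)" if "S \<in> commutant (range \<pi>)" for S u
    using bc right_op_commutant[OF that] by (simp add: commutant_def[of "commutant (\<rho> ` alg0)"])
  have "bounded_clinear T" using T by (simp add: Alg_def)
  from right_commutant[OF this com] obtain X where X: "X \<in> adjointable ipF" "T = \<rho> X" by blast
  then have "X \<in> hardy" using bicommutant_hardy bc by blast
  then show "T \<in> \<rho> ` hardy" using X(2) by blast
qed

end

theorem theorem3p18:
  fixes P :: "('m::cstar_algebra \<Rightarrow> complex) set"
    and ip :: "'e::cbanach \<Rightarrow> 'e \<Rightarrow> 'm"
    and act :: "'e \<Rightarrow> 'm \<Rightarrow> 'e"
    and \<phi> :: "'m \<Rightarrow> 'e \<Rightarrow> 'e"
    and ipF :: "'f::cbanach \<Rightarrow> 'f \<Rightarrow> 'm"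
    and actF :: "'f \<Rightarrow> 'm \<Rightarrow> 'f"
    and pow :: "nat \<Rightarrow> 'f set"
    and vac :: "'m \<Rightarrow> 'f"
    and tens :: "'e list \<Rightarrow> 'f"
    and \<pi> :: "'m \<Rightarrow> 'h::chilbert \<Rightarrow> 'h"
    and tensH :: "'f \<Rightarrow> 'h \<Rightarrow> 'k::chilbert"
  assumes "factor P"
    and "wstar_correspondence P ip act \<phi>"
    and "fock_space ip \<phi> ipF actF pow vac tens"
    and "normal_representation P \<pi>" and "inj \<pi>" and "reducible \<pi>"
    and "induced_hilbert_space ipF \<pi> tensH"
  shows "reflexive (induced_rep tensH ` hardy_algebra P act \<phi> ipF vac tens)"
proof -
  have P: "is_predual P" and center: "(center :: 'm set) = range (\<lambda>c. c *\<^sub>C 1)"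
    using assms(1) by (simp_all add: factor_def wstar_algebra_def)
  have "tensor_space P \<pi> ipF actF tensH"
    by (rule tensor_space.intro[OF normal_representation_faithful[OF P assms(4,5)] _ assms(7)])
      (use assms(3) in \<open>simp add: fock_space_def\<close>)
  then have "fock_tensor P \<pi> ip act \<phi> ipF actF pow vac tens tensH"
    by (rule fock_tensor.intro[OF _ assms(2,3)])
  from fock_tensor.reflexive_hardy[OF this center assms(6)] show ?thesis .
qed

end
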